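(* For $t\in\mathbb{Z}$, $k,l\in\mathbb{N}_0$ write $M_{t,k,l}=\alpha^t\gamma^k\gamma^{*l}$ (with $\alpha^{-s}:=\alpha^{*s}$ for $s\in\mathbb N$) and $[m]=\frac{q^{2m}-1}{q^2-1}$. For all $t\in\mathbb{Z}$, $k,l\in\mathbb{N}_0$ with $t+k-l=0$ define $e(t,k,l)$ and $c(t,k,l)$ by: - if $t=0$ (so $k=l$): $e=-\big((q^{-2k}+q^4)[k]+q^{-2k+2}(1+q^2)[k]^2\big)$ and $c=-q^{-2k}(1+q^4)[k]^2$; - if $t\ge1$: $e=-q^{-2l}\big([l][t+1]+q^{2t+2}[l][k]+q^4[t][l+1]+q^{4+2t}[k][l+1]\big)$ and $c=-q^{-2l+2t}(1+q^4)[l][k]$; - if $t=-s$ with $s\ge1$: $e=-q^{-2s}\big([s][k+1]+q^{-2l}[l][k+1]+q^4[k][s+1]+q^{-2l+4}[k][l]\big)$ and $c=-q^{-2s-2l}(1+q^4)[l][k]$. Then the left quantum Laplacian $\square_q:\mathbb{H}^2_q\to\mathbb{H}^2_q$ satisfies $\square_q(M_{t,k,l})=e(t,k,l)M_{t,k,l}+c(t,k,l)M_{t,k-1,l-1}$ for all such $(t,k,l)$ (the last term being absent if $kl=0$). The elements $$p(M_{t,k,l})=M_{t,k,l}+\sum_{i=1}^{\min(k,l)}\Big(\prod_{j=0}^{i-1}\frac{c(t,k-j,l-j)}{e(t,k,l)-e(t,k-j-1,l-j-1)}\Big)M_{t,k-i,l-i}$$ are well defined (all denominators are nonzero), satisfy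 $\square_q\big(p(M_{t,k,l})\big)=e(t,k,l)\,p(M_{t,k,l})$, and form a linear basis of $\mathbb{H}^2_q$ when $(t,k,l)$ ranges over all triples with $t+k-l=0$. The set of eigenvalues of $\square_q$ on $\mathbb{H}^2_q$ is infinite and discrete.
   Context: Fix $q\in(-1,1)\setminus\{0\}$; Sweedler notation is used. **Algebras.** $P=SU_q(1,1)$ is the unital $\ast$-algebra generated by $\alpha,\gamma$ with $\alpha^*\alpha-\gamma^*\gamma=1$, $\alpha\alpha^*-q^2\gamma\gamma^*=1$, $\gamma\gamma^*=\gamma^*\gamma$, $q\gamma\alpha=\alpha\gamma$, $q\gamma^*\alpha=\alpha\gamma^*$; it is a $\ast$-Hopf algebra with $\Delta(\alpha)=\alpha\otimes\alpha+q\gamma^*\otimes\gamma$, $\Delta(\gamma)=\gamma\otimes\alpha+\alpha^*\otimes\gamma$, $\epsilon(\alpha)=1$, $\epsilon(\gamma)=0$, $S(\alpha)=\alpha^*$, $S(\alpha^* )=\alpha$, $S(\gamma)=-q\gamma$, $S(\gamma^* )=-q^{-1}\gamma^*$. A linear basis of $P$ is $\{\alpha^m\gamma^k\gamma^{*l}: m\in\mathbb{Z},k,l\in\mathbb{N}_0\}$. $G=\mathbb{C}[z,z^{-1}]$ with $z^*=z^{-1}$, $\Delta'(z)=z\otimes z$; $j:P\to G$ is the $\ast$-Hopf morphism with $j(\alpha)=z$, $j(\gamma)=0$; $\Delta_P=(\mathrm{id}\otimes j)\Delta$; $\mathbb{H}^2_q=\{b\in P:\Delta_P(b)=b\otimes1\}$,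 the quantum hyperboloid. **Calculus.** $\mathcal R_3\subseteq\ker\epsilon$ is the right ideal generated by $\gamma^2,\gamma^{*2},\gamma\gamma^*,\alpha\gamma-\gamma,\alpha\gamma^*-\gamma^*,\alpha^*\gamma-\gamma,\alpha^*\gamma^*-\gamma^*,q^2\alpha+\alpha^*-(1+q^2)1$. The associated left covariant first order $\ast$-calculus is $\Omega^1(P)=P\otimes(\ker\epsilon/\mathcal R_3)$, with $\pi(p)=[p-\epsilon(p)1]$, $dp=p^{(1)}\pi(p^{(2)})$, $\pi(a)\,p=p^{(1)}\,\pi(ap^{(2)}-\epsilon(a)p^{(2)})$, $\pi(p)^*=-\pi(S(p)^* )$. It is a free left $P$-module on $\eta_3=\pi(\alpha-\alpha^* )$, $\eta_+=\pi(\gamma)$, $\eta_-=q\pi(\gamma^* )$. $(\Omega^\bullet(P),d,\ast)$ is its universal differential envelope: $\bigotimes_P^\bullet\Omega^1(P)$ modulo the two-sided ideal generated by $\sum_i dg_i\otimes_P dh_i$ with $\sum_i g_i\,dh_i=0$. The base forms are the graded differential $\ast$-subalgebra $\Omega^\bullet(\mathbb{H}^2_q)\subseteq\Omega^\bullet(P)$ given by $\Omega^0(\mathbb{H}^2_q)=\mathbb{H}^2_q$, $\Omega^1(\mathbb{H}^2_q)=\{x\eta_-+y\eta_+:x,y\in P,\ \Delta_P(x)=x\otimes z^2,\ \Delta_P(y)=y\otimes z^{*2}\}$, $\Omega^2(\mathbb{H}^2_q)=\mathbb{H}^2_q\,\mathrm{dvol}$ with $\mathrm{dvol}:=\eta_-\eta_+$.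 **Laplacian.** The left Hodge operator is the antilinear map with $\star_L(b)=b^*\mathrm{dvol}$, $\star_L(x\eta_-+y\eta_+)=-y^*\eta_-+x^*\eta_+$, $\star_L(b\,\mathrm{dvol})=b^*$. The left codifferential on $\Omega^{k+1}(\mathbb{H}^2_q)$ is $d^{\star_L}=(-1)^{k+1}\star_L^{-1}\circ d\circ\star_L$ (zero on $\Omega^0$), and $\square_q=d\circ d^{\star_L}+d^{\star_L}\circ d$, here considered on $\Omega^0(\mathbb{H}^2_q)=\mathbb{H}^2_q$. *)

theory Defs
  imports
    "HOL-Algebra.QuotRing"
    "HOL-Algebra.Module"
    "HOL-Library.Poly_Mapping"
    "HOL-Analysis.Isolated"
begin

section \<open>Complex algebras, quotients and tensor products\<close>

text \<open>
  Complex vector spaces and (not necessarily commutative) complex algebras are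
  \<open>module\<close> records of HOL-Algebra with scalars in \<^typ>\<open>complex\<close>. For a mere vector space
  the fields \<open>mult\<close> and \<open>one\<close> carry no meaning.
\<close>

type_synonym 'v calg = "(complex, 'v) module"

definition type_alg :: "(complex \<Rightarrow> 'a \<Rightarrow> 'a) \<Rightarrow> 'a::ring_1 calg" where
  "type_alg s = \<lparr>carrier = UNIV, mult = (*), one = 1, zero = 0, add = (+), smult = s\<rparr>"

definition pm_scale :: "complex \<Rightarrow> ('x \<Rightarrow>\<^sub>0 complex) \<Rightarrow> ('x \<Rightarrow>\<^sub>0 complex)" where
  "pm_scale c = Poly_Mapping.map ((*) c)"

definition quot_alg :: "'v calg \<Rightarrow> 'v set \<Rightarrow> 'v set calg" where
  "quot_alg V W = ring.extend (V Quot W)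
     (module.fields (\<lambda>c X. \<Union>x\<in>X. W +>\<^bsub>V\<^esub> (c \<odot>\<^bsub>V\<^esub> x)))"

text \<open>The map induced on cosets by a map that is constant on each of them.\<close>

definition descend :: "('v \<Rightarrow> 'u) \<Rightarrow> 'v set \<Rightarrow> 'u" where
  "descend f X = (THE y. f ` X = {y})"

definition lsum :: "'v calg \<Rightarrow> ('i \<Rightarrow> 'v) \<Rightarrow> 'i list \<Rightarrow> 'v" where
  "lsum V f xs = foldr (\<lambda>x s. f x \<oplus>\<^bsub>V\<^esub> s) xs \<zero>\<^bsub>V\<^esub>"

definition lprod :: "'v calg \<Rightarrow> ('i \<Rightarrow> 'v) \<Rightarrow> 'i list \<Rightarrow> 'v" where
  "lprod A f xs = foldr (\<lambda>x s. f x \<otimes>\<^bsub>A\<^esub> s) xs \<one>\<^bsub>A\<^esub>"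

subsection \<open>Free algebras\<close>

text \<open>
  Words form a monoid (written additively, as the convolution product of
  \<^type>\<open>poly_mapping\<close> requires), so \<open>'g fword \<Rightarrow>\<^sub>0 complex\<close> is the free unital
  associative algebra on \<open>'g\<close>.
\<close>

datatype 'g fword = Word (letters: "'g list")

instantiation fword :: (type) monoid_add
begin

definition zero_fword :: "'a fword" where
  "zero_fword = Word []"

definition plus_fword :: "'a fword \<Rightarrow> 'a fword \<Rightarrow> 'a fword" where
  "plus_fword u v = Word (letters u @ letters v)"

instance
  by standard (simp_all add: zero_fword_def plus_fword_def)

end

definition free_alg :: "'g set \<Rightarrow> ('g fword \<Rightarrow>\<^sub>0 complex) calg" where
  "free_alg X = (type_alg pm_scale)
     \<lparr>carrier := {f. \<forall>w\<in>Poly_Mapping.keys f. set (letters w) \<subseteq> X}\<rparr>"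

definition free_var :: "'g \<Rightarrow> 'g fword \<Rightarrow>\<^sub>0 complex" where
  "free_var x = Poly_Mapping.single (Word [x]) 1"

definition free_eval :: "'a calg \<Rightarrow> ('g \<Rightarrow> 'a) \<Rightarrow> ('g fword \<Rightarrow>\<^sub>0 complex) \<Rightarrow> 'a" where
  "free_eval A g f =
     (\<Oplus>\<^bsub>A\<^esub>w\<in>Poly_Mapping.keys f. Poly_Mapping.lookup f w \<odot>\<^bsub>A\<^esub> lprod A g (letters w))"

subsection \<open>Tensor products over the complex numbers\<close>

definition free_vs :: "'x set \<Rightarrow> ('x \<Rightarrow>\<^sub>0 complex) calg" where
  "free_vs X = \<lparr>carrier = {f. Poly_Mapping.keys f \<subseteq> X}, mult = (\<lambda>_ _. 0), one = 0,
     zero = 0, add = (+), smult = pm_scale\<rparr>"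

inductive_set tensor_null :: "'v calg \<Rightarrow> 'w calg \<Rightarrow> ('v \<times> 'w \<Rightarrow>\<^sub>0 complex) set"
  for V :: "'v calg" and W :: "'w calg" where
  zero: "0 \<in> tensor_null V W"
| add: "\<lbrakk>f \<in> tensor_null V W; g \<in> tensor_null V W\<rbrakk> \<Longrightarrow> f + g \<in> tensor_null V W"
| scale: "f \<in> tensor_null V W \<Longrightarrow> pm_scale c f \<in> tensor_null V W"
| add_left: "\<lbrakk>x \<in> carrier V; x' \<in> carrier V; y \<in> carrier W\<rbrakk> \<Longrightarrow>
    Poly_Mapping.single (x \<oplus>\<^bsub>V\<^esub> x', y) 1 - Poly_Mapping.single (x, y) 1
      - Poly_Mapping.single (x', y) 1 \<in> tensor_null V W"
| add_right: "\<lbrakk>x \<in> carrier V; y \<in> carrier W; y' \<in> carrier W\<rbrakk> \<Longrightarrow>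
    Poly_Mapping.single (x, y \<oplus>\<^bsub>W\<^esub> y') 1 - Poly_Mapping.single (x, y) 1
      - Poly_Mapping.single (x, y') 1 \<in> tensor_null V W"
| scale_left: "\<lbrakk>x \<in> carrier V; y \<in> carrier W\<rbrakk> \<Longrightarrow>
    Poly_Mapping.single (c \<odot>\<^bsub>V\<^esub> x, y) 1 - Poly_Mapping.single (x, y) c \<in> tensor_null V W"
| scale_right: "\<lbrakk>x \<in> carrier V; y \<in> carrier W\<rbrakk> \<Longrightarrow>
    Poly_Mapping.single (x, c \<odot>\<^bsub>W\<^esub> y) 1 - Poly_Mapping.single (x, y) c \<in> tensor_null V W"

definition tensor :: "'v calg \<Rightarrow> 'w calg \<Rightarrow> ('v \<times> 'w \<Rightarrow>\<^sub>0 complex) set calg" where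
  "tensor V W = quot_alg (free_vs (carrier V \<times> carrier W)) (tensor_null V W)"

definition pure_tensor :: "'v calg \<Rightarrow> 'w calg \<Rightarrow> 'v \<Rightarrow> 'w \<Rightarrow> ('v \<times> 'w \<Rightarrow>\<^sub>0 complex) set" where
  "pure_tensor V W x y =
     tensor_null V W +>\<^bsub>free_vs (carrier V \<times> carrier W)\<^esub> Poly_Mapping.single (x, y) 1"

text \<open>
  The linear map into \<open>U\<close> induced on a tensor product by a bilinear map \<open>\<beta>\<close>; with
  \<open>T = \<Delta> p\<close> it renders the Sweedler expression \<open>\<beta>(p\<^sub>1, p\<^sub>2)\<close>.
\<close>

definition tensor_lift :: "'u calg \<Rightarrow> ('v \<Rightarrow> 'w \<Rightarrow> 'u) \<Rightarrow> ('v \<times> 'w \<Rightarrow>\<^sub>0 complex) set \<Rightarrow> 'u" where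
  "tensor_lift U \<beta> T = descend (\<lambda>f. \<Oplus>\<^bsub>U\<^esub>xy\<in>Poly_Mapping.keys f.
     Poly_Mapping.lookup f xy \<odot>\<^bsub>U\<^esub> \<beta> (fst xy) (snd xy)) T"

definition tensor_alg :: "'v calg \<Rightarrow> 'w calg \<Rightarrow> ('v \<times> 'w \<Rightarrow>\<^sub>0 complex) set calg" where
  "tensor_alg A B = (tensor A B)
     \<lparr>mult := (\<lambda>S T. tensor_lift (tensor A B) (\<lambda>a b. tensor_lift (tensor A B)
        (\<lambda>a' b'. pure_tensor A B (a \<otimes>\<^bsub>A\<^esub> a') (b \<otimes>\<^bsub>B\<^esub> b')) T) S),
      one := pure_tensor A B \<one>\<^bsub>A\<^esub> \<one>\<^bsub>B\<^esub>\<rparr>"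

subsection \<open>Tensor algebra of a bimodule\<close>

text \<open>
  The tensor algebra \<open>T\<^sub>A(M)\<close> of an \<open>A\<close>-bimodule \<open>M\<close>, with actions \<open>l\<close> and \<open>r\<close>: the algebra
  generated by \<open>A\<close> and \<open>M\<close> subject to the relations that hold in \<open>A\<close> and in the bimodule \<open>M\<close>.
  Its product restricted to \<open>M \<times> M\<close> is \<open>\<otimes>\<^sub>A\<close>.
\<close>

definition bimodule_rel ::
  "'a calg \<Rightarrow> 'm calg \<Rightarrow> ('a \<Rightarrow> 'm \<Rightarrow> 'm) \<Rightarrow> ('m \<Rightarrow> 'a \<Rightarrow> 'm) \<Rightarrow> (('a + 'm) fword \<Rightarrow>\<^sub>0 complex) set"
where
  "bimodule_rel A M l r =
     {free_var (Inl (a \<oplus>\<^bsub>A\<^esub> b)) - free_var (Inl a) - free_var (Inl b) |a b.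
        a \<in> carrier A \<and> b \<in> carrier A} \<union>
     {free_var (Inl (c \<odot>\<^bsub>A\<^esub> a)) - pm_scale c (free_var (Inl a)) |c a. a \<in> carrier A} \<union>
     {free_var (Inl (a \<otimes>\<^bsub>A\<^esub> b)) - free_var (Inl a) * free_var (Inl b) |a b.
        a \<in> carrier A \<and> b \<in> carrier A} \<union>
     {free_var (Inl \<one>\<^bsub>A\<^esub>) - 1} \<union>
     {free_var (Inr (m \<oplus>\<^bsub>M\<^esub> n)) - free_var (Inr m) - free_var (Inr n) |m n.
        m \<in> carrier M \<and> n \<in> carrier M} \<union>
     {free_var (Inr (c \<odot>\<^bsub>M\<^esub> m)) - pm_scale c (free_var (Inr m)) |c m. m \<in> carrier M} \<union>
     {free_var (Inr (l a m)) - free_var (Inl a) * free_var (Inr m) |a m.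
        a \<in> carrier A \<and> m \<in> carrier M} \<union>
     {free_var (Inr (r m a)) - free_var (Inr m) * free_var (Inl a) |a m.
        a \<in> carrier A \<and> m \<in> carrier M}"

definition bimodule_ideal ::
  "'a calg \<Rightarrow> 'm calg \<Rightarrow> ('a \<Rightarrow> 'm \<Rightarrow> 'm) \<Rightarrow> ('m \<Rightarrow> 'a \<Rightarrow> 'm) \<Rightarrow> (('a + 'm) fword \<Rightarrow>\<^sub>0 complex) set"
where
  "bimodule_ideal A M l r = Idl\<^bsub>free_alg (carrier A <+> carrier M)\<^esub> (bimodule_rel A M l r)"

definition tensor_algebra ::
  "'a calg \<Rightarrow> 'm calg \<Rightarrow> ('a \<Rightarrow> 'm \<Rightarrow> 'm) \<Rightarrow> ('m \<Rightarrow> 'a \<Rightarrow> 'm) \<Rightarrow>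
     (('a + 'm) fword \<Rightarrow>\<^sub>0 complex) set calg"
where
  "tensor_algebra A M l r =
     quot_alg (free_alg (carrier A <+> carrier M)) (bimodule_ideal A M l r)"

subsection \<open>Right ideals and bases\<close>

inductive_set right_ideal :: "'a calg \<Rightarrow> 'a set \<Rightarrow> 'a set"
  for A :: "'a calg" and S :: "'a set" where
  zero: "\<zero>\<^bsub>A\<^esub> \<in> right_ideal A S"
| gen: "x \<in> S \<Longrightarrow> x \<in> right_ideal A S"
| add: "\<lbrakk>x \<in> right_ideal A S; y \<in> right_ideal A S\<rbrakk> \<Longrightarrow> x \<oplus>\<^bsub>A\<^esub> y \<in> right_ideal A S"
| mult: "\<lbrakk>x \<in> right_ideal A S; a \<in> carrier A\<rbrakk> \<Longrightarrow> x \<otimes>\<^bsub>A\<^esub> a \<in> right_ideal A S"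

text \<open>The family \<open>v\<close> indexed by \<open>I\<close> is a linear basis of the subspace \<open>U\<close> of \<open>V\<close>.\<close>

definition linear_basis :: "'v calg \<Rightarrow> 'v set \<Rightarrow> 'i set \<Rightarrow> ('i \<Rightarrow> 'v) \<Rightarrow> bool" where
  "linear_basis V U I v \<longleftrightarrow>
     (\<forall>i\<in>I. v i \<in> U) \<and>
     (\<forall>J a. finite J \<and> J \<subseteq> I \<and> (\<Oplus>\<^bsub>V\<^esub>i\<in>J. a i \<odot>\<^bsub>V\<^esub> v i) = \<zero>\<^bsub>V\<^esub> \<longrightarrow> (\<forall>i\<in>J. a i = 0)) \<and>
     (\<forall>u\<in>U. \<exists>J a. finite J \<and> J \<subseteq> I \<and> u = (\<Oplus>\<^bsub>V\<^esub>i\<in>J. a i \<odot>\<^bsub>V\<^esub> v i))"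

section \<open>The Hopf algebra of quantum SU(1,1) and the quantum hyperboloid\<close>

datatype gen = GenAlpha | GenAlphaStar | GenGamma | GenGammaStar

fun gen_star :: "gen \<Rightarrow> gen" where
  "gen_star GenAlpha = GenAlphaStar"
| "gen_star GenAlphaStar = GenAlpha"
| "gen_star GenGamma = GenGammaStar"
| "gen_star GenGammaStar = GenGamma"

definition free_star :: "(gen fword \<Rightarrow>\<^sub>0 complex) \<Rightarrow> (gen fword \<Rightarrow>\<^sub>0 complex)" where
  "free_star f = (\<Sum>w\<in>Poly_Mapping.keys f.
     Poly_Mapping.single (Word (rev (map gen_star (letters w)))) (cnj (Poly_Mapping.lookup f w)))"

definition suq_rel :: "real \<Rightarrow> (gen fword \<Rightarrow>\<^sub>0 complex) set" where
  "suq_rel q =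
     (let a = free_var GenAlpha; a' = free_var GenAlphaStar;
          c = free_var GenGamma; c' = free_var GenGammaStar
      in {a' * a - c' * c - 1,
          a * a' - pm_scale (complex_of_real (q^2)) (c * c') - 1,
          c * c' - c' * c,
          pm_scale (complex_of_real q) (c * a) - a * c,
          pm_scale (complex_of_real q) (c' * a) - a * c'})"

definition suq_ideal :: "real \<Rightarrow> (gen fword \<Rightarrow>\<^sub>0 complex) set" where
  "suq_ideal q = Idl\<^bsub>free_alg UNIV\<^esub> (suq_rel q \<union> free_star ` suq_rel q)"

type_synonym suq = "(gen fword \<Rightarrow>\<^sub>0 complex) set"

definition SUq :: "real \<Rightarrow> suq calg" where
  "SUq q = quot_alg (free_alg UNIV) (suq_ideal q)"

definition suq_gen :: "real \<Rightarrow> gen \<Rightarrow> suq" where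
  "suq_gen q g = suq_ideal q +>\<^bsub>free_alg UNIV\<^esub> free_var g"

abbreviation alpha :: "real \<Rightarrow> suq" where "alpha q \<equiv> suq_gen q GenAlpha"
abbreviation alpha_star :: "real \<Rightarrow> suq" where "alpha_star q \<equiv> suq_gen q GenAlphaStar"
abbreviation gamma :: "real \<Rightarrow> suq" where "gamma q \<equiv> suq_gen q GenGamma"
abbreviation gamma_star :: "real \<Rightarrow> suq" where "gamma_star q \<equiv> suq_gen q GenGammaStar"

definition suq_star :: "suq \<Rightarrow> suq" where
  "suq_star X = free_star ` X"

definition counit :: "real \<Rightarrow> suq \<Rightarrow> complex" where
  "counit q = descend (free_eval (type_alg (*))
     (\<lambda>g. case g of GenAlpha \<Rightarrow> 1 | GenAlphaStar \<Rightarrow> 1 | GenGamma \<Rightarrow> 0 | GenGammaStar \<Rightarrow> 0))"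

text \<open>The values on the adjoint generators come from \<open>\<Delta>\<close> being a *-homomorphism.\<close>

definition comult_gen :: "real \<Rightarrow> gen \<Rightarrow> (suq \<times> suq \<Rightarrow>\<^sub>0 complex) set" where
  "comult_gen q g =
     (let PP = tensor_alg (SUq q) (SUq q); t = pure_tensor (SUq q) (SUq q) in
      case g of
        GenAlpha \<Rightarrow> t (alpha q) (alpha q)
          \<oplus>\<^bsub>PP\<^esub> complex_of_real q \<odot>\<^bsub>PP\<^esub> t (gamma_star q) (gamma q)
      | GenAlphaStar \<Rightarrow> t (alpha_star q) (alpha_star q)
          \<oplus>\<^bsub>PP\<^esub> complex_of_real q \<odot>\<^bsub>PP\<^esub> t (gamma q) (gamma_star q)
      | GenGamma \<Rightarrow> t (gamma q) (alpha q) \<oplus>\<^bsub>PP\<^esub> t (alpha_star q) (gamma q)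
      | GenGammaStar \<Rightarrow> t (gamma_star q) (alpha_star q) \<oplus>\<^bsub>PP\<^esub> t (alpha q) (gamma_star q))"

definition comult :: "real \<Rightarrow> suq \<Rightarrow> (suq \<times> suq \<Rightarrow>\<^sub>0 complex) set" where
  "comult q = descend (free_eval (tensor_alg (SUq q) (SUq q)) (comult_gen q))"

text \<open>
  Laurent polynomials are finitely supported functions on the integers; \<open>z\<^sup>n\<close> is
  \<^term>\<open>Poly_Mapping.single n 1\<close>.
\<close>

definition laurent :: "(int \<Rightarrow>\<^sub>0 complex) calg" where
  "laurent = type_alg pm_scale"

abbreviation zpow :: "int \<Rightarrow> int \<Rightarrow>\<^sub>0 complex" where
  "zpow n \<equiv> Poly_Mapping.single n 1"

definition to_laurent :: "real \<Rightarrow> suq \<Rightarrow> (int \<Rightarrow>\<^sub>0 complex)" where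
  "to_laurent q = descend (free_eval laurent
     (\<lambda>g. case g of GenAlpha \<Rightarrow> zpow 1 | GenAlphaStar \<Rightarrow> zpow (-1) | GenGamma \<Rightarrow> 0 | GenGammaStar \<Rightarrow> 0))"

definition coaction :: "real \<Rightarrow> suq \<Rightarrow> (suq \<times> (int \<Rightarrow>\<^sub>0 complex) \<Rightarrow>\<^sub>0 complex) set" where
  "coaction q p = tensor_lift (tensor (SUq q) laurent)
     (\<lambda>x y. pure_tensor (SUq q) laurent x (to_laurent q y)) (comult q p)"

definition weight_space :: "real \<Rightarrow> int \<Rightarrow> suq set" where
  "weight_space q n =
     {x \<in> carrier (SUq q). coaction q x = pure_tensor (SUq q) laurent x (zpow n)}"

definition hyperboloid :: "real \<Rightarrow> suq set" where
  "hyperboloid q =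
     {b \<in> carrier (SUq q). coaction q b = pure_tensor (SUq q) laurent b \<one>\<^bsub>laurent\<^esub>}"

section \<open>The first order calculus\<close>

definition ker_counit :: "real \<Rightarrow> suq calg" where
  "ker_counit q = (SUq q)\<lparr>carrier := {a \<in> carrier (SUq q). counit q a = 0}\<rparr>"

definition R3 :: "real \<Rightarrow> suq set" where
  "R3 q =
     (let P = SUq q; a = alpha q; a' = alpha_star q; c = gamma q; c' = gamma_star q;
          r = complex_of_real (q^2)
      in right_ideal P
        {c \<otimes>\<^bsub>P\<^esub> c, c' \<otimes>\<^bsub>P\<^esub> c', c \<otimes>\<^bsub>P\<^esub> c',
         a \<otimes>\<^bsub>P\<^esub> c \<ominus>\<^bsub>P\<^esub> c, a \<otimes>\<^bsub>P\<^esub> c' \<ominus>\<^bsub>P\<^esub> c',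
         a' \<otimes>\<^bsub>P\<^esub> c \<ominus>\<^bsub>P\<^esub> c, a' \<otimes>\<^bsub>P\<^esub> c' \<ominus>\<^bsub>P\<^esub> c',
         (r \<odot>\<^bsub>P\<^esub> a \<oplus>\<^bsub>P\<^esub> a') \<ominus>\<^bsub>P\<^esub> (1 + r) \<odot>\<^bsub>P\<^esub> \<one>\<^bsub>P\<^esub>})"

definition inv_forms :: "real \<Rightarrow> suq set calg" where
  "inv_forms q = quot_alg (ker_counit q) (R3 q)"

definition qpi :: "real \<Rightarrow> suq \<Rightarrow> suq set" where
  "qpi q p = R3 q +>\<^bsub>ker_counit q\<^esub> (p \<ominus>\<^bsub>SUq q\<^esub> counit q p \<odot>\<^bsub>SUq q\<^esub> \<one>\<^bsub>SUq q\<^esub>)"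

type_synonym form1 = "(suq \<times> suq set \<Rightarrow>\<^sub>0 complex) set"

definition Omega1 :: "real \<Rightarrow> form1 calg" where
  "Omega1 q = tensor (SUq q) (inv_forms q)"

abbreviation form :: "real \<Rightarrow> suq \<Rightarrow> suq set \<Rightarrow> form1" where
  "form q \<equiv> pure_tensor (SUq q) (inv_forms q)"

definition lact :: "real \<Rightarrow> suq \<Rightarrow> form1 \<Rightarrow> form1" where
  "lact q p = tensor_lift (Omega1 q) (\<lambda>x v. form q (p \<otimes>\<^bsub>SUq q\<^esub> x) v)"

text \<open>\<open>\<pi>(a) \<triangleleft> p = \<pi>(a p - \<epsilon>(a) p)\<close>, so that \<open>\<pi>(a) p = p\<^sub>1 (\<pi>(a) \<triangleleft> p\<^sub>2)\<close>.\<close>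

definition inv_act :: "real \<Rightarrow> suq set \<Rightarrow> suq \<Rightarrow> suq set" where
  "inv_act q v p = (THE w. \<exists>a\<in>carrier (SUq q). v = qpi q a \<and>
     w = qpi q (a \<otimes>\<^bsub>SUq q\<^esub> p \<ominus>\<^bsub>SUq q\<^esub> counit q a \<odot>\<^bsub>SUq q\<^esub> p))"

definition ract :: "real \<Rightarrow> form1 \<Rightarrow> suq \<Rightarrow> form1" where
  "ract q \<omega> p = tensor_lift (Omega1 q) (\<lambda>x v. tensor_lift (Omega1 q)
     (\<lambda>p1 p2. form q (x \<otimes>\<^bsub>SUq q\<^esub> p1) (inv_act q v p2)) (comult q p)) \<omega>"

definition calc_d :: "real \<Rightarrow> suq \<Rightarrow> form1" where
  "calc_d q p = tensor_lift (Omega1 q) (\<lambda>p1 p2. form q p1 (qpi q p2)) (comult q p)"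

section \<open>The universal differential envelope\<close>

type_synonym tform = "((suq + form1) fword \<Rightarrow>\<^sub>0 complex) set"

definition TOmega :: "real \<Rightarrow> tform calg" where
  "TOmega q = tensor_algebra (SUq q) (Omega1 q) (lact q) (ract q)"

definition tgen :: "real \<Rightarrow> suq + form1 \<Rightarrow> tform" where
  "tgen q x = bimodule_ideal (SUq q) (Omega1 q) (lact q) (ract q)
     +>\<^bsub>free_alg (carrier (SUq q) <+> carrier (Omega1 q))\<^esub> free_var x"

definition envelope_ideal :: "real \<Rightarrow> tform set" where
  "envelope_ideal q = Idl\<^bsub>TOmega q\<^esub>
     {lsum (TOmega q) (\<lambda>(g, h). tgen q (Inr (calc_d q g)) \<otimes>\<^bsub>TOmega q\<^esub> tgen q (Inr (calc_d q h))) gs |gs.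
        set gs \<subseteq> carrier (SUq q) \<times> carrier (SUq q) \<and>
        lsum (Omega1 q) (\<lambda>(g, h). lact q g (calc_d q h)) gs = \<zero>\<^bsub>Omega1 q\<^esub>}"

definition Omega :: "real \<Rightarrow> tform set calg" where
  "Omega q = quot_alg (TOmega q) (envelope_ideal q)"

definition of_P :: "real \<Rightarrow> suq \<Rightarrow> tform set" where
  "of_P q p = envelope_ideal q +>\<^bsub>TOmega q\<^esub> tgen q (Inl p)"

definition of_form :: "real \<Rightarrow> form1 \<Rightarrow> tform set" where
  "of_form q \<omega> = envelope_ideal q +>\<^bsub>TOmega q\<^esub> tgen q (Inr \<omega>)"

text \<open>
  The differential on forms of degree \<open>k\<close>:
  \<open>d (\<Sum> p\<^sub>0 dp\<^sub>1 \<dots> dp\<^sub>k) = \<Sum> dp\<^sub>0 dp\<^sub>1 \<dots> dp\<^sub>k\<close>.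
\<close>

definition ext_diff :: "real \<Rightarrow> nat \<Rightarrow> tform set \<Rightarrow> tform set" where
  "ext_diff q k \<omega> = (THE \<omega>'. \<exists>ts :: (suq \<times> suq list) list.
     (\<forall>(p, ps)\<in>set ts. p \<in> carrier (SUq q) \<and> set ps \<subseteq> carrier (SUq q) \<and> length ps = k) \<and>
     \<omega> = lsum (Omega q) (\<lambda>(p, ps).
            of_P q p \<otimes>\<^bsub>Omega q\<^esub> lprod (Omega q) (of_form q \<circ> calc_d q) ps) ts \<and>
     \<omega>' = lsum (Omega q) (\<lambda>(p, ps).
            of_form q (calc_d q p) \<otimes>\<^bsub>Omega q\<^esub> lprod (Omega q) (of_form q \<circ> calc_d q) ps) ts)"

section \<open>Base forms, Hodge operator and Laplacian\<close>

definition eta_plus :: "real \<Rightarrow> tform set" where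
  "eta_plus q = of_form q (form q \<one>\<^bsub>SUq q\<^esub> (qpi q (gamma q)))"

definition eta_minus :: "real \<Rightarrow> tform set" where
  "eta_minus q = complex_of_real q \<odot>\<^bsub>Omega q\<^esub> of_form q (form q \<one>\<^bsub>SUq q\<^esub> (qpi q (gamma_star q)))"

definition dvol :: "real \<Rightarrow> tform set" where
  "dvol q = eta_minus q \<otimes>\<^bsub>Omega q\<^esub> eta_plus q"

definition base_form1 :: "real \<Rightarrow> suq \<Rightarrow> suq \<Rightarrow> tform set" where
  "base_form1 q x y = (of_P q x \<otimes>\<^bsub>Omega q\<^esub> eta_minus q) \<oplus>\<^bsub>Omega q\<^esub> (of_P q y \<otimes>\<^bsub>Omega q\<^esub> eta_plus q)"

definition base_form2 :: "real \<Rightarrow> suq \<Rightarrow> tform set" where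
  "base_form2 q b = of_P q b \<otimes>\<^bsub>Omega q\<^esub> dvol q"

definition base_forms :: "real \<Rightarrow> nat \<Rightarrow> tform set set" where
  "base_forms q k =
     (if k = 0 then of_P q ` hyperboloid q
      else if k = 1 then {base_form1 q x y |x y. x \<in> weight_space q 2 \<and> y \<in> weight_space q (-2)}
      else if k = 2 then base_form2 q ` hyperboloid q
      else {\<zero>\<^bsub>Omega q\<^esub>})"

definition hodge :: "real \<Rightarrow> nat \<Rightarrow> tform set \<Rightarrow> tform set" where
  "hodge q k \<omega> = (THE \<omega>'.
     if k = 0 then \<exists>b\<in>hyperboloid q. \<omega> = of_P q b \<and> \<omega>' = base_form2 q (suq_star b)
     else if k = 1 then \<exists>x\<in>weight_space q 2. \<exists>y\<in>weight_space q (-2).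
       \<omega> = base_form1 q x y \<and> \<omega>' = base_form1 q (\<ominus>\<^bsub>SUq q\<^esub> suq_star y) (suq_star x)
     else if k = 2 then \<exists>b\<in>hyperboloid q. \<omega> = base_form2 q b \<and> \<omega>' = of_P q (suq_star b)
     else \<omega>' = \<zero>\<^bsub>Omega q\<^esub>)"

text \<open>
  On degree \<open>k + 1\<close> the codifferential is \<open>(-1)\<^sup>k\<^sup>+\<^sup>1 \<star>\<^sup>-\<^sup>1 d \<star>\<close>; here \<open>\<star>\<close> lands in degree
  \<open>2 - (k + 1) = 1 - k\<close>, and \<open>\<star>\<^sup>-\<^sup>1\<close> is the inverse of \<open>\<star>\<close> on degree \<open>k\<close>.
\<close>

fun codiff :: "real \<Rightarrow> nat \<Rightarrow> tform set \<Rightarrow> tform set" where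
  "codiff q 0 \<omega> = \<zero>\<^bsub>Omega q\<^esub>"
| "codiff q (Suc k) \<omega> = (-1) ^ (k + 1) \<odot>\<^bsub>Omega q\<^esub>
     inv_into (base_forms q k) (hodge q k) (ext_diff q (1 - k) (hodge q (Suc k) \<omega>))"

definition laplacian :: "real \<Rightarrow> nat \<Rightarrow> tform set \<Rightarrow> tform set" where
  "laplacian q k \<omega> =
     (if k = 0 then \<zero>\<^bsub>Omega q\<^esub> else ext_diff q (k - 1) (codiff q k \<omega>))
       \<oplus>\<^bsub>Omega q\<^esub> codiff q (k + 1) (ext_diff q k \<omega>)"

text \<open>The Laplacian in degree 0, read on the hyperboloid itself.\<close>

definition square_q :: "real \<Rightarrow> suq \<Rightarrow> suq" where
  "square_q q b = inv_into (hyperboloid q) (of_P q) (laplacian q 0 (of_P q b))"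

definition eigenvalues :: "real \<Rightarrow> complex set" where
  "eigenvalues q = {\<mu>. \<exists>b\<in>hyperboloid q. b \<noteq> \<zero>\<^bsub>SUq q\<^esub> \<and> square_q q b = \<mu> \<odot>\<^bsub>SUq q\<^esub> b}"

section \<open>Monomials and the eigenvalue data\<close>

definition alpha_pow :: "real \<Rightarrow> int \<Rightarrow> suq" where
  "alpha_pow q t = (if t \<ge> 0 then alpha q [^]\<^bsub>SUq q\<^esub> nat t else alpha_star q [^]\<^bsub>SUq q\<^esub> nat (- t))"

definition monomial :: "real \<Rightarrow> int \<Rightarrow> nat \<Rightarrow> nat \<Rightarrow> suq" where
  "monomial q t k l = alpha_pow q t \<otimes>\<^bsub>SUq q\<^esub> gamma q [^]\<^bsub>SUq q\<^esub> k \<otimes>\<^bsub>SUq q\<^esub> gamma_star q [^]\<^bsub>SUq q\<^esub> l"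

definition triples :: "(int \<times> nat \<times> nat) set" where
  "triples = {(t, k, l). t + int k - int l = 0}"

definition qint :: "real \<Rightarrow> int \<Rightarrow> real" where
  "qint q m = (q powi (2 * m) - 1) / (q^2 - 1)"

definition eig_e :: "real \<Rightarrow> int \<Rightarrow> nat \<Rightarrow> nat \<Rightarrow> real" where
  "eig_e q t k l =
     (let K = int k; L = int l; s = - t in
      if t = 0 then
        - ((q powi (-2 * K) + q^4) * qint q K + q powi (-2 * K + 2) * (1 + q^2) * (qint q K)^2)
      else if t \<ge> 1 then
        - (q powi (-2 * L)) * (qint q L * qint q (t + 1) + q powi (2 * t + 2) * qint q L * qint q K
             + q^4 * qint q t * qint q (L + 1) + q powi (4 + 2 * t) * qint q K * qint q (L + 1))
      else
        - (q powi (-2 * s)) * (qint q s * qint q (K + 1) + q powi (-2 * L) * qint q L * qint q (K + 1)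
             + q^4 * qint q K * qint q (s + 1) + q powi (-2 * L + 4) * qint q K * qint q L))"

definition eig_c :: "real \<Rightarrow> int \<Rightarrow> nat \<Rightarrow> nat \<Rightarrow> real" where
  "eig_c q t k l =
     (let K = int k; L = int l; s = - t in
      if t = 0 then - (q powi (-2 * K)) * (1 + q^4) * (qint q K)^2
      else if t \<ge> 1 then - (q powi (-2 * L + 2 * t)) * (1 + q^4) * qint q L * qint q K
      else - (q powi (-2 * s - 2 * L)) * (1 + q^4) * qint q L * qint q K)"

definition p_coeff :: "real \<Rightarrow> int \<Rightarrow> nat \<Rightarrow> nat \<Rightarrow> nat \<Rightarrow> real" where
  "p_coeff q t k l i =
     (\<Prod>j<i. eig_c q t (k - j) (l - j) / (eig_e q t k l - eig_e q t (k - j - 1) (l - j - 1)))"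

definition eig_p :: "real \<Rightarrow> int \<Rightarrow> nat \<Rightarrow> nat \<Rightarrow> suq" where
  "eig_p q t k l = monomial q t k l \<oplus>\<^bsub>SUq q\<^esub>
     (\<Oplus>\<^bsub>SUq q\<^esub>i\<in>{1..min k l}. complex_of_real (p_coeff q t k l i) \<odot>\<^bsub>SUq q\<^esub> monomial q t (k - i) (l - i))"

end

theory Submission
  imports Defs
begin

text \<open>
  The functionals \<open>\<chi>\<^sub>3, \<chi>\<^sub>+, \<chi>\<^sub>-\<close> dual to \<open>\<eta>\<^sub>3, \<eta>\<^sub>+, \<eta>\<^sub>-\<close> are upper right entries of homomorphisms of
  \<open>P\<close> into upper triangular matrices; the one-forms have as coordinates the skew derivations
  \<open>\<partial>\<^sub>i p = p\<^sub>1 \<chi>\<^sub>i(p\<^sub>2)\<close>. The form \<open>\<eta>\<^sub>\<plusminus>\<close> is a combination \<open>\<Sum> g dh\<close>, and with the relations that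
  exact lists impose on products of the \<open>\<eta>\<^sub>i\<close> this gives
  \<open>d(x \<eta>\<^sub>- + y \<eta>\<^sub>+) = (\<partial>\<^sub>- y - q\<^sup>2 \<partial>\<^sub>+ x) dvol\<close> on base forms. That \<open>dvol\<close> is free over \<open>P\<close> follows from an
  operator model of the envelope in degrees at most two. As \<open>\<partial>\<^sub>+\<close> and \<open>\<partial>\<^sub>-\<close> are adjoint to each other up to
  powers of \<open>q\<close> and \<open>\<partial>\<^sub>- \<partial>\<^sub>+ = q\<^sup>2 \<partial>\<^sub>+ \<partial>\<^sub>-\<close> in weight zero, \<open>\<square>\<^sub>q = - (1 + q\<^sup>4) \<partial>\<^sub>+ \<partial>\<^sub>-\<close> on the hyperboloid.

  On monomials this operator is triangular, and the three formulas for \<open>e(t, k, l)\<close> all equal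
  \<open>- (1 + q\<^sup>4) q\<^sup>-\<^sup>2\<^sup>n [n] [n + 1]\<close> with \<open>n = max k l\<close>. These values decrease by at least one from \<open>n\<close> to \<open>n + 1\<close>,
  so the triangular system is solvable and the spectrum is uniformly discrete.
\<close>

section \<open>Linear algebra in records\<close>

text \<open>The objects are defined by quotients, definite descriptions and inverse images, so no
  formula for the Laplacian is usable before representatives are known to be unique: functions,
  one-forms and multiples of \<open>dvol\<close> must embed into the envelope, and
  \<open>ext_diff\<close> must not depend on the list that represents a form. The second point is
  the defining relation of the envelope, since two lists for one form differ by a null list. The
  first needs a representation, because an ideal generated by all null lists does not show what
  survives. The model exists because \<open>dd_commutator\<close> expresses
  \<open>dd Imi (dd Ipl h)\<close> minus \<open>q^2\<close> times \<open>dd Ipl (dd Imi h)\<close>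
  by \<open>dd Ith h\<close>: the \<open>dvol\<close> coefficient of a sum of terms
  \<open>dg dh\<close> is then determined by the sums of \<open>g dd i h\<close>, which vanish on
  null lists. The same commutator produces the factor \<open>1 + q^4\<close>: the Laplacian is minus
  the sum of \<open>dd Ipl (dd Imi b)\<close> and \<open>q^2\<close> times
  \<open>dd Imi (dd Ipl b)\<close>, and in weight zero the second summand is \<open>q^4\<close>
  times the first. Faithfulness rests on the independence of the monomials, read off from a left
  regular representation.\<close>

locale cspace = abelian_group V for V :: "'v calg" (structure) +
  assumes smult_closed [simp, intro]: "x \<in> carrier V \<Longrightarrow> c \<odot> x \<in> carrier V"
    and smult_l_distr: "x \<in> carrier V \<Longrightarrow> (a + b) \<odot> x = a \<odot> x \<oplus> b \<odot> x"
    and smult_r_distr: "\<lbrakk>x \<in> carrier V; y \<in> carrier V\<rbrakk> \<Longrightarrow> a \<odot> (x \<oplus> y) = a \<odot> x \<oplus> a \<odot> y"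
    and smult_assoc: "x \<in> carrier V \<Longrightarrow> (a * b) \<odot> x = a \<odot> (b \<odot> x)"
    and smult_one [simp]: "x \<in> carrier V \<Longrightarrow> 1 \<odot> x = x"
begin

lemma smult_zero_left [simp]:
  assumes "x \<in> carrier V" shows "0 \<odot> x = \<zero>"
proof -
  have "0 \<odot> x = 0 \<odot> x \<oplus> 0 \<odot> x" using smult_l_distr[OF assms, of 0 0] by simp
  then show ?thesis using assms by (metis add.l_cancel_one' smult_closed)
qed

lemma smult_zero_right [simp]: "c \<odot> \<zero> = \<zero>"
  by (metis zero_closed smult_assoc smult_zero_left mult_zero_right)

lemma minus_eq_smult:
  assumes "x \<in> carrier V" shows "\<ominus> x = (-1) \<odot> x"
proof -
  have "x \<oplus> (-1) \<odot> x = \<zero>" using smult_l_distr[OF assms, of 1 "-1"] assms by simp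
  then show ?thesis using assms by (metis minus_equality a_comm smult_closed)
qed

lemma finsum_smult:
  "finite A \<Longrightarrow> f \<in> A \<rightarrow> carrier V \<Longrightarrow> c \<odot> (\<Oplus>x\<in>A. f x) = (\<Oplus>x\<in>A. c \<odot> f x)"
  by (induction A rule: finite_induct) (auto simp: smult_r_distr finsum_insert Pi_iff)

end

text \<open>The linear extension of \<phi> from a basis to finite combinations. Evaluation of free
  algebras, maps out of tensor products, the involution of the free algebra and linear spans are all
  instances, so additivity and homogeneity are proved once.\<close>

definition lext :: "'v calg \<Rightarrow> ('x \<Rightarrow> 'v) \<Rightarrow> ('x \<Rightarrow>\<^sub>0 complex) \<Rightarrow> 'v" where
  "lext V \<phi> f = (\<Oplus>\<^bsub>V\<^esub>x\<in>Poly_Mapping.keys f. Poly_Mapping.lookup f x \<odot>\<^bsub>V\<^esub> \<phi> x)"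

lemma lookup_pm_scale [simp]: "Poly_Mapping.lookup (pm_scale c f) x = c * Poly_Mapping.lookup f x"
  by (simp add: pm_scale_def Poly_Mapping.map.rep_eq when_def)

lemma keys_pm_scale: "Poly_Mapping.keys (pm_scale c f) \<subseteq> Poly_Mapping.keys f"
  by (auto simp: in_keys_iff)

lemma pm_scale_single [simp]: "pm_scale c (Poly_Mapping.single x a) = Poly_Mapping.single x (c * a)"
  by (rule poly_mapping_eqI) (simp add: lookup_single when_def)

lemma pm_scale_add: "pm_scale c (f + g) = pm_scale c f + pm_scale c g"
  and pm_scale_diff: "pm_scale c (f - g) = pm_scale c f - pm_scale c g"
  and pm_scale_left: "pm_scale (a + b) f = pm_scale a f + pm_scale b f"
  and pm_scale_scale [simp]: "pm_scale a (pm_scale b f) = pm_scale (a * b) f"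
  and pm_scale_one [simp]: "pm_scale 1 f = f"
  and pm_scale_zero [simp]: "pm_scale 0 f = 0" "pm_scale c 0 = 0"
  and pm_scale_minus: "pm_scale (-1) f = - f"
  by (auto intro!: poly_mapping_eqI simp: lookup_add lookup_minus algebra_simps)

lemma pm_scale_conv_mult: "pm_scale c p = Poly_Mapping.single 0 c * p"
  by (simp add: pm_scale_def mult_map_scale_conv_mult)

lemma pm_scale_mult_left: "pm_scale c f * g = pm_scale c (f * g)"
  by (simp add: pm_scale_conv_mult mult.assoc)

text \<open>Peels off one basis vector at a time and keeps the support inside \<open>X\<close>, so
  that maps controlled only on a carrier can be treated.\<close>

lemma pm_induct [consumes 1, case_names zero single_add]:
  assumes "Poly_Mapping.keys f \<subseteq> X" "P 0"
    and step: "\<And>x c f. \<lbrakk>x \<in> X; Poly_Mapping.keys f \<subseteq> X; P f\<rbrakk> \<Longrightarrow> P (Poly_Mapping.single x c + f)"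
  shows "P f"
  using assms(1)
proof (induction f rule: update_induct)
  case const
  then show ?case using assms(2) by simp
next
  case (update f a b)
  have eq: "Poly_Mapping.update a b f = Poly_Mapping.single a b + f"
    using update.hyps(1) by (intro poly_mapping_eqI) (auto simp: lookup_update lookup_add lookup_single when_def in_keys_iff)
  have "Poly_Mapping.keys f \<subseteq> X" "a \<in> X" using update.prems update.hyps by (auto simp: keys_update)
  then show ?case unfolding eq using step update.IH by blast
qed

text \<open>Elements supported on the neutral word are the scalars. Multiplying by them is
  \<open>pm_scale\<close>, so their centrality is what moves a scalar past the left factor of a
  noncommutative product.\<close>

lemma single_zero_commutes:
  fixes f :: "'b::monoid_add \<Rightarrow>\<^sub>0 complex"
  shows "f * Poly_Mapping.single 0 c = Poly_Mapping.single 0 c * f"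
proof -
  have "Poly_Mapping.keys f \<subseteq> UNIV" by simp
  then show ?thesis
    by (induction f rule: pm_induct) (simp_all add: mult_single distrib_left distrib_right mult.commute)
qed

lemma pm_scale_mult_right: "f * pm_scale c g = pm_scale c (f * g)"
  by (simp add: pm_scale_conv_mult mult.assoc[symmetric] single_zero_commutes)

section \<open>Linear maps between spaces given as records\<close>

definition lin :: "'v calg \<Rightarrow> 'u calg \<Rightarrow> ('v \<Rightarrow> 'u) \<Rightarrow> bool" where
  "lin V U f \<longleftrightarrow> f \<in> carrier V \<rightarrow> carrier U \<and>
     (\<forall>x\<in>carrier V. \<forall>y\<in>carrier V. f (x \<oplus>\<^bsub>V\<^esub> y) = f x \<oplus>\<^bsub>U\<^esub> f y) \<and>
     (\<forall>c. \<forall>x\<in>carrier V. f (c \<odot>\<^bsub>V\<^esub> x) = c \<odot>\<^bsub>U\<^esub> f x)"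

lemma linI:
  assumes "\<And>x. x \<in> carrier V \<Longrightarrow> f x \<in> carrier U"
    and "\<And>x y. \<lbrakk>x \<in> carrier V; y \<in> carrier V\<rbrakk> \<Longrightarrow> f (x \<oplus>\<^bsub>V\<^esub> y) = f x \<oplus>\<^bsub>U\<^esub> f y"
    and "\<And>c x. x \<in> carrier V \<Longrightarrow> f (c \<odot>\<^bsub>V\<^esub> x) = c \<odot>\<^bsub>U\<^esub> f x"
  shows "lin V U f"
  using assms by (auto simp: lin_def)

lemma lin_closed: "lin V U f \<Longrightarrow> x \<in> carrier V \<Longrightarrow> f x \<in> carrier U"
  and lin_add: "lin V U f \<Longrightarrow> x \<in> carrier V \<Longrightarrow> y \<in> carrier V \<Longrightarrow> f (x \<oplus>\<^bsub>V\<^esub> y) = f x \<oplus>\<^bsub>U\<^esub> f y"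
  and lin_smult: "lin V U f \<Longrightarrow> x \<in> carrier V \<Longrightarrow> f (c \<odot>\<^bsub>V\<^esub> x) = c \<odot>\<^bsub>U\<^esub> f x"
  by (auto simp: lin_def)

lemma lin_zero: "cspace V \<Longrightarrow> cspace U \<Longrightarrow> lin V U f \<Longrightarrow> f \<zero>\<^bsub>V\<^esub> = \<zero>\<^bsub>U\<^esub>"
proof -
  assume "cspace V" "cspace U" and L: "lin V U f"
  then interpret V: cspace V + U: cspace U by simp_all
  have "f (0 \<odot>\<^bsub>V\<^esub> \<zero>\<^bsub>V\<^esub>) = 0 \<odot>\<^bsub>U\<^esub> f \<zero>\<^bsub>V\<^esub>" using L by (simp only: lin_smult V.zero_closed)
  then show ?thesis using lin_closed[OF L V.zero_closed] by simp
qed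

lemma lin_uminus: "cspace V \<Longrightarrow> cspace U \<Longrightarrow> lin V U f \<Longrightarrow> x \<in> carrier V \<Longrightarrow> f (\<ominus>\<^bsub>V\<^esub> x) = \<ominus>\<^bsub>U\<^esub> f x"
  by (simp add: cspace.minus_eq_smult lin_closed lin_smult)

lemma lin_minus:
  "cspace V \<Longrightarrow> cspace U \<Longrightarrow> lin V U f \<Longrightarrow> x \<in> carrier V \<Longrightarrow> y \<in> carrier V \<Longrightarrow>
     f (x \<ominus>\<^bsub>V\<^esub> y) = f x \<ominus>\<^bsub>U\<^esub> f y"
  by (simp add: a_minus_def lin_add lin_uminus abelian_group.a_inv_closed cspace_def)

lemma lin_comp: "lin V U f \<Longrightarrow> lin U T g \<Longrightarrow> lin V T (\<lambda>x. g (f x))"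
  by (auto simp: lin_def Pi_iff)

lemma lin_finsum:
  assumes "cspace V" "cspace U" "lin V U f" "finite A" "\<And>x. x \<in> A \<Longrightarrow> g x \<in> carrier V"
  shows "f (\<Oplus>\<^bsub>V\<^esub>x\<in>A. g x) = (\<Oplus>\<^bsub>U\<^esub>x\<in>A. f (g x))"
proof -
  interpret V: cspace V by fact
  interpret U: cspace U by fact
  show ?thesis using assms(4,5)
    by (induction A rule: finite_induct)
      (auto simp: lin_zero[OF assms(1-3)] V.finsum_insert U.finsum_insert Pi_iff lin_add[OF assms(3)] lin_closed[OF assms(3)])
qed

lemma lin_lsum:
  assumes "cspace V" "cspace U" "lin V U f" "\<And>x. x \<in> set xs \<Longrightarrow> g x \<in> carrier V"
  shows "f (lsum V g xs) = lsum U (\<lambda>x. f (g x)) xs \<and> lsum V g xs \<in> carrier V"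
proof -
  interpret V: cspace V by fact
  interpret U: cspace U by fact
  show ?thesis using assms(4)
    by (induction xs) (auto simp: lsum_def lin_zero[OF assms(1-3)] lin_add[OF assms(3)])
qed

context cspace
begin

text \<open>Two combinations have different supports; summing both over one common finite set makes
  their sum a termwise computation.\<close>

lemma lext_superset:
  assumes "finite K" "Poly_Mapping.keys f \<subseteq> K" "\<phi> \<in> K \<rightarrow> carrier V"
  shows "lext V \<phi> f = (\<Oplus>x\<in>K. Poly_Mapping.lookup f x \<odot> \<phi> x)"
  unfolding lext_def
  by (rule add.finprod_mono_neutral_cong_left) (use assms in \<open>auto simp: in_keys_iff Pi_iff\<close>)

lemma lext_closed:
  assumes "Poly_Mapping.keys f \<subseteq> X" "\<phi> \<in> X \<rightarrow> carrier V" shows "lext V \<phi> f \<in> carrier V"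
  unfolding lext_def by (rule finsum_closed) (use assms in \<open>auto simp: Pi_iff\<close>)

lemma lext_zero [simp]: "lext V \<phi> 0 = \<zero>"
  by (simp add: lext_def)

lemma lext_add:
  assumes "Poly_Mapping.keys f \<subseteq> X" "Poly_Mapping.keys g \<subseteq> X" "\<phi> \<in> X \<rightarrow> carrier V"
  shows "lext V \<phi> (f + g) = lext V \<phi> f \<oplus> lext V \<phi> g"
proof -
  let ?K = "Poly_Mapping.keys f \<union> Poly_Mapping.keys g"
  have K: "finite ?K" "\<phi> \<in> ?K \<rightarrow> carrier V" using assms by auto
  have "Poly_Mapping.keys (f + g) \<subseteq> ?K" by (rule keys_add)
  with K have "lext V \<phi> (f + g) = (\<Oplus>x\<in>?K. Poly_Mapping.lookup (f + g) x \<odot> \<phi> x)"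
    by (intro lext_superset)
  also have "\<dots> = (\<Oplus>x\<in>?K. Poly_Mapping.lookup f x \<odot> \<phi> x \<oplus> Poly_Mapping.lookup g x \<odot> \<phi> x)"
    by (rule finsum_cong') (use K in \<open>auto simp: lookup_add smult_l_distr Pi_iff\<close>)
  also have "\<dots> = lext V \<phi> f \<oplus> lext V \<phi> g"
    using K by (subst finsum_addf) (auto simp: lext_superset[of ?K] Pi_iff)
  finally show ?thesis .
qed

lemma lext_scale:
  assumes "Poly_Mapping.keys f \<subseteq> X" "\<phi> \<in> X \<rightarrow> carrier V"
  shows "lext V \<phi> (pm_scale c f) = c \<odot> lext V \<phi> f"
proof -
  have K: "\<phi> \<in> Poly_Mapping.keys f \<rightarrow> carrier V" using assms by auto
  have "lext V \<phi> (pm_scale c f) = (\<Oplus>x\<in>Poly_Mapping.keys f. Poly_Mapping.lookup (pm_scale c f) x \<odot> \<phi> x)"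
    by (rule lext_superset) (use K keys_pm_scale[of c f] in auto)
  also have "\<dots> = (\<Oplus>x\<in>Poly_Mapping.keys f. c \<odot> (Poly_Mapping.lookup f x \<odot> \<phi> x))"
    by (rule finsum_cong') (use K in \<open>auto simp: smult_assoc Pi_iff\<close>)
  also have "\<dots> = c \<odot> lext V \<phi> f"
    unfolding lext_def using K by (subst finsum_smult) (auto simp: Pi_iff)
  finally show ?thesis .
qed

lemma lext_single [simp]:
  assumes "\<phi> x \<in> carrier V" shows "lext V \<phi> (Poly_Mapping.single x c) = c \<odot> \<phi> x"
  using assms by (simp add: lext_def)

lemma lext_diff:
  assumes "Poly_Mapping.keys f \<subseteq> X" "Poly_Mapping.keys g \<subseteq> X" "\<phi> \<in> X \<rightarrow> carrier V"
  shows "lext V \<phi> (f - g) = lext V \<phi> f \<ominus> lext V \<phi> g"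
proof -
  have g: "Poly_Mapping.keys (pm_scale (-1) g) \<subseteq> X" using assms(2) keys_pm_scale[of "-1" g] by auto
  have eq: "f - g = f + pm_scale (-1) g" by (simp add: pm_scale_minus)
  show ?thesis unfolding eq
    using lext_add[OF assms(1) g assms(3)] lext_scale[OF assms(2,3), of "-1"] lext_closed[OF assms(2,3)]
    by (simp add: minus_eq_smult a_minus_def)
qed

end

subsection \<open>Functionals\<close>

locale functional = cspace V for V :: "'v calg" (structure) and f :: "'v \<Rightarrow> complex" +
  assumes functional_add [simp]: "\<lbrakk>x \<in> carrier V; y \<in> carrier V\<rbrakk> \<Longrightarrow> f (x \<oplus> y) = f x + f y"
    and functional_smult [simp]: "x \<in> carrier V \<Longrightarrow> f (c \<odot> x) = c * f x"
begin

lemma functional_zero [simp]: "f \<zero> = 0"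
  using functional_smult[of \<zero> 0] by simp

lemma functional_uminus [simp]: "x \<in> carrier V \<Longrightarrow> f (\<ominus> x) = - f x"
  by (simp add: minus_eq_smult)

lemma functional_minus [simp]: "\<lbrakk>x \<in> carrier V; y \<in> carrier V\<rbrakk> \<Longrightarrow> f (x \<ominus> y) = f x - f y"
  by (simp add: a_minus_def)

end

interpretation pm: vector_space "pm_scale :: complex \<Rightarrow> ('x \<Rightarrow>\<^sub>0 complex) \<Rightarrow> _"
  by standard (auto simp: pm_scale_add pm_scale_left)

interpretation cpx: vector_space "(*) :: complex \<Rightarrow> complex \<Rightarrow> _"
  by standard (auto simp: algebra_simps)

interpretation pm_cpx: vector_space_pair "pm_scale :: complex \<Rightarrow> ('x \<Rightarrow>\<^sub>0 complex) \<Rightarrow> _" "(*) :: complex \<Rightarrow> complex \<Rightarrow> _" ..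

text \<open>An algebraic Hahn-Banach theorem, pulled back from the free vector space on the carrier:
  it reduces every identity between linear combinations to complex arithmetic.\<close>

lemma (in cspace) ex_functional:
  assumes x: "x \<in> carrier V" "x \<noteq> \<zero>"
  obtains f where "functional V f" "f x \<noteq> 0"
proof -
  have id: "(\<lambda>x. x) \<in> carrier V \<rightarrow> carrier V" by simp
  define K where "K = {f. Poly_Mapping.keys f \<subseteq> carrier V \<and> lext V (\<lambda>x. x) f = \<zero>}"
  have "pm.subspace K"
  proof (rule pm.subspaceI)
    show "0 \<in> K" by (simp add: K_def)
    show "f + g \<in> K" if "f \<in> K" "g \<in> K" for f g
    proof -
      have "Poly_Mapping.keys (f + g) \<subseteq> carrier V" using that keys_add[of f g] by (auto simp: K_def)
      then show ?thesis using that lext_add[OF _ _ id, of f g] by (simp add: K_def)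
    qed
    show "pm_scale c f \<in> K" if "f \<in> K" for c f
      using that lext_scale[OF _ id] keys_pm_scale[of c f] by (auto simp: K_def)
  qed
  obtain B where B: "B \<subseteq> K" "pm.independent B" "K \<subseteq> pm.span B"
    by (rule pm.maximal_independent_subset[of K])
  let ?x = "Poly_Mapping.single x (1::complex)"
  have span: "pm.span B \<subseteq> K" using B(1) \<open>pm.subspace K\<close> by (rule pm.span_minimal)
  have "?x \<notin> K" using x by (simp add: K_def)
  then have "?x \<notin> pm.span B" using span by auto
  then have indep: "pm.independent (insert ?x B)" using B(2) by (simp add: pm.independent_insert)
  have "\<exists>g. Vector_Spaces.linear pm_scale (*) g \<and> (\<forall>y\<in>insert ?x B. g y = (if y = ?x then 1 else 0))"
    by (rule pm_cpx.linear_independent_extend[OF indep])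
  then obtain g where g': "Vector_Spaces.linear pm_scale (*) g \<and> (\<forall>y\<in>insert ?x B. g y = (if y = ?x then 1 else 0))" ..
  note g = conjunct1[OF g'] conjunct2[OF g']
  have hom: "module_hom pm_scale (*) g" using g(1) by (rule Vector_Spaces.linear.axioms(3))
  note g_simps = module_hom.add[OF hom] module_hom.diff[OF hom] module_hom.scale[OF hom]
  have "?x \<notin> B" using \<open>?x \<notin> pm.span B\<close> pm.span_base[of ?x B] by auto
  then have "\<forall>y\<in>B. g y = 0" using g(2) by auto
  have gK: "g y = 0" if "y \<in> K" for y
    by (rule module_hom.eq_0_on_span[OF hom, of B]) (use that B(3) \<open>\<forall>y\<in>B. g y = 0\<close> in auto)
  define f where "f v = g (Poly_Mapping.single v 1)" for v
  have "functional V f"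
  proof unfold_locales
    fix u v assume uv: "u \<in> carrier V" "v \<in> carrier V"
    let ?d = "Poly_Mapping.single (u \<oplus> v) 1 - (Poly_Mapping.single u 1 + Poly_Mapping.single v (1::complex))"
    have k: "Poly_Mapping.keys (Poly_Mapping.single u 1 + Poly_Mapping.single v (1::complex)) \<subseteq> carrier V"
      using uv keys_add[of "Poly_Mapping.single u (1::complex)" "Poly_Mapping.single v 1"] by auto
    have k': "Poly_Mapping.keys (Poly_Mapping.single (u \<oplus> v) (1::complex)) \<subseteq> carrier V" using uv by auto
    have "Poly_Mapping.keys ?d \<subseteq> carrier V" by (rule order_trans[OF keys_diff Un_least[OF k' k]])
    moreover have "lext V (\<lambda>x. x) ?d = \<zero>"
      using uv by (subst lext_diff[OF k' k id]) (simp add: lext_add[of _ "carrier V"] a_minus_def r_neg)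
    ultimately have "?d \<in> K" by (simp add: K_def)
    from gK[OF this] show "f (u \<oplus> v) = f u + f v"
      by (simp add: f_def g_simps)
  next
    fix u c assume u: "u \<in> carrier V"
    let ?d = "Poly_Mapping.single (c \<odot> u) 1 - Poly_Mapping.single u c"
    have k: "Poly_Mapping.keys (Poly_Mapping.single u c) \<subseteq> carrier V" using u by auto
    have k': "Poly_Mapping.keys (Poly_Mapping.single (c \<odot> u) (1::complex)) \<subseteq> carrier V" using u by auto
    have "Poly_Mapping.keys ?d \<subseteq> carrier V" by (rule order_trans[OF keys_diff Un_least[OF k' k]])
    moreover have "lext V (\<lambda>x. x) ?d = \<zero>"
      using u by (subst lext_diff[OF k' k id]) (simp add: a_minus_def r_neg)
    ultimately have "?d \<in> K" by (simp add: K_def)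
    from gK[OF this] have "f (c \<odot> u) = g (Poly_Mapping.single u c)" by (simp add: f_def g_simps)
    also have "Poly_Mapping.single u c = pm_scale c (Poly_Mapping.single u 1)" by simp
    finally show "f (c \<odot> u) = c * f u" by (simp only: f_def g_simps)
  qed
  moreover have "f x \<noteq> 0" using g(2) by (simp add: f_def)
  ultimately show ?thesis using that by blast
qed

lemma (in cspace) eq_by_functionals:
  assumes "x \<in> carrier V" "y \<in> carrier V" and "\<And>f. functional V f \<Longrightarrow> f x = f y"
  shows "x = y"
proof (rule ccontr)
  assume "x \<noteq> y"
  have "x \<ominus> y \<noteq> \<zero>"
  proof
    assume "x \<ominus> y = \<zero>"
    then have "(x \<ominus> y) \<oplus> y = y" using assms(2) by simp
    then show False using assms(1,2) \<open>x \<noteq> y\<close> by (simp add: a_minus_def a_assoc l_neg)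
  qed
  with ex_functional[OF minus_closed[OF assms(1,2)]]
  obtain f where f: "functional V f" "f (x \<ominus> y) \<noteq> 0" by auto
  interpret functional V f by (rule f(1))
  show False using f(2) assms(3)[OF f(1)] by (simp add: assms(1,2))
qed

subsection \<open>Algebras\<close>

locale calgebra = cspace V + ring V for V :: "'v calg" (structure) +
  assumes smult_mult_left [simp]: "\<lbrakk>x \<in> carrier V; y \<in> carrier V\<rbrakk> \<Longrightarrow> (c \<odot> x) \<otimes> y = c \<odot> (x \<otimes> y)"
    and smult_mult_right [simp]: "\<lbrakk>x \<in> carrier V; y \<in> carrier V\<rbrakk> \<Longrightarrow> x \<otimes> (c \<odot> y) = c \<odot> (x \<otimes> y)"

text \<open>The additive inverse of x is (-1) x; distributivity and the last assumption turn this
  into an inverse law.\<close>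

lemma cspaceI:
  fixes V :: "'v calg" (structure)
  assumes "\<And>x y. \<lbrakk>x \<in> carrier V; y \<in> carrier V\<rbrakk> \<Longrightarrow> x \<oplus> y \<in> carrier V"
    and "\<zero> \<in> carrier V"
    and "\<And>x y z. \<lbrakk>x \<in> carrier V; y \<in> carrier V; z \<in> carrier V\<rbrakk> \<Longrightarrow> (x \<oplus> y) \<oplus> z = x \<oplus> (y \<oplus> z)"
    and "\<And>x y. \<lbrakk>x \<in> carrier V; y \<in> carrier V\<rbrakk> \<Longrightarrow> x \<oplus> y = y \<oplus> x"
    and "\<And>x. x \<in> carrier V \<Longrightarrow> \<zero> \<oplus> x = x"
    and "\<And>x c. x \<in> carrier V \<Longrightarrow> c \<odot> x \<in> carrier V"
    and "\<And>x a b. x \<in> carrier V \<Longrightarrow> (a + b) \<odot> x = a \<odot> x \<oplus> b \<odot> x"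
    and "\<And>x y a. \<lbrakk>x \<in> carrier V; y \<in> carrier V\<rbrakk> \<Longrightarrow> a \<odot> (x \<oplus> y) = a \<odot> x \<oplus> a \<odot> y"
    and "\<And>x a b. x \<in> carrier V \<Longrightarrow> (a * b) \<odot> x = a \<odot> (b \<odot> x)"
    and "\<And>x. x \<in> carrier V \<Longrightarrow> 1 \<odot> x = x"
    and "\<And>x. x \<in> carrier V \<Longrightarrow> 0 \<odot> x = \<zero>"
  shows "cspace V"
proof -
  have "abelian_group V"
  proof (rule abelian_groupI)
    fix x assume x: "x \<in> carrier V"
    have "(-1) \<odot> x \<oplus> x = (-1) \<odot> x \<oplus> 1 \<odot> x" using assms(10)[OF x] by simp
    also have "\<dots> = \<zero>" using assms(7)[OF x, of "-1" 1] assms(11)[OF x] by simp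
    finally show "\<exists>y\<in>carrier V. y \<oplus> x = \<zero>" using assms(6)[OF x] by blast
  qed (use assms in auto)
  then show ?thesis by (intro cspace.intro cspace_axioms.intro assms)
qed

lemma calgebraI:
  fixes V :: "'v calg" (structure)
  assumes "cspace V"
    and "\<And>x y. \<lbrakk>x \<in> carrier V; y \<in> carrier V\<rbrakk> \<Longrightarrow> x \<otimes> y \<in> carrier V"
    and "\<one> \<in> carrier V"
    and "\<And>x y z. \<lbrakk>x \<in> carrier V; y \<in> carrier V; z \<in> carrier V\<rbrakk> \<Longrightarrow> (x \<otimes> y) \<otimes> z = x \<otimes> (y \<otimes> z)"
    and "\<And>x. x \<in> carrier V \<Longrightarrow> \<one> \<otimes> x = x"
    and "\<And>x. x \<in> carrier V \<Longrightarrow> x \<otimes> \<one> = x"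
    and "\<And>x y z. \<lbrakk>x \<in> carrier V; y \<in> carrier V; z \<in> carrier V\<rbrakk> \<Longrightarrow> (x \<oplus> y) \<otimes> z = x \<otimes> z \<oplus> y \<otimes> z"
    and "\<And>x y z. \<lbrakk>x \<in> carrier V; y \<in> carrier V; z \<in> carrier V\<rbrakk> \<Longrightarrow> z \<otimes> (x \<oplus> y) = z \<otimes> x \<oplus> z \<otimes> y"
    and "\<And>x y c. \<lbrakk>x \<in> carrier V; y \<in> carrier V\<rbrakk> \<Longrightarrow> (c \<odot> x) \<otimes> y = c \<odot> (x \<otimes> y)"
    and "\<And>x y c. \<lbrakk>x \<in> carrier V; y \<in> carrier V\<rbrakk> \<Longrightarrow> x \<otimes> (c \<odot> y) = c \<odot> (x \<otimes> y)"
  shows "calgebra V"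
proof -
  interpret cspace V by fact
  have "ring V"
    by (intro ringI abelian_group_axioms monoidI) (use assms in auto)
  then show ?thesis using assms by (intro calgebra.intro calgebra_axioms.intro)
qed

text \<open>The axioms are identities, so they pass along any surjection that respects the
  operations. Quotients and the record \<open>tensor_alg\<close>, which differs from
  \<open>tensor\<close> only in its product and unit, receive their structure in this way.\<close>

lemma cspace_image:
  fixes V :: "'v calg" and U :: "'u calg"
  assumes "cspace V" "f ` carrier V = carrier U" "f \<zero>\<^bsub>V\<^esub> = \<zero>\<^bsub>U\<^esub>"
    and "\<And>x y. \<lbrakk>x \<in> carrier V; y \<in> carrier V\<rbrakk> \<Longrightarrow> f x \<oplus>\<^bsub>U\<^esub> f y = f (x \<oplus>\<^bsub>V\<^esub> y)"
    and "\<And>x c. x \<in> carrier V \<Longrightarrow> c \<odot>\<^bsub>U\<^esub> f x = f (c \<odot>\<^bsub>V\<^esub> x)"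
  shows "cspace U"
proof -
  interpret V: cspace V by fact
  show ?thesis
    by (rule cspaceI)
       (auto simp: assms(2)[symmetric] assms(3)[symmetric] assms(4,5) V.a_ac V.smult_l_distr V.smult_r_distr V.smult_assoc)
qed

lemma calgebra_image:
  fixes V :: "'v calg" and U :: "'u calg"
  assumes "calgebra V" "f ` carrier V = carrier U" "f \<zero>\<^bsub>V\<^esub> = \<zero>\<^bsub>U\<^esub>" "f \<one>\<^bsub>V\<^esub> = \<one>\<^bsub>U\<^esub>"
    and "\<And>x y. \<lbrakk>x \<in> carrier V; y \<in> carrier V\<rbrakk> \<Longrightarrow> f x \<oplus>\<^bsub>U\<^esub> f y = f (x \<oplus>\<^bsub>V\<^esub> y)"
    and "\<And>x y. \<lbrakk>x \<in> carrier V; y \<in> carrier V\<rbrakk> \<Longrightarrow> f x \<otimes>\<^bsub>U\<^esub> f y = f (x \<otimes>\<^bsub>V\<^esub> y)"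
    and "\<And>x c. x \<in> carrier V \<Longrightarrow> c \<odot>\<^bsub>U\<^esub> f x = f (c \<odot>\<^bsub>V\<^esub> x)"
  shows "calgebra U"
proof -
  interpret V: calgebra V by fact
  have U: "cspace U"
    by (rule cspace_image[OF V.cspace_axioms assms(2,3,5,7)])
  show ?thesis
    by (rule calgebraI[OF U])
       (auto simp: assms(2)[symmetric] assms(4)[symmetric] assms(5-7) V.m_assoc V.l_distr V.r_distr)
qed

subsection \<open>Quotients\<close>

definition lsubspace :: "'v calg \<Rightarrow> 'v set \<Rightarrow> bool" where
  "lsubspace V W \<longleftrightarrow> W \<subseteq> carrier V \<and> \<zero>\<^bsub>V\<^esub> \<in> W \<and> (\<forall>x\<in>W. \<forall>y\<in>W. x \<oplus>\<^bsub>V\<^esub> y \<in> W) \<and>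
     (\<forall>c. \<forall>x\<in>W. c \<odot>\<^bsub>V\<^esub> x \<in> W)"

locale quotient_space = cspace V for V :: "'v calg" (structure) and W :: "'v set" +
  assumes subsp: "lsubspace V W"
begin

lemma W_carrier: "x \<in> W \<Longrightarrow> x \<in> carrier V"
  and W_zero [simp]: "\<zero> \<in> W"
  and W_add: "x \<in> W \<Longrightarrow> y \<in> W \<Longrightarrow> x \<oplus> y \<in> W"
  and W_smult: "x \<in> W \<Longrightarrow> c \<odot> x \<in> W"
  using subsp by (auto simp: lsubspace_def)

lemma W_uminus: "x \<in> W \<Longrightarrow> \<ominus> x \<in> W"
  by (simp add: W_carrier minus_eq_smult W_smult)

lemma abelian_subgroup: "abelian_subgroup W V"
proof (rule abelian_subgroupI3[OF _ abelian_group_axioms])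
  show "additive_subgroup W V"
    by (rule additive_subgroup.intro, rule add.subgroupI)
      (use subsp W_uminus W_add W_carrier W_zero in \<open>auto simp: a_inv_def[symmetric] lsubspace_def simp del: W_zero\<close>)
qed

lemma coset_eq_iff:
  assumes "x \<in> carrier V" "y \<in> carrier V"
  shows "W +> x = W +> y \<longleftrightarrow> x \<ominus> y \<in> W"
proof -
  interpret S: abelian_subgroup W V by (rule abelian_subgroup)
  have "x \<in> W +> y \<longleftrightarrow> x \<ominus> y \<in> W"
    using S.a_rcos_module[OF assms(2,1)] by (simp add: a_minus_def)
  moreover have "W +> x = W +> y" if "x \<in> W +> y"
    using a_repr_independence[OF that assms(2) S.a_subgroup] by simp
  moreover have "x \<in> W +> x" using S.a_rcos_self[OF assms(1)] .
  ultimately show ?thesis by auto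
qed

lemma coset_self: "x \<in> carrier V \<Longrightarrow> x \<in> W +> x"
  using abelian_subgroup by (rule abelian_subgroup.a_rcos_self)

lemma in_coset: "x \<in> carrier V \<Longrightarrow> y \<in> W +> x \<Longrightarrow> y \<in> carrier V \<and> y \<ominus> x \<in> W \<and> W +> y = W +> x"
proof -
  assume x: "x \<in> carrier V" and y: "y \<in> W +> x"
  interpret S: abelian_subgroup W V by (rule abelian_subgroup)
  have "y \<in> carrier V" using y x W_carrier by (auto simp: a_r_coset_def r_coset_def)
  moreover have "W +> x = W +> y"
    using a_repr_independence[OF y x S.a_subgroup] .
  ultimately show ?thesis using coset_eq_iff[OF _ x] by auto
qed

lemma quot_carrier: "carrier (quot_alg V W) = (\<lambda>x. W +> x) ` carrier V"
  by (auto simp: quot_alg_def FactRing_def ring.defs A_RCOSETS_defs a_r_coset_def r_coset_def)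

lemma quot_zero: "\<zero>\<^bsub>quot_alg V W\<^esub> = W" "W +> \<zero> = W"
proof -
  show "\<zero>\<^bsub>quot_alg V W\<^esub> = W" by (simp add: quot_alg_def FactRing_def ring.defs)
  show "W +> \<zero> = W" using W_carrier by (auto simp: a_r_coset_def r_coset_def)
qed

lemma quot_add:
  "\<lbrakk>x \<in> carrier V; y \<in> carrier V\<rbrakk> \<Longrightarrow> (W +> x) \<oplus>\<^bsub>quot_alg V W\<^esub> (W +> y) = W +> (x \<oplus> y)"
  using abelian_subgroup.a_rcos_sum[OF abelian_subgroup]
  by (simp add: quot_alg_def FactRing_def ring.defs)

lemma quot_smult:
  assumes "x \<in> carrier V" shows "c \<odot>\<^bsub>quot_alg V W\<^esub> (W +> x) = W +> (c \<odot> x)"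
proof -
  have "W +> (c \<odot> y) = W +> (c \<odot> x)" if "y \<in> W +> x" for y
  proof -
    have y: "y \<in> carrier V" "y \<ominus> x \<in> W" using in_coset[OF assms that] by auto
    have "c \<odot> y \<ominus> c \<odot> x = c \<odot> (y \<ominus> x)"
      using y assms by (simp add: a_minus_def smult_r_distr minus_eq_smult smult_assoc[symmetric])
    then show ?thesis using y assms coset_eq_iff W_smult by simp
  qed
  then have "(\<Union>y\<in>W +> x. W +> (c \<odot> y)) = (\<Union>y\<in>W +> x. W +> (c \<odot> x))"
    by (rule SUP_cong[OF refl])
  also have "\<dots> = W +> (c \<odot> x)" using coset_self[OF assms] by blast
  finally show ?thesis by (simp add: quot_alg_def ring.defs module.defs)
qed

lemma cspace_quot: "cspace (quot_alg V W)"
  by (rule cspace_image[OF cspace_axioms quot_carrier[symmetric]])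
    (simp_all add: quot_zero quot_add quot_smult)

lemma lin_coset: "lin V (quot_alg V W) (\<lambda>x. W +> x)"
  by (rule linI) (simp_all add: quot_carrier quot_add quot_smult)

lemma coset_zero_iff: "x \<in> carrier V \<Longrightarrow> W +> x = \<zero>\<^bsub>quot_alg V W\<^esub> \<longleftrightarrow> x \<in> W"
  using coset_eq_iff[of x \<zero>] by (simp add: quot_zero a_minus_def minus_eq_smult)

text \<open>A linear map that kills \<open>W\<close> is constant on every coset, hence the image of
  the coset is a singleton and the definite description in \<open>descend\<close> picks its
  element.\<close>

lemma descend_coset:
  assumes "cspace U" "lin V U f" "\<And>w. w \<in> W \<Longrightarrow> f w = \<zero>\<^bsub>U\<^esub>" "x \<in> carrier V"
  shows "descend f (W +> x) = f x"
proof -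
  interpret U: cspace U by fact
  have "f y = f x" if "y \<in> W +> x" for y
  proof -
    have y: "y \<in> carrier V" "y \<ominus> x \<in> W" using in_coset[OF assms(4) that] by auto
    have "f y \<ominus>\<^bsub>U\<^esub> f x = \<zero>\<^bsub>U\<^esub>"
      using lin_minus[OF cspace_axioms assms(1,2) y(1) assms(4)] assms(3)[OF y(2)] by simp
    then show ?thesis using lin_closed[OF assms(2)] y(1) assms(4)
      by (simp add: U.minus_eq U.minus_unique U.add.inv_solve_right')
  qed
  then have "f ` (W +> x) = (\<lambda>_. f x) ` (W +> x)" by (rule image_cong[OF refl])
  also have "\<dots> = {f x}" using coset_self[OF assms(4)] by auto
  finally show ?thesis by (simp add: descend_def)
qed

lemma lin_descend:
  assumes "cspace U" "lin V U f" "\<And>w. w \<in> W \<Longrightarrow> f w = \<zero>\<^bsub>U\<^esub>"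
  shows "lin (quot_alg V W) U (descend f)"
  by (rule linI)
    (auto simp: quot_carrier quot_add quot_smult descend_coset[OF assms] lin_closed[OF assms(2)]
      lin_add[OF assms(2)] lin_smult[OF assms(2)])

end

definition alghom :: "'v calg \<Rightarrow> 'u calg \<Rightarrow> ('v \<Rightarrow> 'u) \<Rightarrow> bool" where
  "alghom A B f \<longleftrightarrow> lin A B f \<and> f \<one>\<^bsub>A\<^esub> = \<one>\<^bsub>B\<^esub> \<and>
     (\<forall>x\<in>carrier A. \<forall>y\<in>carrier A. f (x \<otimes>\<^bsub>A\<^esub> y) = f x \<otimes>\<^bsub>B\<^esub> f y)"

lemma alghom_lin: "alghom A B f \<Longrightarrow> lin A B f"
  and alghom_one: "alghom A B f \<Longrightarrow> f \<one>\<^bsub>A\<^esub> = \<one>\<^bsub>B\<^esub>"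
  and alghom_mult: "alghom A B f \<Longrightarrow> x \<in> carrier A \<Longrightarrow> y \<in> carrier A \<Longrightarrow> f (x \<otimes>\<^bsub>A\<^esub> y) = f x \<otimes>\<^bsub>B\<^esub> f y"
  by (auto simp: alghom_def)

locale quotient_algebra = calgebra V for V :: "'v calg" (structure) and W :: "'v set" +
  assumes ideal: "ideal W V"
begin

sublocale quotient_space V W
proof
  interpret I: ideal W V by (rule ideal)
  have "c \<odot> x \<in> W" if "x \<in> W" for c x
  proof -
    have "(c \<odot> \<one>) \<otimes> x \<in> W" using I.I_l_closed[OF that, of "c \<odot> \<one>"] by simp
    then show ?thesis using I.a_Hcarr[OF that] by simp
  qed
  then show "lsubspace V W"
    using I.a_Hcarr by (auto simp: lsubspace_def)
qed

lemma quot_mult: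
  "\<lbrakk>x \<in> carrier V; y \<in> carrier V\<rbrakk> \<Longrightarrow> (W +> x) \<otimes>\<^bsub>quot_alg V W\<^esub> (W +> y) = W +> (x \<otimes> y)"
  using ideal.rcoset_mult_add[OF ideal] by (simp add: quot_alg_def FactRing_def ring.defs)

lemma quot_one: "\<one>\<^bsub>quot_alg V W\<^esub> = W +> \<one>"
  by (simp add: quot_alg_def FactRing_def ring.defs)

lemma calgebra_quot: "calgebra (quot_alg V W)"
  by (rule calgebra_image[OF calgebra_axioms quot_carrier[symmetric]])
    (simp_all add: quot_zero quot_add quot_smult quot_mult quot_one)

lemma alghom_descend:
  assumes "calgebra U" "alghom V U f" "\<And>w. w \<in> W \<Longrightarrow> f w = \<zero>\<^bsub>U\<^esub>"
  shows "alghom (quot_alg V W) U (descend f)"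
proof -
  have U: "cspace U" using assms(1) by (simp add: calgebra_def)
  note L = alghom_lin[OF assms(2)]
  show ?thesis
    using lin_descend[OF U L assms(3)]
    by (auto simp: alghom_def quot_carrier quot_mult quot_one descend_coset[OF U L assms(3)]
        alghom_mult[OF assms(2)] alghom_one[OF assms(2)])
qed

end

lemma (in calgebra) quotient_Idl: "S \<subseteq> carrier V \<Longrightarrow> quotient_algebra V (Idl S)"
  by (intro quotient_algebra.intro calgebra_axioms quotient_algebra_axioms.intro genideal_ideal)

text \<open>The kernel of an algebra map is an ideal, so by minimality it contains the ideal
  generated by any part of it.\<close>

lemma (in calgebra) hom_vanishes_on_Idl:
  assumes "calgebra U" "alghom V U f" "S \<subseteq> carrier V" "\<And>s. s \<in> S \<Longrightarrow> f s = \<zero>\<^bsub>U\<^esub>" "x \<in> Idl S"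
  shows "f x = \<zero>\<^bsub>U\<^esub>"
proof -
  interpret U: calgebra U by fact
  note L = alghom_lin[OF assms(2)]
  note [simp] = lin_zero[OF cspace_axioms U.cspace_axioms L] lin_add[OF L] lin_closed[OF L]
    lin_uminus[OF cspace_axioms U.cspace_axioms L] alghom_mult[OF assms(2)]
  let ?K = "{x \<in> carrier V. f x = \<zero>\<^bsub>U\<^esub>}"
  have "ideal ?K V"
  proof (rule idealI)
    show "ring V" ..
    show "subgroup ?K (add_monoid V)"
      by (rule add.subgroupI) (auto simp: a_inv_def[symmetric])
  qed auto
  then have "Idl S \<subseteq> ?K" by (rule genideal_minimal) (use assms in auto)
  then show ?thesis using assms(5) by auto
qed

subsection \<open>Free algebras\<close>

lemma type_alg_simps [simp]:
  "carrier (type_alg s) = UNIV" "mult (type_alg s) = (*)" "\<one>\<^bsub>type_alg s\<^esub> = 1"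
  "\<zero>\<^bsub>type_alg s\<^esub> = 0" "add (type_alg s) = (+)" "smult (type_alg s) = s"
  by (simp_all add: type_alg_def)

lemma calgebra_complex: "calgebra (type_alg (*) :: complex calg)"
  by (rule calgebraI, rule cspaceI) (simp_all add: algebra_simps)

lemma functional_iff_lin: "cspace V \<Longrightarrow> functional V f \<longleftrightarrow> lin V (type_alg (*)) f"
  by (auto simp: functional_def functional_axioms_def lin_def)

lemma free_alg_simps [simp]:
  "carrier (free_alg X) = {f. \<forall>w\<in>Poly_Mapping.keys f. set (letters w) \<subseteq> X}"
  "mult (free_alg X) = (*)" "\<one>\<^bsub>free_alg X\<^esub> = 1"
  "\<zero>\<^bsub>free_alg X\<^esub> = 0" "add (free_alg X) = (+)" "smult (free_alg X) = pm_scale"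
  by (simp_all add: free_alg_def)

lemma carrier_free_alg_keys:
  "f \<in> carrier (free_alg X) \<longleftrightarrow> Poly_Mapping.keys f \<subseteq> {w. set (letters w) \<subseteq> X}"
  by auto

lemma letters_zero [simp]: "letters 0 = []"
  and letters_plus [simp]: "letters (u + v) = letters u @ letters v"
  by (simp_all add: zero_fword_def plus_fword_def)

lemma calgebra_pm: "calgebra (type_alg pm_scale :: ('m::monoid_add \<Rightarrow>\<^sub>0 complex) calg)"
  by (rule calgebraI, rule cspaceI)
    (simp_all add: algebra_simps pm_scale_add pm_scale_left pm_scale_mult_left pm_scale_mult_right)

lemma free_alg_add_closed:
  "f \<in> carrier (free_alg X) \<Longrightarrow> g \<in> carrier (free_alg X) \<Longrightarrow> f + g \<in> carrier (free_alg X)"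
  unfolding carrier_free_alg_keys by (rule order_trans[OF keys_add Un_least])

lemma free_alg_mult_closed:
  assumes "f \<in> carrier (free_alg X)" "g \<in> carrier (free_alg X)"
  shows "f * g \<in> carrier (free_alg X)"
proof -
  have "w \<in> {w. set (letters w) \<subseteq> X}" if w: "w \<in> Poly_Mapping.keys (f * g)" for w
  proof -
    obtain u v where "w = u + v" "u \<in> Poly_Mapping.keys f" "v \<in> Poly_Mapping.keys g"
      using w keys_mult[of f g] by blast
    then show ?thesis using assms by auto
  qed
  then show ?thesis unfolding carrier_free_alg_keys by blast
qed

lemma free_alg_scale_closed:
  "f \<in> carrier (free_alg X) \<Longrightarrow> pm_scale c f \<in> carrier (free_alg X)"
  unfolding carrier_free_alg_keys by (rule order_trans[OF keys_pm_scale])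

lemma free_alg_one_closed: "1 \<in> carrier (free_alg X)"
  by (simp add: single_one[symmetric] del: single_one)

lemma free_var_closed: "x \<in> X \<Longrightarrow> free_var x \<in> carrier (free_alg X)"
  by (simp add: free_var_def)

lemma calgebra_free_alg: "calgebra (free_alg X)"
  by (rule calgebraI, rule cspaceI;
      (simp only: free_alg_simps(2-6) free_alg_add_closed free_alg_mult_closed free_alg_scale_closed free_alg_one_closed)?)
     (simp_all add: algebra_simps pm_scale_add pm_scale_left pm_scale_mult_left pm_scale_mult_right)

lemma free_alg_uminus: "f \<in> carrier (free_alg X) \<Longrightarrow> \<ominus>\<^bsub>free_alg X\<^esub> f = - f"
  using cspace.minus_eq_smult[OF calgebra.axioms(1)[OF calgebra_free_alg]] by (simp add: pm_scale_minus)

lemma free_alg_minus_closed: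
  assumes "f \<in> carrier (free_alg X)" "g \<in> carrier (free_alg X)"
  shows "f - g \<in> carrier (free_alg X)"
  using free_alg_add_closed[OF assms(1) free_alg_scale_closed[OF assms(2), of "-1"]]
  by (simp add: pm_scale_minus)

text \<open>Words grow by one letter on the left, and general elements are linear combinations of
  words; a property of a multiplicative map thus has to be checked only against left multiplication
  by a generator.\<close>

lemma free_alg_induct [consumes 1, case_names zero one add scale mult]:
  assumes "f \<in> carrier (free_alg X)" "P 0" "P 1"
    and add: "\<And>f g. \<lbrakk>f \<in> carrier (free_alg X); g \<in> carrier (free_alg X); P f; P g\<rbrakk> \<Longrightarrow> P (f + g)"
    and scale: "\<And>c f. \<lbrakk>f \<in> carrier (free_alg X); P f\<rbrakk> \<Longrightarrow> P (pm_scale c f)"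
    and mult: "\<And>x f. \<lbrakk>x \<in> X; f \<in> carrier (free_alg X); P f\<rbrakk> \<Longrightarrow> P (free_var x * f)"
  shows "P f"
proof -
  have word: "P (Poly_Mapping.single (Word xs) 1) \<and> Poly_Mapping.single (Word xs) (1::complex) \<in> carrier (free_alg X)"
    if "set xs \<subseteq> X" for xs
    using that
  proof (induction xs)
    case Nil
    then show ?case using assms(3) by (simp add: zero_fword_def[symmetric])
  next
    case (Cons x xs)
    have "Poly_Mapping.single (Word (x # xs)) (1::complex) = free_var x * Poly_Mapping.single (Word xs) 1"
      by (simp add: free_var_def mult_single plus_fword_def)
    then have "P (Poly_Mapping.single (Word (x # xs)) 1)" using Cons mult by simp
    then show ?case using Cons.prems by auto
  qed
  have "Poly_Mapping.keys f \<subseteq> {w. set (letters w) \<subseteq> X}" using assms(1) by auto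
  then show ?thesis
  proof (induction f rule: pm_induct)
    case zero
    then show ?case using assms(2) by simp
  next
    case (single_add w c f)
    have w: "w = Word (letters w)" by simp
    have "P (pm_scale c (Poly_Mapping.single w 1))" "pm_scale c (Poly_Mapping.single w 1) \<in> carrier (free_alg X)"
      using word[of "letters w"] single_add(1) scale[of "Poly_Mapping.single w 1" c]
        free_alg_scale_closed[of "Poly_Mapping.single w 1" X c] by auto
    then show ?case using add[of "Poly_Mapping.single w c" f] single_add by auto
  qed
qed

context calgebra
begin

lemma lprod_closed: "\<phi> \<in> set xs \<rightarrow> carrier V \<Longrightarrow> lprod V \<phi> xs \<in> carrier V"
  by (induction xs) (auto simp: lprod_def)

lemma lprod_append:
  "\<phi> \<in> set xs \<union> set ys \<rightarrow> carrier V \<Longrightarrow> lprod V \<phi> (xs @ ys) = lprod V \<phi> xs \<otimes> lprod V \<phi> ys"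
proof (induction xs)
  case Nil
  then show ?case using lprod_closed[of \<phi> ys] by (simp add: lprod_def)
next
  case (Cons x xs)
  then have "lprod V \<phi> xs \<in> carrier V" "lprod V \<phi> ys \<in> carrier V" "\<phi> x \<in> carrier V"
    using lprod_closed[of \<phi> xs] lprod_closed[of \<phi> ys] by auto
  then show ?case using Cons by (auto simp: lprod_def m_assoc)
qed

lemma free_eval_lext: "free_eval V \<phi> = lext V (\<lambda>w. lprod V \<phi> (letters w))"
  by (auto simp: free_eval_def lext_def)

text \<open>Multiplicativity is bilinear in the two factors, so a nested induction over both
  supports reduces it to words, where concatenation becomes a product by
  \<open>lprod_append\<close>.\<close>

lemma alghom_free_eval:
  assumes "\<phi> \<in> X \<rightarrow> carrier V"
  shows "alghom (free_alg X) V (free_eval V \<phi>)"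
proof -
  let ?W = "{w. set (letters w) \<subseteq> X}"
  let ?p = "\<lambda>w. lprod V \<phi> (letters w)"
  have p: "?p \<in> ?W \<rightarrow> carrier V" using assms by (auto intro!: lprod_closed)
  have L: "lin (free_alg X) V (free_eval V \<phi>)"
    unfolding free_eval_lext
    by (rule linI; (unfold carrier_free_alg_keys)?) (simp_all add: lext_closed[OF _ p] lext_add[OF _ _ p] lext_scale[OF _ p])
  have "free_eval V \<phi> (f * g) = free_eval V \<phi> f \<otimes> free_eval V \<phi> g"
    if f: "f \<in> carrier (free_alg X)" and g: "g \<in> carrier (free_alg X)" for f g
  proof -
    have kf: "Poly_Mapping.keys f \<subseteq> ?W" and kg: "Poly_Mapping.keys g \<subseteq> ?W" using f g by auto
    have single: "Poly_Mapping.single w c \<in> carrier (free_alg X)" if "w \<in> ?W" for w and c :: complex using that by simp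
    have ev: "free_eval V \<phi> (Poly_Mapping.single w c) = c \<odot> ?p w" if "w \<in> ?W" for w c
      unfolding free_eval_lext using p that by (intro lext_single) auto
    show ?thesis using kf
    proof (induction f rule: pm_induct)
      case zero
      have "free_eval V \<phi> g \<in> carrier V" using L g by (rule lin_closed)
      then show ?case by (simp add: free_eval_lext)
    next
      case (single_add w c f)
      have f': "f \<in> carrier (free_alg X)" using single_add(2) by auto
      have "free_eval V \<phi> (Poly_Mapping.single w c * g) = (c \<odot> ?p w) \<otimes> free_eval V \<phi> g" using kg
      proof (induction g rule: pm_induct)
        case zero
        have "?p w \<in> carrier V" using p single_add(1) by auto
        then show ?case by (simp add: free_eval_lext)
      next
        case inner: (single_add v d h)
        have h: "h \<in> carrier (free_alg X)" using inner(2) by auto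
        have wv: "w + v \<in> ?W" using single_add(1) inner(1) by auto
        have "Poly_Mapping.single w c * (Poly_Mapping.single v d + h) =
          Poly_Mapping.single (w + v) (c * d) + Poly_Mapping.single w c * h"
          by (simp add: distrib_left mult_single)
        moreover have "free_eval V \<phi> \<dots> = (c * d) \<odot> ?p (w + v) \<oplus> (c \<odot> ?p w) \<otimes> free_eval V \<phi> h"
          using lin_add[OF L single[OF wv] free_alg_mult_closed[OF single[OF single_add(1)] h]] ev[OF wv] inner(3)
          by simp
        moreover have "?p (w + v) = ?p w \<otimes> ?p v"
          unfolding letters_plus by (rule lprod_append) (use assms single_add(1) inner(1) in auto)
        moreover have "free_eval V \<phi> (Poly_Mapping.single v d + h) = d \<odot> ?p v \<oplus> free_eval V \<phi> h"
          using lin_add[OF L single[OF inner(1)] h] ev[OF inner(1)] by simp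
        moreover have "?p w \<in> carrier V" "?p v \<in> carrier V" "free_eval V \<phi> h \<in> carrier V"
          using p single_add(1) inner(1) lin_closed[OF L h] by auto
        ultimately show ?case by (simp add: r_distr smult_assoc[symmetric] smult_r_distr mult.commute)
      qed
      moreover have "(Poly_Mapping.single w c + f) * g = Poly_Mapping.single w c * g + f * g"
        by (simp add: distrib_right)
      moreover have "free_eval V \<phi> \<dots> = free_eval V \<phi> (Poly_Mapping.single w c * g) \<oplus> free_eval V \<phi> (f * g)"
        using lin_add[OF L free_alg_mult_closed[OF single[OF single_add(1)] g] free_alg_mult_closed[OF f' g]] by simp
      moreover have "free_eval V \<phi> (Poly_Mapping.single w c + f) = c \<odot> ?p w \<oplus> free_eval V \<phi> f"
        using lin_add[OF L single[OF single_add(1)] f'] ev[OF single_add(1)] by simp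
      moreover have "?p w \<in> carrier V" "free_eval V \<phi> f \<in> carrier V" "free_eval V \<phi> g \<in> carrier V"
        using p single_add(1) lin_closed[OF L f'] lin_closed[OF L g] by auto
      ultimately show ?case using single_add(3) by (simp add: l_distr)
    qed
  qed
  moreover have "free_eval V \<phi> 1 = \<one>"
    unfolding free_eval_lext single_one[symmetric] by (subst lext_single) (simp_all add: lprod_def)
  ultimately show ?thesis using L by (simp add: alghom_def)
qed

lemma free_eval_var: "\<phi> x \<in> carrier V \<Longrightarrow> free_eval V \<phi> (free_var x) = \<phi> x"
  unfolding free_eval_lext free_var_def by (subst lext_single) (simp_all add: lprod_def)

end

subsection \<open>Tensor products\<close>

lemma (in cspace) minus_self: "x \<in> carrier V \<Longrightarrow> x \<ominus> x = \<zero>"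
  by (simp add: a_minus_def r_neg)

lemma (in cspace) add_minus_minus:
  assumes "x \<in> carrier V" "y \<in> carrier V" shows "x \<oplus> y \<ominus> x \<ominus> y = \<zero>"
proof (rule eq_by_functionals)
  fix f assume "functional V f"
  then interpret functional V f .
  show "f (x \<oplus> y \<ominus> x \<ominus> y) = f \<zero>" using assms by simp
qed (use assms in simp_all)

lemma free_vs_simps [simp]:
  "carrier (free_vs X) = {f. Poly_Mapping.keys f \<subseteq> X}" "\<zero>\<^bsub>free_vs X\<^esub> = 0"
  "add (free_vs X) = (+)" "smult (free_vs X) = pm_scale"
  by (simp_all add: free_vs_def)

lemma cspace_free_vs: "cspace (free_vs X)"
  by (rule cspaceI)
    (auto intro: order_trans[OF keys_add Un_least, THEN subsetD] keys_pm_scale[THEN subsetD]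
      simp: pm_scale_add pm_scale_left add_ac)

definition bilin :: "'v calg \<Rightarrow> 'w calg \<Rightarrow> 'u calg \<Rightarrow> ('v \<Rightarrow> 'w \<Rightarrow> 'u) \<Rightarrow> bool" where
  "bilin V W U \<beta> \<longleftrightarrow> (\<forall>x\<in>carrier V. lin W U (\<beta> x)) \<and> (\<forall>y\<in>carrier W. lin V U (\<lambda>x. \<beta> x y))"

lemma bilinI:
  assumes "\<And>x. x \<in> carrier V \<Longrightarrow> lin W U (\<beta> x)" "\<And>y. y \<in> carrier W \<Longrightarrow> lin V U (\<lambda>x. \<beta> x y)"
  shows "bilin V W U \<beta>"
  using assms by (simp add: bilin_def)

lemma bilin_left: "bilin V W U \<beta> \<Longrightarrow> y \<in> carrier W \<Longrightarrow> lin V U (\<lambda>x. \<beta> x y)"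
  and bilin_right: "bilin V W U \<beta> \<Longrightarrow> x \<in> carrier V \<Longrightarrow> lin W U (\<beta> x)"
  by (simp_all add: bilin_def)

locale tensor_product = V: cspace V + W: cspace W for V :: "'v calg" and W :: "'w calg"
begin

abbreviation "T \<equiv> tensor V W"
abbreviation "pt \<equiv> pure_tensor V W"
abbreviation "F \<equiv> free_vs (carrier V \<times> carrier W)"

lemma keys_minus_subset: 
  "Poly_Mapping.keys f \<subseteq> X \<Longrightarrow> Poly_Mapping.keys g \<subseteq> X \<Longrightarrow> Poly_Mapping.keys (f - g) \<subseteq> X"
  for f g :: "'x \<Rightarrow>\<^sub>0 complex"
  by (rule order_trans[OF keys_diff Un_least])

lemma tensor_null_carrier: "f \<in> tensor_null V W \<Longrightarrow> Poly_Mapping.keys f \<subseteq> carrier V \<times> carrier W"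
proof (induction rule: tensor_null.induct)
  case (add f g)
  then show ?case by (intro order_trans[OF keys_add Un_least])
next
  case (scale f c)
  then show ?case by (intro order_trans[OF keys_pm_scale])
qed (rule keys_minus_subset | simp)+

lemma quotient_space_tensor: "quotient_space F (tensor_null V W)"
  by (intro quotient_space.intro quotient_space_axioms.intro cspace_free_vs)
    (auto simp: lsubspace_def intro: tensor_null.intros dest: tensor_null_carrier)

sublocale Q: quotient_space F "tensor_null V W"
  by (rule quotient_space_tensor)

lemma cspace_tensor: "cspace T"
  unfolding tensor_def by (rule Q.cspace_quot)

lemma F_minus: "f \<in> carrier F \<Longrightarrow> g \<in> carrier F \<Longrightarrow> f \<ominus>\<^bsub>F\<^esub> g = f - g"
  by (simp add: a_minus_def Q.minus_eq_smult pm_scale_minus)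

lemma pt_closed [simp]: "x \<in> carrier V \<Longrightarrow> y \<in> carrier W \<Longrightarrow> pt x y \<in> carrier T"
  unfolding tensor_def pure_tensor_def Q.quot_carrier by auto

lemma coset_single:
  assumes "x \<in> carrier V" "y \<in> carrier W"
  shows "tensor_null V W +>\<^bsub>F\<^esub> Poly_Mapping.single (x, y) c = c \<odot>\<^bsub>T\<^esub> pt x y"
proof -
  have "Poly_Mapping.single (x, y) (1::complex) \<in> carrier F" using assms by simp
  from Q.quot_smult[OF this, of c] show ?thesis by (simp add: tensor_def pure_tensor_def)
qed

lemma single_F: "x \<in> carrier V \<Longrightarrow> y \<in> carrier W \<Longrightarrow> Poly_Mapping.single (x, y) (c::complex) \<in> carrier F"
  by simp

lemma F_minus_closed: "f \<in> carrier F \<Longrightarrow> g \<in> carrier F \<Longrightarrow> f - g \<in> carrier F"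
  using keys_minus_subset by simp

lemma F_add: "f \<in> carrier F \<Longrightarrow> g \<in> carrier F \<Longrightarrow> f + g \<in> carrier F"
  using Q.a_closed[of f g] by simp

lemma bilin_pt: "bilin V W T pt"
proof (rule bilinI; rule linI)
  fix x y c assume xy: "x \<in> carrier V" "y \<in> carrier W"
  then show "pt x y \<in> carrier T" "pt x y \<in> carrier T" by simp_all
  have "Poly_Mapping.single (x, c \<odot>\<^bsub>W\<^esub> y) 1 \<ominus>\<^bsub>F\<^esub> Poly_Mapping.single (x, y) c \<in> tensor_null V W"
    using tensor_null.scale_right[OF xy, of c] xy by (simp add: F_minus)
  with xy show "pt x (c \<odot>\<^bsub>W\<^esub> y) = c \<odot>\<^bsub>T\<^esub> pt x y"
    unfolding coset_single[OF xy, symmetric] unfolding pure_tensor_def by (subst Q.coset_eq_iff) simp_all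
  have "Poly_Mapping.single (c \<odot>\<^bsub>V\<^esub> x, y) 1 \<ominus>\<^bsub>F\<^esub> Poly_Mapping.single (x, y) c \<in> tensor_null V W"
    using tensor_null.scale_left[OF xy, of c] xy by (simp add: F_minus)
  with xy show "pt (c \<odot>\<^bsub>V\<^esub> x) y = c \<odot>\<^bsub>T\<^esub> pt x y"
    unfolding coset_single[OF xy, symmetric] unfolding pure_tensor_def by (subst Q.coset_eq_iff) simp_all
next
  fix x y y' assume xy: "x \<in> carrier V" "y \<in> carrier W" "y' \<in> carrier W"
  let ?s = "\<lambda>y. Poly_Mapping.single (x, y) (1::complex)"
  have "?s (y \<oplus>\<^bsub>W\<^esub> y') \<ominus>\<^bsub>F\<^esub> (?s y + ?s y') \<in> tensor_null V W"
    using tensor_null.add_right[OF xy] F_minus[OF single_F F_add[OF single_F single_F], of x "y \<oplus>\<^bsub>W\<^esub> y'" x y x y' 1 1 1] xy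
    by (simp add: diff_diff_eq)
  then have "pt x (y \<oplus>\<^bsub>W\<^esub> y') = tensor_null V W +>\<^bsub>F\<^esub> (?s y + ?s y')"
    unfolding pure_tensor_def using xy by (subst Q.coset_eq_iff) (simp_all add: F_add[simplified])
  also have "\<dots> = pt x y \<oplus>\<^bsub>T\<^esub> pt x y'"
    using Q.quot_add[of "?s y" "?s y'"] xy by (simp add: tensor_def pure_tensor_def)
  finally show "pt x (y \<oplus>\<^bsub>W\<^esub> y') = pt x y \<oplus>\<^bsub>T\<^esub> pt x y'" .
next
  fix x x' y assume xy: "y \<in> carrier W" "x \<in> carrier V" "x' \<in> carrier V"
  let ?s = "\<lambda>x. Poly_Mapping.single (x, y) (1::complex)"
  have "?s (x \<oplus>\<^bsub>V\<^esub> x') \<ominus>\<^bsub>F\<^esub> (?s x + ?s x') \<in> tensor_null V W"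
    using tensor_null.add_left[OF xy(2,3,1)] F_minus[OF single_F F_add[OF single_F single_F], of "x \<oplus>\<^bsub>V\<^esub> x'" y x y x' y 1 1 1] xy
    by (simp add: diff_diff_eq)
  then have "pt (x \<oplus>\<^bsub>V\<^esub> x') y = tensor_null V W +>\<^bsub>F\<^esub> (?s x + ?s x')"
    unfolding pure_tensor_def using xy by (subst Q.coset_eq_iff) (simp_all add: F_add[simplified])
  also have "\<dots> = pt x y \<oplus>\<^bsub>T\<^esub> pt x' y"
    using Q.quot_add[of "?s x" "?s x'"] xy by (simp add: tensor_def pure_tensor_def)
  finally show "pt (x \<oplus>\<^bsub>V\<^esub> x') y = pt x y \<oplus>\<^bsub>T\<^esub> pt x' y" .
qed

lemmas pt_add_left [simp] = lin_add[OF bilin_left[OF bilin_pt]]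
  and pt_add_right [simp] = lin_add[OF bilin_right[OF bilin_pt]]
  and pt_smult_left [simp] = lin_smult[OF bilin_left[OF bilin_pt]]
  and pt_smult_right [simp] = lin_smult[OF bilin_right[OF bilin_pt]]

text \<open>A coefficient c of a pure tensor is absorbed into its left factor; therefore no case for
  scalar multiples occurs.\<close>

lemma tensor_induct [consumes 1, case_names zero pure add]:
  assumes t: "t \<in> carrier T" and "P \<zero>\<^bsub>T\<^esub>"
    and pure: "\<And>x y. x \<in> carrier V \<Longrightarrow> y \<in> carrier W \<Longrightarrow> P (pt x y)"
    and add: "\<And>s t. s \<in> carrier T \<Longrightarrow> t \<in> carrier T \<Longrightarrow> P s \<Longrightarrow> P t \<Longrightarrow> P (s \<oplus>\<^bsub>T\<^esub> t)"
  shows "P t"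
proof -
  obtain f where f: "Poly_Mapping.keys f \<subseteq> carrier V \<times> carrier W" "t = tensor_null V W +>\<^bsub>F\<^esub> f"
    using t by (auto simp: tensor_def Q.quot_carrier)
  have cl: "tensor_null V W +>\<^bsub>F\<^esub> g \<in> carrier T" if "g \<in> carrier F" for g
    using that unfolding tensor_def Q.quot_carrier by blast
  from f(1) have "P (tensor_null V W +>\<^bsub>F\<^esub> f)"
  proof (induction f rule: pm_induct)
    case zero
    then show ?case using assms(2) Q.quot_zero by (simp add: tensor_def)
  next
    case (single_add xy c f)
    obtain x y where xy: "xy = (x, y)" "x \<in> carrier V" "y \<in> carrier W" using single_add(1) by auto
    have "tensor_null V W +>\<^bsub>F\<^esub> (Poly_Mapping.single xy c + f) = pt (c \<odot>\<^bsub>V\<^esub> x) y \<oplus>\<^bsub>T\<^esub> (tensor_null V W +>\<^bsub>F\<^esub> f)"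
      using Q.quot_add[of "Poly_Mapping.single xy c" f] single_add(2) xy coset_single[OF xy(2,3)]
      by (simp add: tensor_def)
    moreover have "P (pt (c \<odot>\<^bsub>V\<^esub> x) y \<oplus>\<^bsub>T\<^esub> (tensor_null V W +>\<^bsub>F\<^esub> f))"
      by (rule add) (use pure xy single_add cl in \<open>auto simp del: pt_smult_left\<close>)
    ultimately show ?case by simp
  qed
  then show ?thesis by (simp add: f(2))
qed

context
  fixes U :: "'u calg" and \<beta>
  assumes U: "cspace U" and \<beta>: "bilin V W U \<beta>"
begin

interpretation U: cspace U by (rule U)

private abbreviation "\<phi> \<equiv> \<lambda>xy. \<beta> (fst xy) (snd xy)"

private lemma \<phi>: "\<phi> \<in> carrier V \<times> carrier W \<rightarrow> carrier U"
  using bilin_right[OF \<beta>] lin_closed by fastforce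

private lemma lift_eq: "tensor_lift U \<beta> = descend (lext U \<phi>)"
proof
  show "tensor_lift U \<beta> t = descend (lext U \<phi>) t" for t
    unfolding tensor_lift_def lext_def ..
qed

private lemma L: "lin F U (lext U \<phi>)"
  by (rule linI) (simp_all add: U.lext_closed[OF _ \<phi>] U.lext_add[OF _ _ \<phi>] U.lext_scale[OF _ \<phi>])

private lemma \<beta>_closed: "x \<in> carrier V \<Longrightarrow> y \<in> carrier W \<Longrightarrow> \<beta> x y \<in> carrier U"
  using lin_closed[OF bilin_left[OF \<beta>]] .

private lemma single: "x \<in> carrier V \<Longrightarrow> y \<in> carrier W \<Longrightarrow> lext U \<phi> (Poly_Mapping.single (x, y) c) = c \<odot>\<^bsub>U\<^esub> \<beta> x y"
  by (subst U.lext_single) (simp_all add: \<beta>_closed)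

private lemma diff: "f \<in> carrier F \<Longrightarrow> g \<in> carrier F \<Longrightarrow> lext U \<phi> (f - g) = lext U \<phi> f \<ominus>\<^bsub>U\<^esub> lext U \<phi> g"
  using U.lext_diff[OF _ _ \<phi>] by simp

text \<open>The generators of \<open>tensor_null\<close> are the defects of bilinearity, and the
  extension of a bilinear map sends each of them to zero. This is the factorisation through the
  tensor product.\<close>

private lemma null: "f \<in> tensor_null V W \<Longrightarrow> lext U \<phi> f = \<zero>\<^bsub>U\<^esub>"
proof (induction rule: tensor_null.induct)
  case (add f g)
  then show ?case
    using U.lext_add[OF tensor_null_carrier tensor_null_carrier \<phi>, of f g] by simp
next
  case (scale f c)
  then show ?case using U.lext_scale[OF tensor_null_carrier \<phi>, of f c] by simp
next
  case (add_left x x' y)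
  then show ?case
    by (simp add: diff F_minus_closed[simplified] single lin_add[OF bilin_left[OF \<beta>]] \<beta>_closed U.add_minus_minus)
next
  case (add_right x y y')
  then show ?case
    by (simp add: diff F_minus_closed[simplified] single lin_add[OF bilin_right[OF \<beta>]] \<beta>_closed U.add_minus_minus)
next
  case (scale_left x y c)
  then show ?case
    by (simp add: diff single lin_smult[OF bilin_left[OF \<beta>]] \<beta>_closed U.minus_self)
next
  case (scale_right x y c)
  then show ?case
    by (simp add: diff single lin_smult[OF bilin_right[OF \<beta>]] \<beta>_closed U.minus_self)
qed simp

lemma lin_tensor_lift: "lin T U (tensor_lift U \<beta>)"
  unfolding lift_eq tensor_def by (rule Q.lin_descend[OF U L null])

lemma tensor_lift_pure:
  "x \<in> carrier V \<Longrightarrow> y \<in> carrier W \<Longrightarrow> tensor_lift U \<beta> (pt x y) = \<beta> x y"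
  unfolding lift_eq pure_tensor_def
  using Q.descend_coset[OF U L null, of "Poly_Mapping.single (x, y) 1"] single[of x y 1] \<beta>_closed by simp

end

end

section \<open>The algebra structure on a tensor product\<close>

locale tensor_of_algebras = A: calgebra A + B: calgebra B for A :: "'v calg" and B :: "'w calg"
begin

sublocale tensor_product A B ..

sublocale T: cspace T by (rule cspace_tensor)

abbreviation "TA \<equiv> tensor_alg A B"

text \<open>Left multiplication by the pure tensor of a and b, that is, the inner of the two nested
  lifts in the product of \<open>tensor_alg\<close>. Its bilinearity in (a, b) is what makes the
  outer lift legitimate.\<close>

definition lmul :: "'v \<Rightarrow> 'w \<Rightarrow> ('v \<times> 'w \<Rightarrow>\<^sub>0 complex) set \<Rightarrow> ('v \<times> 'w \<Rightarrow>\<^sub>0 complex) set" where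
  "lmul a b = tensor_lift T (\<lambda>a' b'. pt (a \<otimes>\<^bsub>A\<^esub> a') (b \<otimes>\<^bsub>B\<^esub> b'))"

lemma TA_simps [simp]:
  "carrier TA = carrier T" "\<zero>\<^bsub>TA\<^esub> = \<zero>\<^bsub>T\<^esub>" "add TA = add T" "smult TA = smult T"
  "\<one>\<^bsub>TA\<^esub> = pt \<one>\<^bsub>A\<^esub> \<one>\<^bsub>B\<^esub>"
  by (simp_all add: tensor_alg_def)

lemma TA_mult: "s \<otimes>\<^bsub>TA\<^esub> t = tensor_lift T (\<lambda>a b. lmul a b t) s"
  by (simp add: tensor_alg_def lmul_def)

context
  fixes a b assumes a: "a \<in> carrier A" and b: "b \<in> carrier B"
begin

lemma bilin_lmul: "bilin A B T (\<lambda>a' b'. pt (a \<otimes>\<^bsub>A\<^esub> a') (b \<otimes>\<^bsub>B\<^esub> b'))"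
  by (rule bilinI; rule linI) (simp_all add: a b A.r_distr B.r_distr)

lemma lin_lmul: "lin T T (lmul a b)"
  unfolding lmul_def by (rule lin_tensor_lift[OF cspace_tensor bilin_lmul])

lemma lmul_pure: "x \<in> carrier A \<Longrightarrow> y \<in> carrier B \<Longrightarrow> lmul a b (pt x y) = pt (a \<otimes>\<^bsub>A\<^esub> x) (b \<otimes>\<^bsub>B\<^esub> y)"
  unfolding lmul_def by (rule tensor_lift_pure[OF cspace_tensor bilin_lmul])

end

lemmas lmul_closed = lin_closed[OF lin_lmul] and lmul_add = lin_add[OF lin_lmul]
  and lmul_smult = lin_smult[OF lin_lmul] and lmul_zero = lin_zero[OF cspace_tensor cspace_tensor lin_lmul]

lemma T_add4: "\<lbrakk>x \<in> carrier T; y \<in> carrier T; z \<in> carrier T; w \<in> carrier T\<rbrakk> \<Longrightarrow>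
  (x \<oplus>\<^bsub>T\<^esub> y) \<oplus>\<^bsub>T\<^esub> (z \<oplus>\<^bsub>T\<^esub> w) = (x \<oplus>\<^bsub>T\<^esub> z) \<oplus>\<^bsub>T\<^esub> (y \<oplus>\<^bsub>T\<^esub> w)"
  by (simp add: T.a_ac)

lemma lmul_add_left:
  assumes "t \<in> carrier T" "a \<in> carrier A" "a' \<in> carrier A" "b \<in> carrier B"
  shows "lmul (a \<oplus>\<^bsub>A\<^esub> a') b t = lmul a b t \<oplus>\<^bsub>T\<^esub> lmul a' b t"
  using assms by (induction rule: tensor_induct)
    (simp_all add: lmul_zero lmul_pure lmul_add lmul_closed A.l_distr T_add4)

lemma lmul_add_right:
  assumes "t \<in> carrier T" "a \<in> carrier A" "b \<in> carrier B" "b' \<in> carrier B"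
  shows "lmul a (b \<oplus>\<^bsub>B\<^esub> b') t = lmul a b t \<oplus>\<^bsub>T\<^esub> lmul a b' t"
  using assms by (induction rule: tensor_induct)
    (simp_all add: lmul_zero lmul_pure lmul_add lmul_closed B.l_distr T_add4)

lemma lmul_smult_left:
  assumes "t \<in> carrier T" "a \<in> carrier A" "b \<in> carrier B"
  shows "lmul (c \<odot>\<^bsub>A\<^esub> a) b t = c \<odot>\<^bsub>T\<^esub> lmul a b t" "lmul a (c \<odot>\<^bsub>B\<^esub> b) t = c \<odot>\<^bsub>T\<^esub> lmul a b t"
  using assms by (induction rule: tensor_induct)
    (simp_all add: lmul_zero lmul_pure lmul_add lmul_closed T.smult_r_distr)

lemma bilin_mult: "t \<in> carrier T \<Longrightarrow> bilin A B T (\<lambda>a b. lmul a b t)"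
  by (rule bilinI; rule linI) (simp_all add: lmul_closed lmul_add_left lmul_add_right lmul_smult_left)

lemma lin_mult_left: "t \<in> carrier T \<Longrightarrow> lin T T (\<lambda>s. s \<otimes>\<^bsub>TA\<^esub> t)"
  unfolding TA_mult by (rule lin_tensor_lift[OF cspace_tensor bilin_mult])

lemma mult_pure_left: "t \<in> carrier T \<Longrightarrow> a \<in> carrier A \<Longrightarrow> b \<in> carrier B \<Longrightarrow> pt a b \<otimes>\<^bsub>TA\<^esub> t = lmul a b t"
  unfolding TA_mult by (rule tensor_lift_pure[OF cspace_tensor bilin_mult])

lemmas TA_mult_closed = lin_closed[OF lin_mult_left]
  and TA_l_distr = lin_add[OF lin_mult_left]
  and TA_smult_left = lin_smult[OF lin_mult_left]
  and TA_zero_left = lin_zero[OF cspace_tensor cspace_tensor lin_mult_left]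

lemma TA_r_distr:
  assumes "s \<in> carrier T" "t \<in> carrier T" "u \<in> carrier T"
  shows "s \<otimes>\<^bsub>TA\<^esub> (t \<oplus>\<^bsub>T\<^esub> u) = s \<otimes>\<^bsub>TA\<^esub> t \<oplus>\<^bsub>T\<^esub> s \<otimes>\<^bsub>TA\<^esub> u"
  using assms by (induction rule: tensor_induct)
    (simp_all add: TA_zero_left mult_pure_left lmul_add TA_l_distr TA_mult_closed T_add4)

lemma TA_smult_right:
  assumes "s \<in> carrier T" "t \<in> carrier T"
  shows "s \<otimes>\<^bsub>TA\<^esub> (c \<odot>\<^bsub>T\<^esub> t) = c \<odot>\<^bsub>T\<^esub> (s \<otimes>\<^bsub>TA\<^esub> t)"
  using assms by (induction rule: tensor_induct)
    (simp_all add: TA_zero_left mult_pure_left lmul_smult TA_l_distr TA_mult_closed T.smult_r_distr)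

lemma TA_mult_zero: "s \<in> carrier T \<Longrightarrow> s \<otimes>\<^bsub>TA\<^esub> \<zero>\<^bsub>T\<^esub> = \<zero>\<^bsub>T\<^esub>"
  using TA_smult_right[of s "\<zero>\<^bsub>T\<^esub>" 0] TA_mult_closed by simp

lemma mult_pure:
  "\<lbrakk>a \<in> carrier A; b \<in> carrier B; a' \<in> carrier A; b' \<in> carrier B\<rbrakk> \<Longrightarrow>
     pt a b \<otimes>\<^bsub>TA\<^esub> pt a' b' = pt (a \<otimes>\<^bsub>A\<^esub> a') (b \<otimes>\<^bsub>B\<^esub> b')"
  by (simp add: mult_pure_left lmul_pure)

lemma TA_assoc:
  assumes "s \<in> carrier T" "t \<in> carrier T" "u \<in> carrier T"
  shows "(s \<otimes>\<^bsub>TA\<^esub> t) \<otimes>\<^bsub>TA\<^esub> u = s \<otimes>\<^bsub>TA\<^esub> (t \<otimes>\<^bsub>TA\<^esub> u)"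
  using assms(1)
proof (induction rule: tensor_induct)
  case (pure a b)
  note ab = this
  show ?case using assms(2)
  proof (induction rule: tensor_induct)
    case (pure a' b')
    note ab' = this
    show ?case using assms(3)
      by (induction rule: tensor_induct)
        (use ab ab' in \<open>simp_all add: TA_mult_zero mult_pure TA_r_distr TA_mult_closed A.m_assoc B.m_assoc\<close>)
  qed (use ab assms(3) in \<open>simp_all add: TA_mult_zero TA_zero_left TA_r_distr TA_l_distr TA_mult_closed\<close>)
qed (use assms in \<open>simp_all add: TA_zero_left TA_l_distr TA_mult_closed\<close>)

lemma TA_one:
  assumes "t \<in> carrier T"
  shows "pt \<one>\<^bsub>A\<^esub> \<one>\<^bsub>B\<^esub> \<otimes>\<^bsub>TA\<^esub> t = t" "t \<otimes>\<^bsub>TA\<^esub> pt \<one>\<^bsub>A\<^esub> \<one>\<^bsub>B\<^esub> = t"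
  using assms by (induction rule: tensor_induct)
    (simp_all add: mult_pure TA_r_distr TA_l_distr TA_mult_closed TA_zero_left TA_mult_zero)

lemma calgebra_TA: "calgebra TA"
proof (rule calgebraI)
  show "cspace TA" by (rule cspace_image[OF cspace_tensor, of "\<lambda>x. x"]) simp_all
qed (simp_all add: TA_mult_closed TA_assoc TA_one TA_l_distr TA_r_distr TA_smult_left TA_smult_right)

end

section \<open>The Hopf algebra\<close>

subsection \<open>The involution of the free algebra\<close>

lemma finsum_type_alg: "finite A \<Longrightarrow> cspace (type_alg s) \<Longrightarrow> (\<Oplus>\<^bsub>type_alg s\<^esub>x\<in>A. f x) = sum f A"
proof (induction A rule: finite_induct)
  case empty
  then interpret cspace "type_alg s" by simp
  show ?case by simp
next
  case (insert x A)
  then interpret cspace "type_alg s" by simp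
  show ?case using insert by (simp add: finsum_insert)
qed

text \<open>With conjugated scalars on the target an antilinear map becomes linear, so the results
  on \<open>lext\<close> apply to \<open>free_star\<close>.\<close>

abbreviation conj_alg :: "('m::monoid_add \<Rightarrow>\<^sub>0 complex) calg" where
  "conj_alg \<equiv> type_alg (\<lambda>c. pm_scale (cnj c))"

lemma cspace_conj: "cspace conj_alg"
  by (rule cspaceI) (simp_all add: algebra_simps pm_scale_add pm_scale_left)

definition star_word :: "gen fword \<Rightarrow> gen fword" where
  "star_word w = Word (rev (map gen_star (letters w)))"

lemma star_word_simps: "star_word (u + v) = star_word v + star_word u" "star_word 0 = 0"
  by (simp_all add: star_word_def plus_fword_def zero_fword_def)

lemma free_star_lext: "free_star = lext conj_alg (\<lambda>w. Poly_Mapping.single (star_word w) 1)"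
  by (rule ext) (simp add: free_star_def lext_def finsum_type_alg[OF _ cspace_conj] star_word_def)

interpretation conj: cspace conj_alg by (rule cspace_conj)

lemma free_star_add: "free_star (f + g) = free_star f + free_star g"
  and free_star_scale: "free_star (pm_scale c f) = pm_scale (cnj c) (free_star f)"
  and free_star_single: "free_star (Poly_Mapping.single w c) = Poly_Mapping.single (star_word w) (cnj c)"
  and free_star_zero [simp]: "free_star 0 = 0"
  unfolding free_star_lext
  using conj.lext_add[of f UNIV g "\<lambda>w. Poly_Mapping.single (star_word w) 1"]
    conj.lext_scale[of f UNIV "\<lambda>w. Poly_Mapping.single (star_word w) 1" c]
  by (simp_all add: conj.lext_zero[simplified])

lemma free_star_diff: "free_star (f - g) = free_star f - free_star g"
  using free_star_add[of "f - g" g] by simp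

lemma free_star_one [simp]: "free_star 1 = 1"
  unfolding single_one[symmetric] free_star_single by (simp add: star_word_simps)

lemma free_star_var [simp]: "free_star (free_var x) = free_var (gen_star x)"
  by (simp add: free_var_def free_star_single star_word_def)

lemma free_star_mult: "free_star (f * g) = free_star g * free_star f"
proof -
  have f: "Poly_Mapping.keys f \<subseteq> UNIV" and g: "Poly_Mapping.keys g \<subseteq> UNIV" by simp_all
  show ?thesis using f
  proof (induction f rule: pm_induct)
    case (single_add w c f)
    have "free_star (Poly_Mapping.single w c * g) = free_star g * free_star (Poly_Mapping.single w c)" using g
      by (induction g rule: pm_induct)
        (simp_all add: distrib_left distrib_right free_star_add free_star_single mult_single star_word_simps mult.commute)
    then show ?case using single_add by (simp add: distrib_left distrib_right free_star_add)
  qed simp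
qed

lemma gen_star_gen_star [simp]: "gen_star (gen_star x) = x"
  by (cases x) simp_all

lemma free_star_free_star [simp]: "free_star (free_star f) = f"
proof -
  have "f \<in> carrier (free_alg UNIV)" by simp
  then show ?thesis
    by (induction rule: free_alg_induct) (simp_all add: free_star_add free_star_scale free_star_mult)
qed

subsection \<open>The universal property of quantum SU(1,1)\<close>

abbreviation (input) "suq_rels q \<equiv> suq_rel q \<union> free_star ` suq_rel q"

lemma free_star_suq_rel:
  "free_star ` suq_rel q =
     (let a = free_var GenAlpha; a' = free_var GenAlphaStar;
          c = free_var GenGamma; c' = free_var GenGammaStar
      in {a' * a - c' * c - 1,
          a * a' - pm_scale (complex_of_real (q^2)) (c * c') - 1,
          c * c' - c' * c,
          pm_scale (complex_of_real q) (a' * c') - c' * a',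
          pm_scale (complex_of_real q) (a' * c) - c * a'})"
  by (simp add: suq_rel_def Let_def free_star_diff free_star_mult free_star_scale)

text \<open>The first three relations of \<open>SU\<^sub>q(1,1)\<close> are self-adjoint, so only the last two contribute adjoints.\<close>

definition suq_point :: "real \<Rightarrow> 'v calg \<Rightarrow> (gen \<Rightarrow> 'v) \<Rightarrow> bool" where
  "suq_point q B g \<longleftrightarrow> range g \<subseteq> carrier B \<and>
     (let a = g GenAlpha; a' = g GenAlphaStar; c = g GenGamma; c' = g GenGammaStar;
        r = complex_of_real q in
      a' \<otimes>\<^bsub>B\<^esub> a = \<one>\<^bsub>B\<^esub> \<oplus>\<^bsub>B\<^esub> c \<otimes>\<^bsub>B\<^esub> c' \<and>
      a \<otimes>\<^bsub>B\<^esub> a' = \<one>\<^bsub>B\<^esub> \<oplus>\<^bsub>B\<^esub> r^2 \<odot>\<^bsub>B\<^esub> (c \<otimes>\<^bsub>B\<^esub> c') \<and>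
      c' \<otimes>\<^bsub>B\<^esub> c = c \<otimes>\<^bsub>B\<^esub> c' \<and>
      a \<otimes>\<^bsub>B\<^esub> c = r \<odot>\<^bsub>B\<^esub> (c \<otimes>\<^bsub>B\<^esub> a) \<and>
      a \<otimes>\<^bsub>B\<^esub> c' = r \<odot>\<^bsub>B\<^esub> (c' \<otimes>\<^bsub>B\<^esub> a) \<and>
      c \<otimes>\<^bsub>B\<^esub> a' = r \<odot>\<^bsub>B\<^esub> (a' \<otimes>\<^bsub>B\<^esub> c) \<and>
      c' \<otimes>\<^bsub>B\<^esub> a' = r \<odot>\<^bsub>B\<^esub> (a' \<otimes>\<^bsub>B\<^esub> c'))"

interpretation FA: calgebra "free_alg UNIV :: (gen fword \<Rightarrow>\<^sub>0 complex) calg"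
  by (rule calgebra_free_alg)

lemma suq_quotient: "quotient_algebra (free_alg UNIV) (suq_ideal q)"
  unfolding suq_ideal_def by (rule FA.quotient_Idl) simp

lemma free_alg_UNIV_minus: "f \<ominus>\<^bsub>free_alg (UNIV :: gen set)\<^esub> g = f - g"
  by (simp add: a_minus_def free_alg_uminus)

lemma (in cspace) minus_zeroI: "x \<in> carrier V \<Longrightarrow> x = y \<Longrightarrow> x \<ominus> y = \<zero>"
  using minus_self by simp

lemma (in cspace) minus_eq_zeroD:
  assumes "x \<ominus> y = \<zero>" "x \<in> carrier V" "y \<in> carrier V" shows "x = y"
proof -
  have "(x \<ominus> y) \<oplus> y = y" using assms by simp
  then show ?thesis using assms(2,3) by (simp add: a_minus_def a_assoc l_neg)
qed

text \<open>The counit, the coproduct, the projection to Laurent polynomials, the triangular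
  representations and the lattice representation are all obtained from here, each by checking the
  seven relations on the images of the generators.\<close>

lemma suq_hom:
  assumes "calgebra B" "suq_point q B g"
  shows "alghom (SUq q) B (descend (free_eval B g))"
    and "descend (free_eval B g) (suq_gen q x) = g x"
proof -
  interpret B: calgebra B by fact
  interpret Q: quotient_algebra "free_alg UNIV" "suq_ideal q" by (rule suq_quotient)
  have g: "g \<in> UNIV \<rightarrow> carrier B" and [simp]: "g y \<in> carrier B" for y using assms(2) by (auto simp: suq_point_def)
  note H = B.alghom_free_eval[OF g]
  note L = alghom_lin[OF H]
  have ev_minus: "free_eval B g (f - h) = free_eval B g f \<ominus>\<^bsub>B\<^esub> free_eval B g h" for f h
    using lin_minus[OF FA.cspace_axioms B.cspace_axioms L, of f h] by (simp add: free_alg_UNIV_minus)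
  have ev_scale: "free_eval B g (pm_scale c f) = c \<odot>\<^bsub>B\<^esub> free_eval B g f" for c f
    using lin_smult[OF L, of f c] by simp
  have ev_mult: "free_eval B g (f * h) = free_eval B g f \<otimes>\<^bsub>B\<^esub> free_eval B g h" for f h
    using alghom_mult[OF H, of f h] by simp
  have ev_one: "free_eval B g 1 = \<one>\<^bsub>B\<^esub>" using alghom_one[OF H] by simp
  have z1: "x \<oplus>\<^bsub>B\<^esub> y \<ominus>\<^bsub>B\<^esub> y \<ominus>\<^bsub>B\<^esub> x = \<zero>\<^bsub>B\<^esub>" if "x \<in> carrier B" "y \<in> carrier B" for x y
    using B.add_minus_minus[OF that(2,1)] that B.a_comm by simp
  have van: "free_eval B g s = \<zero>\<^bsub>B\<^esub>" if "s \<in> suq_rels q" for s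
    using that assms(2) unfolding free_star_suq_rel unfolding suq_rel_def suq_point_def Let_def
    by (auto simp: ev_minus ev_scale ev_mult ev_one B.free_eval_var z1 B.minus_self)
  have null: "free_eval B g w = \<zero>\<^bsub>B\<^esub>" if "w \<in> suq_ideal q" for w
    by (rule FA.hom_vanishes_on_Idl[OF assms(1) H _ van]) (use that in \<open>auto simp: suq_ideal_def\<close>)
  show "alghom (SUq q) B (descend (free_eval B g))"
    unfolding SUq_def by (rule Q.alghom_descend[OF assms(1) H null])
  show "descend (free_eval B g) (suq_gen q x) = g x"
    unfolding suq_gen_def using Q.descend_coset[OF B.cspace_axioms L null] by (simp add: B.free_eval_var)
qed

lemma calgebra_SUq: "calgebra (SUq q)"
  unfolding SUq_def by (rule quotient_algebra.calgebra_quot[OF suq_quotient])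

lemma suq_gen_closed: "suq_gen q x \<in> carrier (SUq q)"
proof -
  interpret Q: quotient_algebra "free_alg UNIV" "suq_ideal q" by (rule suq_quotient)
  show ?thesis unfolding SUq_def suq_gen_def Q.quot_carrier by auto
qed

lemma suq_gen_point: "suq_point q (SUq q) (suq_gen q)"
proof -
  interpret Q: quotient_algebra "free_alg UNIV" "suq_ideal q" by (rule suq_quotient)
  interpret P: calgebra "SUq q" by (rule calgebra_SUq)
  have eq: "suq_ideal q +>\<^bsub>free_alg UNIV\<^esub> x = suq_ideal q +>\<^bsub>free_alg UNIV\<^esub> y" if "x - y \<in> suq_rels q" for x y
    using that FA.genideal_self[of "suq_rels q"]
    by (subst Q.coset_eq_iff) (auto simp: suq_ideal_def free_alg_UNIV_minus)
  have simps: "(suq_ideal q +>\<^bsub>free_alg UNIV\<^esub> x) \<otimes>\<^bsub>SUq q\<^esub> (suq_ideal q +>\<^bsub>free_alg UNIV\<^esub> y) = suq_ideal q +>\<^bsub>free_alg UNIV\<^esub> (x * y)"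
    "(suq_ideal q +>\<^bsub>free_alg UNIV\<^esub> x) \<oplus>\<^bsub>SUq q\<^esub> (suq_ideal q +>\<^bsub>free_alg UNIV\<^esub> y) = suq_ideal q +>\<^bsub>free_alg UNIV\<^esub> (x + y)"
    "c \<odot>\<^bsub>SUq q\<^esub> (suq_ideal q +>\<^bsub>free_alg UNIV\<^esub> x) = suq_ideal q +>\<^bsub>free_alg UNIV\<^esub> (pm_scale c x)"
    "\<one>\<^bsub>SUq q\<^esub> = suq_ideal q +>\<^bsub>free_alg UNIV\<^esub> 1" for x y c
    using Q.quot_mult[of x y] Q.quot_add[of x y] Q.quot_smult[of x c] Q.quot_one by (simp_all add: SUq_def)
  let ?C = "\<lambda>x. suq_ideal q +>\<^bsub>free_alg UNIV\<^esub> x"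
  let ?a = "free_var GenAlpha" and ?a' = "free_var GenAlphaStar" and ?c = "free_var GenGamma" and ?c' = "free_var GenGammaStar"
  have r3: "?C (?c' * ?c) = ?C (?c * ?c')"
    by (rule eq[symmetric]) (simp add: suq_rel_def Let_def)
  have r1: "?C (?a' * ?a) = ?C (1 + ?c' * ?c)"
    by (rule eq) (simp add: suq_rel_def Let_def diff_diff_eq add.commute)
  have r2: "?C (?a * ?a') = ?C (1 + pm_scale (complex_of_real (q^2)) (?c * ?c'))"
    by (rule eq) (simp add: suq_rel_def Let_def diff_diff_eq add.commute)
  have r4: "?C (?a * ?c) = ?C (pm_scale (complex_of_real q) (?c * ?a))"
    by (rule eq[symmetric]) (simp add: suq_rel_def Let_def)
  have r5: "?C (?a * ?c') = ?C (pm_scale (complex_of_real q) (?c' * ?a))"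
    by (rule eq[symmetric]) (simp add: suq_rel_def Let_def)
  have r6: "?C (?c * ?a') = ?C (pm_scale (complex_of_real q) (?a' * ?c))"
    by (rule eq[symmetric]) (simp only: free_star_suq_rel Let_def, simp)
  have r7: "?C (?c' * ?a') = ?C (pm_scale (complex_of_real q) (?a' * ?c'))"
    by (rule eq[symmetric]) (simp only: free_star_suq_rel Let_def, simp)
  have "?C (1 + ?c' * ?c) = ?C (1 + ?c * ?c')"
    using r3 by (simp flip: simps(2))
  then show ?thesis
    unfolding suq_point_def Let_def using suq_gen_closed r1 r2 r3 r4 r5 r6 r7
    by (auto simp: suq_gen_def simps)
qed

lemma suq_induct [consumes 1, case_names zero one add scale mult]:
  assumes "p \<in> carrier (SUq q)" "P \<zero>\<^bsub>SUq q\<^esub>" "P \<one>\<^bsub>SUq q\<^esub>"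
    and add: "\<And>x y. \<lbrakk>x \<in> carrier (SUq q); y \<in> carrier (SUq q); P x; P y\<rbrakk> \<Longrightarrow> P (x \<oplus>\<^bsub>SUq q\<^esub> y)"
    and scale: "\<And>c x. \<lbrakk>x \<in> carrier (SUq q); P x\<rbrakk> \<Longrightarrow> P (c \<odot>\<^bsub>SUq q\<^esub> x)"
    and mult: "\<And>g x. \<lbrakk>x \<in> carrier (SUq q); P x\<rbrakk> \<Longrightarrow> P (suq_gen q g \<otimes>\<^bsub>SUq q\<^esub> x)"
  shows "P p"
proof -
  interpret Q: quotient_algebra "free_alg UNIV" "suq_ideal q" by (rule suq_quotient)
  have cl: "suq_ideal q +>\<^bsub>free_alg UNIV\<^esub> f \<in> carrier (SUq q)" for f
    unfolding SUq_def Q.quot_carrier by auto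
  obtain f where f: "p = suq_ideal q +>\<^bsub>free_alg UNIV\<^esub> f"
    using assms(1) unfolding SUq_def Q.quot_carrier by auto
  have "f \<in> carrier (free_alg UNIV)" by simp
  then have "P (suq_ideal q +>\<^bsub>free_alg UNIV\<^esub> f)"
  proof (induction f rule: free_alg_induct)
    case zero
    then show ?case using assms(2) Q.quot_zero by (simp add: SUq_def)
  next
    case one
    then show ?case using assms(3) Q.quot_one by (simp add: SUq_def)
  next
    case (add f g)
    then show ?case using assms(4)[OF cl cl add(3,4)] Q.quot_add[of f g] by (simp add: SUq_def)
  next
    case (scale c f)
    then show ?case using assms(5)[OF cl scale(2), of c] Q.quot_smult[of f c] by (simp add: SUq_def)
  next
    case (mult x f)
    then show ?case using assms(6)[OF cl, of f x] Q.quot_mult[of "free_var x" f] by (simp add: SUq_def suq_gen_def)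
  qed
  then show ?thesis by (simp add: f)
qed

subsection \<open>Slices of tensors\<close>

lemmas fnl = functional.functional_add functional.functional_smult functional.functional_zero
  functional.functional_minus functional.functional_uminus

context tensor_of_algebras
begin

text \<open>The map id \<otimes> \<psi> from the tensor product to its left factor.\<close>

definition slice :: "('w \<Rightarrow> complex) \<Rightarrow> ('v \<times> 'w \<Rightarrow>\<^sub>0 complex) set \<Rightarrow> 'v" where
  "slice \<psi> = tensor_lift A (\<lambda>x y. \<psi> y \<odot>\<^bsub>A\<^esub> x)"

lemma bilin_slice: "functional B \<psi> \<Longrightarrow> bilin A B A (\<lambda>x y. \<psi> y \<odot>\<^bsub>A\<^esub> x)"
  by (rule bilinI; rule linI)
    (simp_all add: fnl A.smult_l_distr A.smult_r_distr A.smult_assoc[symmetric] mult.commute)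

lemma lin_slice: "functional B \<psi> \<Longrightarrow> lin T A (slice \<psi>)"
  unfolding slice_def by (rule lin_tensor_lift[OF A.cspace_axioms bilin_slice])

lemma slice_pure: "functional B \<psi> \<Longrightarrow> x \<in> carrier A \<Longrightarrow> y \<in> carrier B \<Longrightarrow> slice \<psi> (pt x y) = \<psi> y \<odot>\<^bsub>A\<^esub> x"
  unfolding slice_def by (rule tensor_lift_pure[OF A.cspace_axioms bilin_slice])

lemmas slice_add = lin_add[OF lin_slice] and slice_smult = lin_smult[OF lin_slice]
  and slice_closed = lin_closed[OF lin_slice] and slice_zero = lin_zero[OF cspace_tensor A.cspace_axioms lin_slice]

lemma A_add4: "\<lbrakk>x \<in> carrier A; y \<in> carrier A; z \<in> carrier A; w \<in> carrier A\<rbrakk> \<Longrightarrow>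
  (x \<oplus>\<^bsub>A\<^esub> y) \<oplus>\<^bsub>A\<^esub> (z \<oplus>\<^bsub>A\<^esub> w) = (x \<oplus>\<^bsub>A\<^esub> z) \<oplus>\<^bsub>A\<^esub> (y \<oplus>\<^bsub>A\<^esub> w)"
  by (simp add: A.a_ac)

text \<open>A functional that is a skew derivation with respect to the functionals \<epsilon> and
  \<phi> induces a slice with the corresponding twisted Leibniz rule; composed with the coproduct
  this gives the skew derivations \<open>dd i\<close>.\<close>

lemma slice_mult:
  assumes \<psi>: "functional B \<psi>" "functional B \<phi>" "functional B \<epsilon>"
    and \<psi>_mult: "\<And>x y. x \<in> carrier B \<Longrightarrow> y \<in> carrier B \<Longrightarrow> \<psi> (x \<otimes>\<^bsub>B\<^esub> y) = \<epsilon> x * \<psi> y + \<psi> x * \<phi> y"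
    and "s \<in> carrier T" "t \<in> carrier T"
  shows "slice \<psi> (s \<otimes>\<^bsub>TA\<^esub> t) = slice \<psi> s \<otimes>\<^bsub>A\<^esub> slice \<phi> t \<oplus>\<^bsub>A\<^esub> slice \<epsilon> s \<otimes>\<^bsub>A\<^esub> slice \<psi> t"
  using assms(5)
proof (induction rule: tensor_induct)
  case (pure a b)
  note ab = this
  show ?case using assms(6)
    by (induction rule: tensor_induct)
      (use ab in \<open>simp_all add: TA_mult_zero mult_pure TA_r_distr TA_mult_closed \<psi>_mult slice_pure[OF \<psi>(1)]
        slice_pure[OF \<psi>(2)] slice_pure[OF \<psi>(3)] slice_add[OF \<psi>(1)] slice_add[OF \<psi>(2)] slice_add[OF \<psi>(3)]
        slice_zero[OF \<psi>(1)] slice_zero[OF \<psi>(2)] slice_zero[OF \<psi>(3)] slice_closed[OF \<psi>(1)] slice_closed[OF \<psi>(2)]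
        A.smult_l_distr A.smult_r_distr A.smult_assoc[symmetric] mult.commute A.r_distr A.a_comm A_add4\<close>)
qed (use assms(6) in \<open>simp_all add: TA_zero_left TA_l_distr TA_mult_closed slice_add[OF \<psi>(1)] slice_add[OF \<psi>(3)]
        slice_zero[OF \<psi>(1)] slice_zero[OF \<psi>(3)] slice_closed[OF \<psi>(1)] slice_closed[OF \<psi>(2)] slice_closed[OF \<psi>(3)]
        A.l_distr A_add4\<close>)

lemma slice_hom:
  assumes \<psi>: "functional B \<psi>"
    and \<psi>_mult: "\<And>x y. x \<in> carrier B \<Longrightarrow> y \<in> carrier B \<Longrightarrow> \<psi> (x \<otimes>\<^bsub>B\<^esub> y) = \<psi> x * \<psi> y"
    and "s \<in> carrier T" "t \<in> carrier T"
  shows "slice \<psi> (s \<otimes>\<^bsub>TA\<^esub> t) = slice \<psi> s \<otimes>\<^bsub>A\<^esub> slice \<psi> t"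
  using assms(3)
proof (induction rule: tensor_induct)
  case (pure a b)
  note ab = this
  show ?case using assms(4)
    by (induction rule: tensor_induct)
      (use ab in \<open>simp_all add: TA_mult_zero mult_pure TA_r_distr TA_mult_closed \<psi>_mult slice_pure[OF \<psi>(1)]
        slice_add[OF \<psi>(1)] slice_zero[OF \<psi>(1)] slice_closed[OF \<psi>(1)]
        A.smult_l_distr A.smult_r_distr A.smult_assoc[symmetric] mult.commute A.r_distr\<close>)
qed (use assms(4) in \<open>simp_all add: TA_zero_left TA_l_distr TA_mult_closed slice_add[OF \<psi>(1)]
        slice_zero[OF \<psi>(1)] slice_closed[OF \<psi>(1)] A.l_distr\<close>)

end

lemma hom_eqI:
  assumes "calgebra B" "alghom (SUq q) B f" "alghom (SUq q) B g" "\<And>x. f (suq_gen q x) = g (suq_gen q x)"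
    and "p \<in> carrier (SUq q)"
  shows "f p = g p"
proof -
  interpret B: calgebra B by fact
  interpret P: calgebra "SUq q" by (rule calgebra_SUq)
  note f = alghom_lin[OF assms(2)] and g = alghom_lin[OF assms(3)]
  show ?thesis using assms(5)
    by (induction rule: suq_induct)
      (simp_all add: lin_zero[OF P.cspace_axioms B.cspace_axioms f] lin_zero[OF P.cspace_axioms B.cspace_axioms g]
        lin_add[OF f] lin_add[OF g] lin_smult[OF f] lin_smult[OF g] alghom_mult[OF assms(2)] alghom_mult[OF assms(3)]
        alghom_one[OF assms(2)] alghom_one[OF assms(3)] suq_gen_closed assms(4))
qed

subsection \<open>Upper triangular matrices\<close>

text \<open>The entry \<open>(e, x, f)\<close> stands for the matrix with diagonal \<open>e, f\<close> and upper right entry \<open>x\<close>;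
  a homomorphism into this algebra is a pair of characters together with a skew derivation.\<close>

definition tri :: "(complex \<times> complex \<times> complex) calg" where
  "tri = \<lparr>carrier = UNIV, mult = (\<lambda>(e, x, f) (e', x', f'). (e * e', e * x' + x * f', f * f')), one = (1, 0, 1),
     zero = (0, 0, 0), add = (\<lambda>(e, x, f) (e', x', f'). (e + e', x + x', f + f')),
     smult = (\<lambda>c (e, x, f). (c * e, c * x, c * f))\<rparr>"

lemma tri_simps [simp]:
  "carrier tri = UNIV" "(e, x, f) \<otimes>\<^bsub>tri\<^esub> (e', x', f') = (e * e', e * x' + x * f', f * f')"
  "\<one>\<^bsub>tri\<^esub> = (1, 0, 1)" "\<zero>\<^bsub>tri\<^esub> = (0, 0, 0)" "(e, x, f) \<oplus>\<^bsub>tri\<^esub> (e', x', f') = (e + e', x + x', f + f')"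
  "c \<odot>\<^bsub>tri\<^esub> (e, x, f) = (c * e, c * x, c * f)"
  by (simp_all add: tri_def)

lemma calgebra_tri: "calgebra tri"
  by (rule calgebraI, rule cspaceI) (auto simp: algebra_simps)

datatype ix = Ith | Ipl | Imi

text \<open>The middle entry is the coordinate of \<open>qpi g\<close> along the i-th basis form,
  the last entry the scalar by which right multiplication by g acts on that form modulo
  \<open>R3\<close>. For \<open>Ith\<close> the relation that makes \<open>r^2\<close> times the
  first plus the second coordinate of \<alpha> and its adjoint vanish, together with the
  normalisation that their difference is 1, forces \<open>1 / (1 + r^2)\<close> and
  \<open>- r^2 / (1 + r^2)\<close>. The entry \<open>1 / r\<close> for \<open>Imi\<close>
  compensates the factor q in \<open>\<eta>\<^sub>-\<close>.\<close>

fun tri_gen :: "complex \<Rightarrow> ix \<Rightarrow> gen \<Rightarrow> complex \<times> complex \<times> complex" where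
  "tri_gen r Ith GenAlpha = (1, 1 / (1 + r^2), 1 / r^2)"
| "tri_gen r Ith GenAlphaStar = (1, (-1) * (r^2 / (1 + r^2)), r^2)"
| "tri_gen r Ith GenGamma = (0, 0, 0)"
| "tri_gen r Ith GenGammaStar = (0, 0, 0)"
| "tri_gen r Ipl GenAlpha = (1, 0, 1 / r)"
| "tri_gen r Ipl GenAlphaStar = (1, 0, r)"
| "tri_gen r Ipl GenGamma = (0, 1, 0)"
| "tri_gen r Ipl GenGammaStar = (0, 0, 0)"
| "tri_gen r Imi GenAlpha = (1, 0, 1 / r)"
| "tri_gen r Imi GenAlphaStar = (1, 0, r)"
| "tri_gen r Imi GenGamma = (0, 0, 0)"
| "tri_gen r Imi GenGammaStar = (0, 1 / r, 0)"

lemma one_plus_q2 [simp]: "1 + (complex_of_real q)^2 \<noteq> 0"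
proof -
  have "1 + q^2 > 0" by (simp add: add_pos_nonneg)
  then have "complex_of_real (1 + q^2) \<noteq> 0" by (metis of_real_eq_0_iff less_irrefl)
  then show ?thesis by simp
qed

lemma tri_point: "q \<noteq> 0 \<Longrightarrow> suq_point q tri (tri_gen (complex_of_real q) i)"
  by (cases i) (simp_all add: suq_point_def Let_def field_simps)

lemma counit_point: "suq_point q (type_alg (*))
   (\<lambda>g. case g of GenAlpha \<Rightarrow> 1 | GenAlphaStar \<Rightarrow> 1 | GenGamma \<Rightarrow> 0 | GenGammaStar \<Rightarrow> 0)"
  by (simp add: suq_point_def Let_def)

lemma laurent_simps [simp]:
  "carrier laurent = UNIV" "mult laurent = (*)" "\<one>\<^bsub>laurent\<^esub> = 1" "\<zero>\<^bsub>laurent\<^esub> = 0"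
  "add laurent = (+)" "smult laurent = pm_scale"
  by (simp_all add: laurent_def)

lemma calgebra_laurent: "calgebra laurent"
  unfolding laurent_def by (rule calgebra_pm)

lemma laurent_point: "suq_point q laurent
   (\<lambda>g. case g of GenAlpha \<Rightarrow> zpow 1 | GenAlphaStar \<Rightarrow> zpow (-1) | GenGamma \<Rightarrow> 0 | GenGammaStar \<Rightarrow> 0)"
  by (simp add: suq_point_def Let_def mult_single)

text \<open>\<open>P\<close> is a parameter, although q determines it, because the index-free
  algebra notation refers to a structure fixed by the locale.\<close>

locale quantum_su = calgebra P for P :: "suq calg" (structure) +
  fixes q :: real
  assumes P_def: "P = SUq q" and q_bounds: "-1 < q" "q < 1" and q0 [simp]: "q \<noteq> 0"
begin

abbreviation "Q \<equiv> complex_of_real q"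
abbreviation "al \<equiv> suq_gen q GenAlpha"
abbreviation "al' \<equiv> suq_gen q GenAlphaStar"
abbreviation "ga \<equiv> suq_gen q GenGamma"
abbreviation "ga' \<equiv> suq_gen q GenGammaStar"

lemma SUq_P [simp]: "SUq q = P"
  by (simp add: P_def)

lemma gen_closed [simp, intro]: "suq_gen q g \<in> carrier P"
  using suq_gen_closed[of q g] by simp

lemma rels:
  "al' \<otimes> al = \<one> \<oplus> ga \<otimes> ga'" "al \<otimes> al' = \<one> \<oplus> Q^2 \<odot> (ga \<otimes> ga')" "ga' \<otimes> ga = ga \<otimes> ga'"
  "al \<otimes> ga = Q \<odot> (ga \<otimes> al)" "al \<otimes> ga' = Q \<odot> (ga' \<otimes> al)"
  "ga \<otimes> al' = Q \<odot> (al' \<otimes> ga)" "ga' \<otimes> al' = Q \<odot> (al' \<otimes> ga')"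
  using suq_gen_point[of q] by (simp_all add: suq_point_def Let_def)

text \<open>The relations are oriented towards the monomial basis: \<alpha> and its adjoint move to
  the left and cancel against each other, and \<gamma> moves before its adjoint.
  \<open>order_rels_assoc\<close> repeats the rules with a tail, as is needed once products are
  associated to the right.\<close>

lemma order_rels:
  "al' \<otimes> al = \<one> \<oplus> ga \<otimes> ga'" "al \<otimes> al' = \<one> \<oplus> Q^2 \<odot> (ga \<otimes> ga')" "ga' \<otimes> ga = ga \<otimes> ga'"
  "ga \<otimes> al = (1 / Q) \<odot> (al \<otimes> ga)" "ga' \<otimes> al = (1 / Q) \<odot> (al \<otimes> ga')"
  "ga \<otimes> al' = Q \<odot> (al' \<otimes> ga)" "ga' \<otimes> al' = Q \<odot> (al' \<otimes> ga')"
  using rels by (simp_all add: smult_assoc[symmetric])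

lemma order_rels_assoc:
  assumes [simp]: "x \<in> carrier P"
  shows "al' \<otimes> (al \<otimes> x) = x \<oplus> ga \<otimes> (ga' \<otimes> x)" "al \<otimes> (al' \<otimes> x) = x \<oplus> Q^2 \<odot> (ga \<otimes> (ga' \<otimes> x))"
    "ga' \<otimes> (ga \<otimes> x) = ga \<otimes> (ga' \<otimes> x)"
    "ga \<otimes> (al \<otimes> x) = (1 / Q) \<odot> (al \<otimes> (ga \<otimes> x))" "ga' \<otimes> (al \<otimes> x) = (1 / Q) \<odot> (al \<otimes> (ga' \<otimes> x))"
    "ga \<otimes> (al' \<otimes> x) = Q \<odot> (al' \<otimes> (ga \<otimes> x))" "ga' \<otimes> (al' \<otimes> x) = Q \<odot> (al' \<otimes> (ga' \<otimes> x))"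
  by (simp_all add: m_assoc[symmetric] order_rels l_distr)

lemmas nf = order_rels order_rels_assoc m_assoc l_distr r_distr smult_r_distr smult_assoc[symmetric]

lemmas induct [consumes 1, case_names zero one add scale mult] = suq_induct[of _ q, simplified SUq_P]

lemmas hom_eqI' = hom_eqI[of _ q, unfolded SUq_P]

subsection \<open>Characters and skew derivations\<close>

lemmas counit_hom = suq_hom[OF calgebra_complex counit_point[of q], folded counit_def[of q], simplified SUq_P]
lemmas laurent_hom = suq_hom[OF calgebra_laurent laurent_point[of q], folded to_laurent_def[of q], simplified SUq_P]

lemma functional_counit: "functional P (counit q)"
  using functional_iff_lin[OF cspace_axioms] alghom_lin[OF counit_hom(1)] by simp

lemma counit_one [simp]: "counit q \<one> = 1"
  using alghom_one[OF counit_hom(1)] by simp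

lemma counit_mult [simp]: "x \<in> carrier P \<Longrightarrow> y \<in> carrier P \<Longrightarrow> counit q (x \<otimes> y) = counit q x * counit q y"
  using alghom_mult[OF counit_hom(1)] by simp

lemma counit_gen [simp]: "counit q al = 1" "counit q al' = 1" "counit q ga = 0" "counit q ga' = 0"
  using counit_hom(2) by simp_all

definition rep :: "ix \<Rightarrow> suq \<Rightarrow> complex \<times> complex \<times> complex" where
  "rep i = descend (free_eval tri (tri_gen Q i))"
definition chi :: "ix \<Rightarrow> suq \<Rightarrow> complex" where "chi i p = fst (snd (rep i p))"
definition phi :: "ix \<Rightarrow> suq \<Rightarrow> complex" where "phi i p = snd (snd (rep i p))"

lemmas rep_hom = suq_hom[OF calgebra_tri tri_point[OF q0], folded rep_def, simplified SUq_P]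

lemma tri_add: "u \<oplus>\<^bsub>tri\<^esub> v = (fst u + fst v, fst (snd u) + fst (snd v), snd (snd u) + snd (snd v))"
  and tri_smult: "c \<odot>\<^bsub>tri\<^esub> v = (c * fst v, c * fst (snd v), c * snd (snd v))"
  and tri_mult: "u \<otimes>\<^bsub>tri\<^esub> v = (fst u * fst v, fst u * fst (snd v) + fst (snd u) * snd (snd v), snd (snd u) * snd (snd v))"
  by (cases u; cases v; simp)+

lemma functional_rep: "functional P (\<lambda>p. fst (rep i p))" "functional P (chi i)" "functional P (phi i)"
  by (unfold_locales; simp add: chi_def phi_def lin_add[OF alghom_lin[OF rep_hom(1)]]
      lin_smult[OF alghom_lin[OF rep_hom(1)]] tri_add tri_smult)+

text \<open>Both sides are characters with equal values on the generators. With the counit as left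
  diagonal entry, the first factor stays untwisted in the Leibniz rule
  \<open>dd_mult\<close>.\<close>

lemma fst_rep: "p \<in> carrier P \<Longrightarrow> fst (rep i p) = counit q p"
proof -
  assume p: "p \<in> carrier P"
  have "alghom P (type_alg (*)) (\<lambda>p. fst (rep i p))"
    using functional_rep(1) functional_iff_lin[OF cspace_axioms]
    by (simp add: alghom_def alghom_mult[OF rep_hom(1)] alghom_one[OF rep_hom(1)] tri_mult)
  moreover have "fst (rep i (suq_gen q x)) = counit q (suq_gen q x)" for x
    by (cases x; cases i) (simp_all add: rep_hom(2))
  ultimately show ?thesis
    by (rule hom_eqI'[OF calgebra_complex _ counit_hom(1) _ p])
qed

lemma phi_mult: "x \<in> carrier P \<Longrightarrow> y \<in> carrier P \<Longrightarrow> phi i (x \<otimes> y) = phi i x * phi i y"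
  and chi_mult: "x \<in> carrier P \<Longrightarrow> y \<in> carrier P \<Longrightarrow> chi i (x \<otimes> y) = counit q x * chi i y + chi i x * phi i y"
  and phi_one [simp]: "phi i \<one> = 1" and chi_one [simp]: "chi i \<one> = 0"
  by (simp_all add: chi_def phi_def alghom_mult[OF rep_hom(1)] alghom_one[OF rep_hom(1)] tri_mult fst_rep)

lemma phi_gen: "phi i (suq_gen q x) = snd (snd (tri_gen Q i x))"
  and chi_gen: "chi i (suq_gen q x) = fst (snd (tri_gen Q i x))"
  by (simp_all add: chi_def phi_def rep_hom(2))

subsection \<open>The coproduct\<close>

sublocale PP: tensor_of_algebras P P ..

lemma comult_gen_eq:
  "comult_gen q GenAlpha = PP.pt al al \<oplus>\<^bsub>PP.T\<^esub> Q \<odot>\<^bsub>PP.T\<^esub> PP.pt ga' ga"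
  "comult_gen q GenAlphaStar = PP.pt al' al' \<oplus>\<^bsub>PP.T\<^esub> Q \<odot>\<^bsub>PP.T\<^esub> PP.pt ga ga'"
  "comult_gen q GenGamma = PP.pt ga al \<oplus>\<^bsub>PP.T\<^esub> PP.pt al' ga"
  "comult_gen q GenGammaStar = PP.pt ga' al' \<oplus>\<^bsub>PP.T\<^esub> PP.pt al ga'"
  by (simp_all add: comult_gen_def Let_def)

lemmas TA_rules = PP.TA_l_distr PP.TA_r_distr PP.TA_smult_left PP.TA_smult_right PP.mult_pure PP.TA_mult_closed

text \<open>Expanding the products leaves pure tensors with normal ordered legs; each relation is
  then an identity between scalar combinations and is tested by functionals.\<close>

lemma comult_point: "suq_point q PP.TA (comult_gen q)"
proof -
  have cl: "comult_gen q x \<in> carrier PP.T" for x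
    by (cases x) (simp_all add: comult_gen_eq)
  then have *: "range (comult_gen q) \<subseteq> carrier PP.T" by auto
  show ?thesis
    unfolding suq_point_def Let_def comult_gen_eq
    unfolding PP.TA_simps
    by (intro conjI; (rule * | rule PP.T.eq_by_functionals))
       (simp_all add: TA_rules nf fnl PP.T.smult_r_distr PP.T.smult_assoc[symmetric] field_simps power2_eq_square)
qed

end

text \<open>The weight is the exponent of z in the coaction. The generator \<gamma> has weight 1
  because of the summand \<gamma> \<otimes> \<alpha> of its coproduct; the summand that ends in
  \<gamma> is killed by \<open>to_laurent\<close>.\<close>

fun wt :: "gen \<Rightarrow> int" where
  "wt GenAlpha = 1"
| "wt GenAlphaStar = -1"
| "wt GenGamma = 1"
| "wt GenGammaStar = -1"

lemma lookup_zpow_mult: "Poly_Mapping.lookup (zpow w * f) n = Poly_Mapping.lookup f (n - w)"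
proof -
  have "Poly_Mapping.keys f \<subseteq> UNIV" by simp
  then show ?thesis
    by (induction f rule: pm_induct) (simp_all add: distrib_left mult_single lookup_add lookup_single when_def algebra_simps)
qed

section \<open>Convolution of the coproduct with functionals\<close>

context quantum_su
begin

lemmas comult_hom = suq_hom[OF PP.calgebra_TA comult_point, folded comult_def[of q, unfolded SUq_P], simplified SUq_P]

lemma comult_closed [simp]: "p \<in> carrier P \<Longrightarrow> comult q p \<in> carrier PP.T"
  using lin_closed[OF alghom_lin[OF comult_hom(1)]] by simp

lemma comult_simps:
  "x \<in> carrier P \<Longrightarrow> y \<in> carrier P \<Longrightarrow> comult q (x \<oplus> y) = comult q x \<oplus>\<^bsub>PP.T\<^esub> comult q y"
  "x \<in> carrier P \<Longrightarrow> comult q (c \<odot> x) = c \<odot>\<^bsub>PP.T\<^esub> comult q x"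
  "x \<in> carrier P \<Longrightarrow> y \<in> carrier P \<Longrightarrow> comult q (x \<otimes> y) = comult q x \<otimes>\<^bsub>PP.TA\<^esub> comult q y"
  "comult q \<one> = PP.pt \<one> \<one>"
  using lin_add[OF alghom_lin[OF comult_hom(1)]] lin_smult[OF alghom_lin[OF comult_hom(1)]]
    alghom_mult[OF comult_hom(1)] alghom_one[OF comult_hom(1)] by simp_all

text \<open>In Sweedler notation \<open>conv \<psi> p\<close> is p1 \<psi>(p2).\<close>

definition conv :: "(suq \<Rightarrow> complex) \<Rightarrow> suq \<Rightarrow> suq" where
  "conv \<psi> p = PP.slice \<psi> (comult q p)"

lemma conv_lin: "functional P \<psi> \<Longrightarrow> lin P P (conv \<psi>)"
  by (rule linI) (simp_all add: conv_def comult_simps PP.slice_add PP.slice_smult PP.slice_closed)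

lemma conv_hom:
  assumes "functional P \<psi>" "\<psi> \<one> = 1"
    "\<And>x y. x \<in> carrier P \<Longrightarrow> y \<in> carrier P \<Longrightarrow> \<psi> (x \<otimes> y) = \<psi> x * \<psi> y"
  shows "alghom P P (conv \<psi>)"
  using assms(2) conv_lin[OF assms(1)]
  by (simp add: alghom_def conv_def comult_simps PP.slice_hom[OF assms(1,3)] PP.slice_pure[OF assms(1)])

lemma conv_gen:
  assumes "functional P \<psi>"
  shows "conv \<psi> al = \<psi> al \<odot> al \<oplus> (Q * \<psi> ga) \<odot> ga'" "conv \<psi> al' = \<psi> al' \<odot> al' \<oplus> (Q * \<psi> ga') \<odot> ga"
    "conv \<psi> ga = \<psi> al \<odot> ga \<oplus> \<psi> ga \<odot> al'" "conv \<psi> ga' = \<psi> al' \<odot> ga' \<oplus> \<psi> ga' \<odot> al"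
  by (simp_all add: conv_def comult_hom(2) comult_gen_eq PP.slice_add[OF assms] PP.slice_smult[OF assms]
      PP.slice_pure[OF assms] smult_assoc)

text \<open>The counit axiom. It is what leaves x itself in front of the second term of
  \<open>dd_mult\<close>.\<close>

lemma conv_counit: "p \<in> carrier P \<Longrightarrow> conv (counit q) p = p"
proof (rule hom_eqI'[OF calgebra_axioms conv_hom[OF functional_counit]])
  show "alghom P P (\<lambda>p. p)" by (auto simp: alghom_def lin_def)
  show "conv (counit q) (suq_gen q x) = suq_gen q x" for x
    by (cases x) (simp_all add: conv_gen[OF functional_counit])
qed simp_all

text \<open>The automorphism that governs the bimodule: the i-th basis form times p equals
  \<open>sig i p\<close> times the form, as \<open>X_ract\<close> and \<open>eta_comm\<close>
  show.\<close>

definition sig :: "ix \<Rightarrow> suq \<Rightarrow> suq" where "sig i = conv (phi i)"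
definition dd :: "ix \<Rightarrow> suq \<Rightarrow> suq" where "dd i = conv (chi i)"

lemma sig_hom: "alghom P P (sig i)"
  unfolding sig_def by (rule conv_hom[OF functional_rep(3)]) (simp_all add: phi_mult)

lemma dd_lin: "lin P P (dd i)"
  unfolding dd_def by (rule conv_lin[OF functional_rep(2)])

lemma sig_closed [simp]: "x \<in> carrier P \<Longrightarrow> sig i x \<in> carrier P"
  and sig_add: "x \<in> carrier P \<Longrightarrow> y \<in> carrier P \<Longrightarrow> sig i (x \<oplus> y) = sig i x \<oplus> sig i y"
  and sig_smult: "x \<in> carrier P \<Longrightarrow> sig i (c \<odot> x) = c \<odot> sig i x"
  and sig_zero [simp]: "sig i \<zero> = \<zero>"
  and sig_mult: "x \<in> carrier P \<Longrightarrow> y \<in> carrier P \<Longrightarrow> sig i (x \<otimes> y) = sig i x \<otimes> sig i y"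
  and sig_one [simp]: "sig i \<one> = \<one>"
  using lin_closed[OF alghom_lin[OF sig_hom]] lin_add[OF alghom_lin[OF sig_hom]] lin_smult[OF alghom_lin[OF sig_hom]]
    lin_zero[OF cspace_axioms cspace_axioms alghom_lin[OF sig_hom]] alghom_mult[OF sig_hom] alghom_one[OF sig_hom]
  by simp_all

lemma dd_closed [simp]: "x \<in> carrier P \<Longrightarrow> dd i x \<in> carrier P"
  and dd_add: "x \<in> carrier P \<Longrightarrow> y \<in> carrier P \<Longrightarrow> dd i (x \<oplus> y) = dd i x \<oplus> dd i y"
  and dd_smult: "x \<in> carrier P \<Longrightarrow> dd i (c \<odot> x) = c \<odot> dd i x"
  and dd_zero [simp]: "dd i \<zero> = \<zero>"
  and dd_minus: "x \<in> carrier P \<Longrightarrow> y \<in> carrier P \<Longrightarrow> dd i (x \<ominus> y) = dd i x \<ominus> dd i y"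
  and dd_uminus: "x \<in> carrier P \<Longrightarrow> dd i (\<ominus> x) = \<ominus> dd i x"
  using lin_closed[OF dd_lin] lin_add[OF dd_lin] lin_smult[OF dd_lin] lin_zero[OF cspace_axioms cspace_axioms dd_lin]
    lin_minus[OF cspace_axioms cspace_axioms dd_lin] lin_uminus[OF cspace_axioms cspace_axioms dd_lin]
  by simp_all

lemma dd_one [simp]: "dd i \<one> = \<zero>"
  by (simp add: dd_def conv_def comult_simps PP.slice_pure[OF functional_rep(2)])

lemma dd_mult:
  assumes "x \<in> carrier P" "y \<in> carrier P"
  shows "dd i (x \<otimes> y) = dd i x \<otimes> sig i y \<oplus> x \<otimes> dd i y"
  using PP.slice_mult[OF functional_rep(2)[of i] functional_rep(3)[of i] functional_counit chi_mult
      comult_closed[OF assms(1)] comult_closed[OF assms(2)]] assms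
    conv_counit[OF assms(1)]
  by (simp add: dd_def sig_def conv_def comult_simps)

abbreviation (input) "rp \<equiv> 1 / (1 + Q^2)"
abbreviation (input) "rm \<equiv> (-1) * (Q^2 / (1 + Q^2))"

lemma sig_gen [simp]:
  "sig Ith al = (1 / Q^2) \<odot> al" "sig Ith al' = Q^2 \<odot> al'" "sig Ith ga = (1 / Q^2) \<odot> ga" "sig Ith ga' = Q^2 \<odot> ga'"
  "sig Ipl al = (1 / Q) \<odot> al" "sig Ipl al' = Q \<odot> al'" "sig Ipl ga = (1 / Q) \<odot> ga" "sig Ipl ga' = Q \<odot> ga'"
  "sig Imi al = (1 / Q) \<odot> al" "sig Imi al' = Q \<odot> al'" "sig Imi ga = (1 / Q) \<odot> ga" "sig Imi ga' = Q \<odot> ga'"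
  by (simp_all add: sig_def conv_gen[OF functional_rep(3)] phi_gen)

lemma dd_gen [simp]:
  "dd Ith al = rp \<odot> al" "dd Ith al' = rm \<odot> al'" "dd Ith ga = rp \<odot> ga" "dd Ith ga' = rm \<odot> ga'"
  "dd Ipl al = Q \<odot> ga'" "dd Ipl al' = \<zero>" "dd Ipl ga = al'" "dd Ipl ga' = \<zero>"
  "dd Imi al = \<zero>" "dd Imi al' = ga" "dd Imi ga = \<zero>" "dd Imi ga' = (1 / Q) \<odot> al"
  by (simp_all add: dd_def conv_gen[OF functional_rep(2)] chi_gen)

subsection \<open>The involution\<close>

text \<open>The elements whose star lies in the ideal form an ideal themselves, and it contains the
  relators because their set is closed under the involution.\<close>

lemma free_star_ideal: "w \<in> suq_ideal q \<Longrightarrow> free_star w \<in> suq_ideal q"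
proof -
  let ?K = "{f. free_star f \<in> suq_ideal q}"
  interpret I: ideal "suq_ideal q" "free_alg UNIV"
    using suq_quotient[of q] by (simp add: quotient_algebra_def quotient_algebra_axioms_def)
  have m: "free_star (- f) = - free_star f" for f using free_star_diff[of 0 f] by simp
  have "ideal ?K (free_alg UNIV)"
  proof (rule idealI)
    show "ring (free_alg (UNIV :: gen set))" ..
    show "subgroup ?K (add_monoid (free_alg UNIV))"
    proof (rule FA.add.subgroupI)
      show "\<ominus>\<^bsub>free_alg UNIV\<^esub> f \<in> ?K" if "f \<in> ?K" for f
        using that I.a_inv_closed[of "free_star f"] by (simp add: free_alg_uminus m)
      show "?K \<noteq> {}" using I.zero_closed by (auto intro!: exI[of _ 0])
    qed (use I.a_closed in \<open>auto simp: free_star_add\<close>)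
    show "x \<otimes>\<^bsub>free_alg UNIV\<^esub> f \<in> ?K" "f \<otimes>\<^bsub>free_alg UNIV\<^esub> x \<in> ?K" if "f \<in> ?K" for f x
      using that I.I_l_closed[of "free_star f" "free_star x"] I.I_r_closed[of "free_star f" "free_star x"]
      by (simp_all add: free_star_mult)
  qed
  then have "suq_ideal q \<subseteq> ?K"
    unfolding suq_ideal_def
    by (rule FA.genideal_minimal) (use FA.genideal_self[of "suq_rels q"] in auto)
  then show "w \<in> suq_ideal q \<Longrightarrow> free_star w \<in> suq_ideal q" by auto
qed

sublocale SQ: quotient_algebra "free_alg UNIV" "suq_ideal q"
  by (rule suq_quotient)

abbreviation cls :: "(gen fword \<Rightarrow>\<^sub>0 complex) \<Rightarrow> suq" where
  "cls f \<equiv> suq_ideal q +>\<^bsub>free_alg UNIV\<^esub> f"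

lemma cls_ops: "cls f \<oplus> cls g = cls (f + g)" "c \<odot> cls f = cls (pm_scale c f)" "cls f \<otimes> cls g = cls (f * g)"
  "\<one> = cls 1" "\<zero> = cls 0" "suq_gen q x = cls (free_var x)"
  using SQ.quot_add[of f g] SQ.quot_smult[of f c] SQ.quot_mult[of f g] SQ.quot_one SQ.quot_zero
  by (simp_all add: P_def SUq_def suq_gen_def)

lemma cls_cases: assumes "p \<in> carrier P" obtains f where "p = cls f"
  using assms by (auto simp: P_def SUq_def SQ.quot_carrier)

lemma cls_closed: "cls f \<in> carrier P"
  by (auto simp: P_def SUq_def SQ.quot_carrier)

text \<open>The star of a coset is formed elementwise. Invariance of the ideal gives one inclusion,
  and applying that inclusion to \<open>free_star f\<close> gives the other since the star is
  involutive.\<close>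

lemma star_cls: "suq_star (cls f) = cls (free_star f)"
proof -
  have sub: "free_star ` cls f \<subseteq> cls (free_star f)" for f
  proof
    fix y assume "y \<in> free_star ` cls f"
    then obtain x where x: "x \<in> cls f" "y = free_star x" by auto
    then have "x - f \<in> suq_ideal q" using SQ.in_coset[of f x] by (simp add: free_alg_UNIV_minus)
    then have "free_star x - free_star f \<in> suq_ideal q" using free_star_ideal[of "x - f"] by (simp add: free_star_diff)
    then have "cls (free_star x) = cls (free_star f)" by (subst SQ.coset_eq_iff) (simp_all add: free_alg_UNIV_minus)
    then show "y \<in> cls (free_star f)" using SQ.coset_self[of y] x(2) by simp
  qed
  have "free_star ` cls f = cls (free_star f)"
  proof
    show "cls (free_star f) \<subseteq> free_star ` cls f"
    proof
      fix y assume "y \<in> cls (free_star f)"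
      then have "free_star y \<in> cls f" using sub[of "free_star f"] by auto
      then show "y \<in> free_star ` cls f" by (metis free_star_free_star image_eqI)
    qed
  qed (rule sub)
  then show ?thesis by (simp add: suq_star_def)
qed

lemma star_closed [simp]: "x \<in> carrier P \<Longrightarrow> suq_star x \<in> carrier P"
  by (erule cls_cases) (simp add: star_cls cls_closed)

lemma star_add: "x \<in> carrier P \<Longrightarrow> y \<in> carrier P \<Longrightarrow> suq_star (x \<oplus> y) = suq_star x \<oplus> suq_star y"
  by (elim cls_cases) (simp add: star_cls cls_ops free_star_add)

lemma star_smult: "x \<in> carrier P \<Longrightarrow> suq_star (c \<odot> x) = cnj c \<odot> suq_star x"
  by (elim cls_cases) (simp add: star_cls cls_ops free_star_scale)

lemma star_mult: "x \<in> carrier P \<Longrightarrow> y \<in> carrier P \<Longrightarrow> suq_star (x \<otimes> y) = suq_star y \<otimes> suq_star x"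
  by (elim cls_cases) (simp add: star_cls cls_ops free_star_mult)

lemma star_star [simp]: "x \<in> carrier P \<Longrightarrow> suq_star (suq_star x) = x"
  by (elim cls_cases) (simp add: star_cls)

lemma star_one [simp]: "suq_star \<one> = \<one>" and star_zero [simp]: "suq_star \<zero> = \<zero>"
  by (simp_all add: cls_ops star_cls)

lemma star_uminus: "x \<in> carrier P \<Longrightarrow> suq_star (\<ominus> x) = \<ominus> suq_star x"
  by (simp add: minus_eq_smult star_smult)

lemma star_gen [simp]: "suq_star (suq_gen q x) = suq_gen q (gen_star x)"
  by (simp add: cls_ops star_cls)

subsection \<open>Weights\<close>

interpretation Lau: calgebra laurent by (rule calgebra_laurent)

sublocale PL: tensor_of_algebras P laurent
  by (intro tensor_of_algebras.intro calgebra_axioms calgebra_laurent)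

lemma laurent_simps':
  "x \<in> carrier P \<Longrightarrow> y \<in> carrier P \<Longrightarrow> to_laurent q (x \<oplus> y) = to_laurent q x + to_laurent q y"
  "x \<in> carrier P \<Longrightarrow> to_laurent q (c \<odot> x) = pm_scale c (to_laurent q x)"
  "x \<in> carrier P \<Longrightarrow> y \<in> carrier P \<Longrightarrow> to_laurent q (x \<otimes> y) = to_laurent q x * to_laurent q y"
  "to_laurent q \<one> = 1"
  "to_laurent q al = zpow 1" "to_laurent q al' = zpow (-1)" "to_laurent q ga = 0" "to_laurent q ga' = 0"
  using lin_add[OF alghom_lin[OF laurent_hom(1)]] lin_smult[OF alghom_lin[OF laurent_hom(1)]]
    alghom_mult[OF laurent_hom(1)] alghom_one[OF laurent_hom(1)] laurent_hom(2) by simp_all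

definition pushL :: "(suq \<times> suq \<Rightarrow>\<^sub>0 complex) set \<Rightarrow> (suq \<times> (int \<Rightarrow>\<^sub>0 complex) \<Rightarrow>\<^sub>0 complex) set" where
  "pushL = tensor_lift PL.T (\<lambda>x y. PL.pt x (to_laurent q y))"

lemma coaction_eq: "coaction q p = pushL (comult q p)"
  by (simp add: coaction_def pushL_def)

lemma bilin_pushL: "bilin P P PL.T (\<lambda>x y. PL.pt x (to_laurent q y))"
  by (rule bilinI; rule linI)
    (simp_all add: laurent_simps' PL.pt_add_right[unfolded laurent_simps] PL.pt_smult_right[unfolded laurent_simps])

lemma lin_pushL: "lin PP.T PL.T pushL"
  unfolding pushL_def by (rule PP.lin_tensor_lift[OF PL.cspace_tensor bilin_pushL])

lemma pushL_pure: "x \<in> carrier P \<Longrightarrow> y \<in> carrier P \<Longrightarrow> pushL (PP.pt x y) = PL.pt x (to_laurent q y)"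
  unfolding pushL_def by (rule PP.tensor_lift_pure[OF PL.cspace_tensor bilin_pushL])

lemmas pushL_simps = lin_closed[OF lin_pushL] lin_add[OF lin_pushL] lin_smult[OF lin_pushL]
  lin_zero[OF PP.cspace_tensor PL.cspace_tensor lin_pushL] pushL_pure

lemma pushL_mult:
  assumes "s \<in> carrier PP.T" "t \<in> carrier PP.T"
  shows "pushL (s \<otimes>\<^bsub>PP.TA\<^esub> t) = pushL s \<otimes>\<^bsub>PL.TA\<^esub> pushL t"
  using assms(1)
proof (induction rule: PP.tensor_induct)
  case (pure a b)
  note ab = this
  show ?case using assms(2)
    by (induction rule: PP.tensor_induct)
      (use ab in \<open>simp_all add: PP.TA_mult_zero PL.TA_mult_zero PP.mult_pure PL.mult_pure PP.TA_r_distr PL.TA_r_distr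
        PP.TA_mult_closed PL.TA_mult_closed pushL_simps laurent_simps'\<close>)
qed (use assms(2) in \<open>simp_all add: PP.TA_zero_left PL.TA_zero_left PP.TA_l_distr PL.TA_l_distr PP.TA_mult_closed
      PL.TA_mult_closed pushL_simps\<close>)

lemma coaction_simps:
  "x \<in> carrier P \<Longrightarrow> coaction q x \<in> carrier PL.T"
  "x \<in> carrier P \<Longrightarrow> y \<in> carrier P \<Longrightarrow> coaction q (x \<oplus> y) = coaction q x \<oplus>\<^bsub>PL.T\<^esub> coaction q y"
  "x \<in> carrier P \<Longrightarrow> coaction q (c \<odot> x) = c \<odot>\<^bsub>PL.T\<^esub> coaction q x"
  "x \<in> carrier P \<Longrightarrow> y \<in> carrier P \<Longrightarrow> coaction q (x \<otimes> y) = coaction q x \<otimes>\<^bsub>PL.TA\<^esub> coaction q y"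
  "coaction q \<one> = PL.pt \<one> 1"
  "coaction q \<zero> = \<zero>\<^bsub>PL.T\<^esub>"
proof -
  show "coaction q \<zero> = \<zero>\<^bsub>PL.T\<^esub>"
    using lin_zero[OF cspace_axioms PP.cspace_tensor lin_comp[OF alghom_lin[OF comult_hom(1)], of PP.T "\<lambda>x. x"]]
      lin_zero[OF cspace_axioms PP.T.cspace_axioms, of "comult q"] alghom_lin[OF comult_hom(1)]
    by (simp add: coaction_eq lin_def pushL_simps)
qed (simp_all add: coaction_eq comult_simps pushL_simps pushL_mult PP.TA_mult_closed laurent_simps')

lemma PL_zero: "x \<in> carrier P \<Longrightarrow> PL.pt x 0 = \<zero>\<^bsub>PL.T\<^esub>"
  using lin_zero[OF Lau.cspace_axioms PL.cspace_tensor bilin_right[OF PL.bilin_pt]] by simp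

lemma PL_zero': "PL.pt \<zero> f = \<zero>\<^bsub>PL.T\<^esub>"
  using lin_zero[OF cspace_axioms PL.cspace_tensor bilin_left[OF PL.bilin_pt]] by simp

lemma coaction_gen: "coaction q (suq_gen q g) = PL.pt (suq_gen q g) (zpow (wt g))"
  by (cases g) (simp_all add: coaction_eq comult_hom(2) comult_gen_eq pushL_simps laurent_simps' PL_zero)

lemma weight_spaceI: "x \<in> carrier P \<Longrightarrow> coaction q x = PL.pt x (zpow n) \<Longrightarrow> x \<in> weight_space q n"
  by (simp add: weight_space_def)

lemma weight_spaceD: "x \<in> weight_space q n \<Longrightarrow> x \<in> carrier P" "x \<in> weight_space q n \<Longrightarrow> coaction q x = PL.pt x (zpow n)"
  by (simp_all add: weight_space_def)

lemma hyperboloid_eq: "hyperboloid q = weight_space q 0"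
  by (simp add: hyperboloid_def weight_space_def flip: single_one)

lemma weight_add: "x \<in> weight_space q n \<Longrightarrow> y \<in> weight_space q n \<Longrightarrow> x \<oplus> y \<in> weight_space q n"
  and weight_smult: "x \<in> weight_space q n \<Longrightarrow> c \<odot> x \<in> weight_space q n"
  and weight_zero: "\<zero> \<in> weight_space q n"
  and weight_one: "\<one> \<in> weight_space q 0"
  and weight_gen: "suq_gen q g \<in> weight_space q (wt g)"
  and weight_mult: "x \<in> weight_space q m \<Longrightarrow> y \<in> weight_space q n \<Longrightarrow> x \<otimes> y \<in> weight_space q (m + n)"
  by (auto intro!: weight_spaceI dest: weight_spaceD
      simp: coaction_simps coaction_gen PL_zero' weight_spaceD PL.mult_pure mult_single simp flip: single_one)

lemma functional_lookup: "functional laurent (\<lambda>f. Poly_Mapping.lookup f n)"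
  by unfold_locales (simp_all add: lookup_add)

text \<open>The homogeneous component of weight n: the coaction followed by the coefficient of the
  n-th power of z.\<close>

definition wproj :: "int \<Rightarrow> suq \<Rightarrow> suq" where
  "wproj n p = PL.slice (\<lambda>f. Poly_Mapping.lookup f n) (coaction q p)"

lemma wproj_simps:
  "x \<in> carrier P \<Longrightarrow> wproj n x \<in> carrier P"
  "x \<in> carrier P \<Longrightarrow> y \<in> carrier P \<Longrightarrow> wproj n (x \<oplus> y) = wproj n x \<oplus> wproj n y"
  "x \<in> carrier P \<Longrightarrow> wproj n (c \<odot> x) = c \<odot> wproj n x"
  "wproj n \<zero> = \<zero>"
  by (simp_all add: wproj_def coaction_simps PL.slice_add[OF functional_lookup] PL.slice_smult[OF functional_lookup]
      PL.slice_closed[OF functional_lookup] PL.slice_zero[OF functional_lookup])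

lemma wproj_weight: "x \<in> weight_space q n \<Longrightarrow> wproj m x = (if m = n then x else \<zero>)"
  by (simp add: wproj_def weight_spaceD PL.slice_pure[OF functional_lookup] lookup_single)

lemma slice_shift:
  assumes "t \<in> carrier PL.T" "g \<in> carrier P"
  shows "PL.slice (\<lambda>f. Poly_Mapping.lookup f n) (PL.pt g (zpow w) \<otimes>\<^bsub>PL.TA\<^esub> t) =
    g \<otimes> PL.slice (\<lambda>f. Poly_Mapping.lookup f (n - w)) t"
  using assms
  by (induction rule: PL.tensor_induct)
    (simp_all add: PL.TA_mult_zero PL.mult_pure PL.TA_r_distr PL.TA_mult_closed PL.slice_add[OF functional_lookup]
      PL.slice_pure[OF functional_lookup] PL.slice_zero[OF functional_lookup] PL.slice_closed[OF functional_lookup]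
      lookup_zpow_mult r_distr)

lemma wproj_mult: "p \<in> carrier P \<Longrightarrow> wproj n (suq_gen q g \<otimes> p) = suq_gen q g \<otimes> wproj (n - wt g) p"
  by (simp add: wproj_def coaction_simps coaction_gen slice_shift)

text \<open>Building an element from generators leaves the weight spaces. Hence the claim is proved
  for the projections of an arbitrary p to all weights at once, where a generator shifts the weight,
  and x is then recovered as its own projection.\<close>

lemma weight_induct [consumes 1, case_names one zero add smult mult]:
  assumes "x \<in> weight_space q n" "S 0 \<one>" "\<And>n. S n \<zero>"
    and add: "\<And>n x y. \<lbrakk>x \<in> weight_space q n; y \<in> weight_space q n; S n x; S n y\<rbrakk> \<Longrightarrow> S n (x \<oplus> y)"
    and smult: "\<And>n c x. \<lbrakk>x \<in> weight_space q n; S n x\<rbrakk> \<Longrightarrow> S n (c \<odot> x)"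
    and mult: "\<And>n g x. \<lbrakk>x \<in> weight_space q n; S n x\<rbrakk> \<Longrightarrow> S (wt g + n) (suq_gen q g \<otimes> x)"
  shows "S n x"
proof -
  have "wproj n p \<in> weight_space q n \<and> S n (wproj n p)" if "p \<in> carrier P" for n p
    using that
  proof (induction arbitrary: n rule: induct)
    case zero
    then show ?case using assms(3) weight_zero by (simp add: wproj_simps)
  next
    case one
    then show ?case using assms(2,3) weight_zero weight_one wproj_weight[OF weight_one, of n] by auto
  next
    case (add x y)
    then show ?case using assms(4) weight_add by (simp add: wproj_simps)
  next
    case (scale c x)
    then show ?case using assms(5) weight_smult by (simp add: wproj_simps)
  next
    case (mult g x)
    then show ?case
      using assms(6)[of "wproj (n - wt g) x" "n - wt g" g] weight_mult[OF weight_gen, of "wproj (n - wt g) x" "n - wt g" g]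
      by (simp add: wproj_mult)
  qed
  from this[OF weight_spaceD(1)[OF assms(1)], of n] show ?thesis
    using wproj_weight[OF assms(1), of n] by simp
qed

end

context quantum_su
begin

subsection \<open>Action of the skew derivations on weight vectors\<close>

lemma abs_q_less_1: "\<bar>q\<bar> < 1"
  using q_bounds by auto

lemma q2_less_1: "q^2 < 1"
  using abs_q_less_1 by (simp add: abs_square_less_1)

lemma q4_less_1: "q^4 < 1"
  using q2_less_1 power_less_one_iff[of "q^2" 2] by (simp flip: power_mult)

lemma Q4_neq [simp]: "1 - Q^4 \<noteq> 0" "1 - Q^2 \<noteq> 0"
proof -
  have "complex_of_real (1 - q^4) \<noteq> 0" "complex_of_real (1 - q^2) \<noteq> 0"
    using q4_less_1 q2_less_1 by (simp_all only: of_real_eq_0_iff)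
  then show "1 - Q^4 \<noteq> 0" "1 - Q^2 \<noteq> 0" by simp_all
qed

text \<open>The eigenvalue of \<open>dd Ith\<close> on weight n. The twisted Leibniz rule forces the
  cocycle identity \<open>rr_add\<close>, and the values on the generators fix the solution.\<close>

definition rr :: "int \<Rightarrow> complex" where
  "rr n = Q^2 * (Q powi (-2 * n) - 1) / (1 - Q^4)"

definition sc :: "ix \<Rightarrow> int \<Rightarrow> complex" where
  "sc i n = (if i = Ith then Q powi (-2 * n) else Q powi (- n))"

lemma sc_add: "sc i (m + n) = sc i m * sc i n"
proof -
  have "Q powi (- (m + n)) = Q powi (- m) * Q powi (- n)" for m n
    by (simp flip: power_int_add)
  from this[of m n] this[of "2 * m" "2 * n"] show ?thesis by (simp add: sc_def algebra_simps)
qed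

lemma sc_zero [simp]: "sc i 0 = 1"
  by (simp add: sc_def)

lemma sig_weight_gen: "sig i (suq_gen q g) = sc i (wt g) \<odot> suq_gen q g"
  by (cases g; cases i) (simp_all add: sc_def power_int_minus field_simps)

lemma sig_weight: "x \<in> weight_space q n \<Longrightarrow> sig i x = sc i n \<odot> x"
proof (induction rule: weight_induct)
  case (add n x y)
  then show ?case by (simp add: weight_spaceD sig_add smult_r_distr)
next
  case (smult n c x)
  then show ?case by (simp add: weight_spaceD sig_smult smult_assoc[symmetric] mult.commute)
next
  case (mult n g x)
  then show ?case by (simp add: weight_spaceD sig_mult sig_weight_gen sc_add smult_assoc[symmetric] mult.commute)
qed simp_all

lemma rr_add: "rr (m + n) = rr m * sc Ith n + rr n"
  using sc_add[of Ith m n]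
  by (simp add: rr_def sc_def add_divide_distrib diff_divide_distrib algebra_simps)

lemma rr_zero [simp]: "rr 0 = 0"
  by (simp add: rr_def)

lemma rr_one: "rr 1 = rp" and rr_minus_one: "rr (-1) = rm"
proof -
  have *: "1 - Q^4 = (1 + Q^2) * (1 - Q^2)" by (simp add: algebra_simps power_add[symmetric])
  show "rr 1 = rp" "rr (-1) = rm"
    using Q4_neq(2) one_plus_q2[of q] unfolding rr_def *
    by (simp_all add: power_int_minus divide_simps) (simp_all add: algebra_simps)?
qed

lemma dd_Ith_gen: "dd Ith (suq_gen q g) = rr (wt g) \<odot> suq_gen q g"
  by (cases g) (simp_all add: rr_one rr_minus_one)

lemma dd_Ith_weight: "x \<in> weight_space q n \<Longrightarrow> dd Ith x = rr n \<odot> x"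
proof (induction rule: weight_induct)
  case (add n x y)
  then show ?case by (simp add: weight_spaceD dd_add smult_r_distr)
next
  case (smult n c x)
  then show ?case by (simp add: weight_spaceD dd_smult smult_assoc[symmetric] mult.commute)
next
  case (mult n g x)
  then show ?case
    by (simp add: weight_spaceD dd_mult dd_Ith_gen sig_weight rr_add smult_assoc[symmetric] smult_l_distr mult.commute)
qed simp_all

lemma weight_gen': "al \<in> weight_space q 1" "al' \<in> weight_space q (-1)" "ga \<in> weight_space q 1" "ga' \<in> weight_space q (-1)"
  using weight_gen[of GenAlpha] weight_gen[of GenAlphaStar] weight_gen[of GenGamma] weight_gen[of GenGammaStar] by simp_all

lemma dd_weight_gen: "dd Imi (suq_gen q g) \<in> weight_space q (wt g + 2)" "dd Ipl (suq_gen q g) \<in> weight_space q (wt g - 2)"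
  by (cases g; simp add: weight_zero weight_gen' weight_smult)+

lemma dd_weight: "x \<in> weight_space q n \<Longrightarrow> dd Imi x \<in> weight_space q (n + 2) \<and> dd Ipl x \<in> weight_space q (n - 2)"
proof (induction rule: weight_induct)
  case (add n x y)
  then show ?case by (simp add: weight_spaceD dd_add weight_add)
next
  case (smult n c x)
  then show ?case by (simp add: weight_spaceD dd_smult weight_smult)
next
  case (mult n g x)
  have "dd Imi (suq_gen q g) \<otimes> (c \<odot> x) \<in> weight_space q ((wt g + 2) + n)" "suq_gen q g \<otimes> dd Imi x \<in> weight_space q (wt g + (n + 2))"
    "dd Ipl (suq_gen q g) \<otimes> (c \<odot> x) \<in> weight_space q ((wt g - 2) + n)" "suq_gen q g \<otimes> dd Ipl x \<in> weight_space q (wt g + (n - 2))" for c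
    by (intro weight_mult dd_weight_gen weight_gen weight_smult conjunct1[OF mult(2)] conjunct2[OF mult(2)] mult(1))+
  then show ?case using mult
    by (simp add: weight_spaceD dd_mult sig_weight weight_add algebra_simps del: smult_mult_right)
qed (simp_all add: weight_zero)

lemma star_weight: "x \<in> weight_space q n \<Longrightarrow> suq_star x \<in> weight_space q (- n)"
proof (induction rule: weight_induct)
  case (add n x y)
  then show ?case by (simp add: weight_spaceD star_add weight_add)
next
  case (smult n c x)
  then show ?case by (simp add: weight_spaceD star_smult weight_smult)
next
  case (mult n g x)
  have "suq_gen q (gen_star g) \<in> weight_space q (- wt g)"
    using weight_gen[of "gen_star g"] by (cases g) simp_all
  from weight_mult[OF mult(2) this] show ?case using mult(1)
    by (simp add: weight_spaceD star_mult algebra_simps)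
qed (simp_all add: weight_zero weight_one)

lemma weight_commute_dd:
  assumes "x \<in> weight_space q n"
  shows "sig i (dd Imi x) = sc i (n + 2) \<odot> dd Imi x" "sig i (dd Ipl x) = sc i (n - 2) \<odot> dd Ipl x"
  using assms dd_weight sig_weight by blast+

text \<open>The star reverses products and thus exchanges the twisted with the untwisted factor in
  the Leibniz rule; on weight vectors the twist is a scalar, whose powers accumulate to the stated
  one. At weight 2, the case used for the Laplacian, it is 1.\<close>

lemma star_dd: "x \<in> weight_space q n \<Longrightarrow> suq_star (dd Ipl x) = Q powi (2 - n) \<odot> dd Imi (suq_star x)"
proof (induction rule: weight_induct)
  case (add n x y)
  then show ?case by (simp add: weight_spaceD dd_add star_add smult_r_distr)
next
  case (smult n c x)
  then show ?case by (simp add: weight_spaceD dd_smult star_smult smult_assoc[symmetric] mult.commute)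
next
  case (mult n g x)
  note [simp] = weight_spaceD(1)[OF mult(1)]
  have g: "suq_star (dd Ipl (suq_gen q g)) = Q powi (2 - wt g) \<odot> dd Imi (suq_gen q (gen_star g))"
    by (cases g) (simp_all add: star_smult smult_assoc[symmetric] power2_eq_square)
  have gs: "sig Imi (suq_gen q (gen_star g)) = Q powi (wt g) \<odot> suq_gen q (gen_star g)"
    by (cases g) (simp_all add: power_int_minus field_simps)
  have "sc Ipl n = Q powi (- n)" by (simp add: sc_def)
  moreover have "cnj (Q powi (- n)) = Q powi (- n)" by (simp add: power_int_def)
  moreover have "Q powi (- n) * Q powi (2 - wt g) = Q powi (2 - (wt g + n))"
    "Q powi (2 - (wt g + n)) * Q powi (wt g) = Q powi (2 - n)" by (simp_all add: algebra_simps flip: power_int_add)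
  ultimately show ?case
    using mult by (simp add: dd_mult star_add star_mult star_smult g gs sig_weight smult_r_distr
        smult_assoc[symmetric] a_comm)
qed simp_all

text \<open>The deformed commutator of the quantum tangent space, with \<open>rr n\<close> standing
  for \<open>dd Ith\<close>. On weight vectors all automorphisms \<open>sig i\<close> are scalars,
  so the inductive step is scalar arithmetic. For n = 0 the last term disappears and the two second
  order operators become proportional.\<close>

lemma dd_commutator_weight:
  "x \<in> weight_space q n \<Longrightarrow> dd Imi (dd Ipl x) = Q^2 \<odot> dd Ipl (dd Imi x) \<oplus> ((1 + Q^2) * rr n) \<odot> x"
proof (induction rule: weight_induct)
  case (add n x y)
  note xy = weight_spaceD(1)[OF add(1)] weight_spaceD(1)[OF add(2)]
  show ?case
    by (rule eq_by_functionals) (use add(3,4) xy in \<open>simp_all add: dd_add smult_r_distr fnl algebra_simps\<close>)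
next
  case (smult n c x)
  note x = weight_spaceD(1)[OF smult(1)]
  show ?case
    by (rule eq_by_functionals) (use smult(2) x in \<open>simp_all add: dd_smult smult_r_distr smult_assoc[symmetric] fnl algebra_simps\<close>)
next
  case (mult n g x)
  note x = weight_spaceD(1)[OF mult(1)]
  let ?g = "suq_gen q g"
  have s1: "sc Ipl (n + 2) = sc Ipl n * (1 / Q^2)" "sc Imi (n - 2) = sc Ipl n * Q^2" "sc Imi n = sc Ipl n"
    "sc Imi (n + 2) = sc Ipl n * (1 / Q^2)" "sc Ipl (n - 2) = sc Ipl n * Q^2"
    by (simp_all add: sc_def power_int_add power_int_diff power_int_minus field_simps)
  have gg: "dd Imi (dd Ipl ?g) = Q^2 \<odot> dd Ipl (dd Imi ?g) \<oplus> ((1 + Q^2) * rr (wt g)) \<odot> ?g"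
    by (cases g; rule eq_by_functionals; simp add: dd_smult fnl rr_one rr_minus_one nf; (simp add: field_simps)?)
  have rr: "rr (wt g + n) = rr (wt g) * sc Ipl n * sc Ipl n + rr n"
    using rr_add[of "wt g" n] by (simp add: sc_def flip: power_int_add)
  show ?case
    by (rule eq_by_functionals; (insert x mult(2), simp add: dd_add dd_smult dd_mult sig_smult sig_add sig_mult sig_weight[OF mult(1)]
        weight_commute_dd[OF mult(1)] s1 fnl gg rr l_distr r_distr smult_r_distr smult_assoc[symmetric]); (simp add: field_simps)?)
qed simp_all

end

subsection \<open>Monomials\<close>

definition spanned :: "'v calg \<Rightarrow> ('i \<Rightarrow> 'v) \<Rightarrow> 'i set \<Rightarrow> 'v set" where
  "spanned V v I = lext V v ` {f. Poly_Mapping.keys f \<subseteq> I}"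

context cspace
begin

lemma spanned_zero: "\<zero> \<in> spanned V v I"
  unfolding spanned_def by (rule image_eqI[of _ _ 0]) simp_all

lemma spanned_base: "i \<in> I \<Longrightarrow> v i \<in> carrier V \<Longrightarrow> v i \<in> spanned V v I"
  unfolding spanned_def by (rule image_eqI[of _ _ "Poly_Mapping.single i 1"]) simp_all

lemma spanned_add:
  assumes "v \<in> I \<rightarrow> carrier V" "x \<in> spanned V v I" "y \<in> spanned V v I" shows "x \<oplus> y \<in> spanned V v I"
proof -
  obtain f g where fg: "x = lext V v f" "y = lext V v g" "Poly_Mapping.keys f \<subseteq> I" "Poly_Mapping.keys g \<subseteq> I"
    using assms(2,3) by (auto simp: spanned_def)
  then have "x \<oplus> y = lext V v (f + g)" using lext_add[OF _ _ assms(1)] by simp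
  moreover have "Poly_Mapping.keys (f + g) \<subseteq> I" using fg(3,4) by (rule order_trans[OF keys_add Un_least])
  ultimately show ?thesis by (auto simp: spanned_def)
qed

lemma spanned_smult:
  assumes "v \<in> I \<rightarrow> carrier V" "x \<in> spanned V v I" shows "c \<odot> x \<in> spanned V v I"
proof -
  obtain f where f: "x = lext V v f" "Poly_Mapping.keys f \<subseteq> I"
    using assms(2) by (auto simp: spanned_def)
  then have "c \<odot> x = lext V v (pm_scale c f)" using lext_scale[OF _ assms(1)] by simp
  moreover have "Poly_Mapping.keys (pm_scale c f) \<subseteq> I" using f(2) by (rule order_trans[OF keys_pm_scale])
  ultimately show ?thesis by (auto simp: spanned_def)
qed

lemma spanned_finsum:
  assumes "v \<in> I \<rightarrow> carrier V" "finite A" "\<And>a. a \<in> A \<Longrightarrow> x a \<in> spanned V v I" "\<And>a. a \<in> A \<Longrightarrow> x a \<in> carrier V"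
  shows "(\<Oplus>a\<in>A. x a) \<in> spanned V v I"
  using assms(2-4) by (induction A rule: finite_induct) (auto simp: spanned_zero finsum_insert Pi_iff intro: spanned_add[OF assms(1)])

lemma spanned_induct [consumes 2, case_names zero add_smult]:
  assumes "x \<in> spanned V v I" "v \<in> I \<rightarrow> carrier V" "S \<zero>"
    and "\<And>i c x. \<lbrakk>i \<in> I; x \<in> carrier V; S x\<rbrakk> \<Longrightarrow> S (c \<odot> v i \<oplus> x)"
  shows "S x"
proof -
  obtain f where f: "x = lext V v f" "Poly_Mapping.keys f \<subseteq> I"
    using assms(1) by (auto simp: spanned_def)
  from f(2) have "S (lext V v f)"
  proof (induction f rule: pm_induct)
    case (single_add i c f)
    have "Poly_Mapping.keys (Poly_Mapping.single i c) \<subseteq> I" using single_add(1) by simp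
    then have "lext V v (Poly_Mapping.single i c + f) = c \<odot> v i \<oplus> lext V v f"
      using single_add(1,2) assms(2) by (subst lext_add[OF _ single_add(2) assms(2)]) (auto simp: lext_single[where \<phi>=v] Pi_iff)
    then show ?case using single_add assms(4) lext_closed[OF single_add(2) assms(2)] by simp
  qed (simp add: assms(3))
  then show ?thesis by (simp add: f(1))
qed

end

subsection \<open>The regular representation in the monomial basis\<close>

text \<open>Linear endomorphisms of the space of all functions on the index set. Without a
  finiteness condition on the functions, membership in the carrier is linearity alone.\<close>

definition end_alg :: "(('i \<Rightarrow> complex) \<Rightarrow> ('i \<Rightarrow> complex)) calg" where
  "end_alg = \<lparr>carrier = {F. (\<forall>f g. F (\<lambda>i. f i + g i) = (\<lambda>i. F f i + F g i)) \<and> (\<forall>c f. F (\<lambda>i. c * f i) = (\<lambda>i. c * F f i))},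
     mult = (\<lambda>F G f. F (G f)), one = (\<lambda>f. f), zero = (\<lambda>f i. 0), add = (\<lambda>F G f i. F f i + G f i),
     smult = (\<lambda>c F f i. c * F f i)\<rparr>"

lemma end_alg_simps [simp]:
  "F \<otimes>\<^bsub>end_alg\<^esub> G = (\<lambda>f. F (G f))" "\<one>\<^bsub>end_alg\<^esub> = (\<lambda>f. f)" "\<zero>\<^bsub>end_alg\<^esub> = (\<lambda>f i. 0)"
  "F \<oplus>\<^bsub>end_alg\<^esub> G = (\<lambda>f i. F f i + G f i)" "c \<odot>\<^bsub>end_alg\<^esub> F = (\<lambda>f i. c * F f i)"
  by (simp_all add: end_alg_def)

lemma end_alg_carrier: "F \<in> carrier end_alg \<longleftrightarrow>
  (\<forall>f g. F (\<lambda>i. f i + g i) = (\<lambda>i. F f i + F g i)) \<and> (\<forall>c f. F (\<lambda>i. c * f i) = (\<lambda>i. c * F f i))"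
  by (simp add: end_alg_def)

lemma end_alg_zero_arg: "F \<in> carrier end_alg \<Longrightarrow> F (\<lambda>i. 0) = (\<lambda>i. 0)"
proof -
  assume "F \<in> carrier end_alg"
  then have "F (\<lambda>i. c * f i) = (\<lambda>i. c * F f i)" for c f by (simp add: end_alg_carrier)
  from this[of 0 "\<lambda>i. 0"] show ?thesis by simp
qed

lemma calgebra_end_alg: "calgebra end_alg"
  by (rule calgebraI, rule cspaceI) (auto simp: end_alg_carrier algebra_simps)

type_synonym lat = "int \<times> int \<times> int"

fun rho_gen :: "complex \<Rightarrow> gen \<Rightarrow> (lat \<Rightarrow> complex) \<Rightarrow> (lat \<Rightarrow> complex)" where
  "rho_gen r GenAlpha f = (\<lambda>(t, k, l). f (t - 1, k, l) + (if t \<le> 0 then r powi (2 - 2 * t) * f (t - 1, k - 1, l - 1) else 0))"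
| "rho_gen r GenAlphaStar f = (\<lambda>(t, k, l). f (t + 1, k, l) + (if t \<ge> 0 then r powi (- 2 * t) * f (t + 1, k - 1, l - 1) else 0))"
| "rho_gen r GenGamma f = (\<lambda>(t, k, l). r powi (- t) * f (t, k - 1, l))"
| "rho_gen r GenGammaStar f = (\<lambda>(t, k, l). r powi (- t) * f (t, k, l - 1))"

definition ebasis :: "lat \<Rightarrow> lat \<Rightarrow> complex" where
  "ebasis i = (\<lambda>j. if j = i then 1 else 0)"

lemma rho_gen_closed: "rho_gen r g \<in> carrier end_alg"
  by (cases g) (auto simp: end_alg_carrier algebra_simps fun_eq_iff)

context quantum_su
begin

lemma rho_point: "suq_point q end_alg (rho_gen Q)"
proof -
  have pw: "Q powi (a + b) = Q powi a * Q powi b" "Q powi (a - b) = Q powi a / Q powi b" "Q powi (- a) = 1 / Q powi a" for a b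
    by (simp_all add: power_int_add power_int_diff power_int_minus field_simps)
  have nz: "Q powi a \<noteq> 0" for a by simp
  have sq: "Q powi (2 * t) = Q powi t * Q powi t" "Q powi (t * 2) = Q powi t * Q powi t" for t
    by (simp_all add: mult.commute flip: power_int_add)
  have *: "range (rho_gen Q) \<subseteq> carrier end_alg" using rho_gen_closed by auto
  show ?thesis
    unfolding suq_point_def Let_def end_alg_simps
    by (intro conjI; (rule * | (rule ext)+))
      (auto simp: pw sq field_simps power2_eq_square)
qed

definition rho :: "suq \<Rightarrow> (lat \<Rightarrow> complex) \<Rightarrow> (lat \<Rightarrow> complex)" where
  "rho = descend (free_eval end_alg (rho_gen Q))"

lemmas rho_hom = suq_hom[OF calgebra_end_alg rho_point, folded rho_def, simplified SUq_P]

lemma rho_simps: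
  "x \<in> carrier P \<Longrightarrow> rho x \<in> carrier end_alg"
  "x \<in> carrier P \<Longrightarrow> y \<in> carrier P \<Longrightarrow> rho (x \<oplus> y) = (\<lambda>f i. rho x f i + rho y f i)"
  "x \<in> carrier P \<Longrightarrow> rho (c \<odot> x) = (\<lambda>f i. c * rho x f i)"
  "x \<in> carrier P \<Longrightarrow> y \<in> carrier P \<Longrightarrow> rho (x \<otimes> y) = (\<lambda>f. rho x (rho y f))"
  "rho \<one> = (\<lambda>f. f)" "rho (suq_gen q g) = rho_gen Q g"
  using lin_closed[OF alghom_lin[OF rho_hom(1)]] lin_add[OF alghom_lin[OF rho_hom(1)]] lin_smult[OF alghom_lin[OF rho_hom(1)]]
    alghom_mult[OF rho_hom(1)] alghom_one[OF rho_hom(1)] rho_hom(2) by simp_all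

abbreviation "M \<equiv> monomial q"

lemma alpha_pow_nat: "alpha_pow q (int n) = al [^] n" "alpha_pow q (- int n) = al' [^] n"
  by (auto simp: alpha_pow_def simp del: pow_nat)

lemma alpha_pow_closed [simp]: "alpha_pow q t \<in> carrier P"
  by (cases t rule: int_cases2) (simp_all add: alpha_pow_nat)

lemma M_eq: "M t k l = alpha_pow q t \<otimes> (ga [^] k \<otimes> ga' [^] l)"
  by (simp add: monomial_def m_assoc)

lemma M_closed [simp, intro]: "M t k l \<in> carrier P"
  by (simp add: M_eq)

lemma alpha_pow_0 [simp]: "alpha_pow q 0 = \<one>"
  using alpha_pow_nat(1)[of 0] by simp

lemma alpha_pow_up: "t \<ge> 0 \<Longrightarrow> alpha_pow q (t + 1) = al \<otimes> alpha_pow q t"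
proof -
  assume "t \<ge> 0"
  then obtain n where t: "t = int n" using nonneg_int_cases by blast
  then have "t + 1 = int (Suc n)" by simp
  then show ?thesis unfolding t alpha_pow_nat by (simp only: alpha_pow_nat nat_pow_Suc2 gen_closed)
qed

lemma alpha_pow_down: "t \<le> 0 \<Longrightarrow> alpha_pow q (t - 1) = al' \<otimes> alpha_pow q t"
proof -
  assume "t \<le> 0"
  then obtain n where t: "t = - int n" using nonpos_int_cases by blast
  then have "t - 1 = - int (Suc n)" by simp
  then show ?thesis unfolding t alpha_pow_nat by (simp only: alpha_pow_nat nat_pow_Suc2 gen_closed)
qed

lemma skew_pow:
  assumes "x \<in> carrier P" "y \<in> carrier P" "x \<otimes> y = c \<odot> (y \<otimes> x)"
  shows "x \<otimes> y [^] (n::nat) = c ^ n \<odot> (y [^] n \<otimes> x)"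
proof (induction n)
  case (Suc n)
  have "x \<otimes> y [^] Suc n = (x \<otimes> y [^] n) \<otimes> y" using assms by (simp add: m_assoc)
  also have "\<dots> = c ^ Suc n \<odot> (y [^] Suc n \<otimes> x)"
    using assms by (simp add: Suc m_assoc smult_assoc[symmetric] mult.commute)
  finally show ?case .
qed (use assms in simp)

lemma ga_alpha_pow: "ga \<otimes> alpha_pow q t = Q powi (- t) \<odot> (alpha_pow q t \<otimes> ga)"
  "ga' \<otimes> alpha_pow q t = Q powi (- t) \<odot> (alpha_pow q t \<otimes> ga')"
  by (cases t rule: int_cases2; simp add: alpha_pow_nat skew_pow[OF _ _ order_rels(4)] skew_pow[OF _ _ order_rels(5)]
      skew_pow[OF _ _ order_rels(6)] skew_pow[OF _ _ order_rels(7)] power_int_minus power_one_over field_simps)+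

lemma ga_M: "ga \<otimes> M t k l = Q powi (- t) \<odot> M t (Suc k) l"
proof -
  have "ga \<otimes> M t k l = (ga \<otimes> alpha_pow q t) \<otimes> (ga [^] k \<otimes> ga' [^] l)" by (simp add: M_eq m_assoc)
  also have "\<dots> = Q powi (- t) \<odot> (alpha_pow q t \<otimes> ((ga \<otimes> ga [^] k) \<otimes> ga' [^] l))"
    by (simp add: ga_alpha_pow m_assoc)
  finally show ?thesis by (simp add: M_eq nat_pow_Suc2[symmetric])
qed

lemma ga'_M: "ga' \<otimes> M t k l = Q powi (- t) \<odot> M t k (Suc l)"
proof -
  have c: "ga' \<otimes> ga [^] k = ga [^] k \<otimes> ga'"
    using skew_pow[of ga' ga 1 k] order_rels(3) by simp
  have "ga' \<otimes> M t k l = (ga' \<otimes> alpha_pow q t) \<otimes> (ga [^] k \<otimes> ga' [^] l)" by (simp add: M_eq m_assoc)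
  also have "\<dots> = Q powi (- t) \<odot> (alpha_pow q t \<otimes> ((ga' \<otimes> ga [^] k) \<otimes> ga' [^] l))"
    by (simp add: ga_alpha_pow m_assoc)
  also have "(ga' \<otimes> ga [^] k) \<otimes> ga' [^] l = ga [^] k \<otimes> (ga' \<otimes> ga' [^] l)" unfolding c by (simp add: m_assoc)
  finally show ?thesis by (simp add: M_eq nat_pow_Suc2[symmetric])
qed

lemma al_M_up: "t \<ge> 0 \<Longrightarrow> al \<otimes> M t k l = M (t + 1) k l"
  by (simp add: M_eq alpha_pow_up m_assoc)

lemma al'_M_down: "t \<le> 0 \<Longrightarrow> al' \<otimes> M t k l = M (t - 1) k l"
  by (simp add: M_eq alpha_pow_down m_assoc)

text \<open>One factor \<open>al'\<close> is split off and met by \<open>al\<close>; the resulting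
  product of \<open>ga\<close> and \<open>ga'\<close> is then moved past the remaining power, and
  each of the two contributes a power of q.\<close>

lemma al_M_neg: "t < 0 \<Longrightarrow> al \<otimes> M t k l = M (t + 1) k l \<oplus> Q powi (- 2 * t) \<odot> M (t + 1) (Suc k) (Suc l)"
proof -
  assume t: "t < 0"
  have "al \<otimes> M t k l = al \<otimes> (al' \<otimes> M (t + 1) k l)" using t al'_M_down[of "t + 1" k l] by simp
  also have "\<dots> = M (t + 1) k l \<oplus> (Q^2 * (Q powi (- (t + 1)) * Q powi (- (t + 1)))) \<odot> M (t + 1) (Suc k) (Suc l)"
    by (simp add: order_rels_assoc ga_M ga'_M smult_assoc[symmetric])
  also have "Q^2 * (Q powi (- (t + 1)) * Q powi (- (t + 1))) = Q powi (- 2 * t)"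
  proof -
    have "Q^2 * (Q powi (- (t + 1)) * Q powi (- (t + 1))) = Q powi (2 + (- (t + 1) + - (t + 1)))"
      by (subst power_int_add, simp, subst power_int_add) simp_all
    then show ?thesis by (simp add: algebra_simps)
  qed
  finally show ?thesis .
qed

lemma al'_M_pos: "t > 0 \<Longrightarrow> al' \<otimes> M t k l = M (t - 1) k l \<oplus> Q powi (2 - 2 * t) \<odot> M (t - 1) (Suc k) (Suc l)"
proof -
  assume t: "t > 0"
  have "al' \<otimes> M t k l = al' \<otimes> (al \<otimes> M (t - 1) k l)" using t al_M_up[of "t - 1" k l] by simp
  also have "\<dots> = M (t - 1) k l \<oplus> (Q powi (- (t - 1)) * Q powi (- (t - 1))) \<odot> M (t - 1) (Suc k) (Suc l)"
    by (simp add: order_rels_assoc ga_M ga'_M smult_assoc[symmetric])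
  also have "Q powi (- (t - 1)) * Q powi (- (t - 1)) = Q powi (2 - 2 * t)"
    by (simp flip: power_int_add)
  finally show ?thesis .
qed

lemma M_weight: "M t k l \<in> weight_space q (t + int k - int l)"
proof -
  have p: "x [^] n \<in> weight_space q (int n * w)" if "x \<in> weight_space q w" for x w and n :: nat
    using that by (induction n) (auto simp: weight_one algebra_simps intro: weight_mult[of _ "int _ * w" _ w, simplified algebra_simps])
  have "alpha_pow q t \<in> weight_space q t"
    using p[OF weight_gen'(1)] p[OF weight_gen'(2)] by (cases t rule: int_cases2) (force simp: alpha_pow_nat)+
  from weight_mult[OF this weight_mult[OF p[OF weight_gen'(3), of k] p[OF weight_gen'(4), of l]]]
  show ?thesis by (simp add: M_eq algebra_simps)
qed

abbreviation "mnm \<equiv> \<lambda>(t, k, l). M t k l"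

lemma mnm_closed: "mnm \<in> I \<rightarrow> carrier P"
  by auto

lemma gen_M_spanned: "suq_gen q g \<otimes> M t k l \<in> spanned P mnm UNIV"
proof -
  have b: "c \<odot> M t k l \<in> spanned P mnm UNIV" "M t k l \<in> spanned P mnm UNIV" for c t k l
    using spanned_base[of "(t, k, l)" UNIV mnm] spanned_smult[OF mnm_closed, of "M t k l" UNIV c] by auto
  show ?thesis
    by (cases g; cases "t < 0"; cases "t > 0")
      (simp_all add: al_M_up al_M_neg al'_M_pos al'_M_down ga_M ga'_M b spanned_add[OF mnm_closed])
qed

text \<open>The span contains 1 and is stable under left multiplication by the generators.\<close>

lemma monomials_span: "p \<in> carrier P \<Longrightarrow> p \<in> spanned P mnm UNIV"
proof (induction rule: induct)
  case zero
  then show ?case by (rule spanned_zero)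
next
  case one
  then show ?case using spanned_base[of "(0, 0, 0)" UNIV mnm] by (simp add: M_eq)
next
  case (add x y)
  then show ?case by (simp add: spanned_add[OF mnm_closed])
next
  case (scale c x)
  then show ?case by (simp add: spanned_smult[OF mnm_closed])
next
  case (mult g x)
  from mult(2) mnm_closed show ?case
  proof (induction rule: spanned_induct)
    case zero
    then show ?case by (simp add: spanned_zero)
  next
    case (add_smult i c x)
    obtain t k l where "i = (t, k, l)" by (cases i)
    then show ?case using add_smult gen_M_spanned[of g t k l]
      by (simp add: r_distr spanned_add[OF mnm_closed] spanned_smult[OF mnm_closed])
  qed
qed

lemma hyperboloid_spanned: "b \<in> hyperboloid q \<Longrightarrow> b \<in> spanned P mnm triples"
proof -
  assume b: "b \<in> hyperboloid q"
  have "wproj 0 p \<in> spanned P mnm triples" if "p \<in> spanned P mnm UNIV" for p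
    using that mnm_closed
  proof (induction rule: spanned_induct)
    case zero
    then show ?case by (simp add: spanned_zero wproj_simps)
  next
    case (add_smult i c x)
    obtain t k l where i: "i = (t, k, l)" by (cases i)
    have "wproj 0 (M t k l) \<in> spanned P mnm triples"
      using wproj_weight[OF M_weight[of t k l], of 0] spanned_base[of "(t, k, l)" triples mnm]
      by (auto simp: spanned_zero triples_def)
    then show ?case using add_smult by (simp add: i wproj_simps spanned_add[OF mnm_closed] spanned_smult[OF mnm_closed])
  qed
  then have "wproj 0 b \<in> spanned P mnm triples" using b monomials_span by (simp add: hyperboloid_eq weight_spaceD)
  then show ?thesis using b wproj_weight[of b 0 0] by (simp add: hyperboloid_eq)
qed

section \<open>Coefficient functionals and independence of the monomials\<close>

definition coef :: "int \<times> nat \<times> nat \<Rightarrow> suq \<Rightarrow> complex" where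
  "coef = (\<lambda>(t, k, l) p. rho p (ebasis (0, 0, 0)) (t, int k, int l))"

lemma functional_coef: "functional P (coef i)"
  by (cases i) (unfold_locales; simp add: coef_def rho_simps)

lemma rho_pow_Suc: "rho (suq_gen q g [^] n \<otimes> suq_gen q g) f = rho_gen Q g (rho (suq_gen q g [^] (n::nat)) f)"
  unfolding nat_pow_Suc[symmetric] nat_pow_Suc2[OF gen_closed] by (simp add: rho_simps)

text \<open>The vector at the origin represents 1, so a monomial acts on it by producing its own
  lattice point. An element is therefore determined by its action on this single vector.\<close>

lemma rho_M: "rho (M t k l) (ebasis (0, 0, 0)) = ebasis (t, int k, int l)"
proof -
  have eb: "rho_gen Q GenGammaStar (ebasis (0, k, l)) = ebasis (0, k, 1 + l)"
    "rho_gen Q GenGamma (ebasis (0, k, l)) = ebasis (0, 1 + k, l)"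
    "rho_gen Q GenAlpha (ebasis (int n, k, l)) = ebasis (1 + int n, k, l)"
    "rho_gen Q GenAlphaStar (ebasis (- int n, k, l)) = ebasis (- 1 - int n, k, l)" for k l n
    by (auto simp: ebasis_def fun_eq_iff)
  have l: "rho (ga' [^] l) (ebasis (0, 0, 0)) = ebasis (0, 0, int l)"
    by (induction l) (simp_all add: rho_simps(5) rho_pow_Suc eb del: rho_gen.simps)
  have k: "rho (ga [^] k) (ebasis (0, 0, int l)) = ebasis (0, int k, int l)"
    by (induction k) (simp_all add: rho_simps(5) rho_pow_Suc eb del: rho_gen.simps)
  have a: "rho (al [^] n) (ebasis (0, k, l)) = ebasis (int n, k, l)" for n :: nat and k l
    by (induction n) (simp_all add: rho_simps(5) rho_pow_Suc eb del: rho_gen.simps)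
  have a': "rho (al' [^] n) (ebasis (0, k, l)) = ebasis (- int n, k, l)" for n :: nat and k l
    by (induction n) (simp_all add: rho_simps(5) rho_pow_Suc eb del: rho_gen.simps)
  have "rho (alpha_pow q t) (ebasis (0, k, l)) = ebasis (t, k, l)" for k l
    using a a' by (cases t rule: int_cases2) (simp_all add: alpha_pow_nat)
  then show ?thesis using l k by (simp add: M_eq rho_simps)
qed

lemma coef_M: "coef (t, k, l) (M t' k' l') = (if (t', k', l') = (t, k, l) then 1 else 0)"
  by (simp add: coef_def rho_M) (auto simp: ebasis_def)

lemma coef_faithful: "p \<in> carrier P \<Longrightarrow> (\<And>i. coef i p = 0) \<Longrightarrow> p = \<zero>"
proof -
  assume p: "p \<in> carrier P" and z: "\<And>i. coef i p = 0"
  obtain f where f: "p = lext P mnm f" using monomials_span[OF p] by (auto simp: spanned_def)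
  have "coef i p = Poly_Mapping.lookup f i" for i
  proof -
    interpret functional P "coef i" by (rule functional_coef)
    have "lin P (type_alg (*)) (coef i)" using functional_iff_lin[OF cspace_axioms] functional_coef by blast
    from lin_finsum[OF cspace_axioms calgebra.axioms(1)[OF calgebra_complex] this, of "Poly_Mapping.keys f" "\<lambda>x. Poly_Mapping.lookup f x \<odot> mnm x"]
    have "coef i p = (\<Sum>x\<in>Poly_Mapping.keys f. coef i (Poly_Mapping.lookup f x \<odot> mnm x))"
      using mnm_closed unfolding f lext_def
      by (simp add: finsum_type_alg[OF _ calgebra.axioms(1)[OF calgebra_complex]] case_prod_beta)
    also have "\<dots> = (\<Sum>x\<in>Poly_Mapping.keys f. if x = i then Poly_Mapping.lookup f x else 0)"
      by (rule sum.cong) (auto simp: case_prod_beta coef_M[of "fst i" "fst (snd i)" "snd (snd i)", simplified])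
    finally show ?thesis by (simp add: in_keys_iff)
  qed
  then have "f = 0" using z by (intro poly_mapping_eqI) simp
  then show ?thesis by (simp add: f)
qed

lemma rho_faithful: "p \<in> carrier P \<Longrightarrow> rho p = (\<lambda>f i. 0) \<Longrightarrow> p = \<zero>"
  by (rule coef_faithful) (auto simp: coef_def)

end

context quantum_su
begin

subsection \<open>The Laplacian on monomials\<close>

definition Qn :: "nat \<Rightarrow> complex" where
  "Qn n = complex_of_real (qint q (int n))"

lemma q2m1_neq [simp]: "q^2 - 1 \<noteq> 0" "Q^2 - 1 \<noteq> 0" "1 - q^2 \<noteq> 0"
  using q2_less_1 Q4_neq(2) by auto

lemma Q2_neq_1 [simp]: "Q^2 \<noteq> 1" "Q * Q \<noteq> 1"
  using q2m1_neq(2) by (auto simp: power2_eq_square simp del: q2m1_neq)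

lemma qint_nat: "qint q (int n) = (q ^ (2 * n) - 1) / (q^2 - 1)"
proof -
  have "q powi (2 * int n) = q powi (int (2 * n))" by simp
  also have "\<dots> = q ^ (2 * n)" by (rule power_int_of_nat)
  finally show ?thesis by (simp add: qint_def)
qed

lemma Qn_eq: "Qn n = (Q ^ (2 * n) - 1) / (Q^2 - 1)"
  by (simp add: Qn_def qint_nat)

lemma Qn_0 [simp]: "Qn 0 = 0"
  by (simp add: Qn_eq)

lemma Qn_Suc: "Qn (Suc n) = 1 + Q^2 * Qn n" and Qn_Suc': "Qn (Suc n) = Qn n + Q ^ (2 * n)"
  by (simp_all add: Qn_eq divide_simps) (simp_all add: algebra_simps power2_eq_square)

lemma pw: "Q powi (a + b) = Q powi a * Q powi b" "Q powi (a - b) = Q powi a / Q powi b"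
  "Q powi (- a) = 1 / Q powi a"
  by (simp_all add: power_int_add power_int_diff power_int_minus field_simps)

lemma pw_double: "Q powi (2 * int n) = Q ^ n * Q ^ n" "Q powi (int n * 2) = Q ^ n * Q ^ n"
proof -
  have e: "2 * int n = int n + int n" "int n * 2 = int n + int n" by simp_all
  show "Q powi (2 * int n) = Q ^ n * Q ^ n" "Q powi (int n * 2) = Q ^ n * Q ^ n"
    unfolding e pw by simp_all
qed

lemma sig_M: "sig i (M t k l) = sc i (t + int k - int l) \<odot> M t k l"
  by (rule sig_weight[OF M_weight])

lemma sc_pm: "sc Imi n = Q powi (- n)" "sc Ipl n = Q powi (- n)"
  by (simp_all add: sc_def)

lemma M_one: "M 0 0 0 = \<one>"
  by (simp add: M_eq)

lemma M_Suc_l: "M 0 k (Suc l) = ga' \<otimes> M 0 k l" and M_Suc_k: "M 0 (Suc k) l = ga \<otimes> M 0 k l"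
  by (simp_all add: ga_M ga'_M)

text \<open>\<open>dd Imi\<close> kills \<gamma>, so \<gamma> only passes through, while each
  adjoint of \<gamma> contributes one term and the powers of q add up to a q-integer. For l = 0 the
  truncated \<open>l - 1\<close> is harmless because \<open>Qn 0 = 0\<close>.\<close>

lemma dd_Imi_M0: "dd Imi (M 0 k l) = (Q powi (- int l - int k) * Qn l) \<odot> M 1 k (l - 1)"
proof (induction k)
  case 0
  show ?case
  proof (induction l)
    case (Suc l)
    have "dd Imi (M 0 0 (Suc l)) = (1 / Q * Q ^ l) \<odot> M 1 0 l \<oplus> (Q powi (- int l) * Qn l) \<odot> (ga' \<otimes> M 1 0 (l - 1))"
      using Suc by (simp add: M_Suc_l dd_mult sig_M sc_pm al_M_up smult_assoc[symmetric] power_int_minus mult.commute)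
    also have "\<dots> = (Q powi (- int (Suc l) - int 0) * Qn (Suc l)) \<odot> M 1 0 (Suc l - 1)"
      by (rule eq_by_functionals; cases l)
        (simp_all add: ga'_M fnl Qn_Suc' pw, simp_all add: field_simps power_mult power2_eq_square)
    finally show ?case .
  qed (simp add: M_one)
next
  case (Suc k)
  have "dd Imi (M 0 (Suc k) l) = (Q powi (- int l - int k) * Qn l) \<odot> (ga \<otimes> M 1 k (l - 1))"
    using Suc by (simp add: M_Suc_k dd_mult)
  also have "\<dots> = (Q powi (- int l - int (Suc k)) * Qn l) \<odot> M 1 (Suc k) (l - 1)"
    by (simp add: ga_M smult_assoc[symmetric] pw field_simps)
  finally show ?case .
qed

lemma dd_Imi_M_pos: "dd Imi (M (int n) k l) = (Q powi (- int l - int k) * Qn l) \<odot> M (int n + 1) k (l - 1)"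
proof (induction n)
  case (Suc n)
  have "M (int (Suc n)) k l = al \<otimes> M (int n) k l" by (simp add: al_M_up add.commute)
  then show ?case using Suc al_M_up[of "int n + 1" k "l - 1"] by (simp add: dd_mult add.commute)
qed (simp add: dd_Imi_M0)

text \<open>Here the leading factor is differentiated as well, since \<open>dd Imi al' = ga\<close>;
  this explains the additional term with a higher power of \<gamma>. For nonnegative t it is absent
  because \<open>dd Imi al\<close> vanishes.\<close>

lemma dd_Imi_M_neg: "dd Imi (M (- 1 - int n) k l) =
  (Q powi (int l - int k) * Qn (Suc n) + Q powi (- int l - int k) * Qn l) \<odot> M (- int n) (Suc k) l \<oplus>
  (Q powi (- int l - int k) * Qn l) \<odot> M (- int n) k (l - 1)"
proof (induction n)
  case 0
  have "M (-1) k l = al' \<otimes> M 0 k l" by (simp add: al'_M_down)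
  then have "dd Imi (M (-1) k l) = (Q powi (- (int k - int l))) \<odot> (ga \<otimes> M 0 k l) \<oplus>
      (Q powi (- int l - int k) * Qn l) \<odot> (al' \<otimes> M 1 k (l - 1))"
    by (simp add: dd_mult dd_Imi_M0 sig_M sc_pm)
  also have "\<dots> = (Q powi (int l - int k) * Qn (Suc 0) + Q powi (- int l - int k) * Qn l) \<odot> M 0 (Suc k) l \<oplus>
     (Q powi (- int l - int k) * Qn l) \<odot> M 0 k (l - 1)"
    by (rule eq_by_functionals; cases l)
      (simp_all add: ga_M al'_M_pos fnl Qn_Suc, simp_all add: algebra_simps)
  finally show ?case by simp
next
  case (Suc n)
  have "M (- 1 - int (Suc n)) k l = al' \<otimes> M (- 1 - int n) k l" by (simp add: al'_M_down algebra_simps)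
  then have "dd Imi (M (- 1 - int (Suc n)) k l) = (Q powi (- (- 1 - int n + int k - int l))) \<odot> (ga \<otimes> M (- 1 - int n) k l) \<oplus>
     al' \<otimes> dd Imi (M (- 1 - int n) k l)"
    by (simp add: dd_mult sig_M sc_pm)
  also have "\<dots> = (Q powi (int l - int k) * Qn (Suc (Suc n)) + Q powi (- int l - int k) * Qn l) \<odot> M (- int (Suc n)) (Suc k) l \<oplus>
     (Q powi (- int l - int k) * Qn l) \<odot> M (- int (Suc n)) k (l - 1)"
    unfolding Suc
    by (rule eq_by_functionals)
      (simp_all add: ga_M al'_M_down r_distr fnl Qn_Suc'[of "Suc n"] pw minus_diff_commute[of "int n" 1] diff_diff_eq add.commute,
       simp_all add: field_simps power_mult power2_eq_square)
  finally show ?case .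
qed

lemma dd_Ipl_M0: "dd Ipl (M 0 k l) = (Q powi (1 - int k + int l) * Qn k) \<odot> M (-1) (k - 1) l"
proof (induction k)
  case 0
  show ?case by (induction l) (simp_all add: M_one M_Suc_l dd_mult)
next
  case (Suc k)
  have "dd Ipl (M 0 (Suc k) l) = (Q powi (- (int k - int l))) \<odot> (al' \<otimes> M 0 k l) \<oplus>
      (Q powi (1 - int k + int l) * Qn k) \<odot> (ga \<otimes> M (-1) (k - 1) l)"
    using Suc by (simp add: M_Suc_k dd_mult sig_M sc_pm)
  also have "\<dots> = (Q powi (1 - int (Suc k) + int l) * Qn (Suc k)) \<odot> M (-1) (Suc k - 1) l"
    by (rule eq_by_functionals; cases k)
      (simp_all add: ga_M al'_M_down fnl Qn_Suc pw, simp_all add: field_simps power2_eq_square)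
  finally show ?case .
qed

lemma dd_Ipl_M_neg: "dd Ipl (M (- int n) k l) = (Q powi (1 - int k + int l) * Qn k) \<odot> M (- int n - 1) (k - 1) l"
proof (induction n)
  case (Suc n)
  have e: "- int (Suc n) = - int n - 1" by simp
  have "M (- int (Suc n)) k l = al' \<otimes> M (- int n) k l" unfolding e by (simp add: al'_M_down)
  then show ?case using Suc al'_M_down[of "- int n - 1" "k - 1" l] by (simp add: dd_mult algebra_simps)
qed (simp add: dd_Ipl_M0)

text \<open>The mirror image of \<open>dd_Imi_M_neg\<close>: now the positive powers of \<alpha> are
  differentiated, through \<open>dd Ipl al = Q ga'\<close>, and those of its adjoint are
  not.\<close>

lemma dd_Ipl_M_pos: "dd Ipl (M (int n + 1) k l) =
  (Q powi (1 - 2 * int n - int k + int l) * (Qn (Suc n) + Q ^ (2 * n + 2) * Qn k)) \<odot> M (int n) k (Suc l) \<oplus>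
  (Q powi (1 - int k + int l) * Qn k) \<odot> M (int n) (k - 1) l"
proof (induction n)
  case 0
  have "M 1 k l = al \<otimes> M 0 k l" by (simp add: al_M_up)
  then have "dd Ipl (M 1 k l) = (Q * Q powi (- (int k - int l))) \<odot> (ga' \<otimes> M 0 k l) \<oplus>
      (Q powi (1 - int k + int l) * Qn k) \<odot> (al \<otimes> M (-1) (k - 1) l)"
    by (simp add: dd_mult dd_Ipl_M0 sig_M sc_pm smult_assoc[symmetric] mult.commute)
  also have "\<dots> = (Q powi (1 - int k + int l) * (Qn (Suc 0) + Q ^ 2 * Qn k)) \<odot> M 0 k (Suc l) \<oplus>
    (Q powi (1 - int k + int l) * Qn k) \<odot> M 0 (k - 1) l"
    by (rule eq_by_functionals; cases k)
      (simp_all add: ga'_M al_M_neg fnl Qn_Suc pw, simp_all add: field_simps power2_eq_square)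
  finally show ?case by (simp add: power2_eq_square)
next
  case (Suc n)
  have "M (int (Suc n) + 1) k l = al \<otimes> M (int n + 1) k l" by (simp add: al_M_up algebra_simps)
  then have "dd Ipl (M (int (Suc n) + 1) k l) = (Q * Q powi (- (int n + 1 + int k - int l))) \<odot> (ga' \<otimes> M (int n + 1) k l) \<oplus>
     al \<otimes> dd Ipl (M (int n + 1) k l)"
    by (simp add: dd_mult sig_M sc_pm smult_assoc[symmetric] mult.commute)
  also have "\<dots> = (Q powi (1 - 2 * int (Suc n) - int k + int l) * (Qn (Suc (Suc n)) + Q ^ (2 * Suc n + 2) * Qn k)) \<odot> M (int (Suc n)) k (Suc l) \<oplus>
     (Q powi (1 - int k + int l) * Qn k) \<odot> M (int (Suc n)) (k - 1) l"
  proof -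
    have "Q powi (1 - 2 * int (Suc n) - int k + int l) = Q * Q powi (- (int n + 1 + int k - int l)) * Q powi (- (int n + 1))"
      "Q powi (1 - 2 * int n - int k + int l) = Q * Q powi (- (int n + 1 + int k - int l)) * Q powi (- (int n + 1)) * Q^2"
      by (simp_all add: pw pw_double field_simps power2_eq_square)
    note e = this
    show ?thesis unfolding Suc e
      by (rule eq_by_functionals)
        (simp_all add: ga'_M al_M_up r_distr fnl Qn_Suc[of "Suc n"] add.commute[of 1], simp_all add: algebra_simps power2_eq_square)
  qed
  finally show ?case .
qed

text \<open>The Laplacian in closed form. It makes sense on all of \<open>P\<close>; on the
  hyperboloid \<open>square_q_lap\<close> identifies it with \<open>square_q\<close>.\<close>

definition lap :: "suq \<Rightarrow> suq" where
  "lap b = (- (1 + Q^4)) \<odot> dd Ipl (dd Imi b)"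

definition eigval :: "nat \<Rightarrow> complex" where
  "eigval n = - (1 + Q^4) * Q powi (- 2 * int n) * Qn n * Qn (Suc n)"

text \<open>Under \<open>t + k - l = 0\<close> the exponents of q in all three formulas for
  \<open>c\<close> reduce to \<open>-2 k\<close>.\<close>

definition lower_coeff :: "nat \<Rightarrow> nat \<Rightarrow> complex" where
  "lower_coeff k l = - (1 + Q^4) * Q powi (- 2 * int k) * Qn k * Qn l"

lemma Qn_add: "Qn (m + n) = Qn m + Q ^ (2 * m) * Qn n"
  by (simp add: Qn_eq power_add divide_simps) (simp add: algebra_simps)

lemma lap_M_pos: "lap (M (int n) k (n + k)) = eigval (n + k) \<odot> M (int n) k (n + k) \<oplus> lower_coeff k (n + k) \<odot> M (int n) (k - 1) (n + k - 1)"
proof (cases "n + k")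
  case 0
  then show ?thesis by (simp add: lap_def dd_Imi_M0[of 0 0] eigval_def lower_coeff_def)
next
  case (Suc m)
  \<comment> \<open>The addition rule for q-integers merges the two summands of
    \<open>dd_Ipl_M_pos\<close> into one, since \<open>n + 1 + k = m + 2\<close>.\<close>
  have s: "Qn (Suc n) + Q ^ (2 * n + 2) * Qn k = Qn (Suc (Suc m))"
    using Qn_add[of "Suc n" k] Suc by (simp add: mult.commute)
  have n: "int n = int m + 1 - int k" using Suc by simp
  have "lap (M (int n) k (n + k)) = (- (1 + Q^4) * (Q powi (- int (Suc m) - int k) * Qn (Suc m))) \<odot>
     ((Q powi (1 - 2 * int n - int k + int m) * Qn (Suc (Suc m))) \<odot> M (int n) k (Suc m) \<oplus>
      (Q powi (1 - int k + int m) * Qn k) \<odot> M (int n) (k - 1) m)"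
    using dd_Ipl_M_pos[of n k m] unfolding s
    by (simp add: lap_def dd_Imi_M_pos Suc dd_smult smult_assoc[symmetric])
  moreover have "Q powi (- int (Suc m) - int k) * Q powi (1 - 2 * int n - int k + int m) = Q powi (- 2 * int (Suc m))"
    "Q powi (- int (Suc m) - int k) * Q powi (1 - int k + int m) = Q powi (- 2 * int k)"
    by (simp_all add: n algebra_simps flip: power_int_add)
  ultimately show ?thesis
    unfolding Suc by (intro eq_by_functionals) (simp_all add: fnl eigval_def lower_coeff_def algebra_simps)
qed

lemma lap_M_neg: "lap (M (- 1 - int n) (Suc n + l) l) =
  eigval (Suc n + l) \<odot> M (- 1 - int n) (Suc n + l) l \<oplus> lower_coeff (Suc n + l) l \<odot> M (- 1 - int n) (n + l) (l - 1)"
proof -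
  let ?k = "Suc n + l"
  \<comment> \<open>Again two summands merge into one q-integer, because the exponent of \<gamma> is
    \<open>l + (n + 1)\<close>.\<close>
  have s: "Q powi (int l - int ?k) * Qn (Suc n) + Q powi (- int l - int ?k) * Qn l = Q powi (- int l - int ?k) * Qn ?k"
  proof -
    have "Q powi (int l - int ?k) = Q powi (- int l - int ?k) * Q powi (2 * int l)"
      by (simp flip: power_int_add)
    then have e: "Q powi (int l - int ?k) = Q powi (- int l - int ?k) * Q ^ (2 * l)"
      unfolding pw_double by (simp only: mult_2 power_add)
    have k: "Qn ?k = Qn l + Q ^ (2 * l) * Qn (Suc n)"
      using Qn_add[of l "Suc n"] by (simp add: add.commute)
    show ?thesis unfolding e k by (simp only: distrib_left mult_ac add_ac)
  qed
  have m: "- 1 - int n = - int n - 1" by simp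
  have "lap (M (- 1 - int n) ?k l) = (- (1 + Q^4)) \<odot>
     ((Q powi (- int l - int ?k) * Qn ?k) \<odot> ((Q powi (1 - int (Suc ?k) + int l) * Qn (Suc ?k)) \<odot> M (- 1 - int n) ?k l) \<oplus>
      (Q powi (- int l - int ?k) * Qn l) \<odot> ((Q powi (1 - int ?k + int (l - 1)) * Qn ?k) \<odot> M (- 1 - int n) (n + l) (l - 1)))"
    unfolding lap_def dd_Imi_M_neg s using dd_Ipl_M_neg[of n "Suc ?k" l] dd_Ipl_M_neg[of n ?k "l - 1"]
    by (simp add: dd_add dd_smult m)
  moreover define A B where "A = Q powi (- int l - int ?k)" and "B = Q powi (1 - int (Suc ?k) + int l)"
  moreover have "Q powi (- 2 * int ?k) = A * B"
    unfolding A_def B_def by (simp add: algebra_simps flip: power_int_add)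
  \<comment> \<open>For l = 0 the two powers of q differ because the subtraction is truncated; the
    factor \<open>Qn 0 = 0\<close> hides this.\<close>
  moreover have "Qn l * (Q powi (1 - int ?k + int (l - 1)) * x) = Qn l * (B * x)" for x
    unfolding B_def by (cases l) (simp_all add: algebra_simps)
  ultimately have "lap (M (- 1 - int n) ?k l) = (- (1 + Q^4)) \<odot> ((A * Qn ?k) \<odot> ((B * Qn (Suc ?k)) \<odot> M (- 1 - int n) ?k l) \<oplus>
      (A * (Qn l * B) * Qn ?k) \<odot> M (- 1 - int n) (n + l) (l - 1))"
    "Q powi (- 2 * int ?k) = A * B"
    by (simp_all only: smult_assoc[symmetric] M_closed mult.assoc)
  then show ?thesis
    unfolding eigval_def lower_coeff_def by (intro eq_by_functionals) (simp_all add: fnl algebra_simps del: mult_minus_left)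
qed

lemma lap_M:
  assumes "(t, k, l) \<in> triples"
  shows "lap (M t k l) = eigval (max k l) \<odot> M t k l \<oplus> lower_coeff k l \<odot> M t (k - 1) (l - 1)"
proof (cases "t \<ge> 0")
  case True
  then obtain n where t: "t = int n" using nonneg_int_cases by blast
  then have l: "l = n + k" using assms by (simp add: triples_def)
  show ?thesis using lap_M_pos[of n k] by (simp add: t l max_absorb2)
next
  case False
  then obtain n where t: "t = - 1 - int n" by (metis int_cases minus_add_distrib minus_diff_eq of_nat_Suc uminus_add_conv_diff add.commute diff_minus_eq_add of_nat_0_le_iff)
  then have k: "k = Suc n + l" using assms by (simp add: triples_def)
  show ?thesis using lap_M_neg[of n l] by (simp add: t k max_absorb1)
qed

end

section \<open>The differential calculus\<close>

context quantum_su
begin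

subsection \<open>Invariant forms\<close>

abbreviation "K \<equiv> ker_counit q"

lemma K_simps [simp]:
  "carrier K = {a \<in> carrier P. counit q a = 0}" "mult K = mult P" "\<zero>\<^bsub>K\<^esub> = \<zero>" "add K = add P" "smult K = smult P"
  by (simp_all add: ker_counit_def)

interpretation counit: functional P "counit q" by (rule functional_counit)
interpretation chi: functional P "chi i" for i by (rule functional_rep)

lemma cspace_K: "cspace K"
  by (rule cspaceI) (auto simp: a_ac smult_l_distr smult_r_distr smult_assoc)

definition R3_gens :: "suq set" where
  "R3_gens = {ga \<otimes> ga, ga' \<otimes> ga', ga \<otimes> ga', al \<otimes> ga \<ominus> ga, al \<otimes> ga' \<ominus> ga', al' \<otimes> ga \<ominus> ga, al' \<otimes> ga' \<ominus> ga',
     (Q^2 \<odot> al \<oplus> al') \<ominus> (1 + Q^2) \<odot> \<one>}"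

lemma R3_eq: "R3 q = right_ideal P R3_gens"
  by (simp add: R3_def R3_gens_def Let_def)

lemma R3_gens_props: "x \<in> R3_gens \<Longrightarrow> x \<in> carrier P \<and> counit q x = 0 \<and> chi i x = 0"
proof -
  show "x \<in> R3_gens \<Longrightarrow> ?thesis"
    by (cases i) (auto simp: R3_gens_def chi_mult chi_gen phi_gen field_simps)
qed

text \<open>As the counit vanishes on x, \<open>chi i (x a)\<close> reduces to
  \<open>chi i x\<close> times \<open>phi i a\<close>, so the vanishing survives right
  multiplication. Hence \<open>chi i\<close> descends to the invariant forms.\<close>

lemma R3_props: "x \<in> R3 q \<Longrightarrow> x \<in> carrier P \<and> counit q x = 0 \<and> chi i x = 0"
proof -
  show "x \<in> R3 q \<Longrightarrow> ?thesis"
    unfolding R3_eq by (induction rule: right_ideal.induct) (use R3_gens_props[of _ i] in \<open>auto simp: chi_mult\<close>)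
qed

lemma R3_add: "x \<in> R3 q \<Longrightarrow> y \<in> R3 q \<Longrightarrow> x \<oplus> y \<in> R3 q"
  and R3_mult: "x \<in> R3 q \<Longrightarrow> a \<in> carrier P \<Longrightarrow> x \<otimes> a \<in> R3 q"
  and R3_zero: "\<zero> \<in> R3 q"
  and R3_gen: "x \<in> R3_gens \<Longrightarrow> x \<in> R3 q"
  unfolding R3_eq by (auto intro: right_ideal.intros)

lemma R3_smult: "x \<in> R3 q \<Longrightarrow> c \<odot> x \<in> R3 q"
  using R3_mult[of x "c \<odot> \<one>"] R3_props[of x] by simp

lemma quotient_K: "quotient_space K (R3 q)"
  by (intro quotient_space.intro cspace_K quotient_space_axioms.intro)
    (use R3_props R3_add R3_smult R3_zero in \<open>auto simp: lsubspace_def\<close>)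

sublocale KQ: quotient_space K "R3 q"
  by (rule quotient_K)

abbreviation "V \<equiv> inv_forms q"

lemma cspace_V: "cspace V"
  unfolding inv_forms_def by (rule KQ.cspace_quot)

lemma K_minus: "x \<in> carrier K \<Longrightarrow> y \<in> carrier K \<Longrightarrow> x \<ominus>\<^bsub>K\<^esub> y = x \<ominus> y"
  using KQ.minus_eq_smult[of y] by (simp add: a_minus_def minus_eq_smult)

definition aug :: "suq \<Rightarrow> suq" where "aug p = p \<ominus> counit q p \<odot> \<one>"

lemma aug_K: "p \<in> carrier P \<Longrightarrow> aug p \<in> carrier K"
  by (simp add: aug_def)

lemma qpi_eq: "qpi q p = R3 q +>\<^bsub>K\<^esub> aug p"
  by (simp add: qpi_def aug_def)

lemma qpi_lin: "lin P V (qpi q)"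
proof -
  have "lin P K aug"
  proof (rule linI)
    fix x y c assume [simp]: "x \<in> carrier P" "y \<in> carrier P"
    show "aug (x \<oplus> y) = aug x \<oplus>\<^bsub>K\<^esub> aug y" "aug (c \<odot> x) = c \<odot>\<^bsub>K\<^esub> aug x"
      by (rule eq_by_functionals; simp add: aug_def fnl algebra_simps)+
  qed (use aug_K in simp)
  from lin_comp[OF this KQ.lin_coset] show ?thesis unfolding qpi_eq[abs_def] inv_forms_def .
qed

lemmas qpi_simps = lin_closed[OF qpi_lin] lin_add[OF qpi_lin] lin_smult[OF qpi_lin]
  lin_minus[OF cspace_axioms cspace_V qpi_lin] lin_zero[OF cspace_axioms cspace_V qpi_lin]

lemma V_cases: assumes "v \<in> carrier V" obtains p where "p \<in> carrier P" "v = qpi q p"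
proof -
  obtain p where p: "p \<in> carrier K" "v = R3 q +>\<^bsub>K\<^esub> p"
    using assms by (auto simp: inv_forms_def KQ.quot_carrier)
  then have "aug p = p" by (simp add: aug_def a_minus_def minus_eq_smult)
  with p show ?thesis using that[of p] by (simp add: qpi_eq)
qed

lemma qpi_eq_iff: "x \<in> carrier P \<Longrightarrow> y \<in> carrier P \<Longrightarrow> qpi q x = qpi q y \<longleftrightarrow> aug x \<ominus> aug y \<in> R3 q"
  unfolding qpi_eq using KQ.coset_eq_iff[OF aug_K aug_K] K_minus[OF aug_K aug_K] by simp

section \<open>Coordinates of invariant forms\<close>

definition chibar :: "ix \<Rightarrow> suq set \<Rightarrow> complex" where
  "chibar i = descend (chi i)"

lemma chi_K: "lin K (type_alg (*)) (chi i)"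
  using functional_rep(2)[of i] functional_iff_lin[OF cspace_axioms] by (auto simp: lin_def)

lemma lin_chibar: "lin V (type_alg (*)) (chibar i)"
  unfolding chibar_def inv_forms_def
  by (rule KQ.lin_descend[OF calgebra.axioms(1)[OF calgebra_complex] chi_K]) (use R3_props in simp)

lemma functional_chibar: "functional V (chibar i)"
  using lin_chibar functional_iff_lin[OF cspace_V] by blast

lemma chibar_qpi: "p \<in> carrier P \<Longrightarrow> chibar i (qpi q p) = chi i p"
proof -
  assume p: "p \<in> carrier P"
  have "chibar i (qpi q p) = chi i (aug p)"
    unfolding chibar_def qpi_eq
    by (rule KQ.descend_coset[OF calgebra.axioms(1)[OF calgebra_complex] chi_K]) (use R3_props aug_K p in auto)
  then show ?thesis using p by (simp add: aug_def)
qed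

definition ebas :: "ix \<Rightarrow> suq" where
  "ebas i = (case i of Ith \<Rightarrow> al \<ominus> al' | Ipl \<Rightarrow> ga | Imi \<Rightarrow> Q \<odot> ga')"

lemma ebas_closed [simp]: "ebas i \<in> carrier P"
  by (cases i) (simp_all add: ebas_def)

lemma chi_ebas: "chi i (ebas j) = (if i = j then 1 else 0)"
proof -
  have "1 / (1 + Q^2) + Q^2 / (1 + Q^2) = 1" by (simp flip: add_divide_distrib)
  then show ?thesis by (cases i; cases j) (simp_all add: ebas_def chi_gen)
qed

text \<open>What remains of p after subtracting its counit part and its expected expansion in the
  three representatives. That it lies in \<open>R3\<close> means that three classes span the
  quotient.\<close>

definition red :: "suq \<Rightarrow> suq" where
  "red p = p \<ominus> (counit q p \<odot> \<one> \<oplus> (chi Ith p \<odot> ebas Ith \<oplus> (chi Ipl p \<odot> ebas Ipl \<oplus> chi Imi p \<odot> ebas Imi)))"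

lemma R3_ebas_gen: "ebas i \<otimes> suq_gen q g \<ominus> phi i (suq_gen q g) \<odot> ebas i \<in> R3 q"
proof -
  let ?s1 = "ga \<otimes> ga" and ?s2 = "ga' \<otimes> ga'" and ?sum_ix = "ga \<otimes> ga'" and ?s4 = "al \<otimes> ga \<ominus> ga"
    and ?s5 = "al \<otimes> ga' \<ominus> ga'" and ?s6 = "al' \<otimes> ga \<ominus> ga" and ?s7 = "al' \<otimes> ga' \<ominus> ga'"
    and ?s8 = "(Q^2 \<odot> al \<oplus> al') \<ominus> (1 + Q^2) \<odot> \<one>"
  have s: "?s1 \<in> R3 q" "?s2 \<in> R3 q" "?sum_ix \<in> R3 q" "?s4 \<in> R3 q" "?s5 \<in> R3 q" "?s6 \<in> R3 q" "?s7 \<in> R3 q" "?s8 \<in> R3 q"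
    by (rule R3_gen, simp add: R3_gens_def)+
  have m: "c \<odot> x \<oplus> (d \<odot> y \<oplus> e \<odot> z) \<in> R3 q" if "x \<in> R3 q" "y \<in> R3 q" "z \<in> R3 q" for c d e x y z
    using that by (simp add: R3_add R3_smult)
  note dist = a_minus_def minus_eq_smult nf
  \<comment> \<open>Explicit certificates of membership in terms of the generators of
    \<open>R3\<close>, one for each of the twelve pairs; zero summands bring them all to the shape
    treated by \<open>m\<close>.\<close>
  have "ebas i \<otimes> suq_gen q g \<ominus> phi i (suq_gen q g) \<odot> ebas i = (case i of
      Ith \<Rightarrow> (case g of
         GenAlpha \<Rightarrow> (1 / Q^2) \<odot> (?s8 \<otimes> al) \<oplus> ((1 / Q^2) \<odot> ?s8 \<oplus> (- 1 - 1 / Q^2) \<odot> ?sum_ix)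
       | GenAlphaStar \<Rightarrow> (-1) \<odot> (?s8 \<otimes> al') \<oplus> ((-1) \<odot> ?s8 \<oplus> (Q^2 + Q^4) \<odot> ?sum_ix)
       | GenGamma \<Rightarrow> 1 \<odot> ?s4 \<oplus> ((-1) \<odot> ?s6 \<oplus> 0 \<odot> ?s6)
       | GenGammaStar \<Rightarrow> 1 \<odot> ?s5 \<oplus> ((-1) \<odot> ?s7 \<oplus> 0 \<odot> ?s6))
    | Ipl \<Rightarrow> (case g of
         GenAlpha \<Rightarrow> (1 / Q) \<odot> ?s4 \<oplus> (0 \<odot> ?s6 \<oplus> 0 \<odot> ?s6)
       | GenAlphaStar \<Rightarrow> Q \<odot> ?s6 \<oplus> (0 \<odot> ?s6 \<oplus> 0 \<odot> ?s6)
       | GenGamma \<Rightarrow> 1 \<odot> ?s1 \<oplus> (0 \<odot> ?s6 \<oplus> 0 \<odot> ?s6)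
       | GenGammaStar \<Rightarrow> 1 \<odot> ?sum_ix \<oplus> (0 \<odot> ?s6 \<oplus> 0 \<odot> ?s6))
    | Imi \<Rightarrow> (case g of
         GenAlpha \<Rightarrow> 1 \<odot> ?s5 \<oplus> (0 \<odot> ?s6 \<oplus> 0 \<odot> ?s6)
       | GenAlphaStar \<Rightarrow> Q^2 \<odot> ?s7 \<oplus> (0 \<odot> ?s6 \<oplus> 0 \<odot> ?s6)
       | GenGamma \<Rightarrow> Q \<odot> ?sum_ix \<oplus> (0 \<odot> ?s6 \<oplus> 0 \<odot> ?s6)
       | GenGammaStar \<Rightarrow> Q \<odot> ?s2 \<oplus> (0 \<odot> ?s6 \<oplus> 0 \<odot> ?s6)))"
    by (rule eq_by_functionals; cases i; cases g; simp add: ebas_def phi_gen dist fnl; (simp add: field_simps power4_eq_xxxx power2_eq_square)?)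
  then show ?thesis
    using m s R3_mult by (cases i; cases g) (simp_all only: ix.case gen.case gen_closed)
qed

lemma red_gen: "red (suq_gen q g) \<in> R3 q"
proof -
  let ?s8 = "(Q^2 \<odot> al \<oplus> al') \<ominus> (1 + Q^2) \<odot> \<one>"
  have s: "?s8 \<in> R3 q" by (rule R3_gen, simp add: R3_gens_def)
  have "red (suq_gen q g) = (if g = GenAlpha \<or> g = GenAlphaStar then rp else 0) \<odot> ?s8"
    by (rule eq_by_functionals; cases g; simp add: red_def ebas_def chi_gen fnl; (simp add: divide_simps)?; (simp add: algebra_simps)?)
  then show ?thesis using R3_smult[OF s] by simp
qed

text \<open>\<open>R3\<close> is a right ideal, so letters must be appended on the right. The star
  reverses products and converts the left-handed induction into this one.\<close>

lemma right_induct [consumes 1, case_names zero one add scale mult]: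
  assumes "p \<in> carrier P" "S \<zero>" "S \<one>"
    and "\<And>x y. \<lbrakk>x \<in> carrier P; y \<in> carrier P; S x; S y\<rbrakk> \<Longrightarrow> S (x \<oplus> y)"
    and "\<And>c x. \<lbrakk>x \<in> carrier P; S x\<rbrakk> \<Longrightarrow> S (c \<odot> x)"
    and "\<And>g x. \<lbrakk>x \<in> carrier P; S x\<rbrakk> \<Longrightarrow> S (x \<otimes> suq_gen q g)"
  shows "S p"
proof -
  have "S (suq_star x)" if "x \<in> carrier P" for x
    using that by (induction rule: induct) (simp_all add: assms star_add star_smult star_mult)
  from this[of "suq_star p"] show ?thesis using assms(1) by simp
qed

lemma red_in_R3: "p \<in> carrier P \<Longrightarrow> red p \<in> R3 q"
proof (induction rule: right_induct)
  case zero
  have "red \<zero> = \<zero>"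
    by (rule eq_by_functionals) (simp_all add: red_def fnl functional.functional_zero[OF functional_rep(2)])
  then show ?case by (simp add: R3_zero)
next
  case one
  have "red \<one> = \<zero>" by (rule eq_by_functionals) (simp_all add: red_def fnl)
  then show ?case by (simp add: R3_zero)
next
  case (add x y)
  have "red (x \<oplus> y) = red x \<oplus> red y"
    by (rule eq_by_functionals)
      (use add in \<open>simp_all add: red_def fnl functional.functional_add[OF functional_rep(2)] algebra_simps\<close>)
  then show ?case using add by (simp add: R3_add)
next
  case (scale c x)
  have "red (c \<odot> x) = c \<odot> red x"
    by (rule eq_by_functionals)
      (use scale in \<open>simp_all add: red_def fnl functional.functional_smult[OF functional_rep(2)] algebra_simps\<close>)
  then show ?case using scale by (simp add: R3_smult)
next
  case (mult g x)
  let ?g = "suq_gen q g"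
  let ?r = "\<lambda>i. ebas i \<otimes> ?g \<ominus> phi i ?g \<odot> ebas i"
  \<comment> \<open>The remainder of x is multiplied by the generator, and the subtracted expansion
    is rewritten through the twelve certificates; each summand on the right is in
    \<open>R3\<close>.\<close>
  have "red (x \<otimes> ?g) = red x \<otimes> ?g \<oplus> (counit q x \<odot> red ?g \<oplus> (chi Ith x \<odot> ?r Ith \<oplus> (chi Ipl x \<odot> ?r Ipl \<oplus> chi Imi x \<odot> ?r Imi)))"
    by (rule eq_by_functionals)
      (use mult(1) in \<open>simp_all add: red_def fnl chi_mult l_distr a_minus_def minus_eq_smult algebra_simps\<close>)
  then show ?case using mult R3_ebas_gen red_gen
    by (simp add: R3_add R3_smult R3_mult)
qed

definition pie :: "ix \<Rightarrow> suq set" where "pie i = qpi q (ebas i)"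

lemma pie_closed [simp]: "pie i \<in> carrier V"
  by (simp add: pie_def qpi_simps)

lemma chibar_pie: "chibar i (pie j) = (if i = j then 1 else 0)"
  by (simp add: pie_def chibar_qpi chi_ebas)

lemma qpi_expand:
  assumes "p \<in> carrier P"
  shows "qpi q p = chi Ith p \<odot>\<^bsub>V\<^esub> pie Ith \<oplus>\<^bsub>V\<^esub> (chi Ipl p \<odot>\<^bsub>V\<^esub> pie Ipl \<oplus>\<^bsub>V\<^esub> chi Imi p \<odot>\<^bsub>V\<^esub> pie Imi)"
proof -
  let ?e = "chi Ith p \<odot> ebas Ith \<oplus> (chi Ipl p \<odot> ebas Ipl \<oplus> chi Imi p \<odot> ebas Imi)"
  have ce: "counit q (ebas i) = 0" for i
    by (cases i) (simp_all add: ebas_def)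
  have "aug p \<ominus> aug ?e = red p"
    by (rule eq_by_functionals) (use assms in \<open>simp_all add: aug_def red_def fnl ce\<close>)
  then have "qpi q p = qpi q ?e" using red_in_R3[OF assms] assms by (subst qpi_eq_iff) simp_all
  also have "\<dots> = chi Ith p \<odot>\<^bsub>V\<^esub> pie Ith \<oplus>\<^bsub>V\<^esub> (chi Ipl p \<odot>\<^bsub>V\<^esub> pie Ipl \<oplus>\<^bsub>V\<^esub> chi Imi p \<odot>\<^bsub>V\<^esub> pie Imi)"
    by (simp add: qpi_simps pie_def)
  finally show ?thesis .
qed

lemma V_expand:
  assumes "v \<in> carrier V"
  shows "v = chibar Ith v \<odot>\<^bsub>V\<^esub> pie Ith \<oplus>\<^bsub>V\<^esub> (chibar Ipl v \<odot>\<^bsub>V\<^esub> pie Ipl \<oplus>\<^bsub>V\<^esub> chibar Imi v \<odot>\<^bsub>V\<^esub> pie Imi)"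
proof -
  obtain p where p: "p \<in> carrier P" "v = qpi q p" using assms by (rule V_cases)
  show ?thesis unfolding p(2) chibar_qpi[OF p(1)] by (rule qpi_expand[OF p(1)])
qed

subsection \<open>Coordinates of one-forms\<close>

sublocale VS: cspace V by (rule cspace_V)
sublocale PV: tensor_product P V ..

lemma Omega1_eq: "Omega1 q = PV.T"
  by (simp add: Omega1_def)

sublocale PVT: cspace PV.T by (rule PV.cspace_tensor)

definition X :: "ix \<Rightarrow> form1 \<Rightarrow> suq" where
  "X i = tensor_lift P (\<lambda>x v. chibar i v \<odot> x)"

interpretation chibar: functional V "chibar i" for i by (rule functional_chibar)

lemma bilin_X: "bilin P V P (\<lambda>x v. chibar i v \<odot> x)"
  by (rule bilinI; rule linI) (simp_all add: smult_l_distr smult_r_distr smult_assoc[symmetric] mult.commute)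

lemma lin_X: "lin PV.T P (X i)"
  unfolding X_def by (rule PV.lin_tensor_lift[OF cspace_axioms bilin_X])

lemma X_pure: "x \<in> carrier P \<Longrightarrow> v \<in> carrier V \<Longrightarrow> X i (PV.pt x v) = chibar i v \<odot> x"
  unfolding X_def by (rule PV.tensor_lift_pure[OF cspace_axioms bilin_X])

lemmas X_simps = lin_closed[OF lin_X] lin_add[OF lin_X] lin_smult[OF lin_X]
  lin_zero[OF PV.cspace_tensor cspace_axioms lin_X] lin_minus[OF PV.cspace_tensor cspace_axioms lin_X] X_pure

definition frm :: "suq \<Rightarrow> suq \<Rightarrow> suq \<Rightarrow> form1" where
  "frm x y z = PV.pt x (pie Ith) \<oplus>\<^bsub>PV.T\<^esub> (PV.pt y (pie Ipl) \<oplus>\<^bsub>PV.T\<^esub> PV.pt z (pie Imi))"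

lemma frm_closed [simp]: "x \<in> carrier P \<Longrightarrow> y \<in> carrier P \<Longrightarrow> z \<in> carrier P \<Longrightarrow> frm x y z \<in> carrier PV.T"
  by (simp add: frm_def)

lemma X_frm: "x \<in> carrier P \<Longrightarrow> y \<in> carrier P \<Longrightarrow> z \<in> carrier P \<Longrightarrow>
   X i (frm x y z) = (case i of Ith \<Rightarrow> x | Ipl \<Rightarrow> y | Imi \<Rightarrow> z)"
  by (cases i) (simp_all add: frm_def X_simps chibar_pie)

text \<open>Together with \<open>X_frm\<close> this says that the one-forms are a free left module
  on the three basis forms, so that equality of one-forms can be tested on coordinates.\<close>

lemma form_expand: "w \<in> carrier PV.T \<Longrightarrow> w = frm (X Ith w) (X Ipl w) (X Imi w)"
proof (induction rule: PV.tensor_induct)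
  case zero
  have "PV.pt \<zero> v = \<zero>\<^bsub>PV.T\<^esub>" if "v \<in> carrier V" for v
    using lin_zero[OF cspace_axioms PV.cspace_tensor bilin_left[OF PV.bilin_pt that]] .
  then show ?case by (simp add: frm_def X_simps)
next
  case (pure x v)
  have "PV.pt x v = PV.pt x (chibar Ith v \<odot>\<^bsub>V\<^esub> pie Ith \<oplus>\<^bsub>V\<^esub> (chibar Ipl v \<odot>\<^bsub>V\<^esub> pie Ipl \<oplus>\<^bsub>V\<^esub> chibar Imi v \<odot>\<^bsub>V\<^esub> pie Imi))"
    using V_expand[OF pure(2)] by simp
  also have "\<dots> = frm (X Ith (PV.pt x v)) (X Ipl (PV.pt x v)) (X Imi (PV.pt x v))"
    using pure by (simp add: frm_def X_simps)
  finally show ?case .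
next
  case (add s t)
  have "frm (X Ith (s \<oplus>\<^bsub>PV.T\<^esub> t)) (X Ipl (s \<oplus>\<^bsub>PV.T\<^esub> t)) (X Imi (s \<oplus>\<^bsub>PV.T\<^esub> t)) =
    frm (X Ith s) (X Ipl s) (X Imi s) \<oplus>\<^bsub>PV.T\<^esub> frm (X Ith t) (X Ipl t) (X Imi t)"
    using add(1,2) by (simp add: frm_def X_simps PVT.a_ac)
  then show ?case using add by simp
qed

lemma form_eqI:
  assumes "w \<in> carrier PV.T" "w' \<in> carrier PV.T" "\<And>i. X i w = X i w'" shows "w = w'"
  using form_expand[OF assms(1)] form_expand[OF assms(2)] assms(3) by simp

subsection \<open>Bimodule structure and exterior derivative in coordinates\<close>

lemma bilin_lact: "p \<in> carrier P \<Longrightarrow> bilin P V PV.T (\<lambda>x v. PV.pt (p \<otimes> x) v)"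
  by (rule bilinI; rule linI) (simp_all add: r_distr)

lemma lact_lin: "p \<in> carrier P \<Longrightarrow> lin PV.T PV.T (lact q p)"
  unfolding lact_def Omega1_eq SUq_P by (rule PV.lin_tensor_lift[OF PV.cspace_tensor bilin_lact])

lemma lact_pure: "p \<in> carrier P \<Longrightarrow> x \<in> carrier P \<Longrightarrow> v \<in> carrier V \<Longrightarrow> lact q p (PV.pt x v) = PV.pt (p \<otimes> x) v"
  unfolding lact_def Omega1_eq SUq_P by (rule PV.tensor_lift_pure[OF PV.cspace_tensor bilin_lact])

lemmas lact_simps = lin_closed[OF lact_lin] lin_add[OF lact_lin] lin_smult[OF lact_lin]
  lin_zero[OF PV.cspace_tensor PV.cspace_tensor lact_lin] lact_pure

lemma X_lact: "w \<in> carrier PV.T \<Longrightarrow> p \<in> carrier P \<Longrightarrow> X i (lact q p w) = p \<otimes> X i w"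
  by (induction rule: PV.tensor_induct) (simp_all add: lact_simps X_simps r_distr)

text \<open>Two representatives of one class have augmented parts that differ by an element of
  \<open>R3\<close>. Multiplying on the right by p stays in the right ideal, so the described value
  is unique.\<close>

lemma inv_act_qpi:
  assumes "a \<in> carrier P" "p \<in> carrier P"
  shows "inv_act q (qpi q a) p = qpi q (a \<otimes> p \<ominus> counit q a \<odot> p)"
  unfolding inv_act_def SUq_P
proof (rule the_equality)
  fix w assume "\<exists>b\<in>carrier P. qpi q a = qpi q b \<and> w = qpi q (b \<otimes> p \<ominus> counit q b \<odot> p)"
  then obtain b where b: "b \<in> carrier P" "qpi q a = qpi q b" "w = qpi q (b \<otimes> p \<ominus> counit q b \<odot> p)" by blast
  have "aug a \<ominus> aug b \<in> R3 q" using b(1,2) assms qpi_eq_iff by simp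
  then have "(aug a \<ominus> aug b) \<otimes> p \<in> R3 q" using assms R3_mult by simp
  also have "(aug a \<ominus> aug b) \<otimes> p = aug (a \<otimes> p \<ominus> counit q a \<odot> p) \<ominus> aug (b \<otimes> p \<ominus> counit q b \<odot> p)"
    by (rule eq_by_functionals) (use assms b(1) in \<open>simp_all add: aug_def fnl l_distr a_minus_def minus_eq_smult algebra_simps\<close>)
  finally have "qpi q (a \<otimes> p \<ominus> counit q a \<odot> p) = qpi q (b \<otimes> p \<ominus> counit q b \<odot> p)"
    using b(1) assms by (simp add: qpi_eq_iff)
  then show "w = qpi q (a \<otimes> p \<ominus> counit q a \<odot> p)" using b(3) by simp
qed (use assms in auto)

lemma inv_act_closed: "v \<in> carrier V \<Longrightarrow> p \<in> carrier P \<Longrightarrow> inv_act q v p \<in> carrier V"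
  by (elim V_cases) (simp add: inv_act_qpi qpi_simps)

lemma chibar_inv_act: "v \<in> carrier V \<Longrightarrow> p \<in> carrier P \<Longrightarrow> chibar i (inv_act q v p) = chibar i v * phi i p"
proof (elim V_cases)
  fix a assume "p \<in> carrier P" "a \<in> carrier P" "v = qpi q a"
  show ?thesis using \<open>p \<in> carrier P\<close> \<open>a \<in> carrier P\<close> \<open>v = qpi q a\<close>
    by (simp add: inv_act_qpi chibar_qpi chi_mult)
qed

lemma V_eqI: "v \<in> carrier V \<Longrightarrow> w \<in> carrier V \<Longrightarrow> (\<And>i. chibar i v = chibar i w) \<Longrightarrow> v = w"
  using V_expand[of v] V_expand[of w] by simp

lemma bilin_inv_act: "bilin V P V (inv_act q)"
  by (rule bilinI; rule linI; (rule V_eqI)?)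
    (simp_all add: inv_act_closed chibar_inv_act functional.functional_add[OF functional_rep(3)]
      functional.functional_smult[OF functional_rep(3)] algebra_simps)

lemmas inv_act_simps = inv_act_closed lin_add[OF bilin_left[OF bilin_inv_act]] lin_smult[OF bilin_left[OF bilin_inv_act]]
  lin_add[OF bilin_right[OF bilin_inv_act]] lin_smult[OF bilin_right[OF bilin_inv_act]]

definition rbeta :: "suq \<Rightarrow> suq set \<Rightarrow> (suq \<times> suq \<Rightarrow>\<^sub>0 complex) set \<Rightarrow> form1" where
  "rbeta x v = tensor_lift PV.T (\<lambda>p1 p2. PV.pt (x \<otimes> p1) (inv_act q v p2))"

lemma bilin_rbeta: "x \<in> carrier P \<Longrightarrow> v \<in> carrier V \<Longrightarrow> bilin P P PV.T (\<lambda>p1 p2. PV.pt (x \<otimes> p1) (inv_act q v p2))"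
  by (rule bilinI; rule linI) (simp_all add: inv_act_simps r_distr)

lemma lin_rbeta: "x \<in> carrier P \<Longrightarrow> v \<in> carrier V \<Longrightarrow> lin PP.T PV.T (rbeta x v)"
  unfolding rbeta_def by (rule PP.lin_tensor_lift[OF PV.cspace_tensor bilin_rbeta])

lemma rbeta_pure: "x \<in> carrier P \<Longrightarrow> v \<in> carrier V \<Longrightarrow> p1 \<in> carrier P \<Longrightarrow> p2 \<in> carrier P \<Longrightarrow>
   rbeta x v (PP.pt p1 p2) = PV.pt (x \<otimes> p1) (inv_act q v p2)"
  unfolding rbeta_def by (rule PP.tensor_lift_pure[OF PV.cspace_tensor bilin_rbeta])

lemmas rbeta_simps = lin_closed[OF lin_rbeta] lin_add[OF lin_rbeta] lin_smult[OF lin_rbeta]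
  lin_zero[OF PP.cspace_tensor PV.cspace_tensor lin_rbeta] rbeta_pure

lemma X_rbeta: "t \<in> carrier PP.T \<Longrightarrow> x \<in> carrier P \<Longrightarrow> v \<in> carrier V \<Longrightarrow>
   X i (rbeta x v t) = chibar i v \<odot> (x \<otimes> PP.slice (phi i) t)"
  by (induction rule: PP.tensor_induct)
    (simp_all add: rbeta_simps X_simps inv_act_closed chibar_inv_act PP.slice_zero[OF functional_rep(3)]
      PP.slice_pure[OF functional_rep(3)] PP.slice_add[OF functional_rep(3)] PP.slice_closed[OF functional_rep(3)]
      smult_assoc[symmetric] r_distr smult_r_distr)

lemma X_rbeta_comult: "p \<in> carrier P \<Longrightarrow> x \<in> carrier P \<Longrightarrow> v \<in> carrier V \<Longrightarrow>
   X i (rbeta x v (comult q p)) = chibar i v \<odot> (x \<otimes> sig i p)"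
  by (simp add: X_rbeta sig_def conv_def)

lemma bilin_ract: "p \<in> carrier P \<Longrightarrow> bilin P V PV.T (\<lambda>x v. rbeta x v (comult q p))"
  by (rule bilinI; rule linI; (rule form_eqI)?)
    (simp_all add: rbeta_simps X_rbeta_comult X_simps l_distr smult_l_distr smult_r_distr smult_assoc[symmetric] mult.commute)

lemma ract_eq: "ract q w p = tensor_lift PV.T (\<lambda>x v. rbeta x v (comult q p)) w"
  unfolding ract_def Omega1_eq SUq_P rbeta_def ..

lemma ract_lin: "p \<in> carrier P \<Longrightarrow> lin PV.T PV.T (\<lambda>w. ract q w p)"
  unfolding ract_eq by (rule PV.lin_tensor_lift[OF PV.cspace_tensor bilin_ract])

lemma ract_pure: "p \<in> carrier P \<Longrightarrow> x \<in> carrier P \<Longrightarrow> v \<in> carrier V \<Longrightarrow>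
   ract q (PV.pt x v) p = rbeta x v (comult q p)"
  unfolding ract_eq by (rule PV.tensor_lift_pure[OF PV.cspace_tensor bilin_ract])

lemmas ract_simps = lin_closed[OF ract_lin] lin_add[OF ract_lin] lin_smult[OF ract_lin]
  lin_zero[OF PV.cspace_tensor PV.cspace_tensor ract_lin] ract_pure

text \<open>In coordinates the right action is right multiplication twisted by \<open>sig i\<close>,
  separately for each i; no mixing of the three forms occurs.\<close>

lemma X_ract: "w \<in> carrier PV.T \<Longrightarrow> p \<in> carrier P \<Longrightarrow> X i (ract q w p) = X i w \<otimes> sig i p"
  by (induction rule: PV.tensor_induct) (simp_all add: ract_simps X_simps X_rbeta_comult l_distr)

lemma bilin_d: "bilin P P PV.T (\<lambda>p1 p2. PV.pt p1 (qpi q p2))"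
  by (rule bilinI; rule linI) (simp_all add: qpi_simps)

definition dbeta :: "(suq \<times> suq \<Rightarrow>\<^sub>0 complex) set \<Rightarrow> form1" where
  "dbeta = tensor_lift PV.T (\<lambda>p1 p2. PV.pt p1 (qpi q p2))"

lemma lin_dbeta: "lin PP.T PV.T dbeta"
  unfolding dbeta_def by (rule PP.lin_tensor_lift[OF PV.cspace_tensor bilin_d])

lemma dbeta_pure: "p1 \<in> carrier P \<Longrightarrow> p2 \<in> carrier P \<Longrightarrow> dbeta (PP.pt p1 p2) = PV.pt p1 (qpi q p2)"
  unfolding dbeta_def by (rule PP.tensor_lift_pure[OF PV.cspace_tensor bilin_d])

lemma X_dbeta: "t \<in> carrier PP.T \<Longrightarrow> X i (dbeta t) = PP.slice (chi i) t"
  by (induction rule: PP.tensor_induct)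
    (simp_all add: lin_closed[OF lin_dbeta] lin_add[OF lin_dbeta] dbeta_pure lin_zero[OF PP.cspace_tensor PV.cspace_tensor lin_dbeta]
      X_simps qpi_simps chibar_qpi PP.slice_zero[OF functional_rep(2)] PP.slice_pure[OF functional_rep(2)] PP.slice_add[OF functional_rep(2)])

lemma calc_d_eq: "calc_d q p = dbeta (comult q p)"
  unfolding calc_d_def dbeta_def Omega1_eq SUq_P ..

lemma calc_d_closed [simp]: "p \<in> carrier P \<Longrightarrow> calc_d q p \<in> carrier PV.T"
  by (simp add: calc_d_eq lin_closed[OF lin_dbeta])

lemma X_calc_d: "p \<in> carrier P \<Longrightarrow> X i (calc_d q p) = dd i p"
  by (simp add: calc_d_eq X_dbeta dd_def conv_def)

end

section \<open>The universal differential envelope\<close>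

context quantum_su
begin

text \<open>The weight vector version applies to every monomial, where \<open>dd Ith\<close> is the
  scalar \<open>rr n\<close>, and both sides are linear.\<close>

lemma dd_commutator: "p \<in> carrier P \<Longrightarrow> dd Imi (dd Ipl p) = Q^2 \<odot> dd Ipl (dd Imi p) \<oplus> (1 + Q^2) \<odot> dd Ith p"
proof -
  assume "p \<in> carrier P"
  from monomials_span[OF this] mnm_closed show ?thesis
  proof (induction rule: spanned_induct)
    case (add_smult i c x)
    obtain t k l where i: "i = (t, k, l)" by (cases i)
    show ?case
      by (rule eq_by_functionals)
        (use add_smult dd_commutator_weight[OF M_weight[of t k l]] dd_Ith_weight[OF M_weight[of t k l]] in
          \<open>simp_all add: i dd_add dd_smult fnl algebra_simps\<close>)
  qed simp
qed

subsection \<open>The tensor algebra of the bimodule of one-forms\<close>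

abbreviation "Gs \<equiv> carrier P <+> carrier PV.T"
abbreviation "Rel \<equiv> bimodule_rel P PV.T (lact q) (ract q)"
abbreviation "BI \<equiv> bimodule_ideal P PV.T (lact q) (ract q)"

sublocale FG: calgebra "free_alg Gs"
  by (rule calgebra_free_alg)

lemma Inl_closed: "p \<in> carrier P \<Longrightarrow> free_var (Inl p) \<in> carrier (free_alg Gs)"
  and Inr_closed: "w \<in> carrier PV.T \<Longrightarrow> free_var (Inr w) \<in> carrier (free_alg Gs)"
  by (rule free_var_closed; blast)+

lemma Rel_closed: "Rel \<subseteq> carrier (free_alg Gs)"
  unfolding bimodule_rel_def
  by (intro Un_least subsetI; elim CollectE singletonE exE conjE; hypsubst;
      intro free_alg_minus_closed free_alg_scale_closed free_alg_mult_closed free_alg_one_closed Inl_closed Inr_closed)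
     (simp_all add: lact_simps ract_simps)

sublocale TQ: quotient_algebra "free_alg Gs" BI
  unfolding bimodule_ideal_def by (rule FG.quotient_Idl[OF Rel_closed])

lemma TOmega_eq: "TOmega q = quot_alg (free_alg Gs) BI"
  by (simp add: TOmega_def tensor_algebra_def Omega1_eq)

sublocale TO: calgebra "TOmega q"
  unfolding TOmega_eq by (rule TQ.calgebra_quot)

lemma tgen_eq: "tgen q x = BI +>\<^bsub>free_alg Gs\<^esub> free_var x"
  by (simp add: tgen_def Omega1_eq)

lemma tgen_closed: "x \<in> Gs \<Longrightarrow> tgen q x \<in> carrier (TOmega q)"
  unfolding TOmega_eq tgen_eq TQ.quot_carrier by (rule imageI[OF free_var_closed])

lemma FG_minus: "f \<in> carrier (free_alg Gs) \<Longrightarrow> g \<in> carrier (free_alg Gs) \<Longrightarrow> f \<ominus>\<^bsub>free_alg Gs\<^esub> g = f - g"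
  using free_alg_uminus[of g Gs] by (simp add: a_minus_def)

lemma Rel_eq:
  assumes "f - g \<in> Rel" "f \<in> carrier (free_alg Gs)" "g \<in> carrier (free_alg Gs)"
  shows "BI +>\<^bsub>free_alg Gs\<^esub> f = BI +>\<^bsub>free_alg Gs\<^esub> g"
  using assms FG.genideal_self[OF Rel_closed] TQ.coset_eq_iff[OF assms(2,3)] FG_minus[OF assms(2,3)]
  by (auto simp: bimodule_ideal_def)

lemma TO_cls:
  "f \<in> carrier (free_alg Gs) \<Longrightarrow> g \<in> carrier (free_alg Gs) \<Longrightarrow>
     BI +>\<^bsub>free_alg Gs\<^esub> (f + g) = (BI +>\<^bsub>free_alg Gs\<^esub> f) \<oplus>\<^bsub>TOmega q\<^esub> (BI +>\<^bsub>free_alg Gs\<^esub> g)"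
  "f \<in> carrier (free_alg Gs) \<Longrightarrow> g \<in> carrier (free_alg Gs) \<Longrightarrow>
     BI +>\<^bsub>free_alg Gs\<^esub> (f * g) = (BI +>\<^bsub>free_alg Gs\<^esub> f) \<otimes>\<^bsub>TOmega q\<^esub> (BI +>\<^bsub>free_alg Gs\<^esub> g)"
  "f \<in> carrier (free_alg Gs) \<Longrightarrow> BI +>\<^bsub>free_alg Gs\<^esub> (pm_scale c f) = c \<odot>\<^bsub>TOmega q\<^esub> (BI +>\<^bsub>free_alg Gs\<^esub> f)"
  "BI +>\<^bsub>free_alg Gs\<^esub> 1 = \<one>\<^bsub>TOmega q\<^esub>"
  using TQ.quot_add[of f g] TQ.quot_mult[of f g] TQ.quot_smult[of f c] TQ.quot_one by (simp_all add: TOmega_eq)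

lemmas FG_closed = Inl_closed Inr_closed free_alg_add_closed free_alg_scale_closed free_alg_mult_closed free_alg_one_closed

lemma tgen_add:
  assumes [simp]: "a \<in> carrier P" "b \<in> carrier P"
  shows "tgen q (Inl (a \<oplus> b)) = tgen q (Inl a) \<oplus>\<^bsub>TOmega q\<^esub> tgen q (Inl b)"
proof -
  have "free_var (Inl (a \<oplus> b)) - (free_var (Inl a) + free_var (Inl b)) \<in> Rel"
    unfolding bimodule_rel_def diff_diff_eq[symmetric] using assms by blast
  then have "BI +>\<^bsub>free_alg Gs\<^esub> free_var (Inl (a \<oplus> b)) = BI +>\<^bsub>free_alg Gs\<^esub> (free_var (Inl a) + free_var (Inl b))"
    by (rule Rel_eq; intro FG_closed; simp add: lact_simps ract_simps)
  then show ?thesis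
    by (simp only: tgen_eq TO_cls FG_closed assms)
qed

lemma tgen_smult:
  assumes [simp]: "a \<in> carrier P"
  shows "tgen q (Inl (c \<odot> a)) = c \<odot>\<^bsub>TOmega q\<^esub> tgen q (Inl a)"
proof -
  have "free_var (Inl (c \<odot> a)) - (pm_scale c (free_var (Inl a))) \<in> Rel"
    unfolding bimodule_rel_def diff_diff_eq[symmetric] using assms by blast
  then have "BI +>\<^bsub>free_alg Gs\<^esub> free_var (Inl (c \<odot> a)) = BI +>\<^bsub>free_alg Gs\<^esub> (pm_scale c (free_var (Inl a)))"
    by (rule Rel_eq; intro FG_closed; simp add: lact_simps ract_simps)
  then show ?thesis
    by (simp only: tgen_eq TO_cls FG_closed assms)
qed

lemma tgen_mult:
  assumes [simp]: "a \<in> carrier P" "b \<in> carrier P"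
  shows "tgen q (Inl (a \<otimes> b)) = tgen q (Inl a) \<otimes>\<^bsub>TOmega q\<^esub> tgen q (Inl b)"
proof -
  have "free_var (Inl (a \<otimes> b)) - (free_var (Inl a) * free_var (Inl b)) \<in> Rel"
    unfolding bimodule_rel_def diff_diff_eq[symmetric] using assms by blast
  then have "BI +>\<^bsub>free_alg Gs\<^esub> free_var (Inl (a \<otimes> b)) = BI +>\<^bsub>free_alg Gs\<^esub> (free_var (Inl a) * free_var (Inl b))"
    by (rule Rel_eq; intro FG_closed; simp add: lact_simps ract_simps)
  then show ?thesis
    by (simp only: tgen_eq TO_cls FG_closed assms)
qed

lemma tgen_one:
  shows "tgen q (Inl \<one>) = \<one>\<^bsub>TOmega q\<^esub>"
proof -
  have "free_var (Inl \<one>) - (1) \<in> Rel"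
    unfolding bimodule_rel_def diff_diff_eq[symmetric] by blast
  then have "BI +>\<^bsub>free_alg Gs\<^esub> free_var (Inl \<one>) = BI +>\<^bsub>free_alg Gs\<^esub> (1)"
    by (rule Rel_eq; intro FG_closed; simp add: lact_simps ract_simps)
  then show ?thesis
    by (simp only: tgen_eq TO_cls FG_closed )
qed

lemma tgen_form_add:
  assumes [simp]: "m \<in> carrier PV.T" "n \<in> carrier PV.T"
  shows "tgen q (Inr (m \<oplus>\<^bsub>PV.T\<^esub> n)) = tgen q (Inr m) \<oplus>\<^bsub>TOmega q\<^esub> tgen q (Inr n)"
proof -
  have "free_var (Inr (m \<oplus>\<^bsub>PV.T\<^esub> n)) - (free_var (Inr m) + free_var (Inr n)) \<in> Rel"
    unfolding bimodule_rel_def diff_diff_eq[symmetric] using assms by blast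
  then have "BI +>\<^bsub>free_alg Gs\<^esub> free_var (Inr (m \<oplus>\<^bsub>PV.T\<^esub> n)) = BI +>\<^bsub>free_alg Gs\<^esub> (free_var (Inr m) + free_var (Inr n))"
    by (rule Rel_eq; intro FG_closed; simp add: lact_simps ract_simps)
  then show ?thesis
    by (simp only: tgen_eq TO_cls FG_closed assms)
qed

lemma tgen_form_smult:
  assumes [simp]: "m \<in> carrier PV.T"
  shows "tgen q (Inr (c \<odot>\<^bsub>PV.T\<^esub> m)) = c \<odot>\<^bsub>TOmega q\<^esub> tgen q (Inr m)"
proof -
  have "free_var (Inr (c \<odot>\<^bsub>PV.T\<^esub> m)) - (pm_scale c (free_var (Inr m))) \<in> Rel"
    unfolding bimodule_rel_def diff_diff_eq[symmetric] using assms by blast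
  then have "BI +>\<^bsub>free_alg Gs\<^esub> free_var (Inr (c \<odot>\<^bsub>PV.T\<^esub> m)) = BI +>\<^bsub>free_alg Gs\<^esub> (pm_scale c (free_var (Inr m)))"
    by (rule Rel_eq; intro FG_closed; simp add: lact_simps ract_simps)
  then show ?thesis
    by (simp only: tgen_eq TO_cls FG_closed assms)
qed

lemma tgen_lact:
  assumes [simp]: "a \<in> carrier P" "m \<in> carrier PV.T"
  shows "tgen q (Inr (lact q a m)) = tgen q (Inl a) \<otimes>\<^bsub>TOmega q\<^esub> tgen q (Inr m)"
proof -
  have "free_var (Inr (lact q a m)) - (free_var (Inl a) * free_var (Inr m)) \<in> Rel"
    unfolding bimodule_rel_def diff_diff_eq[symmetric] using assms by blast
  then have "BI +>\<^bsub>free_alg Gs\<^esub> free_var (Inr (lact q a m)) = BI +>\<^bsub>free_alg Gs\<^esub> (free_var (Inl a) * free_var (Inr m))"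
    by (rule Rel_eq; intro FG_closed; simp add: lact_simps ract_simps)
  then show ?thesis
    by (simp only: tgen_eq TO_cls FG_closed assms)
qed

lemma tgen_ract:
  assumes [simp]: "a \<in> carrier P" "m \<in> carrier PV.T"
  shows "tgen q (Inr (ract q m a)) = tgen q (Inr m) \<otimes>\<^bsub>TOmega q\<^esub> tgen q (Inl a)"
proof -
  have "free_var (Inr (ract q m a)) - (free_var (Inr m) * free_var (Inl a)) \<in> Rel"
    unfolding bimodule_rel_def diff_diff_eq[symmetric] using assms by blast
  then have "BI +>\<^bsub>free_alg Gs\<^esub> free_var (Inr (ract q m a)) = BI +>\<^bsub>free_alg Gs\<^esub> (free_var (Inr m) * free_var (Inl a))"
    by (rule Rel_eq; intro FG_closed; simp add: lact_simps ract_simps)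
  then show ?thesis
    by (simp only: tgen_eq TO_cls FG_closed assms)
qed

lemmas tgen_rels = tgen_add tgen_smult tgen_mult tgen_one tgen_form_add tgen_form_smult tgen_lact tgen_ract

subsection \<open>The envelope\<close>

abbreviation null_list :: "(suq \<times> suq) list \<Rightarrow> bool" where
  "null_list gs \<equiv> set gs \<subseteq> carrier P \<times> carrier P \<and> lsum PV.T (\<lambda>(g, h). lact q g (calc_d q h)) gs = \<zero>\<^bsub>PV.T\<^esub>"

definition env_gens :: "tform set" where
  "env_gens = {lsum (TOmega q) (\<lambda>(g, h). tgen q (Inr (calc_d q g)) \<otimes>\<^bsub>TOmega q\<^esub> tgen q (Inr (calc_d q h))) gs |gs. null_list gs}"

lemma env_eq: "envelope_ideal q = Idl\<^bsub>TOmega q\<^esub> env_gens"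
  by (simp add: envelope_ideal_def env_gens_def Omega1_eq)

lemma (in cspace) lsum_closed: "(\<And>x. x \<in> set xs \<Longrightarrow> f x \<in> carrier V) \<Longrightarrow> lsum V f xs \<in> carrier V"
  by (induction xs) (auto simp: lsum_def)

lemma env_gens_closed: "env_gens \<subseteq> carrier (TOmega q)"
  unfolding env_gens_def by (auto intro!: TO.lsum_closed TO.m_closed tgen_closed)

sublocale EQ: quotient_algebra "TOmega q" "envelope_ideal q"
  unfolding env_eq by (rule TO.quotient_Idl[OF env_gens_closed])

lemma Omega_eq: "Omega q = quot_alg (TOmega q) (envelope_ideal q)"
  by (simp add: Omega_def)

sublocale Om: calgebra "Omega q"
  unfolding Omega_eq by (rule EQ.calgebra_quot)

abbreviation "ecls x \<equiv> envelope_ideal q +>\<^bsub>TOmega q\<^esub> x"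

lemma ecls_simps:
  "x \<in> carrier (TOmega q) \<Longrightarrow> ecls x \<in> carrier (Omega q)"
  "x \<in> carrier (TOmega q) \<Longrightarrow> y \<in> carrier (TOmega q) \<Longrightarrow> ecls (x \<oplus>\<^bsub>TOmega q\<^esub> y) = ecls x \<oplus>\<^bsub>Omega q\<^esub> ecls y"
  "x \<in> carrier (TOmega q) \<Longrightarrow> ecls (c \<odot>\<^bsub>TOmega q\<^esub> x) = c \<odot>\<^bsub>Omega q\<^esub> ecls x"
  "x \<in> carrier (TOmega q) \<Longrightarrow> y \<in> carrier (TOmega q) \<Longrightarrow> ecls (x \<otimes>\<^bsub>TOmega q\<^esub> y) = ecls x \<otimes>\<^bsub>Omega q\<^esub> ecls y"
  "ecls \<one>\<^bsub>TOmega q\<^esub> = \<one>\<^bsub>Omega q\<^esub>"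
  by (simp_all add: Omega_eq EQ.quot_carrier EQ.quot_add EQ.quot_smult EQ.quot_mult EQ.quot_one)

lemma of_P_eq: "of_P q p = ecls (tgen q (Inl p))" and of_form_eq: "of_form q w = ecls (tgen q (Inr w))"
  by (simp_all add: of_P_def of_form_def)

lemma of_P_simps:
  "a \<in> carrier P \<Longrightarrow> of_P q a \<in> carrier (Omega q)"
  "a \<in> carrier P \<Longrightarrow> b \<in> carrier P \<Longrightarrow> of_P q (a \<oplus> b) = of_P q a \<oplus>\<^bsub>Omega q\<^esub> of_P q b"
  "a \<in> carrier P \<Longrightarrow> of_P q (c \<odot> a) = c \<odot>\<^bsub>Omega q\<^esub> of_P q a"
  "a \<in> carrier P \<Longrightarrow> b \<in> carrier P \<Longrightarrow> of_P q (a \<otimes> b) = of_P q a \<otimes>\<^bsub>Omega q\<^esub> of_P q b"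
  "of_P q \<one> = \<one>\<^bsub>Omega q\<^esub>"
  by (simp_all add: of_P_eq tgen_rels ecls_simps tgen_closed InlI)

lemma of_form_simps:
  "m \<in> carrier PV.T \<Longrightarrow> of_form q m \<in> carrier (Omega q)"
  "m \<in> carrier PV.T \<Longrightarrow> n \<in> carrier PV.T \<Longrightarrow> of_form q (m \<oplus>\<^bsub>PV.T\<^esub> n) = of_form q m \<oplus>\<^bsub>Omega q\<^esub> of_form q n"
  "m \<in> carrier PV.T \<Longrightarrow> of_form q (c \<odot>\<^bsub>PV.T\<^esub> m) = c \<odot>\<^bsub>Omega q\<^esub> of_form q m"
  "a \<in> carrier P \<Longrightarrow> m \<in> carrier PV.T \<Longrightarrow> of_form q (lact q a m) = of_P q a \<otimes>\<^bsub>Omega q\<^esub> of_form q m"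
  "a \<in> carrier P \<Longrightarrow> m \<in> carrier PV.T \<Longrightarrow> of_form q (ract q m a) = of_form q m \<otimes>\<^bsub>Omega q\<^esub> of_P q a"
  by (simp_all add: of_form_eq of_P_eq tgen_rels ecls_simps tgen_closed InlI InrI)

lemma of_P_lin: "lin P (Omega q) (of_P q)" and of_form_lin: "lin PV.T (Omega q) (of_form q)"
  by (rule linI; simp add: of_P_simps of_form_simps)+

lemma null_list_relation:
  assumes "null_list gs"
  shows "lsum (Omega q) (\<lambda>(g, h). of_form q (calc_d q g) \<otimes>\<^bsub>Omega q\<^esub> of_form q (calc_d q h)) gs = \<zero>\<^bsub>Omega q\<^esub>"
proof -
  let ?t = "\<lambda>x. case x of (g, h) \<Rightarrow> tgen q (Inr (calc_d q g)) \<otimes>\<^bsub>TOmega q\<^esub> tgen q (Inr (calc_d q h))"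
  have cl: "?t x \<in> carrier (TOmega q)" if "x \<in> set gs" for x
    using that assms by (auto intro!: TO.m_closed tgen_closed)
  have L: "lin (TOmega q) (Omega q) (\<lambda>x. ecls x)" by (rule linI) (simp_all add: ecls_simps)
  have "lsum (TOmega q) ?t gs \<in> envelope_ideal q"
    unfolding env_eq using TO.genideal_self[OF env_gens_closed] assms by (auto simp: env_gens_def)
  then have "ecls (lsum (TOmega q) ?t gs) = \<zero>\<^bsub>Omega q\<^esub>"
    using EQ.coset_zero_iff[OF TO.lsum_closed[of gs ?t, OF cl]] by (simp add: Omega_eq)
  then have "lsum (Omega q) (\<lambda>x. ecls (?t x)) gs = \<zero>\<^bsub>Omega q\<^esub>"
    using lin_lsum[OF TO.cspace_axioms Om.cspace_axioms L, of gs ?t] cl by simp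
  moreover have "lsum (Omega q) (\<lambda>x. ecls (?t x)) gs =
    lsum (Omega q) (\<lambda>(g, h). of_form q (calc_d q g) \<otimes>\<^bsub>Omega q\<^esub> of_form q (calc_d q h)) gs"
    using conjunct1[OF assms] by (induction gs) (auto simp: lsum_def of_form_eq ecls_simps tgen_closed InrI)
  ultimately show ?thesis by simp
qed

text \<open>The universal property of the envelope: u and v respect the relations of the tensor
  algebra by linearity and bimodule compatibility, and the last assumption is the vanishing on the
  generators of \<open>envelope_ideal\<close>.\<close>

lemma Omega_hom:
  fixes B :: "'b calg"
  assumes B: "calgebra B" and u: "alghom P B u" and v: "lin PV.T B v"
    and l: "\<And>a m. a \<in> carrier P \<Longrightarrow> m \<in> carrier PV.T \<Longrightarrow> v (lact q a m) = u a \<otimes>\<^bsub>B\<^esub> v m"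
    and r: "\<And>a m. a \<in> carrier P \<Longrightarrow> m \<in> carrier PV.T \<Longrightarrow> v (ract q m a) = v m \<otimes>\<^bsub>B\<^esub> u a"
    and e: "\<And>gs. null_list gs \<Longrightarrow> lsum B (\<lambda>(g, h). v (calc_d q g) \<otimes>\<^bsub>B\<^esub> v (calc_d q h)) gs = \<zero>\<^bsub>B\<^esub>"
  obtains \<Theta> where "alghom (Omega q) B \<Theta>" "\<And>p. p \<in> carrier P \<Longrightarrow> \<Theta> (of_P q p) = u p"
    "\<And>m. m \<in> carrier PV.T \<Longrightarrow> \<Theta> (of_form q m) = v m"
proof -
  interpret B: calgebra B by fact
  define g where "g x = (case x of Inl p \<Rightarrow> u p | Inr m \<Rightarrow> v m)" for x
  have ucl: "p \<in> carrier P \<Longrightarrow> u p \<in> carrier B" for p using lin_closed[OF alghom_lin[OF u]] .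
  have vcl: "m \<in> carrier PV.T \<Longrightarrow> v m \<in> carrier B" for m using lin_closed[OF v] .
  have g: "g \<in> Gs \<rightarrow> carrier B" using ucl vcl by (auto simp: g_def)
  note H = B.alghom_free_eval[OF g]
  note L = alghom_lin[OF H]
  have var: "p \<in> carrier P \<Longrightarrow> free_eval B g (free_var (Inl p)) = u p" "m \<in> carrier PV.T \<Longrightarrow> free_eval B g (free_var (Inr m)) = v m" for p m
    using ucl vcl by (simp_all add: B.free_eval_var g_def)
  have ev: "x \<in> carrier (free_alg Gs) \<Longrightarrow> y \<in> carrier (free_alg Gs) \<Longrightarrow> free_eval B g (x - y) = free_eval B g x \<ominus>\<^bsub>B\<^esub> free_eval B g y"
    "x \<in> carrier (free_alg Gs) \<Longrightarrow> free_eval B g (pm_scale c x) = c \<odot>\<^bsub>B\<^esub> free_eval B g x"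
    "x \<in> carrier (free_alg Gs) \<Longrightarrow> y \<in> carrier (free_alg Gs) \<Longrightarrow> free_eval B g (x * y) = free_eval B g x \<otimes>\<^bsub>B\<^esub> free_eval B g y"
    "free_eval B g 1 = \<one>\<^bsub>B\<^esub>" for x y c
    using lin_minus[OF FG.cspace_axioms B.cspace_axioms L] lin_smult[OF L] alghom_mult[OF H] alghom_one[OF H]
    by (simp_all only: FG_minus free_alg_simps(2-6))
  note cl = Inl_closed Inr_closed free_alg_minus_closed free_alg_scale_closed free_alg_mult_closed free_alg_one_closed
  have relz: "free_eval B g s = \<zero>\<^bsub>B\<^esub>" if "s \<in> Rel" for s
    using that unfolding bimodule_rel_def
    by (elim UnE CollectE singletonE exE conjE; hypsubst)
       (simp_all only: ev cl var a_closed smult_closed m_closed one_closed PVT.a_closed PVT.smult_closed lact_simps(1) ract_simps(1)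
         lin_add[OF alghom_lin[OF u]] lin_smult[OF alghom_lin[OF u]] alghom_mult[OF u] alghom_one[OF u] lin_add[OF v] lin_smult[OF v] l r
         ucl vcl B.add_minus_minus B.minus_self B.smult_closed B.m_closed B.one_closed)
  have n1: "free_eval B g w = \<zero>\<^bsub>B\<^esub>" if "w \<in> BI" for w
    using that FG.hom_vanishes_on_Idl[OF B H Rel_closed relz] by (simp add: bimodule_ideal_def)
  define h where "h = descend (free_eval B g)"
  have h: "alghom (TOmega q) B h" unfolding h_def TOmega_eq by (rule TQ.alghom_descend[OF B H n1])
  have hgen: "h (tgen q x) = g x" if "x \<in> Gs" for x
    unfolding h_def tgen_eq using TQ.descend_coset[OF B.cspace_axioms L n1 free_var_closed[OF that]]
    by (simp only: B.free_eval_var[of g x, OF funcset_mem[OF g that]])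
  have envz: "h s = \<zero>\<^bsub>B\<^esub>" if s: "s \<in> env_gens" for s
  proof -
    obtain gs where gs: "null_list gs" "s = lsum (TOmega q) (\<lambda>(g, h). tgen q (Inr (calc_d q g)) \<otimes>\<^bsub>TOmega q\<^esub> tgen q (Inr (calc_d q h))) gs"
      using s by (auto simp: env_gens_def)
    have "h s = lsum B (\<lambda>x. h (case x of (g, h) \<Rightarrow> tgen q (Inr (calc_d q g)) \<otimes>\<^bsub>TOmega q\<^esub> tgen q (Inr (calc_d q h)))) gs"
      unfolding gs(2) using gs(1) by (intro conjunct1[OF lin_lsum[OF TO.cspace_axioms B.cspace_axioms alghom_lin[OF h]]])
        (auto intro!: TO.m_closed tgen_closed)
    also have "\<dots> = lsum B (\<lambda>(g, h). v (calc_d q g) \<otimes>\<^bsub>B\<^esub> v (calc_d q h)) gs"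
      using gs(1)[THEN conjunct1] by (induction gs) (auto simp: lsum_def alghom_mult[OF h] tgen_closed InrI hgen g_def)
    finally show ?thesis using e[OF gs(1)] by simp
  qed
  have n2: "h w = \<zero>\<^bsub>B\<^esub>" if "w \<in> envelope_ideal q" for w
    using that TO.hom_vanishes_on_Idl[OF B h env_gens_closed envz] by (simp add: env_eq)
  show ?thesis
  proof
    show "alghom (Omega q) B (descend h)" unfolding Omega_eq by (rule EQ.alghom_descend[OF B h n2])
    show "descend h (of_P q p) = u p" if "p \<in> carrier P" for p
      unfolding of_P_eq using EQ.descend_coset[OF B.cspace_axioms alghom_lin[OF h] n2 tgen_closed] hgen[of "Inl p"] that
      by (simp add: InlI g_def)
    show "descend h (of_form q m) = v m" if "m \<in> carrier PV.T" for m
      unfolding of_form_eq using EQ.descend_coset[OF B.cspace_axioms alghom_lin[OF h] n2 tgen_closed] hgen[of "Inr m"] that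
      by (simp add: InrI g_def)
  qed
qed

end

subsection \<open>A faithful model in degrees at most two\<close>

text \<open>The blocks \<open>B0\<close>, \<open>B1 i\<close>, \<open>B2\<close> hold the coefficients of \<open>1\<close>, of the three invariant one-forms
  and of the volume form. All products that involve \<open>\<eta>\<^sub>3\<close> are sent to zero; this is consistent because
  the operator combination in the \<open>B2\<close> block kills the relations of the envelope.\<close>

datatype blk = B0 | B1 ix | B2

definition coords :: "blk \<Rightarrow> (blk \<times> lat \<Rightarrow> complex) \<Rightarrow> lat \<Rightarrow> complex" where
  "coords b f = (\<lambda>j. f (b, j))"

context quantum_su
begin

text \<open>The lattice point (t, k, l) carries the weight \<open>t + k - l\<close> of its monomial,
  so this diagonal operator implements \<open>sig i\<close> in the lattice representation; see
  \<open>sigV_rho\<close>.\<close>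

definition sigV :: "ix \<Rightarrow> (lat \<Rightarrow> complex) \<Rightarrow> lat \<Rightarrow> complex" where
  "sigV i f = (\<lambda>(t, k, l). sc i (t + k - l) * f (t, k, l))"

lemma rho_linear:
  assumes "x \<in> carrier P"
  shows "rho x (\<lambda>j. f j + g j) = (\<lambda>j. rho x f j + rho x g j)" "rho x (\<lambda>j. c * f j) = (\<lambda>j. c * rho x f j)"
    "rho x (\<lambda>j. 0) = (\<lambda>j. 0)" "rho x (\<lambda>j. f j - c * g j) = (\<lambda>j. rho x f j - c * rho x g j)"
proof -
  have x: "rho x \<in> carrier end_alg" using assms by (rule rho_simps)
  have add: "rho x (\<lambda>j. f j + g j) = (\<lambda>j. rho x f j + rho x g j)" and scale: "rho x (\<lambda>j. c * f j) = (\<lambda>j. c * rho x f j)" for f g c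
    using x by (simp_all add: end_alg_carrier)
  show "rho x (\<lambda>j. f j + g j) = (\<lambda>j. rho x f j + rho x g j)" "rho x (\<lambda>j. c * f j) = (\<lambda>j. c * rho x f j)"
    by (rule add, rule scale)
  show "rho x (\<lambda>j. 0) = (\<lambda>j. 0)" using x by (rule end_alg_zero_arg)
  have "(\<lambda>j. f j - c * g j) = (\<lambda>j. f j + (- c) * g j)" by simp
  then show "rho x (\<lambda>j. f j - c * g j) = (\<lambda>j. rho x f j - c * rho x g j)"
    using add[of f "\<lambda>j. (- c) * g j"] scale[of "- c" g] by simp
qed

lemma rho_zero: "rho \<zero> = (\<lambda>f j. 0)"
  using rho_simps(3)[of \<zero> 0] by simp

lemma sigV_lin: "sigV i (\<lambda>j. f j + g j) = (\<lambda>j. sigV i f j + sigV i g j)" "sigV i (\<lambda>j. c * f j) = (\<lambda>j. c * sigV i f j)"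
  "sigV i (\<lambda>j. 0) = (\<lambda>j. 0)" "sigV i (\<lambda>j. f j - c * g j) = (\<lambda>j. sigV i f j - c * sigV i g j)"
  by (auto simp: sigV_def algebra_simps)

lemma sc_diff: "sc i (m - n) = sc i m / sc i n" and sc_uminus: "sc i (- n) = 1 / sc i n" and sc_nonzero [simp]: "sc i n \<noteq> 0"
proof -
  show nz: "sc i n \<noteq> 0" for n by (simp add: sc_def)
  show "sc i (m - n) = sc i m / sc i n" using sc_add[of i "m - n" n] nz[of n] by (simp add: field_simps)
  show "sc i (- n) = 1 / sc i n" using sc_add[of i "- n" n] nz[of n] by (simp add: field_simps)
qed

lemma sigV_rho: "p \<in> carrier P \<Longrightarrow> sigV i (rho p f) = rho (sig i p) (sigV i f)"
proof (induction arbitrary: f rule: induct)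
  case zero
  then show ?case by (simp add: rho_zero sigV_def)
next
  case one
  then show ?case by (simp add: rho_simps)
next
  case (add x y)
  then show ?case by (simp add: rho_simps sig_add sigV_lin)
next
  case (scale c x)
  then show ?case by (simp add: rho_simps sig_smult sigV_lin)
next
  case (mult g x)
  have gen: "sigV i (rho_gen Q g h) = (\<lambda>j. sc i (wt g) * rho_gen Q g (sigV i h) j)" for h
    by (cases g) (auto simp: sigV_def fun_eq_iff sc_add sc_diff sc_uminus field_simps)
  have "sigV i (rho (suq_gen q g \<otimes> x) f) = (\<lambda>j. sc i (wt g) * rho_gen Q g (sigV i (rho x f)) j)"
    using mult by (simp add: rho_simps gen)
  then show ?case using mult by (simp add: rho_simps sig_mult sig_weight_gen)
qed

lemma sigV_surj: "sigV i (\<lambda>(t, k, l). f (t, k, l) / sc i (t + k - l)) = f"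
by (auto simp: sigV_def)

lemma rho_sigV_faithful: "p \<in> carrier P \<Longrightarrow> (\<And>f. rho p (sigV i f) = (\<lambda>j. 0)) \<Longrightarrow> p = \<zero>"
proof (rule rho_faithful)
  assume z: "\<And>f. rho p (sigV i f) = (\<lambda>j. 0)"
  show "rho p = (\<lambda>f i. 0)"
    using z[of "\<lambda>(t, k, l). _ (t, k, l) / sc i (t + k - l)"] unfolding sigV_surj by (rule ext)
qed

definition model_P :: "suq \<Rightarrow> (blk \<times> lat \<Rightarrow> complex) \<Rightarrow> (blk \<times> lat \<Rightarrow> complex)" where
  "model_P p f = (\<lambda>(b, j). rho p (coords b f) j)"

text \<open>A form raises the block degree by one. In the passage to \<open>B2\<close> the product
  of \<open>\<eta>\<^sub>-\<close> and \<open>\<eta>\<^sub>+\<close> acts as the unit volume up to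
  twists, and the reversed product as \<open>- q\<^sup>2\<close> times it, which anticipates
  \<open>E_rels\<close>.\<close>

definition model_form :: "form1 \<Rightarrow> (blk \<times> lat \<Rightarrow> complex) \<Rightarrow> (blk \<times> lat \<Rightarrow> complex)" where
  "model_form w f = (\<lambda>(b, j). case b of B0 \<Rightarrow> 0 | B1 i \<Rightarrow> rho (X i w) (sigV i (coords B0 f)) j
     | B2 \<Rightarrow> rho (X Imi w) (sigV Imi (coords (B1 Ipl) f)) j - Q^2 * rho (X Ipl w) (sigV Ipl (coords (B1 Imi) f)) j)"

lemma coords_lin: "coords b (\<lambda>i. f i + g i) = (\<lambda>j. coords b f j + coords b g j)" "coords b (\<lambda>i. c * f i) = (\<lambda>j. c * coords b f j)"
  by (simp_all add: coords_def)

lemma X_closed [simp]: "w \<in> carrier PV.T \<Longrightarrow> X i w \<in> carrier P"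
  by (rule X_simps)

lemma coords_model_P: "coords b (model_P p f) = rho p (coords b f)"
  by (simp add: coords_def model_P_def)

lemma coords_model_form: "coords B0 (model_form w f) = (\<lambda>j. 0)" "coords (B1 i) (model_form w f) = rho (X i w) (sigV i (coords B0 f))"
  "coords B2 (model_form w f) = (\<lambda>j. rho (X Imi w) (sigV Imi (coords (B1 Ipl) f)) j - Q^2 * rho (X Ipl w) (sigV Ipl (coords (B1 Imi) f)) j)"
  by (simp_all add: coords_def model_form_def)

lemma coords_eqI: "(\<And>b. coords b f = coords b g) \<Longrightarrow> f = g"
  by (auto simp: coords_def fun_eq_iff)

lemma model_P_closed: "p \<in> carrier P \<Longrightarrow> model_P p \<in> carrier end_alg"
  unfolding end_alg_carrier by (auto simp: model_P_def coords_lin rho_linear fun_eq_iff)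

lemma model_form_closed: "w \<in> carrier PV.T \<Longrightarrow> model_form w \<in> carrier end_alg"
  unfolding end_alg_carrier by (auto simp: model_form_def coords_lin sigV_lin rho_linear fun_eq_iff algebra_simps split: blk.split)

lemma model_P_hom: "alghom P end_alg model_P"
proof -
  have "lin P end_alg model_P"
    by (rule linI) (auto simp: model_P_closed, auto simp: model_P_def rho_simps fun_eq_iff)
  moreover have "model_P (x \<otimes> y) = (\<lambda>f. model_P x (model_P y f))" if "x \<in> carrier P" "y \<in> carrier P" for x y
    using that by (intro ext[of _ _, OF coords_eqI]) (simp add: coords_model_P rho_simps)
  moreover have "model_P \<one> = (\<lambda>f. f)" by (auto simp: model_P_def rho_simps coords_def)
  ultimately show ?thesis by (simp add: alghom_def)
qed

lemma model_form_lin: "lin PV.T end_alg model_form"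
  by (rule linI) (auto simp: model_form_closed, auto simp: model_form_def X_simps rho_simps fun_eq_iff algebra_simps split: blk.split)

lemma model_form_lact: "a \<in> carrier P \<Longrightarrow> m \<in> carrier PV.T \<Longrightarrow> model_form (lact q a m) f = model_P a (model_form m f)"
proof (rule coords_eqI)
  fix b assume am: "a \<in> carrier P" "m \<in> carrier PV.T"
  then show "coords b (model_form (lact q a m) f) = coords b (model_P a (model_form m f))"
    by (cases b) (simp_all add: coords_model_P coords_model_form X_lact rho_simps rho_linear)
qed

lemma model_form_ract: "a \<in> carrier P \<Longrightarrow> m \<in> carrier PV.T \<Longrightarrow> model_form (ract q m a) f = model_form m (model_P a f)"
proof (rule coords_eqI)
  fix b assume am: "a \<in> carrier P" "m \<in> carrier PV.T"
  then show "coords b (model_form (ract q m a) f) = coords b (model_form m (model_P a f))"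
    by (cases b) (simp_all add: coords_model_P coords_model_form X_ract rho_simps sigV_rho)
qed

lemma sig_pm: "x \<in> carrier P \<Longrightarrow> sig Imi x = sig Ipl x"
proof (rule hom_eqI'[OF calgebra_axioms sig_hom sig_hom])
  show "sig Imi (suq_gen q g) = sig Ipl (suq_gen q g)" for g by (cases g) simp_all
qed

text \<open>The coefficient in the block \<open>B2\<close> of the product of dg and dh, computed
  with the twisted commutation of forms and functions.\<close>

definition curv :: "suq \<Rightarrow> suq \<Rightarrow> suq" where
  "curv g h = dd Imi g \<otimes> sig Imi (dd Ipl h) \<ominus> Q^2 \<odot> (dd Ipl g \<otimes> sig Ipl (dd Imi h))"

lemma curv_closed [simp]: "g \<in> carrier P \<Longrightarrow> h \<in> carrier P \<Longrightarrow> curv g h \<in> carrier P"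
  by (simp add: curv_def)

text \<open>The Leibniz rule for \<open>g dd Ipl h\<close> and \<open>g dd Imi h\<close> produces
  \<open>curv\<close> plus g times second derivatives of h, and the commutator replaces the latter
  by \<open>dd Ith h\<close>. The right hand side involves g and h only through the coordinates of g
  dh, which is why it vanishes when summed over a null list.\<close>

lemma curv_eq: "g \<in> carrier P \<Longrightarrow> h \<in> carrier P \<Longrightarrow>
  curv g h = dd Imi (g \<otimes> dd Ipl h) \<ominus> Q^2 \<odot> dd Ipl (g \<otimes> dd Imi h) \<ominus> (1 + Q^2) \<odot> (g \<otimes> dd Ith h)"
  by (rule eq_by_functionals) (simp_all add: curv_def dd_mult fnl dd_commutator r_distr smult_r_distr)

lemma null_list_iff:
  assumes "set gs \<subseteq> carrier P \<times> carrier P"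
  shows "lsum PV.T (\<lambda>(g, h). lact q g (calc_d q h)) gs = \<zero>\<^bsub>PV.T\<^esub> \<longleftrightarrow> (\<forall>i. lsum P (\<lambda>(g, h). g \<otimes> dd i h) gs = \<zero>)"
proof -
  let ?w = "lsum PV.T (\<lambda>(g, h). lact q g (calc_d q h)) gs"
  have w: "?w \<in> carrier PV.T \<and> (\<forall>i. X i ?w = lsum P (\<lambda>(g, h). g \<otimes> dd i h) gs)"
    using assms by (induction gs) (auto simp: lsum_def X_simps X_lact X_calc_d lact_simps(1))
  have "?w = \<zero>\<^bsub>PV.T\<^esub> \<longleftrightarrow> (\<forall>i. X i ?w = \<zero>)"
    using w form_eqI[of ?w "\<zero>\<^bsub>PV.T\<^esub>"] by (auto simp: X_simps)
  then show ?thesis using w by simp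
qed

lemma curv_null:
  assumes "null_list gs" shows "lsum P (\<lambda>(g, h). curv g h) gs = \<zero>"
proof -
  let ?S = "\<lambda>i. lsum P (\<lambda>(g, h). g \<otimes> dd i h) gs"
  have gs: "set gs \<subseteq> carrier P \<times> carrier P" using assms ..
  have "?S i \<in> carrier P \<and> lsum P (\<lambda>(g, h). curv g h) gs \<in> carrier P" for i
    using gs by (induction gs) (auto simp: lsum_def)
  have "(\<forall>i. ?S i \<in> carrier P) \<and> lsum P (\<lambda>(g, h). curv g h) gs \<in> carrier P \<and> lsum P (\<lambda>(g, h). curv g h) gs =
    dd Imi (?S Ipl) \<ominus> Q^2 \<odot> dd Ipl (?S Imi) \<ominus> (1 + Q^2) \<odot> ?S Ith"
    using gs
  proof (induction gs)
    case Nil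
    then show ?case by (simp add: lsum_def a_minus_def minus_eq_smult)
  next
    case (Cons x gs)
    obtain g h where x: "x = (g, h)" "g \<in> carrier P" "h \<in> carrier P" using Cons(2) by auto
    let ?S = "\<lambda>i. lsum P (\<lambda>(g, h). g \<otimes> dd i h) gs" and ?C = "lsum P (\<lambda>(g, h). curv g h) gs"
    have IH: "?S i \<in> carrier P" "?C \<in> carrier P" "?C = dd Imi (?S Ipl) \<ominus> Q^2 \<odot> dd Ipl (?S Imi) \<ominus> (1 + Q^2) \<odot> ?S Ith" for i
      using Cons by auto
    have "curv g h \<oplus> ?C = dd Imi (g \<otimes> dd Ipl h \<oplus> ?S Ipl) \<ominus> Q^2 \<odot> dd Ipl (g \<otimes> dd Imi h \<oplus> ?S Imi) \<ominus> (1 + Q^2) \<odot> (g \<otimes> dd Ith h \<oplus> ?S Ith)"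
      unfolding IH(3) curv_eq[OF x(2,3)]
      by (rule eq_by_functionals) (use IH(1) x in \<open>simp_all add: fnl dd_add algebra_simps\<close>)
    then show ?case using IH(1,2) x by (simp add: lsum_def)
  qed
  moreover have "?S i = \<zero>" for i using assms null_list_iff[OF gs] by simp
  ultimately show ?thesis by (simp add: a_minus_def minus_eq_smult)
qed

lemma vM_model_form:
  assumes "g \<in> carrier P" "h \<in> carrier P"
  shows "coords b (model_form (calc_d q g) (model_form (calc_d q h) f)) =
    (case b of B2 \<Rightarrow> rho (curv g h) (sigV Ipl (sigV Ipl (coords B0 f))) | _ \<Rightarrow> (\<lambda>j. 0))"
proof -
  have e: "sigV Imi = sigV Ipl" by (auto simp: fun_eq_iff sigV_def sc_def)
  have m: "rho (x \<ominus> c \<odot> y) f = (\<lambda>j. rho x f j - c * rho y f j)" if "x \<in> carrier P" "y \<in> carrier P" for x y c f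
    using that by (simp add: a_minus_def minus_eq_smult rho_simps smult_assoc[symmetric])
  show ?thesis
    using assms sigV_rho[of "dd Ipl h" Ipl] sigV_rho[of "dd Imi h" Ipl]
    by (cases b) (simp_all add: coords_model_form X_calc_d rho_linear sigV_lin curv_def m rho_simps e sig_pm)
qed

text \<open>Products of two exact forms act only from \<open>B0\<close> to \<open>B2\<close>,
  through \<open>curv\<close>; so the vanishing on null lists required by \<open>Omega_hom\<close>
  is \<open>curv_null\<close>.\<close>

lemma model:
  obtains \<Theta> where "alghom (Omega q) end_alg \<Theta>" "\<And>p. p \<in> carrier P \<Longrightarrow> \<Theta> (of_P q p) = model_P p"
    "\<And>m. m \<in> carrier PV.T \<Longrightarrow> \<Theta> (of_form q m) = model_form m"
proof (rule Omega_hom[OF calgebra_end_alg model_P_hom model_form_lin])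
  show "model_form (lact q a m) = model_P a \<otimes>\<^bsub>end_alg\<^esub> model_form m" "model_form (ract q m a) = model_form m \<otimes>\<^bsub>end_alg\<^esub> model_P a"
    if "a \<in> carrier P" "m \<in> carrier PV.T" for a m
    using that by (auto simp: model_form_lact model_form_ract)
  fix gs assume gs: "null_list gs"
  have "coords b (lsum end_alg (\<lambda>(g, h). model_form (calc_d q g) \<otimes>\<^bsub>end_alg\<^esub> model_form (calc_d q h)) gs f) =
     (case b of B2 \<Rightarrow> rho (lsum P (\<lambda>(g, h). curv g h) gs) (sigV Ipl (sigV Ipl (coords B0 f))) | _ \<Rightarrow> (\<lambda>j. 0))
     \<and> lsum P (\<lambda>(g, h). curv g h) gs \<in> carrier P" for b f
    using conjunct1[OF gs]
  proof (induction gs)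
    case Nil
    then show ?case by (simp add: lsum_def coords_def rho_zero split: blk.split)
  next
    case (Cons x gs)
    obtain g h where x: "x = (g, h)" "g \<in> carrier P" "h \<in> carrier P" using Cons(2) by auto
    then show ?case using Cons vM_model_form[OF x(2,3), of b f]
      by (auto simp: lsum_def rho_simps coords_lin split: blk.splits)
  qed
  then show "lsum end_alg (\<lambda>(g, h). model_form (calc_d q g) \<otimes>\<^bsub>end_alg\<^esub> model_form (calc_d q h)) gs = \<zero>\<^bsub>end_alg\<^esub>"
    unfolding curv_null[OF gs]
    by (intro ext[OF coords_eqI]) (simp add: rho_zero coords_def[of _ "\<lambda>i. 0"] split: blk.split)
qed (use that in blast)

end

subsection \<open>Two-forms\<close>

context quantum_su
begin

definition inv_form :: "ix \<Rightarrow> form1" where "inv_form i = PV.pt \<one> (pie i)"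
definition eta :: "ix \<Rightarrow> tform set" where "eta i = of_form q (inv_form i)"
abbreviation "E i j \<equiv> eta i \<otimes>\<^bsub>Omega q\<^esub> eta j"

lemma inv_form_closed [simp]: "inv_form i \<in> carrier PV.T"
  by (simp add: inv_form_def)

lemma X_inv_form: "X j (inv_form i) = (if j = i then \<one> else \<zero>)"
  by (simp add: inv_form_def X_simps chibar_pie)

lemma eta_closed [simp]: "eta i \<in> carrier (Omega q)"
  by (simp add: eta_def of_form_simps)

lemmas [simp] = of_P_simps(1) of_form_simps(1)

lemma eta_plus_eq: "eta_plus q = eta Ipl"
  by (simp add: eta_plus_def eta_def inv_form_def pie_def ebas_def)

lemma eta_minus_eq: "eta_minus q = eta Imi"
  by (simp add: eta_minus_def eta_def inv_form_def pie_def ebas_def qpi_simps of_form_simps(3))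

lemma of_form_expand: "w \<in> carrier PV.T \<Longrightarrow> of_form q w = of_P q (X Ith w) \<otimes>\<^bsub>Omega q\<^esub> eta Ith \<oplus>\<^bsub>Omega q\<^esub>
    (of_P q (X Ipl w) \<otimes>\<^bsub>Omega q\<^esub> eta Ipl \<oplus>\<^bsub>Omega q\<^esub> of_P q (X Imi w) \<otimes>\<^bsub>Omega q\<^esub> eta Imi)"
proof -
  assume w: "w \<in> carrier PV.T"
  have l: "PV.pt x (pie i) = lact q x (inv_form i)" if "x \<in> carrier P" for x i
    using that by (simp add: inv_form_def lact_pure)
  have "of_form q w = of_form q (frm (X Ith w) (X Ipl w) (X Imi w))" using form_expand[OF w] by simp
  then show ?thesis using w
    by (simp add: frm_def of_form_simps(2)) (simp add: l of_form_simps(4) eta_def)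
qed

lemma eta_comm: "p \<in> carrier P \<Longrightarrow> eta i \<otimes>\<^bsub>Omega q\<^esub> of_P q p = of_P q (sig i p) \<otimes>\<^bsub>Omega q\<^esub> eta i"
proof -
  assume p: "p \<in> carrier P"
  have "ract q (inv_form i) p = lact q (sig i p) (inv_form i)"
    by (rule form_eqI) (use p in \<open>simp_all add: ract_simps(1) lact_simps(1) X_ract X_lact X_inv_form\<close>)
  then show ?thesis using p of_form_simps(4)[of "sig i p" "inv_form i"] of_form_simps(5)[of p "inv_form i"] by (simp add: eta_def)
qed

lemma mono_prod: "x \<in> carrier P \<Longrightarrow> y \<in> carrier P \<Longrightarrow>
  (of_P q x \<otimes>\<^bsub>Omega q\<^esub> eta i) \<otimes>\<^bsub>Omega q\<^esub> (of_P q y \<otimes>\<^bsub>Omega q\<^esub> eta j) = of_P q (x \<otimes> sig i y) \<otimes>\<^bsub>Omega q\<^esub> E i j"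
proof -
  assume xy: "x \<in> carrier P" "y \<in> carrier P"
  have "(of_P q x \<otimes>\<^bsub>Omega q\<^esub> eta i) \<otimes>\<^bsub>Omega q\<^esub> (of_P q y \<otimes>\<^bsub>Omega q\<^esub> eta j) =
    of_P q x \<otimes>\<^bsub>Omega q\<^esub> ((eta i \<otimes>\<^bsub>Omega q\<^esub> of_P q y) \<otimes>\<^bsub>Omega q\<^esub> eta j)" using xy by (simp add: Om.m_assoc)
  then show ?thesis using xy by (simp add: eta_comm of_P_simps(4) Om.m_assoc)
qed

section \<open>Two-forms as coefficient matrices\<close>

definition sum_ix :: "(ix \<Rightarrow> tform set) \<Rightarrow> tform set" where
  "sum_ix f = f Ith \<oplus>\<^bsub>Omega q\<^esub> (f Ipl \<oplus>\<^bsub>Omega q\<^esub> f Imi)"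

definition W :: "(ix \<Rightarrow> ix \<Rightarrow> suq) \<Rightarrow> tform set" where
  "W c = sum_ix (\<lambda>i. sum_ix (\<lambda>j. of_P q (c i j) \<otimes>\<^bsub>Omega q\<^esub> E i j))"

lemma W_add: "(\<And>i j. c i j \<in> carrier P) \<Longrightarrow> (\<And>i j. c' i j \<in> carrier P) \<Longrightarrow>
  W (\<lambda>i j. c i j \<oplus> c' i j) = W c \<oplus>\<^bsub>Omega q\<^esub> W c'"
  by (rule Om.eq_by_functionals) (simp_all add: W_def sum_ix_def of_P_simps(2) Om.l_distr fnl)

lemma W_left: "x \<in> carrier P \<Longrightarrow> (\<And>i j. c i j \<in> carrier P) \<Longrightarrow>
  W (\<lambda>i j. x \<otimes> c i j) = of_P q x \<otimes>\<^bsub>Omega q\<^esub> W c"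
  by (simp add: W_def sum_ix_def of_P_simps(4) Om.r_distr Om.m_assoc)

lemma of_P_zero [simp]: "of_P q \<zero> = \<zero>\<^bsub>Omega q\<^esub>"
  using lin_zero[OF cspace_axioms Om.cspace_axioms of_P_lin] .

lemma W_zero: "W (\<lambda>i j. \<zero>) = \<zero>\<^bsub>Omega q\<^esub>"
  by (simp add: W_def sum_ix_def)

lemma prod_W: "w \<in> carrier PV.T \<Longrightarrow> w' \<in> carrier PV.T \<Longrightarrow>
  of_form q w \<otimes>\<^bsub>Omega q\<^esub> of_form q w' = W (\<lambda>i j. X i w \<otimes> sig i (X j w'))"
  by (rule Om.eq_by_functionals)
    (simp_all add: of_form_expand[of w] of_form_expand[of w'] W_def sum_ix_def mono_prod Om.l_distr Om.r_distr fnl del: of_form_simps(1))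

text \<open>The coefficient matrix of the sum of products dg dh over a list, after all functions
  have been moved to the left; see \<open>dlist_W\<close>.\<close>

definition cc :: "(suq \<times> suq) list \<Rightarrow> ix \<Rightarrow> ix \<Rightarrow> suq" where
  "cc gs i j = lsum P (\<lambda>(g, h). dd i g \<otimes> sig i (dd j h)) gs"

lemma cc_closed: "set gs \<subseteq> carrier P \<times> carrier P \<Longrightarrow> cc gs i j \<in> carrier P"
  unfolding cc_def by (rule lsum_closed) auto

definition dlist :: "(suq \<times> suq) list \<Rightarrow> tform set" where
  "dlist gs = lsum (Omega q) (\<lambda>(g, h). of_form q (calc_d q g) \<otimes>\<^bsub>Omega q\<^esub> of_form q (calc_d q h)) gs"

lemma dlist_W: "set gs \<subseteq> carrier P \<times> carrier P \<Longrightarrow> dlist gs = W (cc gs)"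
proof (induction gs)
  case Nil
  then show ?case using W_zero by (simp add: dlist_def cc_def[abs_def] lsum_def)
next
  case (Cons x gs)
  obtain g h where x: "x = (g, h)" "g \<in> carrier P" "h \<in> carrier P" using Cons(2) by auto
  have "cc (x # gs) = (\<lambda>i j. (dd i g \<otimes> sig i (dd j h)) \<oplus> cc gs i j)"
    by (intro ext) (simp add: cc_def lsum_def x)
  moreover have "dlist (x # gs) = W (\<lambda>i j. dd i g \<otimes> sig i (dd j h)) \<oplus>\<^bsub>Omega q\<^esub> dlist gs"
    using x by (simp add: dlist_def lsum_def prod_W X_calc_d)
  ultimately show ?case using Cons x cc_closed[of gs] by (simp add: W_add)
qed

lemma null_W:
  assumes "set gs \<subseteq> carrier P \<times> carrier P" "\<And>i. lsum P (\<lambda>(g, h). g \<otimes> dd i h) gs = \<zero>"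
  shows "W (cc gs) = \<zero>\<^bsub>Omega q\<^esub>"
  using null_list_relation[of gs] null_list_iff[OF assms(1)] assms dlist_W[OF assms(1)] by (simp add: dlist_def)

text \<open>The lists express that \<open>\<eta>\<^sub>- p = s p \<eta>\<^sub>-\<close> and \<open>\<eta>\<^sub>+ p = s p \<eta>\<^sub>+\<close>, where
  \<open>\<eta>\<^sub>- = - \<gamma>\<^sup>* d\<alpha>\<^sup>* + q \<alpha>\<^sup>* d\<gamma>\<^sup>*\<close> and \<open>\<eta>\<^sub>+ = - q \<gamma> d\<alpha> + \<alpha> d\<gamma>\<close>.\<close>

definition minus_list :: "suq \<Rightarrow> complex \<Rightarrow> (suq \<times> suq) list" where
  "minus_list p s = [((-1) \<odot> ga', al' \<otimes> p), (Q \<odot> al', ga' \<otimes> p), (s \<odot> (p \<otimes> ga'), al'), ((- s * Q) \<odot> (p \<otimes> al'), ga')]"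

definition plus_list :: "suq \<Rightarrow> complex \<Rightarrow> (suq \<times> suq) list" where
  "plus_list p s = [((- Q) \<odot> ga, al \<otimes> p), (al, ga \<otimes> p), ((s * Q) \<odot> (p \<otimes> ga), al), ((- s) \<odot> (p \<otimes> al), ga)]"

lemmas list_simps = minus_list_def plus_list_def lsum_def dd_mult dd_smult dd_add nf fnl sig_add sig_mult sig_smult

lemma Q_pow: "Q^2 = Q * Q" "Q^3 = Q * (Q * Q)" "Q^4 = Q * (Q * (Q * Q))" "Q^5 = Q * (Q * (Q * (Q * Q)))"
  "Q^6 = Q * (Q * (Q * (Q * (Q * Q))))" "Q^8 = Q * (Q * (Q * (Q * (Q * (Q * (Q * Q))))))"
  "Q^10 = Q * (Q * (Q * (Q * (Q * (Q * (Q * (Q * (Q * Q))))))))"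
  by (simp_all add: numeral_eq_Suc)

lemma minus_list_null: "lsum P (\<lambda>(g, h). g \<otimes> dd i h) (minus_list (suq_gen q g) (sc Imi (wt g))) = \<zero>"
  by (rule eq_by_functionals; cases i; cases g; simp add: list_simps sc_def; (simp add: field_simps Q_pow)?)

lemma plus_list_null: "g = GenAlpha \<or> g = GenGamma \<Longrightarrow> lsum P (\<lambda>(g, h). g \<otimes> dd i h) (plus_list (suq_gen q g) (sc Ipl (wt g))) = \<zero>"
  by (rule eq_by_functionals; cases i; cases g; simp add: list_simps sc_def; (simp add: field_simps Q_pow)?)

lemma minus_list_closed: "set (minus_list (suq_gen q g) s) \<subseteq> carrier P \<times> carrier P" and plus_list_closed: "set (plus_list (suq_gen q g) s) \<subseteq> carrier P \<times> carrier P"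
  by (simp_all add: minus_list_def plus_list_def)

lemma W_minus_list: "W (cc (minus_list al (1 / Q))) = \<zero>\<^bsub>Omega q\<^esub>" "W (cc (minus_list ga (1 / Q))) = \<zero>\<^bsub>Omega q\<^esub>"
  "W (cc (minus_list al' Q)) = \<zero>\<^bsub>Omega q\<^esub>" "W (cc (minus_list ga' Q)) = \<zero>\<^bsub>Omega q\<^esub>"
  and W_plus_list: "W (cc (plus_list al (1 / Q))) = \<zero>\<^bsub>Omega q\<^esub>" "W (cc (plus_list ga (1 / Q))) = \<zero>\<^bsub>Omega q\<^esub>"
proof -
  have "sc Imi (wt GenAlpha) = 1 / Q" "sc Imi (wt GenGamma) = 1 / Q" "sc Imi (wt GenAlphaStar) = Q" "sc Imi (wt GenGammaStar) = Q"
    "sc Ipl (wt GenAlpha) = 1 / Q" "sc Ipl (wt GenGamma) = 1 / Q"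
    by (simp_all add: sc_def power_int_minus field_simps)
  then show "W (cc (minus_list al (1 / Q))) = \<zero>\<^bsub>Omega q\<^esub>" "W (cc (minus_list ga (1 / Q))) = \<zero>\<^bsub>Omega q\<^esub>"
    "W (cc (minus_list al' Q)) = \<zero>\<^bsub>Omega q\<^esub>" "W (cc (minus_list ga' Q)) = \<zero>\<^bsub>Omega q\<^esub>"
    "W (cc (plus_list al (1 / Q))) = \<zero>\<^bsub>Omega q\<^esub>" "W (cc (plus_list ga (1 / Q))) = \<zero>\<^bsub>Omega q\<^esub>"
    using null_W[OF minus_list_closed minus_list_null, of GenAlpha] null_W[OF minus_list_closed minus_list_null, of GenGamma]
      null_W[OF minus_list_closed minus_list_null, of GenAlphaStar] null_W[OF minus_list_closed minus_list_null, of GenGammaStar]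
      null_W[OF plus_list_closed plus_list_null, of GenAlpha] null_W[OF plus_list_closed plus_list_null, of GenGamma] by metis+
qed

lemma minus_list_cc_al: "cc (minus_list al (1 / Q)) i j = (case (i, j) of (Ith, Imi) \<Rightarrow> (- (rp / Q^3)) \<odot> al
    | (Imi, Ith) \<Rightarrow> (- (Q * rp)) \<odot> al
    | (Ipl, Imi) \<Rightarrow> (-1) \<odot> ga'
    | (Imi, Ipl) \<Rightarrow> (- (Q^2)) \<odot> ga'
    | _ \<Rightarrow> \<zero>)"
  unfolding cc_def
  by (rule eq_by_functionals; cases i; cases j; simp add: list_simps; (simp add: divide_simps)?; (simp add: algebra_simps Q_pow)?)

lemma minus_list_cc_ga: "cc (minus_list ga (1 / Q)) i j = (case (i, j) of (Ith, Imi) \<Rightarrow> (- (rp / Q^3)) \<odot> ga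
    | (Imi, Ith) \<Rightarrow> (- (Q * rp)) \<odot> ga
    | (Ipl, Imi) \<Rightarrow> (- (1 / Q)) \<odot> al'
    | (Imi, Ipl) \<Rightarrow> (- Q) \<odot> al'
    | _ \<Rightarrow> \<zero>)"
  unfolding cc_def
  by (rule eq_by_functionals; cases i; cases j; simp add: list_simps; (simp add: divide_simps)?; (simp add: algebra_simps Q_pow)?)

lemma minus_list_cc_al': "cc (minus_list al' Q) i j = (case (i, j) of (Ith, Imi) \<Rightarrow> (Q * rp) \<odot> al'
    | (Imi, Ith) \<Rightarrow> (Q^5 * rp) \<odot> al'
    | (Imi, Imi) \<Rightarrow> (- (Q + 1 / Q)) \<odot> ga
    | _ \<Rightarrow> \<zero>)"
  unfolding cc_def
  by (rule eq_by_functionals; cases i; cases j; simp add: list_simps; (simp add: divide_simps)?; (simp add: algebra_simps Q_pow)?)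

lemma minus_list_cc_ga': "cc (minus_list ga' Q) i j = (case (i, j) of (Ith, Imi) \<Rightarrow> (Q * rp) \<odot> ga'
    | (Imi, Ith) \<Rightarrow> (Q^5 * rp) \<odot> ga'
    | (Imi, Imi) \<Rightarrow> (- (1 + 1 / Q^2)) \<odot> al
    | _ \<Rightarrow> \<zero>)"
  unfolding cc_def
  by (rule eq_by_functionals; cases i; cases j; simp add: list_simps; (simp add: divide_simps)?; (simp add: algebra_simps Q_pow)?)

lemma plus_list_cc_al: "cc (plus_list al (1 / Q)) i j = (case (i, j) of (Ith, Ipl) \<Rightarrow> (- (Q * rp)) \<odot> al
    | (Ipl, Ith) \<Rightarrow> (- (rp / Q^3)) \<odot> al
    | (Ipl, Ipl) \<Rightarrow> (- (1 + Q^2)) \<odot> ga'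
    | _ \<Rightarrow> \<zero>)"
  unfolding cc_def
  by (rule eq_by_functionals; cases i; cases j; simp add: list_simps; (simp add: divide_simps)?; (simp add: algebra_simps Q_pow)?)

lemma plus_list_cc_ga: "cc (plus_list ga (1 / Q)) i j = (case (i, j) of (Ith, Ipl) \<Rightarrow> (- (Q * rp)) \<odot> ga
    | (Ipl, Ith) \<Rightarrow> (- (rp / Q^3)) \<odot> ga
    | (Ipl, Ipl) \<Rightarrow> (- (Q + 1 / Q)) \<odot> al'
    | _ \<Rightarrow> \<zero>)"
  unfolding cc_def
  by (rule eq_by_functionals; cases i; cases j; simp add: list_simps; (simp add: divide_simps)?; (simp add: algebra_simps Q_pow)?)

text \<open>The null two-forms have coefficients in \<open>P\<close>. A left combination of two of
  them with suitable multipliers has scalar coefficients, which turns it into a linear relation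
  between products of basis forms.\<close>

lemma W_comb:
  assumes "W c = \<zero>\<^bsub>Omega q\<^esub>" "W c' = \<zero>\<^bsub>Omega q\<^esub>" "x \<in> carrier P" "y \<in> carrier P"
    and [simp]: "\<And>i j. c i j \<in> carrier P" "\<And>i j. c' i j \<in> carrier P"
    and k: "\<And>i j. x \<otimes> c i j \<oplus> y \<otimes> c' i j = k i j \<odot> \<one>"
  shows "sum_ix (\<lambda>i. sum_ix (\<lambda>j. k i j \<odot>\<^bsub>Omega q\<^esub> E i j)) = \<zero>\<^bsub>Omega q\<^esub>"
proof -
  have "W (\<lambda>i j. x \<otimes> c i j \<oplus> y \<otimes> c' i j) = \<zero>\<^bsub>Omega q\<^esub>"
    using assms(1-4) by (simp add: W_add W_left)
  then show ?thesis unfolding k by (simp add: W_def of_P_simps(3,5))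
qed

lemma cc_lists_closed: "cc (minus_list (suq_gen q g) s) i j \<in> carrier P" "cc (plus_list (suq_gen q g) s) i j \<in> carrier P"
  by (rule cc_closed[OF minus_list_closed], rule cc_closed[OF plus_list_closed])

text \<open>The multipliers come from \<open>al' al - ga' ga = 1\<close>, which makes the
  \<open>\<eta>\<^sub>3\<close> coefficients scalar; the other coefficients cancel by
  \<open>ga' al' = Q al' ga'\<close>.\<close>

lemma null_A: "sum_ix (\<lambda>i. sum_ix (\<lambda>j. (if i = Ith \<and> j = Imi then - (rp / Q^3) else if i = Imi \<and> j = Ith then - (Q * rp) else 0) \<odot>\<^bsub>Omega q\<^esub> E i j)) = \<zero>\<^bsub>Omega q\<^esub>"
proof (rule W_comb[OF W_minus_list(1) W_minus_list(2), of "al'" "((-1) \<odot> ga')"])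
  show "al' \<otimes> cc (minus_list al (1 / Q)) i j \<oplus> ((-1) \<odot> ga') \<otimes> cc (minus_list ga (1 / Q)) i j = (if i = Ith \<and> j = Imi then - (rp / Q^3) else if i = Imi \<and> j = Ith then - (Q * rp) else 0) \<odot> \<one>" for i j
    unfolding minus_list_cc_al minus_list_cc_ga
    by (rule eq_by_functionals; cases i; cases j; simp add: nf fnl; (simp add: divide_simps)?; (simp add: algebra_simps Q_pow)?)
qed (simp_all add: cc_lists_closed)

text \<open>The complementary pair of multipliers: \<open>al ga = Q ga al\<close> cancels the
  \<open>\<eta>\<^sub>3\<close> coefficients, and \<open>al al' - Q^2 ga ga' = 1\<close> makes the
  others scalar.\<close>

lemma null_B: "sum_ix (\<lambda>i. sum_ix (\<lambda>j. (if i = Ipl \<and> j = Imi then -1 else if i = Imi \<and> j = Ipl then - (Q^2) else 0) \<odot>\<^bsub>Omega q\<^esub> E i j)) = \<zero>\<^bsub>Omega q\<^esub>"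
proof (rule W_comb[OF W_minus_list(1) W_minus_list(2), of "((- (Q^2)) \<odot> ga)" "(Q \<odot> al)"])
  show "((- (Q^2)) \<odot> ga) \<otimes> cc (minus_list al (1 / Q)) i j \<oplus> (Q \<odot> al) \<otimes> cc (minus_list ga (1 / Q)) i j = (if i = Ipl \<and> j = Imi then -1 else if i = Imi \<and> j = Ipl then - (Q^2) else 0) \<odot> \<one>" for i j
    unfolding minus_list_cc_al minus_list_cc_ga
    by (rule eq_by_functionals; cases i; cases j; simp add: nf fnl; (simp add: divide_simps)?; (simp add: algebra_simps Q_pow)?)
qed (simp_all add: cc_lists_closed)

text \<open>With the lists for \<open>al'\<close> and \<open>ga'\<close> the roles are exchanged:
  the \<open>\<eta>\<^sub>3\<close> coefficients cancel and only the square of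
  \<open>\<eta>\<^sub>-\<close> remains, with a nonzero scalar.\<close>

lemma null_D: "sum_ix (\<lambda>i. sum_ix (\<lambda>j. (if i = Imi \<and> j = Imi then - (Q + 1 / Q) else 0) \<odot>\<^bsub>Omega q\<^esub> E i j)) = \<zero>\<^bsub>Omega q\<^esub>"
proof (rule W_comb[OF W_minus_list(3) W_minus_list(4), of "((-1) \<odot> ga')" "(Q \<odot> al')"])
  show "((-1) \<odot> ga') \<otimes> cc (minus_list al' Q) i j \<oplus> (Q \<odot> al') \<otimes> cc (minus_list ga' Q) i j = (if i = Imi \<and> j = Imi then - (Q + 1 / Q) else 0) \<odot> \<one>" for i j
    unfolding minus_list_cc_al' minus_list_cc_ga'
    by (rule eq_by_functionals; cases i; cases j; simp add: nf fnl; (simp add: divide_simps)?; (simp add: algebra_simps Q_pow)?)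
qed (simp_all add: cc_lists_closed)

lemma null_A': "sum_ix (\<lambda>i. sum_ix (\<lambda>j. (if i = Ith \<and> j = Ipl then - (Q * rp) else if i = Ipl \<and> j = Ith then - (rp / Q^3) else 0) \<odot>\<^bsub>Omega q\<^esub> E i j)) = \<zero>\<^bsub>Omega q\<^esub>"
proof (rule W_comb[OF W_plus_list(1) W_plus_list(2), of "al'" "((-1) \<odot> ga')"])
  show "al' \<otimes> cc (plus_list al (1 / Q)) i j \<oplus> ((-1) \<odot> ga') \<otimes> cc (plus_list ga (1 / Q)) i j = (if i = Ith \<and> j = Ipl then - (Q * rp) else if i = Ipl \<and> j = Ith then - (rp / Q^3) else 0) \<odot> \<one>" for i j
    unfolding plus_list_cc_al plus_list_cc_ga
    by (rule eq_by_functionals; cases i; cases j; simp add: nf fnl; (simp add: divide_simps)?; (simp add: algebra_simps Q_pow)?)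
qed (simp_all add: cc_lists_closed)

lemma null_D': "sum_ix (\<lambda>i. sum_ix (\<lambda>j. (if i = Ipl \<and> j = Ipl then - (1 + Q^2) else 0) \<odot>\<^bsub>Omega q\<^esub> E i j)) = \<zero>\<^bsub>Omega q\<^esub>"
proof (rule W_comb[OF W_plus_list(1) W_plus_list(2), of "((- (Q^2)) \<odot> ga)" "(Q \<odot> al)"])
  show "((- (Q^2)) \<odot> ga) \<otimes> cc (plus_list al (1 / Q)) i j \<oplus> (Q \<odot> al) \<otimes> cc (plus_list ga (1 / Q)) i j = (if i = Ipl \<and> j = Ipl then - (1 + Q^2) else 0) \<odot> \<one>" for i j
    unfolding plus_list_cc_al plus_list_cc_ga
    by (rule eq_by_functionals; cases i; cases j; simp add: nf fnl; (simp add: divide_simps)?; (simp add: algebra_simps Q_pow)?)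
qed (simp_all add: cc_lists_closed)

lemma solve_A:
  fixes x r u v :: complex
  assumes "x \<noteq> 0" "r \<noteq> 0"
  shows "(- (r / x^3)) * u + (- (x * r)) * v = 0 \<Longrightarrow> v = (- (1 / x^4)) * u"
    and "(- (x * r)) * u + (- (r / x^3)) * v = 0 \<Longrightarrow> v = (- (x^4)) * u"
proof -
  have p: "x^4 = x * x^3" by (simp add: eval_nat_numeral)
  {
    assume "(- (r / x^3)) * u + (- (x * r)) * v = 0"
    moreover have "(- (r / x^3)) * u + (- (x * r)) * v = - (r * (u + x^4 * v)) / x^3"
      using assms(1) unfolding p by (simp add: field_simps)
    ultimately have "u + x^4 * v = 0" using assms by simp
    then show "v = (- (1 / x^4)) * u" using assms(1) by (simp add: field_simps eq_neg_iff_add_eq_0)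
  }
  assume "(- (x * r)) * u + (- (r / x^3)) * v = 0"
  moreover have "(- (x * r)) * u + (- (r / x^3)) * v = - (r * (x^4 * u + v)) / x^3"
    using assms(1) unfolding p by (simp add: field_simps)
  ultimately have "x^4 * u + v = 0" using assms by simp
  then show "v = (- (x^4)) * u" by (simp add: eq_neg_iff_add_eq_0 add.commute)
qed

text \<open>Each null combination has one or two nonzero coefficients, so it can be solved for a
  single product; applying functionals makes this a scalar equation.\<close>

lemma E_rels:
  "E Imi Ith = (- (1 / Q^4)) \<odot>\<^bsub>Omega q\<^esub> E Ith Imi" "E Ipl Imi = (- (Q^2)) \<odot>\<^bsub>Omega q\<^esub> E Imi Ipl"
  "E Imi Imi = \<zero>\<^bsub>Omega q\<^esub>" "E Ipl Ith = (- (Q^4)) \<odot>\<^bsub>Omega q\<^esub> E Ith Ipl" "E Ipl Ipl = \<zero>\<^bsub>Omega q\<^esub>"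
proof -
  have "Q + 1 / Q = (1 + Q^2) / Q" by (simp add: field_simps power2_eq_square)
  then have nz: "- (Q + 1 / Q) \<noteq> 0" "- (1 + Q^2) \<noteq> 0" by (simp_all only: neg_equal_0_iff_equal) simp_all
  have Q: "Q \<noteq> 0" and rp: "rp \<noteq> 0" by simp_all
  have s: "f (sum_ix (\<lambda>i. sum_ix (\<lambda>j. k i j \<odot>\<^bsub>Omega q\<^esub> E i j))) = k Ith Ith * f (E Ith Ith) + k Ith Ipl * f (E Ith Ipl) + k Ith Imi * f (E Ith Imi)
     + k Ipl Ith * f (E Ipl Ith) + k Ipl Ipl * f (E Ipl Ipl) + k Ipl Imi * f (E Ipl Imi)
     + k Imi Ith * f (E Imi Ith) + k Imi Ipl * f (E Imi Ipl) + k Imi Imi * f (E Imi Imi)" if "functional (Omega q) f" for f k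
    using that by (simp add: sum_ix_def fnl)
  show "E Imi Ith = (- (1 / Q^4)) \<odot>\<^bsub>Omega q\<^esub> E Ith Imi"
  proof (rule Om.eq_by_functionals)
    fix f assume f: "functional (Omega q) f"
    have "(- (rp / Q^3)) * f (E Ith Imi) + (- (Q * rp)) * f (E Imi Ith) = 0"
      using arg_cong[OF null_A, of f] unfolding s[OF f] functional.functional_zero[OF f] by (simp only: ix.distinct simp_thms if_True if_False mult_zero_left add_0_left add_0_right)
    from solve_A(1)[OF Q rp this] show "f (E Imi Ith) = f ((- (1 / Q^4)) \<odot>\<^bsub>Omega q\<^esub> E Ith Imi)"
      using f by (simp add: fnl)
  qed simp_all
  show "E Ipl Ith = (- (Q^4)) \<odot>\<^bsub>Omega q\<^esub> E Ith Ipl"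
  proof (rule Om.eq_by_functionals)
    fix f assume f: "functional (Omega q) f"
    have "(- (Q * rp)) * f (E Ith Ipl) + (- (rp / Q^3)) * f (E Ipl Ith) = 0"
      using arg_cong[OF null_A', of f] unfolding s[OF f] functional.functional_zero[OF f] by (simp only: ix.distinct simp_thms if_True if_False mult_zero_left add_0_left add_0_right)
    from solve_A(2)[OF Q rp this] show "f (E Ipl Ith) = f ((- (Q^4)) \<odot>\<^bsub>Omega q\<^esub> E Ith Ipl)"
      using f by (simp add: fnl)
  qed simp_all
  show "E Ipl Imi = (- (Q^2)) \<odot>\<^bsub>Omega q\<^esub> E Imi Ipl"
  proof (rule Om.eq_by_functionals)
    fix f assume f: "functional (Omega q) f"
    have "(-1) * f (E Ipl Imi) + (- (Q^2)) * f (E Imi Ipl) = 0"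
      using arg_cong[OF null_B, of f] unfolding s[OF f] functional.functional_zero[OF f] by (simp only: ix.distinct simp_thms if_True if_False mult_zero_left add_0_left add_0_right)
    moreover have "b = a" if "(-1) * a + b = 0" for a b :: complex
    proof -
      have "b = a + ((-1) * a + b)" by simp
      then show ?thesis unfolding that by simp
    qed
    ultimately have "(- (Q^2)) * f (E Imi Ipl) = f (E Ipl Imi)" by blast
    then show "f (E Ipl Imi) = f ((- (Q^2)) \<odot>\<^bsub>Omega q\<^esub> E Imi Ipl)" using f by (simp add: fnl)
  qed simp_all
  show "E Imi Imi = \<zero>\<^bsub>Omega q\<^esub>"
  proof (rule Om.eq_by_functionals)
    fix f assume f: "functional (Omega q) f"
    have "(- (Q + 1 / Q)) * f (E Imi Imi) = 0"
      using arg_cong[OF null_D, of f] unfolding s[OF f] functional.functional_zero[OF f] by (simp only: ix.distinct simp_thms if_True if_False mult_zero_left add_0_left add_0_right)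
    then show "f (E Imi Imi) = f \<zero>\<^bsub>Omega q\<^esub>"
      using nz(1) unfolding functional.functional_zero[OF f] by (simp only: mult_eq_0_iff simp_thms)
  qed simp_all
  show "E Ipl Ipl = \<zero>\<^bsub>Omega q\<^esub>"
  proof (rule Om.eq_by_functionals)
    fix f assume f: "functional (Omega q) f"
    have "(- (1 + Q^2)) * f (E Ipl Ipl) = 0"
      using arg_cong[OF null_D', of f] unfolding s[OF f] functional.functional_zero[OF f] by (simp only: ix.distinct simp_thms if_True if_False mult_zero_left add_0_left add_0_right)
    then show "f (E Ipl Ipl) = f \<zero>\<^bsub>Omega q\<^esub>"
      using nz(2) unfolding functional.functional_zero[OF f] by (simp only: mult_eq_0_iff simp_thms)
  qed simp_all
qed

text \<open>Since \<open>\<eta>\<^sub>-\<close> and \<open>\<eta>\<^sub>+\<close> are combinations of exact forms, this list represents \<open>x \<eta>\<^sub>- + y \<eta>\<^sub>+\<close>.\<close>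

definition base_list :: "suq \<Rightarrow> suq \<Rightarrow> (suq \<times> suq) list" where
  "base_list x y = [((-1) \<odot> (x \<otimes> ga'), al'), (Q \<odot> (x \<otimes> al'), ga'), ((- Q) \<odot> (y \<otimes> ga), al), (y \<otimes> al, ga)]"

lemma base_list_coords:
  assumes "x \<in> carrier P" "y \<in> carrier P"
  shows "lsum P (\<lambda>(g, h). g \<otimes> dd i h) (base_list x y) = (case i of Ith \<Rightarrow> \<zero> | Ipl \<Rightarrow> y | Imi \<Rightarrow> x)"
  by (rule eq_by_functionals; cases i; insert assms; simp add: base_list_def lsum_def nf fnl; (simp add: field_simps Q_pow)?)

lemma rr_two: "rr 2 = 1 / Q^2" and rr_minus_two: "rr (-2) = - (Q^2)"
proof -
  have "Q^4 - 1 = - (1 - Q^4)" by simp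
  then have "Q^2 * (Q^4 - 1) / (1 - Q^4) = - (Q^2)" by (simp only: mult_minus_right nonzero_mult_div_cancel_right Q4_neq minus_divide_left[symmetric] not_False_eq_True)
  then show "rr (-2) = - (Q^2)" by (simp add: rr_def)
  have "Q powi (-4) - 1 = (1 - Q^4) / Q^4" by (simp add: power_int_minus field_simps)
  then have "rr 2 = Q^2 * ((1 - Q^4) / Q^4) / (1 - Q^4)" by (simp add: rr_def)
  also have "\<dots> = 1 / Q^2"
  proof -
    have "Q^2 * (d / Q^4) / d = 1 / Q^2" if "d \<noteq> 0" for d
      using that by (simp add: field_simps)
    then show ?thesis using Q4_neq(1) by blast
  qed
  finally show "rr 2 = 1 / Q^2" .
qed

lemma base_list_cc:
  assumes "x \<in> weight_space q 2" "y \<in> weight_space q (-2)"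
  shows "cc (base_list x y) i j = (case (i, j) of (Ith, Imi) \<Rightarrow> (rp / Q^2) \<odot> x | (Imi, Ith) \<Rightarrow> (Q^2 * rp) \<odot> x
    | (Ipl, Imi) \<Rightarrow> dd Ipl x | (Imi, Imi) \<Rightarrow> dd Imi x
    | (Ith, Ipl) \<Rightarrow> (- (Q^4 * rp)) \<odot> y | (Ipl, Ith) \<Rightarrow> (- rp) \<odot> y
    | (Imi, Ipl) \<Rightarrow> dd Imi y | (Ipl, Ipl) \<Rightarrow> dd Ipl y | _ \<Rightarrow> \<zero>)"
proof -
  note [simp] = weight_spaceD(1)[OF assms(1)] weight_spaceD(1)[OF assms(2)]
  show ?thesis unfolding cc_def
    by (rule eq_by_functionals; cases i; cases j;
        simp add: base_list_def list_simps dd_Ith_weight[OF assms(1)] dd_Ith_weight[OF assms(2)] rr_two rr_minus_two;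
        (simp add: divide_simps)?; (simp add: algebra_simps Q_pow)?)
qed

text \<open>By \<open>E_rels\<close> the coefficients that pair \<open>\<eta>\<^sub>3\<close> with
  \<open>\<eta>\<^sub>-\<close> cancel, and so do those that pair it with
  \<open>\<eta>\<^sub>+\<close>; here the weights 2 and -2 enter. The squares vanish, and reversing
  the remaining mixed product yields the factor \<open>- q\<^sup>2\<close>.\<close>

lemma dlist_base_list:
  assumes "x \<in> weight_space q 2" "y \<in> weight_space q (-2)"
  shows "dlist (base_list x y) = of_P q (dd Imi y \<ominus> Q^2 \<odot> dd Ipl x) \<otimes>\<^bsub>Omega q\<^esub> E Imi Ipl"
proof -
  note [simp] = weight_spaceD(1)[OF assms(1)] weight_spaceD(1)[OF assms(2)]
  have "Q * Q + Q * (Q * (Q * Q)) = Q * Q * (1 + Q^2)"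
    "Q * (Q * (Q * Q)) + Q * (Q * (Q * (Q * (Q * Q)))) = Q * (Q * (Q * Q)) * (1 + Q^2)" "1 + Q * Q = 1 + Q^2"
    by (simp_all add: algebra_simps power2_eq_square)
  then have nz: "Q * Q + Q * (Q * (Q * Q)) \<noteq> 0" "Q * (Q * (Q * Q)) + Q * (Q * (Q * (Q * (Q * Q)))) \<noteq> 0" "1 + Q * Q \<noteq> 0"
    using one_plus_q2[of q] by (simp_all only: mult_eq_0_iff q0 of_real_eq_0_iff simp_thms)
  have "set (base_list x y) \<subseteq> carrier P \<times> carrier P" by (simp add: base_list_def)
  from dlist_W[OF this] show ?thesis
    by (intro Om.eq_by_functionals;
        simp add: W_def sum_ix_def base_list_cc[OF assms] E_rels of_P_simps(2,3) a_minus_def minus_eq_smult Om.l_distr fnl;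
        (simp add: nz divide_simps Q_pow)?; (simp add: algebra_simps)?)
qed

end

lemma (in cspace) lsum_append:
  "(\<And>x. x \<in> set xs \<union> set ys \<Longrightarrow> f x \<in> carrier V) \<Longrightarrow> lsum V f (xs @ ys) = lsum V f xs \<oplus> lsum V f ys"
proof (induction xs)
  case Nil
  then show ?case using lsum_closed[of ys f] by (simp add: lsum_def)
next
  case (Cons x xs)
  have "lsum V f xs \<in> carrier V" "lsum V f ys \<in> carrier V" "f x \<in> carrier V"
    using Cons lsum_closed[of xs f] lsum_closed[of ys f] by auto
  then show ?case using Cons by (simp add: lsum_def a_assoc)
qed

lemma (in cspace) lsum_neg:
  "(\<And>x. x \<in> set xs \<Longrightarrow> f x \<in> carrier V) \<Longrightarrow> (\<And>x. x \<in> set xs \<Longrightarrow> f (g x) = (-1) \<odot> f x) \<Longrightarrow>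
   lsum V f (map g xs) = (-1) \<odot> lsum V f xs"
proof (induction xs)
  case (Cons x xs)
  have "lsum V f xs \<in> carrier V" "f x \<in> carrier V" using Cons lsum_closed[of xs f] by auto
  then show ?case using Cons by (simp add: lsum_def smult_r_distr)
qed (simp add: lsum_def)

lemma lsum_map: "lsum V f (map g xs) = lsum V (\<lambda>x. f (g x)) xs"
  by (simp add: lsum_def foldr_map comp_def)

lemma lsum_cong: "(\<And>x. x \<in> set xs \<Longrightarrow> f x = g x) \<Longrightarrow> lsum V f xs = lsum V g xs"
  by (induction xs) (simp_all add: lsum_def)

context quantum_su
begin

subsection \<open>Injectivity of the embeddings into the envelope\<close>

text \<open>In the model a function acts on the block \<open>B0\<close> by the faithful lattice
  representation. One-forms and volume forms are treated likewise in the blocks \<open>B1 i\<close>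
  and \<open>B2\<close>.\<close>

lemma of_P_inj: "p \<in> carrier P \<Longrightarrow> p' \<in> carrier P \<Longrightarrow> of_P q p = of_P q p' \<Longrightarrow> p = p'"
proof -
  assume p: "p \<in> carrier P" "p' \<in> carrier P" "of_P q p = of_P q p'"
  obtain \<Theta> where \<Theta>: "alghom (Omega q) end_alg \<Theta>" "\<And>p. p \<in> carrier P \<Longrightarrow> \<Theta> (of_P q p) = model_P p"
    "\<And>m. m \<in> carrier PV.T \<Longrightarrow> \<Theta> (of_form q m) = model_form m" by (rule model) (rule that)
  have "model_P p = model_P p'" using p \<Theta>(2)[of p] \<Theta>(2)[of p'] by simp
  then have "coords B0 (model_P p (\<lambda>(b, j). f j)) = coords B0 (model_P p' (\<lambda>(b, j). f j))" for f by simp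
  then have "rho p f = rho p' f" for f by (simp add: coords_model_P) (simp add: coords_def)
  then have "rho (p \<ominus> p') = (\<lambda>f j. 0)" using p by (auto simp: a_minus_def minus_eq_smult rho_simps)
  from rho_faithful[OF minus_closed[OF p(1,2)] this] have "p \<ominus> p' = \<zero>" .
  from minus_eq_zeroD[OF this p(1,2)] show ?thesis .
qed

lemma of_form_inj: "w \<in> carrier PV.T \<Longrightarrow> w' \<in> carrier PV.T \<Longrightarrow> of_form q w = of_form q w' \<Longrightarrow> w = w'"
proof -
  assume w: "w \<in> carrier PV.T" "w' \<in> carrier PV.T" "of_form q w = of_form q w'"
  obtain \<Theta> where \<Theta>: "alghom (Omega q) end_alg \<Theta>" "\<And>p. p \<in> carrier P \<Longrightarrow> \<Theta> (of_P q p) = model_P p"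
    "\<And>m. m \<in> carrier PV.T \<Longrightarrow> \<Theta> (of_form q m) = model_form m" by (rule model) (rule that)
  have v: "model_form w = model_form w'" using w \<Theta>(3)[of w] \<Theta>(3)[of w'] by simp
  show "w = w'"
  proof (rule form_eqI[OF w(1,2)])
    fix i
    have "coords (B1 i) (model_form w (\<lambda>(b, j). f j)) = coords (B1 i) (model_form w' (\<lambda>(b, j). f j))" for f using v by simp
    then have "rho (X i w) (sigV i f) = rho (X i w') (sigV i f)" for f by (simp add: coords_model_form) (simp add: coords_def)
    then have "X i w \<ominus> X i w' = \<zero>"
      using w by (intro rho_sigV_faithful[of _ i]) (simp_all add: a_minus_def minus_eq_smult rho_simps)
    from minus_eq_zeroD[OF this] show "X i w = X i w'" using w by simp
  qed
qed

text \<open>Acting with \<open>dvol\<close> into the block \<open>B2\<close> applies two invertible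
  diagonal twists, after which p acts by \<open>rho\<close>; \<open>sigV_surj\<close> strips the
  inner twist and \<open>rho_sigV_faithful\<close> deals with the outer one.\<close>

lemma volume_inj: "p \<in> carrier P \<Longrightarrow> p' \<in> carrier P \<Longrightarrow> base_form2 q p = base_form2 q p' \<Longrightarrow> p = p'"
proof -
  assume p: "p \<in> carrier P" "p' \<in> carrier P" "base_form2 q p = base_form2 q p'"
  obtain \<Theta> where \<Theta>: "alghom (Omega q) end_alg \<Theta>" "\<And>p. p \<in> carrier P \<Longrightarrow> \<Theta> (of_P q p) = model_P p"
    "\<And>m. m \<in> carrier PV.T \<Longrightarrow> \<Theta> (of_form q m) = model_form m" by (rule model) (rule that)
  have "\<Theta> (base_form2 q p) = (\<lambda>f. model_P p (model_form (inv_form Imi) (model_form (inv_form Ipl) f)))" if "p \<in> carrier P" for p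
    using that by (simp add: base_form2_def dvol_def eta_minus_eq eta_plus_eq alghom_mult[OF \<Theta>(1)] \<Theta>(2)) (simp add: eta_def \<Theta>(3))
  then have "model_P p (model_form (inv_form Imi) (model_form (inv_form Ipl) f)) = model_P p' (model_form (inv_form Imi) (model_form (inv_form Ipl) f))" for f
    using p by metis
  then have "coords B2 (model_P p (model_form (inv_form Imi) (model_form (inv_form Ipl) (\<lambda>(b, j). f j)))) = coords B2 (model_P p' (model_form (inv_form Imi) (model_form (inv_form Ipl) (\<lambda>(b, j). f j))))" for f
    by simp
  then have r: "rho p (sigV Imi (sigV Ipl f)) = rho p' (sigV Imi (sigV Ipl f))" for f
    by (simp add: coords_model_P coords_model_form X_inv_form rho_simps rho_zero) (simp add: coords_def)
  have "rho (p \<ominus> p') (sigV Imi f) = (\<lambda>j. 0)" for f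
    using r[of "\<lambda>(t, k, l). f (t, k, l) / sc Ipl (t + k - l)"] p unfolding sigV_surj
    by (simp add: a_minus_def minus_eq_smult rho_simps)
  from rho_sigV_faithful[OF minus_closed[OF p(1,2)] this] have "p \<ominus> p' = \<zero>" .
  from minus_eq_zeroD[OF this p(1,2)] show ?thesis .
qed

subsection \<open>The exterior derivative\<close>

lemma calc_d_lin: "lin P PV.T (calc_d q)"
  by (rule linI; (rule form_eqI)?) (simp_all add: X_calc_d X_simps dd_add dd_smult)

lemma lprod_sing: "x \<in> carrier P \<Longrightarrow> lprod (Omega q) (of_form q \<circ> calc_d q) [x] = of_form q (calc_d q x)"
  by (simp add: lprod_def)

text \<open>A representing list in degree 0 is a list of functions, and \<open>of_P_inj\<close>
  forces their sum to be b; linearity of \<open>calc_d\<close> then determines the value.\<close>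

lemma ext_diff_0:
  assumes "b \<in> carrier P"
  shows "ext_diff q 0 (of_P q b) = of_form q (calc_d q b)"
  unfolding ext_diff_def SUq_P
proof (rule the_equality)
  let ?F = "\<lambda>(p, ps). of_P q p \<otimes>\<^bsub>Omega q\<^esub> lprod (Omega q) (of_form q \<circ> calc_d q) ps"
  let ?G = "\<lambda>(p, ps). of_form q (calc_d q p) \<otimes>\<^bsub>Omega q\<^esub> lprod (Omega q) (of_form q \<circ> calc_d q) ps"
  show "\<exists>ts. (\<forall>(p, ps)\<in>set ts. p \<in> carrier P \<and> set ps \<subseteq> carrier P \<and> length ps = 0) \<and>
      of_P q b = lsum (Omega q) ?F ts \<and> of_form q (calc_d q b) = lsum (Omega q) ?G ts"
    using assms by (intro exI[of _ "[(b, [])]"]) (simp add: lsum_def lprod_def)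
  fix w assume "\<exists>ts. (\<forall>(p, ps)\<in>set ts. p \<in> carrier P \<and> set ps \<subseteq> carrier P \<and> length ps = 0) \<and>
      of_P q b = lsum (Omega q) ?F ts \<and> w = lsum (Omega q) ?G ts"
  then obtain ts where ts: "\<forall>(p, ps)\<in>set ts. p \<in> carrier P \<and> set ps \<subseteq> carrier P \<and> length ps = 0"
    "of_P q b = lsum (Omega q) ?F ts" "w = lsum (Omega q) ?G ts" by blast
  have c: "fst x \<in> carrier P" if "x \<in> set ts" for x using ts(1) that by auto
  have "lsum (Omega q) ?F ts = lsum (Omega q) (\<lambda>x. of_P q (fst x)) ts" "lsum (Omega q) ?G ts = lsum (Omega q) (\<lambda>x. of_form q (calc_d q (fst x))) ts"
    using ts(1) by (auto intro!: lsum_cong simp: lprod_def)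
  moreover have "of_P q (lsum P fst ts) = lsum (Omega q) (\<lambda>x. of_P q (fst x)) ts \<and> lsum P fst ts \<in> carrier P"
    by (rule lin_lsum[OF cspace_axioms Om.cspace_axioms of_P_lin]) (rule c)
  moreover have "of_form q (calc_d q (lsum P fst ts)) = lsum (Omega q) (\<lambda>x. of_form q (calc_d q (fst x))) ts"
    by (rule conjunct1[OF lin_lsum[OF cspace_axioms Om.cspace_axioms lin_comp[OF calc_d_lin of_form_lin]]]) (rule c)
  moreover have "lsum P fst ts = b"
    using calculation ts(2) assms by (intro of_P_inj) simp_all
  ultimately show "w = of_form q (calc_d q b)" using ts(3) by simp
qed

definition list_form :: "(suq \<times> suq) list \<Rightarrow> form1" where
  "list_form gs = lsum PV.T (\<lambda>(g, h). lact q g (calc_d q h)) gs"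

lemma list_form_closed: "set gs \<subseteq> carrier P \<times> carrier P \<Longrightarrow> list_form gs \<in> carrier PV.T"
  unfolding list_form_def by (rule PVT.lsum_closed) (auto simp: lact_simps)

lemma X_list_form:
  assumes "set gs \<subseteq> carrier P \<times> carrier P"
  shows "X i (list_form gs) = lsum P (\<lambda>(g, h). g \<otimes> dd i h) gs"
proof -
  have "X i (list_form gs) = lsum P (\<lambda>x. X i (case x of (g, h) \<Rightarrow> lact q g (calc_d q h))) gs"
    unfolding list_form_def by (rule conjunct1[OF lin_lsum[OF PVT.cspace_axioms cspace_axioms lin_X]]) (use assms in \<open>auto simp: lact_simps\<close>)
  also have "\<dots> = lsum P (\<lambda>(g, h). g \<otimes> dd i h) gs"
    by (rule lsum_cong) (use assms in \<open>auto simp: X_lact X_calc_d\<close>)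
  finally show ?thesis .
qed

text \<open>Appending the second list with negated left entries to the first gives a null list, so
  the relation of the envelope says that the two sums of products of differentials agree.\<close>

lemma dlist_unique:
  assumes gs: "set gs \<subseteq> carrier P \<times> carrier P" and hs: "set hs \<subseteq> carrier P \<times> carrier P" and eq: "list_form gs = list_form hs"
  shows "dlist gs = dlist hs"
proof -
  let ?n = "\<lambda>(g, h). ((-1) \<odot> g, h)"
  let ?t = "\<lambda>(g, h). lact q g (calc_d q h)"
  let ?d = "\<lambda>(g, h). of_form q (calc_d q g) \<otimes>\<^bsub>Omega q\<^esub> of_form q (calc_d q h)"
  have nh: "set (map ?n hs) \<subseteq> carrier P \<times> carrier P" using hs by auto
  have tn: "lact q ((-1) \<odot> g) w = (-1) \<odot>\<^bsub>PV.T\<^esub> lact q g w" if "g \<in> carrier P" "w \<in> carrier PV.T" for g w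
    by (rule form_eqI) (use that in \<open>simp_all add: lact_simps X_simps X_lact\<close>)
  have "list_form (gs @ map ?n hs) = list_form gs \<oplus>\<^bsub>PV.T\<^esub> list_form (map ?n hs)"
    unfolding list_form_def by (rule PVT.lsum_append) (use gs nh in \<open>auto simp: lact_simps\<close>)
  also have "list_form (map ?n hs) = (-1) \<odot>\<^bsub>PV.T\<^esub> list_form hs"
    unfolding list_form_def by (rule PVT.lsum_neg) (use hs in \<open>auto simp: lact_simps tn\<close>)
  also have "list_form gs \<oplus>\<^bsub>PV.T\<^esub> (-1) \<odot>\<^bsub>PV.T\<^esub> list_form hs = \<zero>\<^bsub>PV.T\<^esub>"
    using eq list_form_closed[OF hs] by (simp add: PVT.minus_eq_smult[symmetric] PVT.r_neg)
  finally have "null_list (gs @ map ?n hs)" using gs nh by (simp add: list_form_def)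
  from null_list_relation[OF this] have "dlist (gs @ map ?n hs) = \<zero>\<^bsub>Omega q\<^esub>" by (simp add: dlist_def)
  moreover have "dlist (gs @ map ?n hs) = dlist gs \<oplus>\<^bsub>Omega q\<^esub> dlist (map ?n hs)"
    unfolding dlist_def by (rule Om.lsum_append) (use gs nh in auto)
  moreover have "dlist (map ?n hs) = (-1) \<odot>\<^bsub>Omega q\<^esub> dlist hs"
    unfolding dlist_def by (rule Om.lsum_neg) (use hs in \<open>auto simp: lin_smult[OF calc_d_lin] of_form_simps(3)\<close>)
  moreover have "dlist gs \<in> carrier (Omega q)" "dlist hs \<in> carrier (Omega q)"
    unfolding dlist_def by (rule Om.lsum_closed; use gs hs in auto)+
  ultimately show ?thesis by (intro Om.minus_eq_zeroD[of "dlist gs"]) (simp_all add: a_minus_def Om.minus_eq_smult)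
qed

lemma of_form_list_form:
  assumes "set gs \<subseteq> carrier P \<times> carrier P"
  shows "of_form q (list_form gs) = lsum (Omega q) (\<lambda>(g, h). of_P q g \<otimes>\<^bsub>Omega q\<^esub> of_form q (calc_d q h)) gs"
proof -
  have "of_form q (list_form gs) = lsum (Omega q) (\<lambda>x. of_form q (case x of (g, h) \<Rightarrow> lact q g (calc_d q h))) gs"
    unfolding list_form_def by (rule conjunct1[OF lin_lsum[OF PVT.cspace_axioms Om.cspace_axioms of_form_lin]]) (use assms in \<open>auto simp: lact_simps\<close>)
  also have "\<dots> = lsum (Omega q) (\<lambda>(g, h). of_P q g \<otimes>\<^bsub>Omega q\<^esub> of_form q (calc_d q h)) gs"
    by (rule lsum_cong) (use assms in \<open>auto simp: of_form_simps\<close>)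
  finally show ?thesis .
qed

text \<open>Any list that represents the form in the envelope already represents it as a one-form,
  by \<open>of_form_inj\<close>; then \<open>dlist_unique\<close> makes the value independent of the
  list.\<close>

lemma ext_diff_1:
  assumes "set gs \<subseteq> carrier P \<times> carrier P"
  shows "ext_diff q 1 (of_form q (list_form gs)) = dlist gs"
  unfolding ext_diff_def SUq_P
proof (rule the_equality)
  let ?F = "\<lambda>(p, ps). of_P q p \<otimes>\<^bsub>Omega q\<^esub> lprod (Omega q) (of_form q \<circ> calc_d q) ps"
  let ?G = "\<lambda>(p, ps). of_form q (calc_d q p) \<otimes>\<^bsub>Omega q\<^esub> lprod (Omega q) (of_form q \<circ> calc_d q) ps"
  \<comment> \<open>Translates between the lists in the definition, whose second entries are lists
    of length one, and lists of pairs.\<close>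
  have fw: "of_form q (list_form hs) = lsum (Omega q) ?F ts \<and> dlist hs = lsum (Omega q) ?G ts"
    if "hs = map (\<lambda>(p, ps). (p, hd ps)) ts" "set hs \<subseteq> carrier P \<times> carrier P" "\<forall>(p, ps)\<in>set ts. length ps = 1" for hs ts
  proof -
    have sing: "ps = [hd ps]" if "(p, ps) \<in> set ts" for p ps
      using \<open>\<forall>(p, ps)\<in>set ts. length ps = 1\<close> that by (cases ps) auto
    have cl: "hd ps \<in> carrier P" if "(p, ps) \<in> set ts" for p ps using \<open>set hs \<subseteq> _\<close> \<open>hs = _\<close> that by force
    have "?F x = (case (case x of (p, ps) \<Rightarrow> (p, hd ps)) of (g, h) \<Rightarrow> of_P q g \<otimes>\<^bsub>Omega q\<^esub> of_form q (calc_d q h))"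
      "?G x = (case (case x of (p, ps) \<Rightarrow> (p, hd ps)) of (g, h) \<Rightarrow> of_form q (calc_d q g) \<otimes>\<^bsub>Omega q\<^esub> of_form q (calc_d q h))"
      if "x \<in> set ts" for x
    proof -
      obtain p ps where x: "x = (p, ps)" by (cases x)
      have "lprod (Omega q) (of_form q \<circ> calc_d q) ps = of_form q (calc_d q (hd ps))"
        using sing[of p ps] cl[of p ps] that x lprod_sing[of "hd ps"] by metis
      then show "?F x = (case (case x of (p, ps) \<Rightarrow> (p, hd ps)) of (g, h) \<Rightarrow> of_P q g \<otimes>\<^bsub>Omega q\<^esub> of_form q (calc_d q h))"
        "?G x = (case (case x of (p, ps) \<Rightarrow> (p, hd ps)) of (g, h) \<Rightarrow> of_form q (calc_d q g) \<otimes>\<^bsub>Omega q\<^esub> of_form q (calc_d q h))"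
        by (simp_all add: x)
    qed
    note * = this
    have "lsum (Omega q) ?F ts = lsum (Omega q) (\<lambda>(g, h). of_P q g \<otimes>\<^bsub>Omega q\<^esub> of_form q (calc_d q h)) hs"
      "lsum (Omega q) ?G ts = dlist hs"
      unfolding that(1) dlist_def lsum_map by (rule lsum_cong, erule *)+
    then show ?thesis using of_form_list_form[OF that(2)] by simp
  qed
  show "\<exists>ts. (\<forall>(p, ps)\<in>set ts. p \<in> carrier P \<and> set ps \<subseteq> carrier P \<and> length ps = 1) \<and>
      of_form q (list_form gs) = lsum (Omega q) ?F ts \<and> dlist gs = lsum (Omega q) ?G ts"
  proof (intro exI[of _ "map (\<lambda>(g, h). (g, [h])) gs"] conjI)
    have "gs = map (\<lambda>(p, ps). (p, hd ps)) (map (\<lambda>(g, h). (g, [h])) gs)" by (induction gs) auto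
    from fw[OF this assms] show "of_form q (list_form gs) = lsum (Omega q) ?F (map (\<lambda>(g, h). (g, [h])) gs)"
      "dlist gs = lsum (Omega q) ?G (map (\<lambda>(g, h). (g, [h])) gs)" by (simp_all add: split_def)
  qed (use assms in auto)
  fix w assume "\<exists>ts. (\<forall>(p, ps)\<in>set ts. p \<in> carrier P \<and> set ps \<subseteq> carrier P \<and> length ps = 1) \<and>
      of_form q (list_form gs) = lsum (Omega q) ?F ts \<and> w = lsum (Omega q) ?G ts"
  then obtain ts where ts: "\<forall>(p, ps)\<in>set ts. p \<in> carrier P \<and> set ps \<subseteq> carrier P \<and> length ps = 1"
    "of_form q (list_form gs) = lsum (Omega q) ?F ts" "w = lsum (Omega q) ?G ts" by blast
  let ?hs = "map (\<lambda>(p, ps). (p, hd ps)) ts"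
  have hs: "set ?hs \<subseteq> carrier P \<times> carrier P"
  proof
    fix x assume "x \<in> set ?hs"
    then obtain p ps where x: "(p, ps) \<in> set ts" "x = (p, hd ps)" by auto
    then have "p \<in> carrier P" "set ps \<subseteq> carrier P" "ps \<noteq> []" using ts(1) by auto
    then show "x \<in> carrier P \<times> carrier P" using x(2) hd_in_set[of ps] by auto
  qed
  have F: "of_form q (list_form ?hs) = lsum (Omega q) ?F ts \<and> dlist ?hs = lsum (Omega q) ?G ts"
    by (rule fw[OF refl hs]) (use ts(1) in auto)
  then have "list_form ?hs = list_form gs" using ts(2) list_form_closed hs assms by (intro of_form_inj) simp_all
  then show "w = dlist gs" using F ts(3) dlist_unique[OF hs assms] by simp
qed

subsection \<open>The Laplacian\<close>

lemma base_form1_eq: "x \<in> carrier P \<Longrightarrow> y \<in> carrier P \<Longrightarrow> base_form1 q x y = of_form q (frm \<zero> y x)"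
  using of_form_expand[of "frm \<zero> y x"]
  by (simp add: X_frm base_form1_def eta_minus_eq eta_plus_eq Om.a_comm)

lemma base_form1_inj:
  assumes "x \<in> carrier P" "y \<in> carrier P" "x' \<in> carrier P" "y' \<in> carrier P" "base_form1 q x y = base_form1 q x' y'"
  shows "x = x' \<and> y = y'"
proof -
  have "frm \<zero> y x = frm \<zero> y' x'" using assms by (intro of_form_inj) (simp_all add: base_form1_eq)
  from arg_cong[OF this, of "X Ipl"] arg_cong[OF this, of "X Imi"] show ?thesis using assms by (simp add: X_frm)
qed

lemma hodge_1:
  assumes "x \<in> weight_space q 2" "y \<in> weight_space q (-2)"
  shows "hodge q 1 (base_form1 q x y) = base_form1 q (\<ominus> suq_star y) (suq_star x)"
  unfolding hodge_def
proof (simp, rule the_equality)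
  fix w assume "\<exists>x'\<in>weight_space q 2. \<exists>y'\<in>weight_space q (-2). base_form1 q x y = base_form1 q x' y' \<and>
    w = base_form1 q (\<ominus> suq_star y') (suq_star x')"
  then show "w = base_form1 q (\<ominus> suq_star y) (suq_star x)"
    using base_form1_inj[of x y] assms weight_spaceD(1) by blast
qed (use assms in blast)

lemma hodge_0: "b \<in> hyperboloid q \<Longrightarrow> hodge q 0 (of_P q b) = base_form2 q (suq_star b)"
  unfolding hodge_def
proof (simp, rule the_equality)
  fix w assume b: "b \<in> hyperboloid q" and "\<exists>b'\<in>hyperboloid q. of_P q b = of_P q b' \<and> w = base_form2 q (suq_star b')"
  then show "w = base_form2 q (suq_star b)" using of_P_inj weight_spaceD(1)[of _ 0] unfolding hyperboloid_eq by metis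
qed blast

text \<open>The Hodge operator on functions is injective because the coefficient of the volume form
  is unique and the star is involutive, so the chosen preimage is the obvious one.\<close>

lemma inv_hodge_0:
  assumes "c \<in> hyperboloid q"
  shows "inv_into (base_forms q 0) (hodge q 0) (base_form2 q c) = of_P q (suq_star c)"
proof (rule inv_into_f_eq)
  have c: "c \<in> carrier P" "suq_star c \<in> hyperboloid q"
    using assms star_weight[of c 0] by (simp_all add: hyperboloid_eq weight_spaceD)
  show "inj_on (hodge q 0) (base_forms q 0)"
  proof (rule inj_onI)
    fix u v assume "u \<in> base_forms q 0" "v \<in> base_forms q 0" and e: "hodge q 0 u = hodge q 0 v"
    then obtain x y where xy: "x \<in> hyperboloid q" "y \<in> hyperboloid q" "u = of_P q x" "v = of_P q y" by (auto simp: base_forms_def)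
    then have P: "x \<in> carrier P" "y \<in> carrier P" by (simp_all add: hyperboloid_eq weight_spaceD)
    have "suq_star x = suq_star y" using e xy P by (intro volume_inj) (simp_all add: hodge_0)
    then have "suq_star (suq_star x) = suq_star (suq_star y)" by simp
    then show "u = v" using P xy by simp
  qed
  show "of_P q (suq_star c) \<in> base_forms q 0" using c(2) by (simp add: base_forms_def)
  show "hodge q 0 (of_P q (suq_star c)) = base_form2 q c" using hodge_0[OF c(2)] c(1) by simp
qed

lemma lap_weight: "b \<in> hyperboloid q \<Longrightarrow> lap b \<in> hyperboloid q"
  unfolding hyperboloid_eq lap_def using dd_weight[of b 0] dd_weight[of "dd Imi b" 2] by (auto intro: weight_smult)

text \<open>On functions only the codifferential of db contributes. The Hodge operator moves the
  stars onto the coefficients of db, the exterior derivative takes their skew derivatives, and the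
  inverse Hodge operator stars back; \<open>star_dd\<close> removes all stars again.\<close>

lemma square_q_lap:
  assumes "b \<in> hyperboloid q"
  shows "square_q q b = lap b"
proof -
  have b0: "b \<in> weight_space q 0" and [simp]: "b \<in> carrier P" using assms by (simp_all add: hyperboloid_eq weight_spaceD)
  define x y where "x = dd Imi b" and "y = dd Ipl b"
  have x: "x \<in> weight_space q 2" and y: "y \<in> weight_space q (-2)" using dd_weight[OF b0] by (simp_all add: x_def y_def)
  have [simp]: "x \<in> carrier P" "y \<in> carrier P" by (simp_all add: x_def y_def)
  have "calc_d q b = frm \<zero> y x"
  proof (rule form_eqI)
    show "X i (calc_d q b) = X i (frm \<zero> y x)" for i
      using dd_Ith_weight[OF b0] by (cases i) (simp_all add: X_calc_d X_frm x_def y_def)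
  qed simp_all
  then have d0: "ext_diff q 0 (of_P q b) = base_form1 q x y"
    by (simp add: ext_diff_0 base_form1_eq)
  define x' y' where "x' = \<ominus> suq_star y" and "y' = suq_star x"
  have x': "x' \<in> weight_space q 2" and y': "y' \<in> weight_space q (-2)"
    using star_weight[OF x] star_weight[OF y] weight_smult[OF star_weight[OF y], of "-1"]
    by (simp_all add: x'_def y'_def minus_eq_smult)
  have [simp]: "x' \<in> carrier P" "y' \<in> carrier P" by (simp_all add: x'_def y'_def)
  have gs: "set (base_list x' y') \<subseteq> carrier P \<times> carrier P" by (simp add: base_list_def)
  have "list_form (base_list x' y') = frm \<zero> y' x'"
  proof (rule form_eqI)
    show "X i (list_form (base_list x' y')) = X i (frm \<zero> y' x')" for i
      by (simp add: X_list_form[OF gs] base_list_coords X_frm)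
  qed (simp_all add: list_form_closed[OF gs])
  \<comment> \<open>The coefficient of the volume form in the derivative of the Hodge dual of db,
    taken from \<open>dlist_base_list\<close>.\<close>
  define c where "c = dd Imi y' \<ominus> Q^2 \<odot> dd Ipl x'"
  have c: "c \<in> weight_space q 0"
  proof -
    have "dd Imi y' \<in> weight_space q 0" "dd Ipl x' \<in> weight_space q 0" using dd_weight[OF x'] dd_weight[OF y'] by simp_all
    then have "dd Imi y' \<oplus> (- (Q^2)) \<odot> dd Ipl x' \<in> weight_space q 0" by (intro weight_add weight_smult)
    then show ?thesis by (simp add: c_def a_minus_def minus_eq_smult smult_assoc[symmetric])
  qed
  have d1: "ext_diff q 1 (base_form1 q x' y') = base_form2 q c"
    using ext_diff_1[OF gs] \<open>list_form (base_list x' y') = _\<close> dlist_base_list[OF x' y']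
    by (simp add: base_form1_eq base_form2_def dvol_def eta_minus_eq eta_plus_eq c_def)
  have cd: "codiff q 1 (base_form1 q x y) = (-1) \<odot>\<^bsub>Omega q\<^esub> of_P q (suq_star c)"
    using hodge_1[OF x y] d1 inv_hodge_0[of c] c by (simp add: x'_def y'_def hyperboloid_eq)
  have [simp]: "c \<in> carrier P" using c by (rule weight_spaceD)
  have star_c: "suq_star c = (1 + Q^4) \<odot> dd Ipl (dd Imi b)"
  proof -
    \<comment> \<open>Both x and x' have weight 2, so the power of q in \<open>star_dd\<close> is
      trivial.\<close>
    have 1: "suq_star (dd Imi y') = dd Ipl x"
    proof -
      have "suq_star (dd Ipl x) = dd Imi y'" using star_dd[OF x] by (simp add: y'_def)
      then have "suq_star (suq_star (dd Ipl x)) = suq_star (dd Imi y')" by simp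
      then show ?thesis by simp
    qed
    have 2: "suq_star (dd Ipl x') = (-1) \<odot> dd Imi y"
      using star_dd[OF x'] by (simp add: x'_def star_uminus dd_uminus) (simp add: minus_eq_smult)
    have "suq_star c = dd Ipl x \<oplus> Q^2 \<odot> dd Imi y"
      by (simp add: c_def a_minus_def star_add star_smult star_uminus 1 2 minus_eq_smult smult_assoc[symmetric])
    \<comment> \<open>The commutator in weight zero; with the factor \<open>Q^2\<close> already
      present this is the source of \<open>1 + Q^4\<close>.\<close>
    also have "dd Imi y = Q^2 \<odot> dd Ipl x"
      using dd_commutator_weight[OF b0] by (simp add: x_def y_def)
    finally show ?thesis
      by (simp add: x_def smult_assoc[symmetric] smult_l_distr flip: power_add)
  qed
  have "laplacian q 0 (of_P q b) = of_P q (lap b)"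
    using cd d0 by (simp add: laplacian_def star_c lap_def of_P_simps(3)[symmetric] smult_assoc[symmetric] del: of_P_simps(3))
  moreover have "inj_on (of_P q) (hyperboloid q)"
    by (rule inj_onI, rule of_P_inj) (simp_all add: hyperboloid_eq weight_spaceD)
  ultimately show ?thesis
    unfolding square_q_def using lap_weight[OF assms] by simp
qed

end

context quantum_su
begin

subsection \<open>The eigenvalues\<close>

definition real_eigval :: "nat \<Rightarrow> real" where
  "real_eigval n = - (1 + q^4) * q powi (- 2 * int n) * qint q (int n) * qint q (int (Suc n))"

lemma eigval_real_eigval: "eigval n = complex_of_real (real_eigval n)"
  by (simp add: eigval_def real_eigval_def Qn_def)

lemma powi_double: "q powi (2 * int n) = (q^2) ^ n" "q powi (- 2 * int n) = 1 / (q^2) ^ n"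
proof -
  show 1: "q powi (2 * int n) = (q^2) ^ n" using power_int_of_nat[of q "2 * n"] by (simp add: power_mult)
  have "q powi (- 2 * int n) = inverse (q powi (2 * int n))" using power_int_minus[of q "2 * int n"] by simp
  then show "q powi (- 2 * int n) = 1 / (q^2) ^ n" unfolding 1 by (simp add: inverse_eq_divide)
qed

lemma qint_pow: "qint q (int n) = ((q^2) ^ n - 1) / (q^2 - 1)"
  "qint q (int n + 1) = (q^2 * (q^2) ^ n - 1) / (q^2 - 1)"
proof -
  show *: "qint q (int n) = ((q^2) ^ n - 1) / (q^2 - 1)" for n by (simp add: qint_nat power_mult)
  show "qint q (int n + 1) = (q^2 * (q^2) ^ n - 1) / (q^2 - 1)" using *[of "Suc n"] by (simp add: add.commute)
qed

lemma real_eigval_eq: "real_eigval n = - (1 + q^4) * (1 / (q^2) ^ n) * (((q^2) ^ n - 1) / (q^2 - 1)) * ((q^2 * (q^2) ^ n - 1) / (q^2 - 1))"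
  unfolding real_eigval_def powi_double using qint_pow[of n] by (simp add: add.commute)

text \<open>With powers of \<open>q^2\<close> abbreviated by variables the claim is an identity of
  rational functions. The cases of positive and negative t follow the same pattern with two such
  variables.\<close>

lemma eig_e_zero: "eig_e q 0 k k = real_eigval k"
proof -
  define x r d where "x = (q^2) ^ k" and "r = q^2" and "d = r - 1"
  have nz: "x \<noteq> 0" "d \<noteq> 0" using q2_less_1 by (simp_all add: x_def r_def d_def)
  have "q powi (- 2 * int k + 2) = r / x"
    using power_int_add[of q "- 2 * int k" 2] powi_double(2)[of k] by (simp add: x_def r_def)
  then have "eig_e q 0 k k = - ((1 / x + r^2) * ((x - 1) / d) + r / x * (1 + r) * ((x - 1) / d)^2)"
    using powi_double(2)[of k] by (simp add: eig_e_def Let_def qint_pow x_def r_def d_def)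
  also have "\<dots> = - (1 + r^2) * (1 / x) * ((x - 1) / d) * ((r * x - 1) / d)"
    using nz by (simp add: divide_simps) (simp add: d_def algebra_simps power2_eq_square)
  finally show ?thesis unfolding real_eigval_eq by (simp add: x_def r_def d_def)
qed

lemma eig_e_pos: "s \<ge> 1 \<Longrightarrow> eig_e q (int s) k (s + k) = real_eigval (s + k)"
proof -
  assume s: "s \<ge> 1"
  define x y r d where "x = (q^2) ^ s" and "y = (q^2) ^ k" and "r = q^2" and "d = r - 1"
  have nz: "x \<noteq> 0" "y \<noteq> 0" "d \<noteq> 0" using q2_less_1 by (simp_all add: x_def y_def r_def d_def)
  have p: "q powi (2 * int s + 2) = x * r" "q powi (4 + 2 * int s) = x * r^2" "q powi (- 2 * int (s + k)) = 1 / (x * y)"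
    using power_int_add[of q "2 * int s" 2] power_int_add[of q 4 "2 * int s"] powi_double(1)[of s] powi_double(2)[of "s + k"]
    by (simp_all add: x_def y_def r_def power_add)
  have i: "qint q (int (s + k)) = (x * y - 1) / d" "qint q (int (s + k) + 1) = (r * (x * y) - 1) / d"
    "qint q (int s) = (x - 1) / d" "qint q (int s + 1) = (r * x - 1) / d" "qint q (int k) = (y - 1) / d"
    unfolding qint_pow by (simp_all add: x_def y_def r_def d_def power_add)
  have "eig_e q (int s) k (s + k) = - (1 / (x * y)) * ((x * y - 1) / d * ((r * x - 1) / d) + x * r * ((x * y - 1) / d) * ((y - 1) / d)
      + r^2 * ((x - 1) / d) * ((r * (x * y) - 1) / d) + x * r^2 * ((y - 1) / d) * ((r * (x * y) - 1) / d))"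
    using s unfolding eig_e_def Let_def p i by (simp add: r_def)
  also have "\<dots> = - (1 + r^2) * (1 / (x * y)) * ((x * y - 1) / d) * ((r * (x * y) - 1) / d)"
    using nz by (simp add: divide_simps) (simp add: algebra_simps power2_eq_square)
  finally show ?thesis unfolding real_eigval_eq by (simp add: x_def y_def r_def d_def power_add)
qed

lemma eig_e_neg: "s \<ge> 1 \<Longrightarrow> eig_e q (- int s) (s + l) l = real_eigval (s + l)"
proof -
  assume s: "s \<ge> 1"
  define x y r d where "x = (q^2) ^ s" and "y = (q^2) ^ l" and "r = q^2" and "d = r - 1"
  have nz: "x \<noteq> 0" "y \<noteq> 0" "d \<noteq> 0" using q2_less_1 by (simp_all add: x_def y_def r_def d_def)
  have p: "q powi (- 2 * int s) = 1 / x" "q powi (- 2 * int l) = 1 / y" "q powi (- 2 * int l + 4) = r^2 / y"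
    using power_int_add[of q "- 2 * int l" 4] powi_double(2)[of l] powi_double(2)[of s]
    by (simp_all add: x_def y_def r_def)
  have i: "qint q (int (s + l)) = (x * y - 1) / d" "qint q (int (s + l) + 1) = (r * (x * y) - 1) / d"
    "qint q (int s) = (x - 1) / d" "qint q (int s + 1) = (r * x - 1) / d" "qint q (int l) = (y - 1) / d"
    unfolding qint_pow by (simp_all add: x_def y_def r_def d_def power_add)
  have "eig_e q (- int s) (s + l) l = - (1 / x) * ((x - 1) / d * ((r * (x * y) - 1) / d) + 1 / y * ((y - 1) / d) * ((r * (x * y) - 1) / d)
      + r^2 * ((x * y - 1) / d) * ((r * x - 1) / d) + r^2 / y * ((x * y - 1) / d) * ((y - 1) / d))"
    using s unfolding eig_e_def Let_def unfolding minus_minus unfolding p i by (simp add: i p(1)[simplified] r_def)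
  also have "\<dots> = - (1 + r^2) * (1 / (x * y)) * ((x * y - 1) / d) * ((r * (x * y) - 1) / d)"
    using nz by (simp add: divide_simps) (simp add: algebra_simps power2_eq_square)
  finally show ?thesis unfolding real_eigval_eq by (simp add: x_def y_def r_def d_def power_add)
qed

lemma triples_cases:
  assumes "(t, k, l) \<in> triples"
  obtains (zero) "t = 0" "k = l" | (pos) s where "s \<ge> 1" "t = int s" "l = s + k" | (neg) s where "s \<ge> 1" "t = - int s" "k = s + l"
proof -
  have e: "t + int k - int l = 0" using assms by (simp add: triples_def)
  show ?thesis
  proof (cases "t = 0")
    case True then show ?thesis using e zero by simp
  next
    case False
    then show ?thesis using e pos[of "nat t"] neg[of "nat (- t)"] by (cases "t > 0") auto
  qed
qed

lemma eig_e_real_eigval: "(t, k, l) \<in> triples \<Longrightarrow> eig_e q t k l = real_eigval (max k l)"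
  by (erule triples_cases) (simp_all add: eig_e_zero eig_e_pos eig_e_neg)

text \<open>For positive t one has \<open>t = l - k\<close>, for negative t
  \<open>s = k - l\<close>; both turn the exponent of q into \<open>-2 k\<close>.\<close>

lemma eig_c_lower_coeff:
  assumes "(t, k, l) \<in> triples"
  shows "complex_of_real (eig_c q t k l) = lower_coeff k l"
proof -
  have "eig_c q t k l = - (1 + q^4) * q powi (- 2 * int k) * qint q (int k) * qint q (int l)"
    using assms by (cases rule: triples_cases) (simp_all add: eig_c_def Let_def power2_eq_square algebra_simps)
  then show ?thesis by (simp add: lower_coeff_def Qn_def)
qed

text \<open>Up to the factor \<open>- (1 + q^4)\<close>, of absolute value at least 1, the value at
  n is the product of \<open>g n\<close>, which is \<open>q^(-2n) [n]\<close>, and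
  \<open>b (n + 1)\<close>, which is \<open>[n + 1]\<close>. From n to n + 1 the first factor grows
  by \<open>r^(-n-1)\<close>, hence by at least 1, while the second is at least 1 and does not
  decrease.\<close>

lemma real_eigval_gap: "real_eigval (Suc n) + 1 \<le> real_eigval n"
proof -
  define r g b where "r = q^2" and "g = (\<lambda>n. (1 / r ^ n - 1) / (1 - r))" and "b = (\<lambda>n. (1 - r ^ n) / (1 - r))"
  have r: "0 < r" "r < 1" using q2_less_1 by (simp_all add: r_def)
  have E: "real_eigval m = - (1 + q^4) * (g m * b (Suc m))" for m
  proof -
    define x d where "x = r ^ m" and "d = r - 1"
    have nz: "x \<noteq> 0" "d \<noteq> 0" and e: "1 - r = - d" using r by (simp_all add: x_def d_def)
    show ?thesis unfolding real_eigval_eq g_def b_def r_def[symmetric] x_def[symmetric] d_def[symmetric] e power_Suc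
      using nz by (simp add: divide_simps) (simp add: r_def algebra_simps)
  qed
  have g: "g (Suc n) - g n = 1 / r ^ Suc n"
    using r by (simp add: g_def divide_simps) (simp add: algebra_simps)
  have rn: "r ^ m \<le> 1" for m using r by (simp add: power_le_one)
  have b: "b (Suc n) \<ge> 1" "b (Suc (Suc n)) \<ge> b (Suc n)"
    using r rn[of n] rn[of "Suc n"] mult_left_le[of "r ^ n" r] mult_right_mono[of r 1 "r ^ Suc n"]
    by (simp_all add: b_def divide_simps)
  have gn: "g n \<ge> 0" using r rn[of n] by (simp add: g_def divide_simps)
  have "1 \<le> 1 / r ^ Suc n" using r rn[of "Suc n"] by (simp add: divide_simps)
  then have "1 * 1 \<le> (g (Suc n) - g n) * b (Suc n)" unfolding g[symmetric] using b(1) by (intro mult_mono) simp_all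
  also have "\<dots> \<le> g (Suc n) * b (Suc (Suc n)) - g n * b (Suc n)"
  proof -
    have "g (Suc n) \<ge> 0" using gn g \<open>1 \<le> 1 / r ^ Suc n\<close> by linarith
    then have "g (Suc n) * b (Suc n) \<le> g (Suc n) * b (Suc (Suc n))" using b(2) by (rule mult_left_mono[rotated])
    then show ?thesis by (simp add: left_diff_distrib)
  qed
  finally have "1 * 1 \<le> (1 + q^4) * (g (Suc n) * b (Suc (Suc n)) - g n * b (Suc n))"
    by (intro mult_mono) simp_all
  then show ?thesis unfolding E by (simp add: algebra_simps)
qed

lemma real_eigval_less: "m < n \<Longrightarrow> real_eigval n + 1 \<le> real_eigval m"
proof (induction rule: less_Suc_induct)
  case (1 i)
  show ?case by (rule real_eigval_gap)
qed simp

lemma real_eigval_dist: "m \<noteq> n \<Longrightarrow> \<bar>real_eigval m - real_eigval n\<bar> \<ge> 1"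
  using real_eigval_less[of m n] real_eigval_less[of n m] by (cases m n rule: linorder_cases) auto

lemma real_eigval_eq_iff [simp]: "real_eigval m = real_eigval n \<longleftrightarrow> m = n"
  using real_eigval_dist[of m n] by force

lemma triples_minus: "(t, k, l) \<in> triples \<Longrightarrow> j \<le> min k l \<Longrightarrow> (t, k - j, l - j) \<in> triples"
  by (auto simp: triples_def)

lemma max_minus: "j \<le> min k l \<Longrightarrow> max (k - j) (l - j) = max k l - j" for k l j :: nat
  by (auto simp: max_def)

lemma denominator:
  assumes "(t, k, l) \<in> triples" "j < min k l"
  shows "eig_e q t k l - eig_e q t (k - j - 1) (l - j - 1) = real_eigval (max k l) - real_eigval (max k l - Suc j)"
    and "eig_e q t k l - eig_e q t (k - j - 1) (l - j - 1) \<noteq> 0"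
  using assms(2) eig_e_real_eigval[OF assms(1)] eig_e_real_eigval[OF triples_minus[OF assms(1), of "Suc j"]] max_minus[of "Suc j" k l]
  by (auto simp: max_def)

subsection \<open>The eigenbasis\<close>

lemma lap_lin: "lin P P lap"
  by (rule linI) (auto simp: lap_def dd_add dd_smult smult_r_distr smult_assoc[symmetric] mult.commute)

text \<open>Truncations of \<open>eig_p\<close>. They make the eigenvector equation provable by
  induction on the number of correction terms.\<close>

definition psum :: "int \<Rightarrow> nat \<Rightarrow> nat \<Rightarrow> nat \<Rightarrow> suq" where
  "psum t k l j = M t k l \<oplus> (\<Oplus>i\<in>{1..j}. complex_of_real (p_coeff q t k l i) \<odot> M t (k - i) (l - i))"

lemma psum_0: "psum t k l 0 = M t k l"
  by (simp add: psum_def)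

lemma psum_Suc: "psum t k l (Suc j) = psum t k l j \<oplus> complex_of_real (p_coeff q t k l (Suc j)) \<odot> M t (k - Suc j) (l - Suc j)"
  by (simp add: psum_def atLeastAtMostSuc_conv finsum_insert Pi_iff a_ac)

lemma psum_closed [simp]: "psum t k l j \<in> carrier P"
  by (induction j) (simp_all add: psum_0 psum_Suc)

lemma eig_p_psum: "eig_p q t k l = psum t k l (min k l)"
  by (simp add: eig_p_def psum_def)

lemma p_coeff_Suc:
  assumes "(t, k, l) \<in> triples" "j < min k l"
  shows "complex_of_real (p_coeff q t k l (Suc j)) * (eigval (max k l) - eigval (max k l - Suc j)) =
    complex_of_real (p_coeff q t k l j) * lower_coeff (k - j) (l - j)"
proof -
  have "lower_coeff (k - j) (l - j) = complex_of_real (eig_c q t (k - j) (l - j))"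
    using triples_minus[OF assms(1), of j] assms(2) by (simp add: eig_c_lower_coeff)
  moreover have "p_coeff q t k l (Suc j) * (real_eigval (max k l) - real_eigval (max k l - Suc j)) = p_coeff q t k l j * eig_c q t (k - j) (l - j)"
    unfolding denominator(1)[OF assms, symmetric] using denominator(2)[OF assms] by (simp add: p_coeff_def)
  ultimately show ?thesis unfolding eigval_real_eigval by (metis of_real_diff of_real_mult)
qed

text \<open>A truncated sum fails the eigenvector equation by one multiple of the next lower
  monomial. The recursion \<open>p_coeff_Suc\<close> chooses the next coefficient to compensate this
  defect, which moves it one step further down.\<close>

lemma lap_psum:
  assumes "(t, k, l) \<in> triples" "j \<le> min k l"
  shows "lap (psum t k l j) = eigval (max k l) \<odot> psum t k l j \<oplus>
    (complex_of_real (p_coeff q t k l j) * lower_coeff (k - j) (l - j)) \<odot> M t (k - Suc j) (l - Suc j)"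
  using assms(2)
proof (induction j)
  case 0
  then show ?case using lap_M[OF assms(1)] by (simp add: psum_0 p_coeff_def)
next
  case (Suc j)
  let ?p = "complex_of_real (p_coeff q t k l (Suc j))" and ?e = "eigval (max k l)" and ?e' = "eigval (max k l - Suc j)"
  have p: "complex_of_real (p_coeff q t k l j) * lower_coeff (k - j) (l - j) = ?p * (?e - ?e')"
    using p_coeff_Suc[OF assms(1), of j] Suc by simp
  have m: "lap (M t (k - Suc j) (l - Suc j)) = ?e' \<odot> M t (k - Suc j) (l - Suc j) \<oplus>
      lower_coeff (k - Suc j) (l - Suc j) \<odot> M t (k - Suc (Suc j)) (l - Suc (Suc j))"
    using lap_M[OF triples_minus[OF assms(1) Suc.prems]] max_minus[OF Suc.prems] by simp
  have "lap (psum t k l (Suc j)) = lap (psum t k l j) \<oplus> ?p \<odot> lap (M t (k - Suc j) (l - Suc j))"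
    unfolding psum_Suc by (simp add: lin_add[OF lap_lin] lin_smult[OF lap_lin])
  also have "\<dots> = ?e \<odot> psum t k l (Suc j) \<oplus> (?p * lower_coeff (k - Suc j) (l - Suc j)) \<odot> M t (k - Suc (Suc j)) (l - Suc (Suc j))"
    unfolding m using Suc unfolding psum_Suc p by (intro eq_by_functionals) (simp_all add: fnl algebra_simps)
  finally show ?case .
qed

lemma lower_coeff_zero: "k * l = 0 \<Longrightarrow> lower_coeff k l = 0"
  by (auto simp: lower_coeff_def)

text \<open>At \<open>j = min k l\<close> one of the remaining exponents is 0, so the defect carries
  the q-integer of 0 and vanishes.\<close>

lemma lap_eig_p:
  assumes "(t, k, l) \<in> triples"
  shows "lap (eig_p q t k l) = eigval (max k l) \<odot> eig_p q t k l"
  using lap_psum[OF assms order_refl] by (simp add: eig_p_psum lower_coeff_zero min_def split: if_splits)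

lemma psum_hyperboloid: "(t, k, l) \<in> triples \<Longrightarrow> j \<le> min k l \<Longrightarrow> psum t k l j \<in> hyperboloid q"
proof (induction j)
  case 0
  then show ?case using M_weight[of t k l] by (simp add: psum_0 hyperboloid_eq triples_def)
next
  case (Suc j)
  have "t + int (k - Suc j) - int (l - Suc j) = 0"
    using triples_minus[OF Suc.prems] unfolding triples_def by blast
  with M_weight[of t "k - Suc j" "l - Suc j"] have "M t (k - Suc j) (l - Suc j) \<in> weight_space q 0" by (simp only:)
  then show ?case using Suc by (simp add: psum_Suc hyperboloid_eq weight_add weight_smult)
qed

text \<open>All correction terms have a \<gamma> exponent strictly below \<open>k'\<close>, hence
  below k; only the leading monomial can contribute.\<close>

lemma coef_psum:
  assumes "k' \<le> k" "j \<le> min k' l'"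
  shows "coef (t, k, l) (psum t' k' l' j) = (if (t', k', l') = (t, k, l) then 1 else 0)"
  using assms(2)
proof (induction j)
  case (Suc j)
  interpret functional P "coef (t, k, l)" by (rule functional_coef)
  have "k' - Suc j \<noteq> k" using Suc.prems assms(1) by linarith
  then show ?case using Suc by (simp add: psum_Suc coef_M)
qed (simp add: psum_0 coef_M)

lemma coef_eig_p: "k' \<le> k \<Longrightarrow> coef (t, k, l) (eig_p q t' k' l') = (if (t', k', l') = (t, k, l) then 1 else 0)"
  by (simp add: eig_p_psum coef_psum)

abbreviation "evec \<equiv> \<lambda>(t, k, l). eig_p q t k l"

lemma evec_closed: "evec \<in> I \<rightarrow> carrier P"
  by (auto simp: eig_p_psum)

lemma evec_independent:
  assumes "finite J" "(\<Oplus>i\<in>J. a i \<odot> evec i) = \<zero>" "i \<in> J"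
  shows "a i = 0"
proof (rule ccontr)
  assume "a i \<noteq> 0"
  define N where "N = {i \<in> J. a i \<noteq> 0}"
  have "i \<in> N" using assms(3) \<open>a i \<noteq> 0\<close> by (simp add: N_def)
  then have N: "finite N" "N \<noteq> {}" using assms(1) unfolding N_def by (simp, blast)
  \<comment> \<open>Among the indices with nonzero coefficient one with maximal \<gamma> exponent is
    selected; by \<open>coef_eig_p\<close> its coefficient functional sees none of the other
    vectors.\<close>
  from N have "Max ((fst \<circ> snd) ` N) \<in> (fst \<circ> snd) ` N" by (intro Max_in) simp_all
  then obtain i0 where i0: "i0 \<in> N" "Max ((fst \<circ> snd) ` N) = fst (snd i0)" by auto
  have max: "fst (snd j) \<le> fst (snd i0)" if "j \<in> N" for j
    unfolding i0(2)[symmetric] using that N(1) by (intro Max_ge) auto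
  have L: "lin P (type_alg (*)) (coef i0)" using functional_iff_lin[OF cspace_axioms] functional_coef by blast
  interpret functional P "coef i0" by (rule functional_coef)
  have "0 = coef i0 (\<Oplus>i\<in>J. a i \<odot> evec i)" using assms(2) by simp
  also have "\<dots> = (\<Sum>i\<in>J. a i * coef i0 (evec i))"
    using lin_finsum[OF cspace_axioms calgebra.axioms(1)[OF calgebra_complex] L assms(1), of "\<lambda>i. a i \<odot> evec i"] evec_closed
    by (simp add: finsum_type_alg[OF assms(1) calgebra.axioms(1)[OF calgebra_complex]] Pi_iff)
  also have "\<dots> = (\<Sum>i\<in>J. if i = i0 then a i else 0)"
  proof (rule sum.cong)
    fix j assume j: "j \<in> J"
    have "coef i0 (evec j) = (if j = i0 then 1 else 0)" if "a j \<noteq> 0"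
      using coef_eig_p[of "fst (snd j)" "fst (snd i0)" "fst i0" "snd (snd i0)" "fst j" "snd (snd j)"] max[of j] j that
      by (simp add: case_prod_beta N_def)
    then show "a j * coef i0 (evec j) = (if j = i0 then a j else 0)" by (cases "a j = 0") auto
  qed simp
  also have "\<dots> = a i0" using i0(1) assms(1) by (simp add: N_def)
  finally show False using i0(1) by (simp add: N_def)
qed

text \<open>The passage from monomials to eigenvectors is unitriangular with respect to the \<gamma>
  exponent, so it is inverted by strong induction on k.\<close>

lemma M_spanned: "(t, k, l) \<in> triples \<Longrightarrow> M t k l \<in> spanned P evec triples"
proof (induction k arbitrary: l rule: less_induct)
  case (less k)
  let ?S = "\<Oplus>i\<in>{1..min k l}. complex_of_real (p_coeff q t k l i) \<odot> M t (k - i) (l - i)"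
  have "?S \<in> spanned P evec triples"
  proof (rule spanned_finsum[OF evec_closed])
    fix i assume i: "i \<in> {1..min k l}"
    then have "M t (k - i) (l - i) \<in> spanned P evec triples"
      using triples_minus[OF less.prems, of i] by (intro less.IH) auto
    then show "complex_of_real (p_coeff q t k l i) \<odot> M t (k - i) (l - i) \<in> spanned P evec triples"
      by (rule spanned_smult[OF evec_closed])
  qed simp_all
  from spanned_smult[OF evec_closed this, of "-1"]
  have "eig_p q t k l \<oplus> (-1) \<odot> ?S \<in> spanned P evec triples"
    using spanned_base[of "(t, k, l)" triples evec] less.prems by (intro spanned_add[OF evec_closed]) (simp_all add: eig_p_psum)
  moreover have "?S \<in> carrier P" by (intro finsum_closed) auto
  then have "eig_p q t k l \<oplus> (-1) \<odot> ?S = M t k l"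
    by (simp add: eig_p_def a_assoc r_neg flip: minus_eq_smult)
  ultimately show ?case by simp
qed

lemma hyperboloid_spanned_evec: "b \<in> hyperboloid q \<Longrightarrow> b \<in> spanned P evec triples"
proof -
  assume "b \<in> hyperboloid q"
  from hyperboloid_spanned[OF this] mnm_closed show ?thesis
  proof (induction rule: spanned_induct)
    case zero
    then show ?case by (rule spanned_zero)
  next
    case (add_smult i c x)
    have "mnm i \<in> spanned P evec triples" using add_smult(1) M_spanned by (cases i) simp
    then show ?case using add_smult(3) by (rule spanned_add[OF evec_closed spanned_smult[OF evec_closed]])
  qed
qed

lemma linear_basis_evec: "linear_basis P (hyperboloid q) triples evec"
  unfolding linear_basis_def
proof (intro conjI ballI allI impI)
  show "evec i \<in> hyperboloid q" if "i \<in> triples" for i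
    using that psum_hyperboloid by (cases i) (auto simp: eig_p_psum)
  show "a i = 0" if "finite J \<and> J \<subseteq> triples \<and> (\<Oplus>i\<in>J. a i \<odot> evec i) = \<zero>" "i \<in> J" for J a i
    using that evec_independent by blast
  show "\<exists>J a. finite J \<and> J \<subseteq> triples \<and> u = (\<Oplus>i\<in>J. a i \<odot> evec i)" if u: "u \<in> hyperboloid q" for u
  proof -
    obtain f where "u = lext P evec f" "Poly_Mapping.keys f \<subseteq> triples"
      using hyperboloid_spanned_evec[OF u] by (auto simp: spanned_def)
    then show ?thesis unfolding lext_def
      by (intro exI[of _ "Poly_Mapping.keys f"] exI[of _ "Poly_Mapping.lookup f"]) simp
  qed
qed

text \<open>The operator \<open>lap - \<mu>\<close> is diagonal in the eigenbasis. Since it kills b,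
  independence forces \<mu> to be the eigenvalue of every basis vector that occurs in b, and b is
  nonzero.\<close>

lemma eigenvalue_eigval:
  assumes b: "b \<in> hyperboloid q" "b \<noteq> \<zero>" and e: "lap b = \<mu> \<odot> b"
  shows "\<mu> \<in> range eigval"
proof -
  obtain f where f: "b = lext P evec f" "Poly_Mapping.keys f \<subseteq> triples"
    using hyperboloid_spanned_evec[OF b(1)] by (auto simp: spanned_def)
  let ?K = "Poly_Mapping.keys f" and ?f = "Poly_Mapping.lookup f"
  have cl: "evec i \<in> carrier P" for i using evec_closed by auto
  have L: "lin P P (\<lambda>x. lap x \<oplus> (- \<mu>) \<odot> x)"
    by (rule linI; (rule eq_by_functionals)?) (simp_all add: fnl lin_add[OF lap_lin] lin_smult[OF lap_lin] lin_closed[OF lap_lin] algebra_simps)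
  have "lap b \<oplus> (- \<mu>) \<odot> b = (\<Oplus>i\<in>?K. lap (?f i \<odot> evec i) \<oplus> (- \<mu>) \<odot> (?f i \<odot> evec i))"
    unfolding f(1) lext_def by (rule lin_finsum[OF cspace_axioms cspace_axioms L]) (simp_all add: cl)
  also have "\<dots> = (\<Oplus>i\<in>?K. (?f i * (eigval (max (fst (snd i)) (snd (snd i))) - \<mu>)) \<odot> evec i)"
  proof (rule finsum_cong')
    fix i assume "i \<in> ?K"
    then have "lap (evec i) = eigval (max (fst (snd i)) (snd (snd i))) \<odot> evec i"
      using f(2) lap_eig_p by (cases i) auto
    then show "lap (?f i \<odot> evec i) \<oplus> (- \<mu>) \<odot> (?f i \<odot> evec i) = (?f i * (eigval (max (fst (snd i)) (snd (snd i))) - \<mu>)) \<odot> evec i"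
      using cl by (intro eq_by_functionals) (simp_all add: fnl lin_smult[OF lap_lin] lin_closed[OF lap_lin] algebra_simps)
  qed (auto simp: cl)
  finally have "(\<Oplus>i\<in>?K. (?f i * (eigval (max (fst (snd i)) (snd (snd i))) - \<mu>)) \<odot> evec i) = lap b \<oplus> (- \<mu>) \<odot> b" ..
  also have "\<dots> = \<zero>"
    unfolding e using b(1) by (intro eq_by_functionals) (simp_all add: fnl hyperboloid_eq weight_spaceD)
  finally have z: "(\<Oplus>i\<in>?K. (?f i * (eigval (max (fst (snd i)) (snd (snd i))) - \<mu>)) \<odot> evec i) = \<zero>" .
  have "?f i * (eigval (max (fst (snd i)) (snd (snd i))) - \<mu>) = 0" if "i \<in> ?K" for i
    by (rule evec_independent[OF finite_keys z that])
  moreover obtain i where "i \<in> ?K" using b(2) f(1) by fastforce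
  ultimately have "eigval (max (fst (snd i)) (snd (snd i))) = \<mu>" by (simp add: in_keys_iff)
  then show ?thesis by blast
qed

lemma eigenvalues_eq: "eigenvalues q = range eigval"
proof
  show "eigenvalues q \<subseteq> range eigval" using eigenvalue_eigval by (auto simp: eigenvalues_def square_q_lap)
  have "eigval n \<in> eigenvalues q" for n
  proof -
    \<comment> \<open>The eigenvalue depends on \<open>max k l\<close> only, so the triple with t =
      0 and k = l = n realises the n-th value.\<close>
    have t: "(0, n, n) \<in> triples" by (simp add: triples_def)
    interpret functional P "coef (0, n, n)" by (rule functional_coef)
    have "eig_p q 0 n n \<noteq> \<zero>" using coef_eig_p[of n n 0 n 0 n] by auto
    moreover have "eig_p q 0 n n \<in> hyperboloid q" unfolding eig_p_psum by (rule psum_hyperboloid[OF t]) simp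
    ultimately show ?thesis using lap_eig_p[OF t] by (auto simp: eigenvalues_def square_q_lap intro!: bexI[of _ "eig_p q 0 n n"])
  qed
  then show "range eigval \<subseteq> eigenvalues q" by auto
qed

lemma infinite_eigenvalues: "infinite (eigenvalues q)"
proof -
  have "inj eigval" by (rule injI) (simp add: eigval_real_eigval)
  then show ?thesis unfolding eigenvalues_eq by (rule range_inj_infinite)
qed

text \<open>Distinct eigenvalues are at distance at least 1, so the set is even uniformly discrete
  with constant 1.\<close>

lemma discrete_eigenvalues: "discrete (eigenvalues q)"
proof (rule uniform_discrete_imp_discrete)
  have "m = n" if "dist (eigval m) (eigval n) < 1" for m n
    using that real_eigval_dist[of m n] by (force simp: eigval_real_eigval dist_norm simp flip: of_real_diff)
  then show "uniform_discrete (eigenvalues q)"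
    unfolding uniform_discrete_def eigenvalues_eq by (intro exI[of _ 1]) auto
qed

lemma square_q_closed: "b \<in> hyperboloid q \<Longrightarrow> square_q q b \<in> hyperboloid q"
  by (simp add: square_q_lap lap_weight)

lemma M_hyperboloid: "(t, k, l) \<in> triples \<Longrightarrow> M t k l \<in> hyperboloid q"
  using psum_hyperboloid[of t k l 0] by (simp add: psum_0)

lemma square_q_M:
  assumes "(t, k, l) \<in> triples"
  shows "square_q q (M t k l) = complex_of_real (eig_e q t k l) \<odot> M t k l \<oplus>
    (if k * l = 0 then \<zero> else complex_of_real (eig_c q t k l) \<odot> M t (k - 1) (l - 1))"
  using lap_M[OF assms] lower_coeff_zero[of k l]
  by (auto simp: square_q_lap[OF M_hyperboloid[OF assms]] eig_e_real_eigval[OF assms] eig_c_lower_coeff[OF assms] eigval_real_eigval)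

lemma square_q_eig_p:
  assumes "(t, k, l) \<in> triples"
  shows "square_q q (eig_p q t k l) = complex_of_real (eig_e q t k l) \<odot> eig_p q t k l"
  using lap_eig_p[OF assms] psum_hyperboloid[OF assms order_refl]
  by (simp add: square_q_lap eig_p_psum eig_e_real_eigval[OF assms] eigval_real_eigval)

end

theorem mainTheorem2:
  fixes q :: real
  assumes "-1 < q" and "q < 1" and "q \<noteq> 0"
  shows
    "(\<forall>b\<in>hyperboloid q. square_q q b \<in> hyperboloid q) \<and>
     (\<forall>(t, k, l)\<in>triples.
        monomial q t k l \<in> hyperboloid q \<and>
        square_q q (monomial q t k l) =
          complex_of_real (eig_e q t k l) \<odot>\<^bsub>SUq q\<^esub> monomial q t k l \<oplus>\<^bsub>SUq q\<^esub>
            (if k * l = 0 then \<zero>\<^bsub>SUq q\<^esub>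
             else complex_of_real (eig_c q t k l) \<odot>\<^bsub>SUq q\<^esub> monomial q t (k - 1) (l - 1))) \<and>
     (\<forall>(t, k, l)\<in>triples. \<forall>j < min k l. eig_e q t k l - eig_e q t (k - j - 1) (l - j - 1) \<noteq> 0) \<and>
     (\<forall>(t, k, l)\<in>triples. square_q q (eig_p q t k l) = complex_of_real (eig_e q t k l) \<odot>\<^bsub>SUq q\<^esub> eig_p q t k l) \<and>
     linear_basis (SUq q) (hyperboloid q) triples (\<lambda>(t, k, l). eig_p q t k l) \<and>
     infinite (eigenvalues q) \<and> discrete (eigenvalues q)"
proof -
  have "quantum_su (SUq q) q"
    by (intro quantum_su.intro quantum_su_axioms.intro calgebra_SUq refl assms)
  note * = quantum_su.square_q_closed[OF this] quantum_su.M_hyperboloid[OF this] quantum_su.square_q_M[OF this]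
    quantum_su.denominator(2)[OF this] quantum_su.square_q_eig_p[OF this] quantum_su.linear_basis_evec[OF this]
    quantum_su.infinite_eigenvalues[OF this] quantum_su.discrete_eigenvalues[OF this]
  show ?thesis
    by (intro conjI ballI case_prodI2 allI impI; rule *; simp)
qed

end
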